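(* Let $n\ge2$, $m\ge0$, and let $\{\chi_j\}_{j\in\{1,\dots,n\}}$ be the partition of unity in frequency space described in the context. Let $C>0$ be the constant, independent of $w$, in the following estimates for the resolvent of the Laplacian: for every $w\in\mathbb{C}\setminus[0,+\infty)$, $f\in L^1_{x_j}L^2_{\widehat{x}_j}$ and $j,k\in\{1,\dots,n\}$, $$\|\chi_j(|w|^{-1/2}D)R_{-\Delta}(w)f\|_{L^\infty_{x_j}L^2_{\widehat{x}_j}}\le C|w|^{-1/2}\|f\|_{L^1_{x_j}L^2_{\widehat{x}_j}},\qquad \|\chi_j(|w|^{-1/2}D)\partial_kR_{-\Delta}(w)f\|_{L^\infty_{x_j}L^2_{\widehat{x}_j}}\le C\|f\|_{L^1_{x_j}L^2_{\widehat{x}_j}}$$ (such a constant exists, and in particular $\|R_{-\Delta}(w)\|_{X\to X^*}\le C|w|^{-1/2}$ and $\|\partial_kR_{-\Delta}(w)\|_{X\to X^*}\le C$). Then, with this same $C$, for every $z\in\rho(\mathscr{D}_0)=\mathbb{C}\setminus\{\zeta\in\mathbb{R}:|\zeta|\ge m\}$, $f\in L^1_{x_j}L^2_{\widehat{x}_j}$ and $j\in\{1,\dots,n\}$, $$\big\|\chi_j(|z^2-m^2|^{-1/2}D)\,R_{\mathscr{D}_0}(z)f\big\|_{L^\infty_{x_j}L^2_{\widehat{x}_j}}\le C\left[n+\left|\frac{z+m}{z-m}\right|^{\mathrm{sgn}(\mathrm{Re}\,z)/2}\right]\|f\|_{L^1_{x_j}L^2_{\widehat{x}_j}} .$$ In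 particular, it follows that $$\|R_{\mathscr{D}_0}(z)\|_{X\to X^*}\le C\left[n+\left|\frac{z+m}{z-m}\right|^{\mathrm{sgn}(\mathrm{Re}\,z)/2}\right].$$
   Context: The free Dirac operator with non-negative mass $m$ acts on $\mathfrak{H}=L^2(\mathbb{R}^n;\mathbb{C}^N)$, $N:=2^{\lceil n/2\rceil}$, as $$\mathscr{D}_0=-i\sum_{k=1}^n\alpha_k\frac{\partial}{\partial x_k}+m\,\alpha_0,\qquad \mathrm{dom}(\mathscr{D}_0)=\{\psi\in\mathfrak{H}:\nabla\psi\in\mathfrak{H}^n\},$$ where the matrices $\alpha_0,\dots,\alpha_n\in\mathbb{C}^{N\times N}$ satisfy $\alpha_j\alpha_k+\alpha_k\alpha_j=2\delta_{j,k}I_N$ for $j,k\in\{0,\dots,n\}$, with $\delta_{j,k}$ the Kronecker symbol, and $\alpha_0=\mathrm{diag}(I_{N/2},-I_{N/2})$; the operator $\mathscr{D}_0$ is selfadjoint. $R_{\mathscr{D}_0}(z)=(\mathscr{D}_0-z)^{-1}$ and $R_{-\Delta}(w)=(-\Delta-w)^{-1}$ denote resolvents, and $\partial_k=\partial/\partial x_k$. Functions to which $R_{\mathscr{D}_0}(z)$ is applied are $\mathbb{C}^N$-valued, with $|f(x)|$ the Euclidean norm; scalar operators act on them componentwise. For $x\in\mathbb{R}^n$ and $j\in\{1,\dots,n\}$, $\widehat{x}_j:=(x_1,\dots,x_{j-1},x_{j+1},\dots,x_n)\in\mathbb{R}^{n-1}$ (similarly $\widehat{\xi}_j$). The mixed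 norm $\|f\|_{L^p_{x_j}L^q_{\widehat{x}_j}}$ is the $L^p(\mathbb{R},dx_j)$ norm of the function $x_j\mapsto\|f(x_j,\cdot)\|_{L^q(\mathbb{R}^{n-1},d\widehat{x}_j)}$. Set $$X:=\bigcap_{j=1}^nL^1_{x_j}L^2_{\widehat{x}_j}(\mathbb{R}^n),\qquad \|f\|_X=\max_{j\in\{1,\dots,n\}}\|f\|_{L^1_{x_j}L^2_{\widehat{x}_j}},$$ $$X^*:=\sum_{j=1}^nL^\infty_{x_j}L^2_{\widehat{x}_j}(\mathbb{R}^n),\qquad \|f\|_{X^*}=\inf\Big\{\sum_{j=1}^n\|f_j\|_{L^\infty_{x_j}L^2_{\widehat{x}_j}}: f=\sum_{j=1}^nf_j\Big\}.$$ Partition of unity: fix constants $r,R,\delta>0$ such that $1<r<R$ and $\sqrt{R^2-1}<\delta<1$, and consider the open cover $\mathcal{S}=\{\mathcal{S}^+_j,\mathcal{S}^-_j,\mathcal{S}_\infty\}_{j\in\{1,\dots,n\}}$ of the space $\mathbb{R}^n$ defined by $$\mathcal{S}^\pm_j=\{\xi\in\mathbb{R}^n:\pm\xi_j>\delta|\widehat{\xi}_j|,\ |\xi|<R\},\qquad \mathcal{S}_\infty=\{\xi\in\mathbb{R}^n:|\xi|>r\}.$$ Let $\{\chi_j^+,\chi_j^-,\chi_\infty\}_{j\in\{1,\dots,n\}}$ be a smooth partition of unity subordinate to $\mathcal{S}$, i.e. a family of smooth positive (that is, non-negative) functions such that $\mathrm{supp}\,\chi_j^\pm\subset\mathcal{S}_j^\pm$,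 $\mathrm{supp}\,\chi_\infty\subset\mathcal{S}_\infty$, and $\chi_\infty+\sum_{j=1}^n[\chi_j^++\chi_j^-]\equiv1$. Define the smooth partition of unity $$\chi_j:=\chi_j^++\chi_j^-+\tfrac1n\chi_\infty,\qquad j\in\{1,\dots,n\},$$ and, for $t>0$, the Fourier multipliers $\chi_j(t^{-1/2}D)f=\mathcal{F}^{-1}_\xi[\chi_j(t^{-1/2}\xi)\,\mathcal{F}_xf]$, where $\mathcal{F}_x$ is the Fourier transform on $\mathbb{R}^n$ and $\mathcal{F}^{-1}_\xi$ its inverse.
   Formalization: The cover misses the origin, so the partition of unity is required only on R^n without 0; the final X→X* bound uses that C also satisfies the listed X→X* Laplacian bounds for C^N-valued functions (without them it is proved with an extra factor n). *)

theory Defs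
  imports "HOL-Probability.Essential_Supremum"
begin

text \<open>
  Elements of function spaces are represented by Borel functions on \<^typ>\<open>real ^ 'n\<close>, identified
  almost everywhere only through the relations below. Norms take values in \<^typ>\<open>ennreal\<close>, and an
  operator value is a \<open>SOME\<close>-chosen representative of its equivalence class.
\<close>

section \<open>Lebesgue and mixed norms\<close>

definition ennreal_sqrt :: "ennreal \<Rightarrow> ennreal" where
  "ennreal_sqrt a = (if a = \<infinity> then \<infinity> else ennreal (sqrt (enn2real a)))"

definition L2_norm :: "'x measure \<Rightarrow> ('x \<Rightarrow> 'b::real_normed_vector) \<Rightarrow> ennreal" where
  "L2_norm M f = ennreal_sqrt (\<integral>\<^sup>+ x. ennreal ((norm (f x))\<^sup>2) \<partial>M)"

definition L2 :: "((real ^ 'n) \<Rightarrow> 'b::{banach, second_countable_topology}) set" where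
  "L2 = {f \<in> borel_measurable borel. L2_norm lborel f < \<infinity>}"

text \<open>
  The remaining coordinates (all but the \<open>j\<close>-th) form a point of the product space over
  \<open>- {j}\<close>, which carries the (n-1)-dimensional Lebesgue measure as a product of copies
  of \<^term>\<open>lborel\<close>.
\<close>

definition insert_coord :: "'n \<Rightarrow> real \<Rightarrow> ('n \<Rightarrow> real) \<Rightarrow> real ^ 'n::finite" where
  "insert_coord j t y = (\<chi> i. if i = j then t else y i)"

definition slice_norm ::
    "'n::finite \<Rightarrow> ((real ^ 'n) \<Rightarrow> 'b::real_normed_vector) \<Rightarrow> real \<Rightarrow> ennreal" where
  "slice_norm j f t =
     L2_norm (Pi\<^sub>M (- {j}) (\<lambda>_. lborel)) (\<lambda>y. f (insert_coord j t y))"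

definition L1L2_norm ::
    "'n::finite \<Rightarrow> ((real ^ 'n) \<Rightarrow> 'b::real_normed_vector) \<Rightarrow> ennreal" where
  "L1L2_norm j f = (\<integral>\<^sup>+ t. slice_norm j f t \<partial>lborel)"

definition LinfL2_norm ::
    "'n::finite \<Rightarrow> ((real ^ 'n) \<Rightarrow> 'b::real_normed_vector) \<Rightarrow> ennreal" where
  "LinfL2_norm j f = esssup lborel (slice_norm j f)"

definition L1L2 :: "'n::finite \<Rightarrow> ((real ^ 'n) \<Rightarrow> 'b::real_normed_vector) set" where
  "L1L2 j = {f \<in> borel_measurable borel. L1L2_norm j f < \<infinity>}"

definition X_space :: "((real ^ 'n::finite) \<Rightarrow> 'b::real_normed_vector) set" where
  "X_space = (\<Inter>j. L1L2 j)"

definition X_norm :: "((real ^ 'n::finite) \<Rightarrow> 'b::real_normed_vector) \<Rightarrow> ennreal" where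
  "X_norm f = Max (range (\<lambda>j. L1L2_norm j f))"

text \<open>Equal to \<open>\<infinity>\<close> exactly outside the sum space.\<close>

definition Xstar_norm :: "((real ^ 'n::finite) \<Rightarrow> 'b::real_normed_vector) \<Rightarrow> ennreal" where
  "Xstar_norm f =
     (INF g \<in> {g. (\<forall>j. g j \<in> borel_measurable borel) \<and>
                   (AE x in lborel. f x = (\<Sum>j\<in>UNIV. g j x))}.
        \<Sum>j\<in>UNIV. LinfL2_norm j (g j))"

definition op_norm_X_Xstar ::
    "(((real ^ 'n::finite) \<Rightarrow> 'b::real_normed_vector) \<Rightarrow> ((real ^ 'n) \<Rightarrow> 'b)) \<Rightarrow> ennreal" where
  "op_norm_X_Xstar T = Inf {c. \<forall>f\<in>X_space. Xstar_norm (T f) \<le> c * X_norm f}"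

section \<open>Smooth functions and weak derivatives\<close>

text \<open>Meaningful on open sets only: the derivative is the two-sided one.\<close>

definition pd :: "'n \<Rightarrow> ((real ^ 'n::finite) \<Rightarrow> real) \<Rightarrow> (real ^ 'n) \<Rightarrow> real" where
  "pd k f x = frechet_derivative f (at x) (axis k 1)"

primrec Ck_on :: "nat \<Rightarrow> (real ^ 'n::finite) set \<Rightarrow> ((real ^ 'n) \<Rightarrow> real) \<Rightarrow> bool" where
  "Ck_on 0 S f \<longleftrightarrow> continuous_on S f"
| "Ck_on (Suc l) S f \<longleftrightarrow> f differentiable_on S \<and> (\<forall>k. Ck_on l S (pd k f))"

definition smooth_on :: "(real ^ 'n::finite) set \<Rightarrow> ((real ^ 'n) \<Rightarrow> real) \<Rightarrow> bool" where
  "smooth_on S f \<longleftrightarrow> (\<forall>l. Ck_on l S f)"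

definition test_function :: "((real ^ 'n::finite) \<Rightarrow> real) \<Rightarrow> bool" where
  "test_function \<phi> \<longleftrightarrow> smooth_on UNIV \<phi> \<and> compact (closure {x. \<phi> x \<noteq> 0})"

definition has_weak_pd ::
    "'n \<Rightarrow> ((real ^ 'n::finite) \<Rightarrow> 'b::{banach, second_countable_topology}) \<Rightarrow> ((real ^ 'n) \<Rightarrow> 'b) \<Rightarrow> bool" where
  "has_weak_pd k u v \<longleftrightarrow>
     (\<forall>\<phi>. test_function \<phi> \<longrightarrow>
        (LINT x|lborel. pd k \<phi> x *\<^sub>R u x) = - (LINT x|lborel. \<phi> x *\<^sub>R v x))"

definition wpd ::
    "'n \<Rightarrow> ((real ^ 'n::finite) \<Rightarrow> 'b::{banach, second_countable_topology}) \<Rightarrow> (real ^ 'n) \<Rightarrow> 'b" where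
  "wpd k u = (SOME v. v \<in> L2 \<and> has_weak_pd k u v)"

definition H1 :: "((real ^ 'n::finite) \<Rightarrow> 'b::{banach, second_countable_topology}) set" where
  "H1 = {u \<in> L2. \<forall>k. \<exists>v\<in>L2. has_weak_pd k u v}"

definition H2 :: "((real ^ 'n::finite) \<Rightarrow> 'b::{banach, second_countable_topology}) set" where
  "H2 = {u \<in> H1. \<forall>k. wpd k u \<in> H1}"

section \<open>Fourier transform and Fourier multipliers\<close>

text \<open>
  The convention is the one for which \<open>-i\<partial>\<^sub>k\<close> becomes multiplication by \<open>\<xi>\<^sub>k\<close>, so that the
  multiplier with symbol \<open>\<sigma>\<close> is \<open>\<sigma>(D)\<close> with \<open>D = -i\<nabla>\<close>. On square-integrable functions the
  transform is the mean-square limit of the integrals over growing balls.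
\<close>

definition fourier_int :: "((real ^ 'n::finite) \<Rightarrow> complex) \<Rightarrow> (real ^ 'n) \<Rightarrow> complex" where
  "fourier_int f \<xi> =
     of_real ((2 * pi) powr (- real CARD('n) / 2)) * (LINT x|lborel. cis (- (x \<bullet> \<xi>)) * f x)"

definition fourier :: "((real ^ 'n::finite) \<Rightarrow> complex) \<Rightarrow> (real ^ 'n) \<Rightarrow> complex" where
  "fourier f =
     (SOME g. g \<in> L2 \<and>
        (\<lambda>l. L2_norm lborel
           (\<lambda>\<xi>. fourier_int (\<lambda>x. indicator (ball 0 (real l)) x * f x) \<xi> - g \<xi>)) \<longlonglongrightarrow> 0)"

definition inv_fourier :: "((real ^ 'n::finite) \<Rightarrow> complex) \<Rightarrow> (real ^ 'n) \<Rightarrow> complex" where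
  "inv_fourier h = (SOME f. f \<in> L2 \<and> (AE \<xi> in lborel. fourier f \<xi> = h \<xi>))"

definition multiplier ::
    "((real ^ 'n::finite) \<Rightarrow> real) \<Rightarrow> ((real ^ 'n) \<Rightarrow> complex) \<Rightarrow> (real ^ 'n) \<Rightarrow> complex" where
  "multiplier \<sigma> f = inv_fourier (\<lambda>\<xi>. of_real (\<sigma> \<xi>) * fourier f \<xi>)"

definition componentwise ::
    "(((real ^ 'n::finite) \<Rightarrow> complex) \<Rightarrow> (real ^ 'n) \<Rightarrow> complex) \<Rightarrow>
     ((real ^ 'n) \<Rightarrow> complex ^ 's::finite) \<Rightarrow> (real ^ 'n) \<Rightarrow> complex ^ 's" where
  "componentwise T f x = (\<chi> a. T (\<lambda>y. f y $ a) x)"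

section \<open>The frequency partition\<close>

definition cone_plus :: "real \<Rightarrow> real \<Rightarrow> 'n::finite \<Rightarrow> (real ^ 'n) set" where
  "cone_plus \<delta> R j = {\<xi>. \<xi> $ j > \<delta> * L2_set (\<lambda>i. \<xi> $ i) (- {j}) \<and> norm \<xi> < R}"

definition cone_minus :: "real \<Rightarrow> real \<Rightarrow> 'n::finite \<Rightarrow> (real ^ 'n) set" where
  "cone_minus \<delta> R j = {\<xi>. - (\<xi> $ j) > \<delta> * L2_set (\<lambda>i. \<xi> $ i) (- {j}) \<and> norm \<xi> < R}"

definition outer_region :: "real \<Rightarrow> (real ^ 'n::finite) set" where
  "outer_region r = {\<xi>. norm \<xi> > r}"

text \<open>
  The origin lies in none of the sets of the cover, so no partition of unity on the whole space
  can be subordinate to it. All conditions are therefore imposed on the punctured space (with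
  supports taken relative to it); the values at the origin do not affect the multipliers.
\<close>

definition frequency_partition ::
    "real \<Rightarrow> real \<Rightarrow> real \<Rightarrow> ('n::finite \<Rightarrow> (real ^ 'n) \<Rightarrow> real) \<Rightarrow> ('n \<Rightarrow> (real ^ 'n) \<Rightarrow> real) \<Rightarrow>
     ((real ^ 'n) \<Rightarrow> real) \<Rightarrow> bool" where
  "frequency_partition r R \<delta> \<chi>p \<chi>m \<chi>inf \<longleftrightarrow>
     (\<forall>j. smooth_on (- {0}) (\<chi>p j) \<and> (\<forall>\<xi>\<noteq>0. \<chi>p j \<xi> \<ge> 0) \<and>
          closure {\<xi>. \<chi>p j \<xi> \<noteq> 0} - {0} \<subseteq> cone_plus \<delta> R j) \<and>
     (\<forall>j. smooth_on (- {0}) (\<chi>m j) \<and> (\<forall>\<xi>\<noteq>0. \<chi>m j \<xi> \<ge> 0) \<and>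
          closure {\<xi>. \<chi>m j \<xi> \<noteq> 0} - {0} \<subseteq> cone_minus \<delta> R j) \<and>
     smooth_on (- {0}) \<chi>inf \<and> (\<forall>\<xi>\<noteq>0. \<chi>inf \<xi> \<ge> 0) \<and>
     closure {\<xi>. \<chi>inf \<xi> \<noteq> 0} - {0} \<subseteq> outer_region r \<and>
     (\<forall>\<xi>\<noteq>0. \<chi>inf \<xi> + (\<Sum>j\<in>UNIV. \<chi>p j \<xi> + \<chi>m j \<xi>) = 1)"

definition chi ::
    "('n::finite \<Rightarrow> (real ^ 'n) \<Rightarrow> real) \<Rightarrow> ('n \<Rightarrow> (real ^ 'n) \<Rightarrow> real) \<Rightarrow> ((real ^ 'n) \<Rightarrow> real) \<Rightarrow>
     'n \<Rightarrow> (real ^ 'n) \<Rightarrow> real" where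
  "chi \<chi>p \<chi>m \<chi>inf j \<xi> = \<chi>p j \<xi> + \<chi>m j \<xi> + \<chi>inf \<xi> / real CARD('n)"

definition dilated :: "real \<Rightarrow> ((real ^ 'n::finite) \<Rightarrow> real) \<Rightarrow> (real ^ 'n) \<Rightarrow> real" where
  "dilated t \<sigma> \<xi> = \<sigma> (t powr (-1/2) *\<^sub>R \<xi>)"

section \<open>The operators and their resolvents\<close>

text \<open>
  \<open>None\<close> plays the role of the index 0. The spinor index type \<open>'h + 'h\<close> has size \<open>N\<close> and
  displays the two blocks of size \<open>N/2\<close>. Hermiticity of the matrices does not follow from the
  anticommutation relations; it is what makes the Dirac operator selfadjoint.
\<close>

definition dirac_matrices ::
    "('n::finite option \<Rightarrow> complex ^ ('h::finite + 'h) ^ ('h + 'h)) \<Rightarrow> bool" where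
  "dirac_matrices \<alpha> \<longleftrightarrow>
     CARD('h + 'h) = 2 ^ nat \<lceil>real CARD('n) / 2\<rceil> \<and>
     (\<forall>j k. \<alpha> j ** \<alpha> k + \<alpha> k ** \<alpha> j = (if j = k then mat 2 else 0)) \<and>
     (\<forall>j a b. \<alpha> j $ a $ b = cnj (\<alpha> j $ b $ a)) \<and>
     \<alpha> None = (\<chi> a b. if a = b then (case a of Inl _ \<Rightarrow> 1 | Inr _ \<Rightarrow> -1) else 0)"

definition dirac ::
    "('n::finite option \<Rightarrow> complex ^ 's ^ 's::finite) \<Rightarrow> real \<Rightarrow>
     ((real ^ 'n) \<Rightarrow> complex ^ 's) \<Rightarrow> (real ^ 'n) \<Rightarrow> complex ^ 's" where
  "dirac \<alpha> m \<psi> x =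
     (- \<i>) *s (\<Sum>k\<in>UNIV. \<alpha> (Some k) *v wpd k \<psi> x) + of_real m *s (\<alpha> None *v \<psi> x)"

text \<open>Graphs of the resolvents of the unbounded operators, with domains \<^term>\<open>H1\<close> and \<^term>\<open>H2\<close>.\<close>

definition dirac_res_graph ::
    "('n::finite option \<Rightarrow> complex ^ 's ^ 's::finite) \<Rightarrow> real \<Rightarrow> complex \<Rightarrow>
     ((real ^ 'n) \<Rightarrow> complex ^ 's) \<Rightarrow> ((real ^ 'n) \<Rightarrow> complex ^ 's) \<Rightarrow> bool" where
  "dirac_res_graph \<alpha> m z f u \<longleftrightarrow>
     f \<in> L2 \<and> u \<in> H1 \<and> (AE x in lborel. dirac \<alpha> m u x - z *s u x = f x)"

definition dirac_resolvent_set ::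
    "('n::finite option \<Rightarrow> complex ^ 's ^ 's::finite) \<Rightarrow> real \<Rightarrow> complex set" where
  "dirac_resolvent_set \<alpha> m =
     {z. (\<forall>f\<in>L2. \<exists>u. dirac_res_graph \<alpha> m z f u \<and>
            (\<forall>u'. dirac_res_graph \<alpha> m z f u' \<longrightarrow> (AE x in lborel. u' x = u x))) \<and>
         (\<exists>c. \<forall>f u. dirac_res_graph \<alpha> m z f u \<longrightarrow>
            L2_norm lborel u \<le> ennreal c * L2_norm lborel f)}"

definition laplace_res_graph ::
    "complex \<Rightarrow> ((real ^ 'n::finite) \<Rightarrow> complex) \<Rightarrow> ((real ^ 'n) \<Rightarrow> complex) \<Rightarrow> bool" where
  "laplace_res_graph w f u \<longleftrightarrow>
     f \<in> L2 \<and> u \<in> H2 \<and> (AE x in lborel. - (\<Sum>k\<in>UNIV. wpd k (wpd k u) x) - w * u x = f x)"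

text \<open>
  A function in a mixed-norm space need not be square integrable, so a resolvent acts on it
  through its continuous extension from the square-integrable functions of finite norm
  \<open>nrm\<close>. For \<open>nrm\<close> one of the \<^const>\<open>L1L2_norm\<close>s or \<^const>\<open>X_norm\<close> these are dense, and both
  resolvents extend continuously with square-integrable values: by duality, this is the
  embedding of \<^const>\<open>H1\<close> into the functions with finite \<^const>\<open>LinfL2_norm\<close>.
\<close>

definition extend_cont ::
    "(((real ^ 'n::finite) \<Rightarrow> 'b::{banach, second_countable_topology}) \<Rightarrow> ennreal) \<Rightarrow>
     (((real ^ 'n) \<Rightarrow> 'b) \<Rightarrow> ((real ^ 'n) \<Rightarrow> 'b) \<Rightarrow> bool) \<Rightarrow>
     ((real ^ 'n) \<Rightarrow> 'b) \<Rightarrow> (real ^ 'n) \<Rightarrow> 'b" where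
  "extend_cont nrm G f =
     (SOME u. u \<in> L2 \<and>
        (\<exists>fs us. (\<forall>l. G (fs l) (us l) \<and> nrm (fs l) < \<infinity>) \<and>
                 (\<lambda>l. nrm (\<lambda>x. fs l x - f x)) \<longlonglongrightarrow> 0 \<and>
                 (\<lambda>l::nat. L2_norm lborel (\<lambda>x. us l x - u x)) \<longlonglongrightarrow> 0))"

definition dirac_resolvent ::
    "('n::finite option \<Rightarrow> complex ^ 's ^ 's::finite) \<Rightarrow> real \<Rightarrow>
     (((real ^ 'n) \<Rightarrow> complex ^ 's) \<Rightarrow> ennreal) \<Rightarrow> complex \<Rightarrow>
     ((real ^ 'n) \<Rightarrow> complex ^ 's) \<Rightarrow> (real ^ 'n) \<Rightarrow> complex ^ 's" where
  "dirac_resolvent \<alpha> m nrm z = extend_cont nrm (dirac_res_graph \<alpha> m z)"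

definition laplace_resolvent ::
    "(((real ^ 'n::finite) \<Rightarrow> complex) \<Rightarrow> ennreal) \<Rightarrow> complex \<Rightarrow>
     ((real ^ 'n) \<Rightarrow> complex) \<Rightarrow> (real ^ 'n) \<Rightarrow> complex" where
  "laplace_resolvent nrm w = extend_cont nrm (laplace_res_graph w)"

definition dirac_factor :: "nat \<Rightarrow> real \<Rightarrow> complex \<Rightarrow> real" where
  "dirac_factor n m z =
     real n + (cmod ((z + of_real m) / (z - of_real m))) powr (sgn (Re z) / 2)"

end

(*
  Since the square of the Dirac operator is m^2 minus the Laplacian,
    (D_0 - z)^-1 = (D_0 + z) (- Laplacian - w)^-1,   w = z^2 - m^2.
  After applying the multiplier chi_j, each of the n terms alpha_k d_k is bounded by C because alpha_k
  is unitary, and m alpha_0 + z is diagonal with entries z + m and z - m, so the zeroth-order term is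
  bounded by C |w|^(-1/2) max(|z + m|, |z - m|) = C |(z + m) / (z - m)|^(sgn(Re z) / 2).

  The constant is preserved in passing from scalar to vector functions because Minkowski's integral
  inequality bounds the Euclidean norm of the components' L^1 L^2 norms by the L^1 L^2 norm of the
  Euclidean norm, and the reverse holds for L^infinity L^2.

  That the factorization survives the extension to L^1 L^2 rests on the transform g of an L^2
  function f satisfying: the L^2 norm of g / sqrt(1 + xi_j^2) is at most the norm of f in L^1 L^2.
  Hence the Laplace resolvent and its first derivatives, whose symbols decay at least like 1 / |xi|,
  are continuous from L^1 L^2 to L^2.
*)

theory Submission
  imports
    Defs
    "HOL-Probability.Characteristic_Functions"
    "HOL-Computational_Algebra.Polynomial"
    "HOL-Analysis.Interval_Integral"
begin

section \<open>Square-integrable functions\<close>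

text \<open>Weak derivatives, transforms and extended resolvents are chosen representatives, so
  every identity between them is one between classes and needs a uniqueness argument. The Fourier
  side supplies it: once Plancherel holds for this transform, a weak derivative is multiplication by
  i xi_k, and both resolvent equations become pointwise equations at almost every frequency.

  The sum space is the second obstacle. Splitting by the chi_j gives one estimate for each
  direction, and the norm of X* adds the n pieces, so this route ends with n times the constant of a
  single direction. The constant without this factor comes from applying the factorization directly
  to X to X* bounds for the Laplacian. Hence the two forms of the last assertion.

  The description of the resolvent set uses n >= 2: to reach both signs of zeta, the frequency is
  put on one axis, which leaves a matrix of another direction that anticommutes with the
  symbol.\<close>

lemma ennreal_sqrt_square [simp]: "(ennreal_sqrt a)\<^sup>2 = a"
proof (cases a)
  case (real r)
  then show ?thesis
    by (simp add: ennreal_sqrt_def ennreal_power)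
qed (simp add: ennreal_sqrt_def ennreal_top_eq_mult_iff power2_eq_square)

lemma ennreal_power2_le_iff: "(a::ennreal)\<^sup>2 \<le> b\<^sup>2 \<longleftrightarrow> a \<le> b"
proof
  assume "a\<^sup>2 \<le> b\<^sup>2"
  show "a \<le> b"
  proof (rule ccontr)
    assume "\<not> a \<le> b"
    then have "b < a" by simp
    then have "b\<^sup>2 < a\<^sup>2"
      by (cases a; cases b) (auto simp: ennreal_power ennreal_less_iff power_strict_mono power2_eq_square[of top])
    then show False using \<open>a\<^sup>2 \<le> b\<^sup>2\<close> by simp
  qed
qed (simp add: power_mono)

lemma ennreal_power2_eq_iff: "(a::ennreal)\<^sup>2 = b\<^sup>2 \<longleftrightarrow> a = b"
  by (metis ennreal_power2_le_iff order_antisym order_refl)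

lemma ennreal_sqrt_power2 [simp]: "ennreal_sqrt (a\<^sup>2) = a"
  using ennreal_power2_eq_iff ennreal_sqrt_square by blast

lemma ennreal_sqrt_le_iff: "ennreal_sqrt a \<le> b \<longleftrightarrow> a \<le> b\<^sup>2"
  by (metis ennreal_power2_le_iff ennreal_sqrt_square)

lemma ennreal_sqrt_mono: "a \<le> b \<Longrightarrow> ennreal_sqrt a \<le> ennreal_sqrt b"
  by (simp add: ennreal_sqrt_le_iff)

lemma ennreal_sqrt_eq_0_iff [simp]: "ennreal_sqrt a = 0 \<longleftrightarrow> a = 0"
  by (metis ennreal_sqrt_power2 ennreal_sqrt_square power_zero_numeral)

lemma ennreal_sqrt_mult: "ennreal_sqrt (a * b) = ennreal_sqrt a * ennreal_sqrt b"
  by (metis ennreal_power2_eq_iff ennreal_sqrt_square power_mult_distrib)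

lemma ennreal_sqrt_less_top_iff [simp]: "ennreal_sqrt a < \<infinity> \<longleftrightarrow> a < \<infinity>"
  by (auto simp: ennreal_sqrt_def less_top)

lemma ennreal_tendsto_0_iff:
  fixes f :: "'i \<Rightarrow> ennreal"
  shows "(f \<longlongrightarrow> 0) F \<longleftrightarrow> (\<forall>e>0. eventually (\<lambda>x. f x \<le> ennreal e) F)"
proof
  assume f: "(f \<longlongrightarrow> 0) F"
  show "\<forall>e>0. eventually (\<lambda>x. f x \<le> ennreal e) F"
  proof (intro allI impI)
    fix e :: real assume "e > 0"
    then have "eventually (\<lambda>x. f x < ennreal e) F" using f by (intro order_tendstoD) auto
    then show "eventually (\<lambda>x. f x \<le> ennreal e) F" by (auto elim: eventually_mono)
  qed
next
  assume *: "\<forall>e>0. eventually (\<lambda>x. f x \<le> ennreal e) F"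
  show "(f \<longlongrightarrow> 0) F"
  proof (rule order_tendstoI)
    fix a :: ennreal assume "0 < a"
    then obtain e' where e': "0 < e'" "e' < a" using dense by blast
    then have "e' < top" by (auto intro: order.strict_trans2)
    then obtain e where "0 < ennreal e" "ennreal e < a" using e' by (cases e') auto
    then have "e > 0" by auto
    with * have "eventually (\<lambda>x. f x \<le> ennreal e) F" by auto
    then show "eventually (\<lambda>x. f x < a) F"
      by eventually_elim (use \<open>ennreal e < a\<close> in auto)
  qed simp
qed

lemma borel_measurable_ennreal_sqrt [measurable]: "ennreal_sqrt \<in> borel_measurable borel"
  unfolding ennreal_sqrt_def[abs_def] by measurable

lemma ennreal_sqrt_tendsto_0:
  assumes "(f \<longlongrightarrow> 0) F"
  shows "((\<lambda>x. ennreal_sqrt (f x)) \<longlongrightarrow> 0) F"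
proof (rule order_tendstoI)
  fix a :: ennreal assume "0 < a"
  then have "0 < a\<^sup>2" by (simp add: power2_eq_square ennreal_zero_less_mult_iff)
  with assms have "eventually (\<lambda>x. f x < a\<^sup>2) F" by (rule order_tendstoD)
  then show "eventually (\<lambda>x. ennreal_sqrt (f x) < a) F"
    by eventually_elim (metis ennreal_power2_le_iff ennreal_sqrt_square linorder_not_less)
qed simp

section \<open>The mean-square norm\<close>

lemma L2_norm_square: "(L2_norm M f)\<^sup>2 = (\<integral>\<^sup>+x. ennreal ((norm (f x))\<^sup>2) \<partial>M)"
  by (simp add: L2_norm_def)

lemma L2_norm_le_iff: "L2_norm M f \<le> c \<longleftrightarrow> (\<integral>\<^sup>+x. ennreal ((norm (f x))\<^sup>2) \<partial>M) \<le> c\<^sup>2"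
  by (simp add: L2_norm_def ennreal_sqrt_le_iff)

lemma L2_norm_less_top_iff:
  "L2_norm M f < \<infinity> \<longleftrightarrow> (\<integral>\<^sup>+x. ennreal ((norm (f x))\<^sup>2) \<partial>M) < \<infinity>"
  using ennreal_sqrt_less_top_iff by (simp add: L2_norm_def)

lemma L2_norm_cong_AE:
  assumes "AE x in M. norm (f x) = norm (g x)"
  shows "L2_norm M f = L2_norm M g"
  unfolding L2_norm_def by (rule arg_cong[where f=ennreal_sqrt], rule nn_integral_cong_AE) (use assms in auto)

lemma L2_norm_mono_AE:
  assumes "AE x in M. norm (f x) \<le> norm (g x)"
  shows "L2_norm M f \<le> L2_norm M g"
  unfolding L2_norm_def
  by (rule ennreal_sqrt_mono, rule nn_integral_mono_AE)
     (use assms in \<open>auto elim!: eventually_mono intro!: ennreal_leI power_mono\<close>)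

lemma L2_norm_scale:
  assumes "AE x in M. norm (f x) = c * norm (g x)" "c \<ge> 0"
    and [measurable]: "g \<in> borel_measurable M"
  shows "L2_norm M f = ennreal c * L2_norm M g"
proof -
  have "(\<integral>\<^sup>+x. ennreal ((norm (f x))\<^sup>2) \<partial>M) = (\<integral>\<^sup>+x. ennreal (c\<^sup>2) * ennreal ((norm (g x))\<^sup>2) \<partial>M)"
    by (rule nn_integral_cong_AE) (use assms in \<open>auto simp: power_mult_distrib ennreal_mult\<close>)
  also have "\<dots> = (ennreal c)\<^sup>2 * (\<integral>\<^sup>+x. ennreal ((norm (g x))\<^sup>2) \<partial>M)"
    using assms(2) by (subst nn_integral_cmult) (auto simp: ennreal_power)
  finally show ?thesis by (simp add: L2_norm_def ennreal_sqrt_mult)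
qed

lemma L2_norm_zero [simp]: "L2_norm M (\<lambda>x. 0) = 0"
  by (simp add: L2_norm_def)

lemma L2_norm_eq_0_iff:
  fixes f :: "'x \<Rightarrow> 'b::real_normed_vector"
  assumes [measurable]: "f \<in> borel_measurable M"
  shows "L2_norm M f = 0 \<longleftrightarrow> (AE x in M. f x = 0)"
  by (simp add: L2_norm_def nn_integral_0_iff_AE)

lemma nn_integral_Cauchy_Schwarz_sqrt:
  assumes "f \<in> borel_measurable M" "g \<in> borel_measurable M"
  shows "(\<integral>\<^sup>+x. f x * g x \<partial>M) \<le> ennreal_sqrt (\<integral>\<^sup>+x. (f x)\<^sup>2 \<partial>M) * ennreal_sqrt (\<integral>\<^sup>+x. (g x)\<^sup>2 \<partial>M)"
  by (subst ennreal_power2_le_iff[symmetric])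
     (simp add: power_mult_distrib Cauchy_Schwarz_nn_integral[OF assms])

lemma nn_integral_Minkowski2:
  assumes [measurable]: "f \<in> borel_measurable M" "g \<in> borel_measurable M"
  shows "ennreal_sqrt (\<integral>\<^sup>+x. (f x + g x)\<^sup>2 \<partial>M)
    \<le> ennreal_sqrt (\<integral>\<^sup>+x. (f x)\<^sup>2 \<partial>M) + ennreal_sqrt (\<integral>\<^sup>+x. (g x)\<^sup>2 \<partial>M)"
proof -
  have "(\<integral>\<^sup>+x. (f x + g x)\<^sup>2 \<partial>M) = (\<integral>\<^sup>+x. (f x)\<^sup>2 + 2 * (f x * g x) + (g x)\<^sup>2 \<partial>M)"
    by (intro nn_integral_cong) (simp add: power2_eq_square algebra_simps mult_2 flip: mult_2)
  also have "\<dots> = (\<integral>\<^sup>+x. (f x)\<^sup>2 \<partial>M) + 2 * (\<integral>\<^sup>+x. f x * g x \<partial>M) + (\<integral>\<^sup>+x. (g x)\<^sup>2 \<partial>M)"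
    by (simp add: nn_integral_add nn_integral_cmult)
  also have "\<dots> \<le> (\<integral>\<^sup>+x. (f x)\<^sup>2 \<partial>M)
      + 2 * (ennreal_sqrt (\<integral>\<^sup>+x. (f x)\<^sup>2 \<partial>M) * ennreal_sqrt (\<integral>\<^sup>+x. (g x)\<^sup>2 \<partial>M))
      + (\<integral>\<^sup>+x. (g x)\<^sup>2 \<partial>M)"
    by (intro add_mono mult_left_mono nn_integral_Cauchy_Schwarz_sqrt) auto
  also have "\<dots> = (ennreal_sqrt (\<integral>\<^sup>+x. (f x)\<^sup>2 \<partial>M) + ennreal_sqrt (\<integral>\<^sup>+x. (g x)\<^sup>2 \<partial>M))\<^sup>2"
    unfolding power2_sum by (simp add: ac_simps)
  finally show ?thesis by (simp add: ennreal_sqrt_le_iff)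
qed

lemma L2_norm_add_le:
  fixes f g :: "'x \<Rightarrow> 'b::{real_normed_vector, second_countable_topology}"
  assumes [measurable]: "f \<in> borel_measurable M" "g \<in> borel_measurable M"
  shows "L2_norm M (\<lambda>x. f x + g x) \<le> L2_norm M f + L2_norm M g"
proof -
  have "L2_norm M (\<lambda>x. f x + g x) \<le> ennreal_sqrt (\<integral>\<^sup>+x. (ennreal (norm (f x)) + ennreal (norm (g x)))\<^sup>2 \<partial>M)"
    unfolding L2_norm_def
    by (intro ennreal_sqrt_mono nn_integral_mono)
       (auto simp: ennreal_power norm_triangle_ineq simp flip: ennreal_plus intro!: ennreal_leI power_mono)
  also have "\<dots> \<le> L2_norm M f + L2_norm M g"
    unfolding L2_norm_def using nn_integral_Minkowski2[of "\<lambda>x. ennreal (norm (f x))" M "\<lambda>x. ennreal (norm (g x))"]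
    by (simp add: ennreal_power)
  finally show ?thesis .
qed

lemma L2_norm_minus_commute: "L2_norm M (\<lambda>x. f x - g x) = L2_norm M (\<lambda>x. g x - f x)"
  by (simp add: L2_norm_def norm_minus_commute)

lemma L2_norm_uminus [simp]: "L2_norm M (\<lambda>x. - f x) = L2_norm M f"
  by (simp add: L2_norm_def)

lemma L2_norm_diff_triangle:
  fixes f g :: "'x \<Rightarrow> 'b::{real_normed_vector, second_countable_topology}"
  assumes [measurable]: "f \<in> borel_measurable M" "g \<in> borel_measurable M" "h \<in> borel_measurable M"
  shows "L2_norm M (\<lambda>x. f x - h x) \<le> L2_norm M (\<lambda>x. f x - g x) + L2_norm M (\<lambda>x. g x - h x)"
  using L2_norm_add_le[of "\<lambda>x. f x - g x" M "\<lambda>x. g x - h x"] by simp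

lemma L2_norm_sum_le:
  fixes f :: "'i \<Rightarrow> 'x \<Rightarrow> 'b::{real_normed_vector, second_countable_topology}"
  assumes [measurable]: "\<And>i. i \<in> I \<Longrightarrow> f i \<in> borel_measurable M"
  shows "L2_norm M (\<lambda>x. \<Sum>i\<in>I. f i x) \<le> (\<Sum>i\<in>I. L2_norm M (f i))"
  using assms
proof (induction I rule: infinite_finite_induct)
  case (insert i I)
  then have "L2_norm M (\<lambda>x. f i x + (\<Sum>i\<in>I. f i x)) \<le> L2_norm M (f i) + L2_norm M (\<lambda>x. \<Sum>i\<in>I. f i x)"
    by (intro L2_norm_add_le) auto
  with insert show ?case by (auto intro: order_trans add_left_mono)
qed auto

section \<open>Fatou's lemma and completeness\<close>

lemma L2_norm_liminf:
  fixes f :: "'x \<Rightarrow> 'b::{real_normed_vector, second_countable_topology}"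
  assumes [measurable]: "\<And>n. fs n \<in> borel_measurable M"
    and lim: "AE x in M. (\<lambda>n. fs n x) \<longlonglongrightarrow> f x"
    and le: "\<And>n. L2_norm M (fs n) \<le> c"
  shows "L2_norm M f \<le> c"
proof -
  have "(\<integral>\<^sup>+x. ennreal ((norm (f x))\<^sup>2) \<partial>M) = (\<integral>\<^sup>+x. liminf (\<lambda>n. ennreal ((norm (fs n x))\<^sup>2)) \<partial>M)"
  proof (rule nn_integral_cong_AE, use lim in eventually_elim)
    fix x assume "(\<lambda>n. fs n x) \<longlonglongrightarrow> f x"
    then have "(\<lambda>n. ennreal ((norm (fs n x))\<^sup>2)) \<longlonglongrightarrow> ennreal ((norm (f x))\<^sup>2)"
      by (intro tendsto_ennrealI tendsto_intros)
    then show "ennreal ((norm (f x))\<^sup>2) = liminf (\<lambda>n. ennreal ((norm (fs n x))\<^sup>2))"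
      by (intro lim_imp_Liminf[symmetric]) simp_all
  qed
  also have "\<dots> \<le> liminf (\<lambda>n. \<integral>\<^sup>+x. ennreal ((norm (fs n x))\<^sup>2) \<partial>M)"
    by (rule nn_integral_liminf) measurable
  also have "\<dots> \<le> c\<^sup>2"
    using le by (intro Liminf_le) (auto simp: L2_norm_le_iff)
  finally show ?thesis by (simp add: L2_norm_le_iff)
qed

text \<open>Riesz-Fischer: along a subsequence whose increments have norms at most 2^-n, the sum of
  the absolute increments has norm at most 2. It is therefore finite almost everywhere, and the
  telescoping series converges there. Kept apart from completeness because the almost-everywhere
  convergence is needed by itself as well.\<close>

lemma L2_norm_Cauchy_AE_subseq:
  fixes fs :: "nat \<Rightarrow> 'x \<Rightarrow> 'b::{banach, second_countable_topology}"
  assumes [measurable]: "\<And>n. fs n \<in> borel_measurable M"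
    and Cauchy: "\<And>e. e > 0 \<Longrightarrow> \<exists>N. \<forall>i\<ge>N. \<forall>j\<ge>N. L2_norm M (\<lambda>x. fs i x - fs j x) \<le> ennreal e"
  obtains r f where "strict_mono (r::nat\<Rightarrow>nat)" "f \<in> borel_measurable M" "AE x in M. (\<lambda>n. fs (r n) x) \<longlonglongrightarrow> f x"
proof -
  have "\<exists>r. \<forall>n. (\<forall>i\<ge>r n. \<forall>j\<ge>r n. L2_norm M (\<lambda>x. fs i x - fs j x) \<le> ennreal ((1/2)^n)) \<and> r n < r (Suc n)"
  proof (intro dependent_nat_choice)
    show "\<exists>x. \<forall>i\<ge>x. \<forall>j\<ge>x. L2_norm M (\<lambda>x. fs i x - fs j x) \<le> ennreal ((1/2)^0)"
      using Cauchy[of 1] by simp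
    fix x n
    obtain N where "\<forall>i\<ge>N. \<forall>j\<ge>N. L2_norm M (\<lambda>x. fs i x - fs j x) \<le> ennreal ((1/2)^(Suc n))"
      using Cauchy[of "(1/2)^(Suc n)"] by auto
    then show "\<exists>y. (\<forall>i\<ge>y. \<forall>j\<ge>y. L2_norm M (\<lambda>x. fs i x - fs j x) \<le> ennreal ((1/2)^(Suc n))) \<and> x < y"
      by (intro exI[of _ "max N (Suc x)"]) auto
  qed
  then obtain r where r: "\<And>n i j. i \<ge> r n \<Longrightarrow> j \<ge> r n \<Longrightarrow> L2_norm M (\<lambda>x. fs i x - fs j x) \<le> ennreal ((1/2)^n)"
    and r_less: "\<And>n. r n < r (Suc n)" by blast
  have mono: "strict_mono r" using r_less by (simp add: strict_mono_Suc_iff)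
  define d where "d n x = norm (fs (r (Suc n)) x - fs (r n) x)" for n x
  have [measurable]: "d n \<in> borel_measurable M" for n unfolding d_def by measurable
  have dn: "L2_norm M (d n) \<le> ennreal ((1/2)^n)" for n
  proof -
    have "L2_norm M (d n) = L2_norm M (\<lambda>x. fs (r (Suc n)) x - fs (r n) x)"
      by (rule L2_norm_cong_AE) (simp add: d_def)
    also have "\<dots> \<le> ennreal ((1/2)^n)" using r_less[of n] by (intro r) auto
    finally show ?thesis .
  qed
  have part: "L2_norm M (\<lambda>x. \<Sum>k<n. d k x) \<le> 2" for n
  proof -
    have "L2_norm M (\<lambda>x. \<Sum>k<n. d k x) \<le> (\<Sum>k<n. L2_norm M (d k))" by (rule L2_norm_sum_le) measurable
    also have "\<dots> \<le> (\<Sum>k<n. ennreal ((1/2)^k))" by (intro sum_mono dn)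
    also have "\<dots> = ennreal (\<Sum>k<n. (1/2)^k)" by (simp add: sum_ennreal)
    also have "\<dots> \<le> ennreal 2" by (intro ennreal_leI) (simp add: geometric_sum)
    finally show ?thesis by simp
  qed
  have "(\<integral>\<^sup>+x. (\<Sum>k. ennreal (d k x))\<^sup>2 \<partial>M) = (\<integral>\<^sup>+x. (SUP n. ennreal ((norm (\<Sum>k<n. d k x))\<^sup>2)) \<partial>M)"
  proof (rule nn_integral_cong)
    fix x
    have *: "ennreal ((norm (\<Sum>k<n. d k x))\<^sup>2) = (\<Sum>k<n. ennreal (d k x))\<^sup>2" for n
      by (subst sum_ennreal) (auto simp: d_def ennreal_power sum_nonneg)
    have "(\<lambda>n. (\<Sum>k<n. ennreal (d k x))\<^sup>2) \<longlonglongrightarrow> (\<Sum>k. ennreal (d k x))\<^sup>2"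
      unfolding power2_eq_square by (intro tendsto_mult_ennreal summable_LIMSEQ summableI) auto
    moreover have "(\<lambda>n. (\<Sum>k<n. ennreal (d k x))\<^sup>2) \<longlonglongrightarrow> (SUP n. (\<Sum>k<n. ennreal (d k x))\<^sup>2)"
      by (intro LIMSEQ_SUP) (auto intro!: monoI power_mono sum_mono2)
    ultimately show "(\<Sum>k. ennreal (d k x))\<^sup>2 = (SUP n. ennreal ((norm (\<Sum>k<n. d k x))\<^sup>2))"
      unfolding * using LIMSEQ_unique by blast
  qed
  also have "\<dots> = (SUP n. \<integral>\<^sup>+x. ennreal ((norm (\<Sum>k<n. d k x))\<^sup>2) \<partial>M)"
  proof (rule nn_integral_monotone_convergence_SUP)
    show "incseq (\<lambda>n x. ennreal ((norm (\<Sum>k<n. d k x))\<^sup>2))"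
      by (auto intro!: incseq_SucI le_funI ennreal_leI power_mono simp: d_def sum_nonneg)
  qed measurable
  also have "\<dots> \<le> 2\<^sup>2" using part by (intro SUP_least) (simp add: L2_norm_le_iff)
  finally have "(\<integral>\<^sup>+x. (\<Sum>k. ennreal (d k x))\<^sup>2 \<partial>M) \<noteq> \<infinity>" by (auto simp: top_unique)
  then have "AE x in M. (\<Sum>k. ennreal (d k x))\<^sup>2 \<noteq> \<infinity>"
    by (intro nn_integral_PInf_AE) measurable
  then have AE: "AE x in M. convergent (\<lambda>n. fs (r n) x)"
  proof eventually_elim
    fix x assume "(\<Sum>k. ennreal (d k x))\<^sup>2 \<noteq> \<infinity>"
    then have "(\<Sum>k. ennreal (d k x)) \<noteq> top" by (auto simp: power2_eq_square)
    then have "summable (\<lambda>k. d k x)" by (intro summable_suminf_not_top) (auto simp: d_def)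
    then have "summable (\<lambda>k. fs (r (Suc k)) x - fs (r k) x)"
      unfolding d_def by (rule summable_norm_cancel)
    then have "convergent (\<lambda>n. fs (r 0) x + (\<Sum>k<n. fs (r (Suc k)) x - fs (r k) x))"
      by (intro convergent_add convergent_const) (simp add: summable_iff_convergent)
    then show "convergent (\<lambda>n. fs (r n) x)"
      by (simp add: sum_lessThan_telescope[of "\<lambda>k. fs (r k) x"])
  qed
  define f where "f x = lim (\<lambda>n. fs (r n) x)" for x
  have "f \<in> borel_measurable M" unfolding f_def by measurable
  moreover have "AE x in M. (\<lambda>n. fs (r n) x) \<longlonglongrightarrow> f x"
    using AE by eventually_elim (simp add: f_def convergent_LIMSEQ_iff)
  ultimately show thesis using mono that by blast
qed

lemma L2_norm_complete:
  fixes fs :: "nat \<Rightarrow> 'x \<Rightarrow> 'b::{banach, second_countable_topology}"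
  assumes [measurable]: "\<And>n. fs n \<in> borel_measurable M"
    and Cauchy: "\<And>e. e > 0 \<Longrightarrow> \<exists>N. \<forall>i\<ge>N. \<forall>j\<ge>N. L2_norm M (\<lambda>x. fs i x - fs j x) \<le> ennreal e"
  obtains f where "f \<in> borel_measurable M" "(\<lambda>n. L2_norm M (\<lambda>x. fs n x - f x)) \<longlonglongrightarrow> 0"
proof -
  obtain r f where r: "strict_mono (r::nat\<Rightarrow>nat)" and f[measurable]: "f \<in> borel_measurable M"
    and lim: "AE x in M. (\<lambda>n. fs (r n) x) \<longlonglongrightarrow> f x"
    using L2_norm_Cauchy_AE_subseq[OF assms] by blast
  have "(\<lambda>n. L2_norm M (\<lambda>x. fs n x - f x)) \<longlonglongrightarrow> 0"
    unfolding ennreal_tendsto_0_iff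
  proof (intro allI impI)
    fix e :: real assume "e > 0"
    then obtain N where N: "\<And>i j. i \<ge> N \<Longrightarrow> j \<ge> N \<Longrightarrow> L2_norm M (\<lambda>x. fs i x - fs j x) \<le> ennreal e"
      using Cauchy by blast
    show "\<forall>\<^sub>F n in sequentially. L2_norm M (\<lambda>x. fs n x - f x) \<le> ennreal e"
      unfolding eventually_sequentially
    proof (intro exI allI impI)
      fix n assume "N \<le> n"
      show "L2_norm M (\<lambda>x. fs n x - f x) \<le> ennreal e"
      \<comment> \<open>Since \<open>r i \<ge> i\<close>, the shift by \<open>N\<close> keeps every
        index of the subsequence beyond \<open>N\<close>, so the Cauchy bound holds along the whole
        sequence to which Fatou's lemma is applied.\<close>
      proof (rule L2_norm_liminf[where fs="\<lambda>k x. fs n x - fs (r (k + N)) x"])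
        show "AE x in M. (\<lambda>k. fs n x - fs (r (k + N)) x) \<longlonglongrightarrow> fs n x - f x"
          using lim by eventually_elim (intro tendsto_intros LIMSEQ_ignore_initial_segment)
        show "L2_norm M (\<lambda>x. fs n x - fs (r (k + N)) x) \<le> ennreal e" for k
          using \<open>N \<le> n\<close> seq_suble[OF r, of "k + N"] by (intro N) auto
      qed measurable
    qed
  qed
  with f show thesis using that by blast
qed

section \<open>Convergence in mean square\<close>

definition L2_lim :: "'x measure \<Rightarrow> (nat \<Rightarrow> 'x \<Rightarrow> 'b::real_normed_vector) \<Rightarrow> ('x \<Rightarrow> 'b) \<Rightarrow> bool" where
  "L2_lim M fs f \<longleftrightarrow> (\<lambda>n. L2_norm M (\<lambda>x. fs n x - f x)) \<longlonglongrightarrow> 0"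

lemma ennreal_tendsto_0_le:
  fixes f g :: "'i \<Rightarrow> ennreal"
  assumes "(g \<longlongrightarrow> 0) F" "\<And>x. f x \<le> g x"
  shows "(f \<longlongrightarrow> 0) F"
  by (rule tendsto_sandwich[OF _ _ tendsto_const assms(1)]) (auto simp: assms(2))

lemma ennreal_tendsto_0_cmult:
  fixes f :: "'i \<Rightarrow> ennreal"
  assumes "(f \<longlongrightarrow> 0) F" "c < \<infinity>"
  shows "((\<lambda>x. c * f x) \<longlongrightarrow> 0) F"
  using ennreal_tendsto_cmult[OF _ assms(1), of c] assms(2) by simp

lemma L2_lim_unique:
  fixes f :: "'x \<Rightarrow> 'b::{real_normed_vector, second_countable_topology}"
  assumes [measurable]: "\<And>n. fs n \<in> borel_measurable M" "f \<in> borel_measurable M" "g \<in> borel_measurable M"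
    and "L2_lim M fs f" "L2_lim M fs g"
  shows "AE x in M. f x = g x"
proof -
  have "(\<lambda>n. L2_norm M (\<lambda>x. fs n x - f x) + L2_norm M (\<lambda>x. fs n x - g x)) \<longlonglongrightarrow> 0 + 0"
    using assms unfolding L2_lim_def by (intro tendsto_add)
  moreover have "L2_norm M (\<lambda>x. f x - g x) \<le> L2_norm M (\<lambda>x. fs n x - f x) + L2_norm M (\<lambda>x. fs n x - g x)" for n
    using L2_norm_diff_triangle[of f M "fs n" g] by (simp add: L2_norm_minus_commute)
  ultimately have "L2_norm M (\<lambda>x. f x - g x) \<le> 0"
    by (intro LIMSEQ_le_const) auto
  then show ?thesis by (subst (asm) le_zero_eq, subst (asm) L2_norm_eq_0_iff) auto
qed

text \<open>Mean-square convergence makes the sequence Cauchy, so a subsequence converges almost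
  everywhere to some \<open>g\<close>. Fatou's lemma then bounds the norm of \<open>f - g\<close> by
  every positive \<open>e\<close>, which identifies the two limits.\<close>

lemma L2_lim_AE_subseq:
  fixes f :: "'x \<Rightarrow> 'b::{banach, second_countable_topology}"
  assumes [measurable]: "\<And>n. fs n \<in> borel_measurable M" "f \<in> borel_measurable M"
    and lim: "L2_lim M fs f"
  obtains r where "strict_mono (r::nat\<Rightarrow>nat)" "AE x in M. (\<lambda>n. fs (r n) x) \<longlonglongrightarrow> f x"
proof -
  have "\<exists>N. \<forall>i\<ge>N. \<forall>j\<ge>N. L2_norm M (\<lambda>x. fs i x - fs j x) \<le> ennreal e" if "e > 0" for e
  proof -
    have "\<forall>\<^sub>F n in sequentially. L2_norm M (\<lambda>x. fs n x - f x) \<le> ennreal (e/2)"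
      using lim that unfolding L2_lim_def ennreal_tendsto_0_iff by auto
    then obtain N where N: "\<And>n. n \<ge> N \<Longrightarrow> L2_norm M (\<lambda>x. fs n x - f x) \<le> ennreal (e/2)"
      unfolding eventually_sequentially by blast
    have "L2_norm M (\<lambda>x. fs i x - fs j x) \<le> ennreal e" if "i \<ge> N" "j \<ge> N" for i j
    proof -
      have "L2_norm M (\<lambda>x. fs i x - fs j x) \<le> ennreal (e/2) + ennreal (e/2)"
        using L2_norm_diff_triangle[of "fs i" M f "fs j"] N[OF that(1)] N[OF that(2)]
        by (simp add: L2_norm_minus_commute[of M f]) (meson add_mono order_trans)
      then show ?thesis using \<open>e > 0\<close> by (simp flip: ennreal_plus)
    qed
    then show ?thesis by blast
  qed
  then obtain r g where r: "strict_mono (r::nat\<Rightarrow>nat)" "g \<in> borel_measurable M" and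
    AE: "AE x in M. (\<lambda>n. fs (r n) x) \<longlonglongrightarrow> g x"
    using L2_norm_Cauchy_AE_subseq[of fs M] assms(1) by blast
  have "L2_norm M (\<lambda>x. f x - g x) \<le> ennreal e" if "e > 0" for e
  proof -
    obtain N where N: "\<And>n. n \<ge> N \<Longrightarrow> L2_norm M (\<lambda>x. fs n x - f x) \<le> ennreal e"
      using lim \<open>e > 0\<close> unfolding L2_lim_def ennreal_tendsto_0_iff eventually_sequentially by blast
    show ?thesis
    proof (rule L2_norm_liminf[where fs="\<lambda>k x. f x - fs (r (k + N)) x"])
      show "AE x in M. (\<lambda>k. f x - fs (r (k + N)) x) \<longlonglongrightarrow> f x - g x"
        using AE by eventually_elim (intro tendsto_intros LIMSEQ_ignore_initial_segment)
      show "L2_norm M (\<lambda>x. f x - fs (r (k + N)) x) \<le> ennreal e" for k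
        using seq_suble[OF r(1), of "k + N"] by (subst L2_norm_minus_commute, intro N) linarith
    qed measurable
  qed
  then have "L2_norm M (\<lambda>x. f x - g x) \<le> 0 + ennreal e" if "e > 0" for e
    using that by simp
  then have "L2_norm M (\<lambda>x. f x - g x) \<le> 0"
    by (rule ennreal_le_epsilon)
  then have "L2_norm M (\<lambda>x. f x - g x) = 0" by (simp only: le_zero_eq)
  then have "AE x in M. f x = g x" using r(2) by (subst (asm) L2_norm_eq_0_iff) auto
  with AE have "AE x in M. (\<lambda>n. fs (r n) x) \<longlonglongrightarrow> f x" by eventually_elim simp
  with r(1) show thesis using that by blast
qed

lemma L2_lim_add:
  fixes f :: "'x \<Rightarrow> 'b::{real_normed_vector, second_countable_topology}"
  assumes [measurable]: "\<And>n. fs n \<in> borel_measurable M" "f \<in> borel_measurable M"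
    "\<And>n. gs n \<in> borel_measurable M" "g \<in> borel_measurable M"
    and lim: "L2_lim M fs f" "L2_lim M gs g"
  shows "L2_lim M (\<lambda>n x. fs n x + gs n x) (\<lambda>x. f x + g x)"
  unfolding L2_lim_def
proof (rule ennreal_tendsto_0_le)
  show "(\<lambda>n. L2_norm M (\<lambda>x. fs n x - f x) + L2_norm M (\<lambda>x. gs n x - g x)) \<longlonglongrightarrow> 0"
    using tendsto_add[OF lim[unfolded L2_lim_def]] by simp
  show "L2_norm M (\<lambda>x. fs n x + gs n x - (f x + g x)) \<le> L2_norm M (\<lambda>x. fs n x - f x) + L2_norm M (\<lambda>x. gs n x - g x)" for n
    using L2_norm_add_le[of "\<lambda>x. fs n x - f x" M "\<lambda>x. gs n x - g x"] by (simp add: algebra_simps)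
qed

lemma L2_lim_sum:
  fixes f :: "'i \<Rightarrow> 'x \<Rightarrow> 'b::{real_normed_vector, second_countable_topology}"
  assumes [measurable]: "\<And>i n. i \<in> I \<Longrightarrow> fs i n \<in> borel_measurable M" "\<And>i. i \<in> I \<Longrightarrow> f i \<in> borel_measurable M"
    and lim: "\<And>i. i \<in> I \<Longrightarrow> L2_lim M (fs i) (f i)"
  shows "L2_lim M (\<lambda>n x. \<Sum>i\<in>I. fs i n x) (\<lambda>x. \<Sum>i\<in>I. f i x)"
  using assms
proof (induction I rule: infinite_finite_induct)
  case (insert i I)
  then have "L2_lim M (\<lambda>n x. fs i n x + (\<Sum>i\<in>I. fs i n x)) (\<lambda>x. f i x + (\<Sum>i\<in>I. f i x))"
    by (intro L2_lim_add) auto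
  with insert show ?case by simp
qed (auto simp: L2_lim_def)

text \<open>Carries a limit through any pointwise Lipschitz operation, also into another value
  space: negation, multiples, components of vectors, factors of modulus one.\<close>

lemma L2_lim_bound:
  fixes f :: "'x \<Rightarrow> 'b::{real_normed_vector, second_countable_topology}"
    and g :: "'x \<Rightarrow> 'c::{real_normed_vector, second_countable_topology}"
  assumes lim: "L2_lim M fs f" and [measurable]: "\<And>n. fs n \<in> borel_measurable M" "f \<in> borel_measurable M"
    and "\<And>n. AE x in M. norm (gs n x - g x) \<le> K * norm (fs n x - f x)"
  shows "L2_lim M gs g"
  unfolding L2_lim_def
proof (rule ennreal_tendsto_0_le)
  show "(\<lambda>n. ennreal \<bar>K\<bar> * L2_norm M (\<lambda>x. fs n x - f x)) \<longlonglongrightarrow> 0"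
    using lim by (intro ennreal_tendsto_0_cmult) (auto simp: L2_lim_def)
  fix n
  have "L2_norm M (\<lambda>x. gs n x - g x) \<le> L2_norm M (\<lambda>x. \<bar>K\<bar> *\<^sub>R (fs n x - f x))"
    using assms(4)[of n]
    by (intro L2_norm_mono_AE, eventually_elim)
       (auto intro!: order_trans[OF _ mult_right_mono[OF abs_ge_self]])
  also have "\<dots> = ennreal \<bar>K\<bar> * L2_norm M (\<lambda>x. fs n x - f x)"
    by (rule L2_norm_scale) auto
  finally show "L2_norm M (\<lambda>x. gs n x - g x) \<le> ennreal \<bar>K\<bar> * L2_norm M (\<lambda>x. fs n x - f x)" .
qed

lemma L2_lim_cong_AE:
  assumes "\<And>n. AE x in M. fs n x = fs' n x" "AE x in M. f x = f' x"
  shows "L2_lim M fs f \<longleftrightarrow> L2_lim M fs' f'"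
proof -
  have "L2_norm M (\<lambda>x. fs n x - f x) = L2_norm M (\<lambda>x. fs' n x - f' x)" for n
    by (rule L2_norm_cong_AE) (use assms(1)[of n] assms(2) in eventually_elim, simp)
  then show ?thesis by (simp add: L2_lim_def)
qed

section \<open>The space L2 on R^n\<close>

lemma L2_D [measurable_dest]: "f \<in> L2 \<Longrightarrow> f \<in> borel_measurable borel"
  by (simp add: L2_def)

lemma L2_norm_less_top: "f \<in> L2 \<Longrightarrow> L2_norm lborel f < \<infinity>"
  by (simp add: L2_def)

lemma L2I: "f \<in> borel_measurable borel \<Longrightarrow> L2_norm lborel f < \<infinity> \<Longrightarrow> f \<in> L2"
  by (simp add: L2_def)

lemma L2_add: "f \<in> L2 \<Longrightarrow> g \<in> L2 \<Longrightarrow> (\<lambda>x. f x + g x) \<in> L2"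
proof (rule L2I)
  assume [measurable]: "f \<in> L2" "g \<in> L2"
  show "(\<lambda>x. f x + g x) \<in> borel_measurable borel" by measurable
  have "L2_norm lborel (\<lambda>x. f x + g x) \<le> L2_norm lborel f + L2_norm lborel g"
    by (rule L2_norm_add_le) auto
  also have "\<dots> < \<infinity>" using L2_norm_less_top[of f] L2_norm_less_top[of g] \<open>f \<in> L2\<close> \<open>g \<in> L2\<close> by simp
  finally show "L2_norm lborel (\<lambda>x. f x + g x) < \<infinity>" .
qed

lemma L2_bound:
  assumes "f \<in> L2" "AE x in lborel. norm (g x) \<le> K * norm (f x)" and [measurable]: "g \<in> borel_measurable borel"
  shows "g \<in> L2"
proof (rule L2I)
  have [measurable]: "f \<in> borel_measurable borel" using assms(1) by measurable
  have "L2_norm lborel g \<le> L2_norm lborel (\<lambda>x. \<bar>K\<bar> *\<^sub>R f x)"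
    using assms(2) by (intro L2_norm_mono_AE, eventually_elim) (auto intro!: order_trans[OF _ mult_right_mono[OF abs_ge_self]])
  also have "\<dots> = ennreal \<bar>K\<bar> * L2_norm lborel f"
    by (rule L2_norm_scale) auto
  also have "\<dots> < \<infinity>" using L2_norm_less_top[OF assms(1)] by (simp add: ennreal_mult_less_top)
  finally show "L2_norm lborel g < \<infinity>" .
qed (rule assms)

lemma L2_zero [simp]: "(\<lambda>x. 0) \<in> L2"
  by (simp add: L2_def)

lemma L2_uminus: "f \<in> L2 \<Longrightarrow> (\<lambda>x. - f x) \<in> L2"
  by (simp add: L2_def)

lemma L2_diff: "f \<in> L2 \<Longrightarrow> g \<in> L2 \<Longrightarrow> (\<lambda>x. f x - g x) \<in> L2"
  using L2_add[of f "\<lambda>x. - g x"] L2_uminus[of g] by simp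

lemma L2_sum: "(\<And>i. i \<in> I \<Longrightarrow> f i \<in> L2) \<Longrightarrow> (\<lambda>x. \<Sum>i\<in>I. f i x) \<in> L2"
  by (induction I rule: infinite_finite_induct) (auto intro: L2_add)

lemma L2_cong_AE: "f \<in> L2 \<Longrightarrow> AE x in lborel. f x = g x \<Longrightarrow> g \<in> borel_measurable borel \<Longrightarrow> g \<in> L2"
  by (rule L2_bound[where K=1]) (auto elim: eventually_mono)

lemma L2_lim_L2:
  assumes "L2_lim lborel fs f" "\<And>n. fs n \<in> L2" "f \<in> borel_measurable borel"
  shows "f \<in> L2"
proof -
  have [measurable]: "f \<in> borel_measurable borel" "fs n \<in> borel_measurable borel" for n using assms by auto
  obtain n where n: "L2_norm lborel (\<lambda>x. fs n x - f x) \<le> 1"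
  proof -
    have "\<forall>\<^sub>F n in sequentially. L2_norm lborel (\<lambda>x. fs n x - f x) \<le> ennreal 1"
      using assms(1) unfolding L2_lim_def ennreal_tendsto_0_iff by (meson zero_less_one)
    then have "\<exists>n. L2_norm lborel (\<lambda>x. fs n x - f x) \<le> ennreal 1" by (intro eventually_happens'[OF sequentially_bot])
    then show thesis using that by auto
  qed
  then have "(\<lambda>x. fs n x - f x) \<in> L2" by (intro L2I) (auto simp: le_less_trans)
  from L2_diff[OF assms(2)[of n] this] show ?thesis by simp
qed

lemma L2_complete:
  fixes fs :: "nat \<Rightarrow> (real ^ 'n) \<Rightarrow> 'b::{banach, second_countable_topology}"
  assumes "\<And>n. fs n \<in> L2"
    and Cauchy: "\<And>e. e > 0 \<Longrightarrow> \<exists>N. \<forall>i\<ge>N. \<forall>j\<ge>N. L2_norm lborel (\<lambda>x. fs i x - fs j x) \<le> ennreal e"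
  obtains f where "f \<in> L2" "L2_lim lborel fs f"
proof -
  have m: "fs n \<in> borel_measurable lborel" for n using assms(1)[of n] by auto
  obtain f where "f \<in> borel_measurable lborel" "(\<lambda>n. L2_norm lborel (\<lambda>x. fs n x - f x)) \<longlonglongrightarrow> 0"
    by (rule L2_norm_complete[of fs lborel, OF m Cauchy]) blast+
  then have "f \<in> borel_measurable borel" "L2_lim lborel fs f" by (auto simp: L2_lim_def)
  then show thesis using L2_lim_L2[of fs f] assms(1) that[of f] by blast
qed

section \<open>Lebesgue measure as a product, and slicing along one coordinate\<close>

lemma measurable_vec_lambda_PiM [measurable]:
  "(\<lambda>y. \<chi> i. y i) \<in> measurable (Pi\<^sub>M UNIV (\<lambda>_::'n::finite. lborel)) (borel :: (real ^ 'n) measure)"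
  by (rule borel_measurable_euclidean_space[THEN iffD2]) (auto simp: Basis_vec_def inner_axis)

lemma prod_Basis_vec:
  fixes f :: "real ^ 'n::finite \<Rightarrow> 'b::comm_monoid_mult"
  shows "(\<Prod>b\<in>Basis. f b) = (\<Prod>i\<in>UNIV. f (axis i 1))"
proof -
  have "Basis = range (\<lambda>i::'n. axis i (1::real))" by (auto simp: Basis_vec_def)
  moreover have "inj (\<lambda>i::'n. axis i (1::real))" by (auto simp: inj_on_def axis_eq_axis)
  ultimately show ?thesis using prod.reindex[of "\<lambda>i::'n. axis i (1::real)" UNIV f] by (simp add: comp_def)
qed

text \<open>A Borel measure that gives every box the product of its side lengths is Lebesgue
  measure. This ties the coordinate products in \<open>slice_norm\<close> to \<open>lborel\<close>
  on vectors.\<close>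

lemma lborel_vec_PiM:
  "distr (Pi\<^sub>M UNIV (\<lambda>_. lborel)) borel (\<lambda>y. \<chi> i. y i) = (lborel :: (real ^ 'n::finite) measure)"
proof (rule lborel_eqI[symmetric])
  interpret product_sigma_finite "\<lambda>_::'n. lborel :: real measure" by standard
  fix l u :: "real ^ 'n" assume le: "\<And>b. b \<in> Basis \<Longrightarrow> l \<bullet> b \<le> u \<bullet> b"
  have le': "l $ i \<le> u $ i" for i using le[of "axis i 1"] by (auto simp: inner_axis axis_in_Basis_iff)
  have "emeasure (distr (Pi\<^sub>M UNIV (\<lambda>_. lborel)) borel (\<lambda>y. \<chi> i. y i)) (box l u)
    = emeasure (Pi\<^sub>M UNIV (\<lambda>_::'n. lborel)) (PiE UNIV (\<lambda>i. {l $ i <..< u $ i}))"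
    by (subst emeasure_distr)
       (auto intro!: arg_cong[where f="emeasure _"] simp: box_def Basis_vec_def inner_axis space_PiM PiE_def Pi_def)
  also have "\<dots> = (\<Prod>i\<in>UNIV. ennreal (u $ i - l $ i))"
    by (subst emeasure_PiM) (auto simp: le')
  also have "\<dots> = (\<Prod>b\<in>Basis. (u - l) \<bullet> b)"
    by (simp add: prod_Basis_vec inner_axis prod_ennreal le')
  finally show "emeasure (distr (Pi\<^sub>M UNIV (\<lambda>_. lborel)) borel (\<lambda>y. \<chi> i. y i)) (box l u) = (\<Prod>b\<in>Basis. (u - l) \<bullet> b)" .
qed simp

lemma measurable_insert_coord [measurable]:
  "(\<lambda>(t, y). insert_coord j t y) \<in> measurable (borel \<Otimes>\<^sub>M Pi\<^sub>M (- {j}) (\<lambda>_. lborel)) (borel :: (real ^ 'n::finite) measure)"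
proof -
  have "(\<lambda>p. (case p of (t, y) \<Rightarrow> insert_coord j t y) $ i)
      \<in> borel_measurable (borel \<Otimes>\<^sub>M Pi\<^sub>M (- {j}) (\<lambda>_. lborel))" for i
    by (cases "i = j") (auto simp: insert_coord_def case_prod_unfold)
  then show ?thesis
    by (intro borel_measurable_euclidean_space[THEN iffD2]) (auto simp: Basis_vec_def inner_axis)
qed

text \<open>Tonelli's theorem in the product over all coordinates, with the \<open>j\<close>-th one
  split off as the outer variable. This is the order of integration in the mixed norms.\<close>

lemma nn_integral_insert_coord:
  fixes f :: "real ^ 'n::finite \<Rightarrow> ennreal"
  assumes [measurable]: "f \<in> borel_measurable borel"
  shows "(\<integral>\<^sup>+x. f x \<partial>lborel) = (\<integral>\<^sup>+t. \<integral>\<^sup>+y. f (insert_coord j t y) \<partial>Pi\<^sub>M (- {j}) (\<lambda>_. lborel) \<partial>lborel)"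
proof -
  interpret product_sigma_finite "\<lambda>_::'n. lborel :: real measure" by standard
  have eq: "(\<chi> i. (y(j := t)) i) = insert_coord j t y" for t y
    by (auto simp: insert_coord_def vec_eq_iff)
  have ins: "insert j (- {j}) = UNIV" by auto
  have "(\<integral>\<^sup>+x. f x \<partial>lborel) = (\<integral>\<^sup>+y. f (\<chi> i. y i) \<partial>Pi\<^sub>M UNIV (\<lambda>_. lborel))"
    by (subst lborel_vec_PiM[symmetric], subst nn_integral_distr) auto
  also have "\<dots> = (\<integral>\<^sup>+t. \<integral>\<^sup>+y. f (\<chi> i. (y(j := t)) i) \<partial>Pi\<^sub>M (- {j}) (\<lambda>_. lborel) \<partial>lborel)"
    using product_nn_integral_insert_rev[of "- {j}" j "\<lambda>y. f (\<chi> i. y i)"] by (simp only: ins) auto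
  finally show ?thesis by (simp only: eq)
qed

text \<open>The slices of a null set are null for almost every \<open>t\<close>, because their
  measures integrate to the measure of the set. For this reason the mixed norms do not depend on the
  representative.\<close>

lemma AE_insert_coord:
  fixes P :: "real ^ 'n::finite \<Rightarrow> bool"
  assumes "AE x in lborel. P x"
  shows "AE t in lborel. AE y in Pi\<^sub>M (- {j}) (\<lambda>_. lborel). P (insert_coord j t y)"
proof -
  interpret product_sigma_finite "\<lambda>_::'n. lborel :: real measure" by standard
  interpret finite_product_sigma_finite "\<lambda>_::'n. lborel :: real measure" "- {j}" by standard simp
  obtain N where N: "N \<in> null_sets lborel" "{x \<in> space lborel. \<not> P x} \<subseteq> N"
    using assms by (auto simp: eventually_ae_filter)
  have [measurable]: "N \<in> sets borel" using N by auto
  have "(\<integral>\<^sup>+t. \<integral>\<^sup>+y. indicator N (insert_coord j t y) \<partial>Pi\<^sub>M (- {j}) (\<lambda>_. lborel) \<partial>lborel) = emeasure lborel N"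
    by (subst nn_integral_insert_coord[symmetric]) auto
  also have "\<dots> = 0" using N by auto
  finally have "AE t in lborel. (\<integral>\<^sup>+y. indicator N (insert_coord j t y) \<partial>Pi\<^sub>M (- {j}) (\<lambda>_. lborel)) = 0"
    by (subst (asm) nn_integral_0_iff_AE) auto
  then show ?thesis
  proof eventually_elim
    fix t assume "(\<integral>\<^sup>+y. indicator N (insert_coord j t y) \<partial>Pi\<^sub>M (- {j}) (\<lambda>_. lborel)) = (0::ennreal)"
    then have "AE y in Pi\<^sub>M (- {j}) (\<lambda>_. lborel). (indicator N (insert_coord j t y) :: ennreal) = 0"
      by (subst (asm) nn_integral_0_iff_AE) auto
    then show "AE y in Pi\<^sub>M (- {j}) (\<lambda>_. lborel). P (insert_coord j t y)"
      by eventually_elim (use N in \<open>auto simp: indicator_def split: if_splits\<close>)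
  qed
qed

section \<open>Bilinear pairing and dominated convergence in L2\<close>

lemma L2_mult_integrable:
  fixes f g :: "real ^ 'n::finite \<Rightarrow> complex"
  assumes "f \<in> L2" "g \<in> L2"
  shows "integrable lborel (\<lambda>x. f x * g x)"
    and "ennreal (norm (LINT x|lborel. f x * g x)) \<le> L2_norm lborel f * L2_norm lborel g"
proof -
  have [measurable]: "f \<in> borel_measurable borel" "g \<in> borel_measurable borel" using assms by auto
  have le: "(\<integral>\<^sup>+x. ennreal (norm (f x * g x)) \<partial>lborel) \<le> L2_norm lborel f * L2_norm lborel g"
    unfolding L2_norm_def
    using nn_integral_Cauchy_Schwarz_sqrt[of "\<lambda>x. ennreal (norm (f x))" lborel "\<lambda>x. ennreal (norm (g x))"]
    by (simp add: norm_mult ennreal_mult ennreal_power)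
  also have "\<dots> < \<infinity>" using assms L2_norm_less_top by (auto simp: ennreal_mult_less_top)
  finally show *: "integrable lborel (\<lambda>x. f x * g x)" by (intro integrableI_bounded) auto
  show "ennreal (norm (LINT x|lborel. f x * g x)) \<le> L2_norm lborel f * L2_norm lborel g"
    using integral_norm_bound_ennreal[OF *] le by (rule order_trans)
qed

lemma L2_cnj: "f \<in> L2 \<Longrightarrow> (\<lambda>x. cnj (f x)) \<in> L2"
  by (rule L2_bound[where K=1]) (auto intro!: borel_measurable_continuous_on[OF continuous_on_cnj])

lemma L2_norm_cnj [simp]: "L2_norm M (\<lambda>x. cnj (f x)) = L2_norm M f"
  by (simp add: L2_norm_def)

lemma L2_cmult: "f \<in> L2 \<Longrightarrow> (\<lambda>x. (c::complex) * f x) \<in> L2"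
  by (rule L2_bound[where K="norm c"]) (auto simp: norm_mult)

lemma L2_mult_bounded:
  fixes f g :: "real ^ 'n::finite \<Rightarrow> complex"
  assumes "f \<in> L2" "AE x in lborel. norm (s x) \<le> K" "s \<in> borel_measurable borel"
  shows "(\<lambda>x. s x * f x) \<in> L2"
  by (rule L2_bound[OF assms(1), where K=K])
     (use assms in \<open>auto simp: norm_mult elim!: eventually_mono intro!: mult_right_mono\<close>)

lemma L2_norm_square_integral:
  fixes f :: "real ^ 'n::finite \<Rightarrow> complex"
  assumes "f \<in> L2"
  shows "LINT x|lborel. f x * cnj (f x) = of_real ((enn2real (L2_norm lborel f))\<^sup>2)"
proof -
  have [measurable]: "f \<in> borel_measurable borel" using assms by auto
  have "(LINT x|lborel. f x * cnj (f x)) = of_real (LINT x|lborel. (norm (f x))\<^sup>2)"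
    by (subst integral_complex_of_real[symmetric]) (simp add: complex_norm_square del: of_real_power)
  also have "(LINT x|lborel. (norm (f x))\<^sup>2) = enn2real ((L2_norm lborel f)\<^sup>2)"
    by (simp add: integral_eq_nn_integral L2_norm_square)
  also have "\<dots> = (enn2real (L2_norm lborel f))\<^sup>2"
    by (simp add: power2_eq_square enn2real_mult)
  finally show ?thesis .
qed

lemma L2_lim_norm_bounded:
  fixes fs :: "nat \<Rightarrow> real ^ 'n::finite \<Rightarrow> complex"
  assumes "L2_lim lborel fs f" "f \<in> L2" "\<And>n. fs n \<in> L2"
  shows "\<forall>\<^sub>F n in sequentially. L2_norm lborel (fs n) \<le> L2_norm lborel f + 1"
proof -
  have "\<forall>\<^sub>F n in sequentially. L2_norm lborel (\<lambda>x. fs n x - f x) \<le> ennreal 1"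
    using assms(1) unfolding L2_lim_def ennreal_tendsto_0_iff by (meson zero_less_one)
  then show ?thesis
  proof eventually_elim
    fix n assume n: "L2_norm lborel (\<lambda>x. fs n x - f x) \<le> ennreal 1"
    have "L2_norm lborel (fs n) \<le> L2_norm lborel f + L2_norm lborel (\<lambda>x. fs n x - f x)"
      using L2_norm_add_le[of f lborel "\<lambda>x. fs n x - f x"] assms by auto
    also have "\<dots> \<le> L2_norm lborel f + 1" using n by (intro add_left_mono) simp
    finally show "L2_norm lborel (fs n) \<le> L2_norm lborel f + 1" .
  qed
qed

text \<open>The difference of the products is \<open>(fs n - f) * gs n + f * (gs n - g)\<close>.
  Cauchy-Schwarz applies to both terms, and in the first one the norm of \<open>gs n\<close> is
  eventually at most that of \<open>g\<close> plus 1.\<close>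

lemma L2_lim_mult_integral:
  fixes f g :: "real ^ 'n::finite \<Rightarrow> complex"
  assumes fs: "L2_lim lborel fs f" "f \<in> L2" "\<And>n. fs n \<in> L2"
    and gs: "L2_lim lborel gs g" "g \<in> L2" "\<And>n. gs n \<in> L2"
  shows "(\<lambda>n. LINT x|lborel. fs n x * gs n x) \<longlonglongrightarrow> (LINT x|lborel. f x * g x)"
proof -
  let ?B = "\<lambda>n. L2_norm lborel (\<lambda>x. fs n x - f x) * (L2_norm lborel g + 1)
      + L2_norm lborel f * L2_norm lborel (\<lambda>x. gs n x - g x)"
  have B: "?B \<longlonglongrightarrow> 0"
  proof -
    have "(\<lambda>n. (L2_norm lborel g + 1) * L2_norm lborel (\<lambda>x. fs n x - f x)) \<longlonglongrightarrow> 0"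
      using fs(1) L2_norm_less_top[OF gs(2)] unfolding L2_lim_def by (intro ennreal_tendsto_0_cmult) auto
    moreover have "(\<lambda>n. L2_norm lborel f * L2_norm lborel (\<lambda>x. gs n x - g x)) \<longlonglongrightarrow> 0"
      using gs(1) L2_norm_less_top[OF fs(2)] unfolding L2_lim_def by (intro ennreal_tendsto_0_cmult) auto
    ultimately show ?thesis using tendsto_add[of _ 0 sequentially _ 0] by (fastforce simp: mult.commute)
  qed
  have ev: "\<forall>\<^sub>F n in sequentially.
    ennreal (norm ((LINT x|lborel. fs n x * gs n x) - (LINT x|lborel. f x * g x))) \<le> ?B n"
    using L2_lim_norm_bounded[OF gs]
  proof eventually_elim
    fix n assume n: "L2_norm lborel (gs n) \<le> L2_norm lborel g + 1"
    note i = L2_mult_integrable(1)[OF L2_diff[OF fs(3)[of n] fs(2)] gs(3)[of n]]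
             L2_mult_integrable(1)[OF fs(2) L2_diff[OF gs(3)[of n] gs(2)]]
    have "(LINT x|lborel. fs n x * gs n x) - (LINT x|lborel. f x * g x)
      = (LINT x|lborel. fs n x * gs n x - f x * g x)"
      by (rule Bochner_Integration.integral_diff[symmetric]) (auto intro: L2_mult_integrable fs gs)
    also have "\<dots> = (LINT x|lborel. (fs n x - f x) * gs n x + f x * (gs n x - g x))"
      by (rule arg_cong[where f="integral\<^sup>L lborel"]) (auto simp: algebra_simps)
    also have "\<dots> = (LINT x|lborel. (fs n x - f x) * gs n x) + (LINT x|lborel. f x * (gs n x - g x))"
      using i by (rule Bochner_Integration.integral_add)
    finally have "ennreal (norm ((LINT x|lborel. fs n x * gs n x) - (LINT x|lborel. f x * g x)))
      \<le> ennreal (norm (LINT x|lborel. (fs n x - f x) * gs n x)) + ennreal (norm (LINT x|lborel. f x * (gs n x - g x)))"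
      by (simp add: norm_triangle_ineq flip: ennreal_plus)
    also have "\<dots> \<le> L2_norm lborel (\<lambda>x. fs n x - f x) * L2_norm lborel (gs n)
      + L2_norm lborel f * L2_norm lborel (\<lambda>x. gs n x - g x)"
      by (intro add_mono L2_mult_integrable fs gs L2_diff)
    also have "\<dots> \<le> ?B n" using n by (intro add_right_mono mult_left_mono) auto
    finally show "ennreal (norm ((LINT x|lborel. fs n x * gs n x) - (LINT x|lborel. f x * g x))) \<le> ?B n" .
  qed
  have "(\<lambda>n. ennreal (norm ((LINT x|lborel. fs n x * gs n x) - (LINT x|lborel. f x * g x)))) \<longlonglongrightarrow> 0"
    by (rule tendsto_sandwich[OF _ ev tendsto_const B]) auto
  then have "(\<lambda>n. norm ((LINT x|lborel. fs n x * gs n x) - (LINT x|lborel. f x * g x))) \<longlonglongrightarrow> 0"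
    by (simp flip: ennreal_0)
  then show ?thesis by (simp add: tendsto_norm_zero_iff LIM_zero_iff)
qed

lemma L2_lim_dominated:
  fixes f :: "real ^ 'n::finite \<Rightarrow> 'b::{banach, second_countable_topology}"
    and g :: "real ^ 'n::finite \<Rightarrow> 'c::{banach, second_countable_topology}"
  assumes [measurable]: "\<And>n. fs n \<in> borel_measurable borel" "f \<in> borel_measurable borel"
    and g: "g \<in> L2" and le: "\<And>n. AE x in lborel. norm (fs n x - f x) \<le> norm (g x)"
    and lim: "AE x in lborel. (\<lambda>n. fs n x) \<longlonglongrightarrow> f x"
  shows "L2_lim lborel fs f"
proof -
  have [measurable]: "g \<in> borel_measurable borel" using g by auto
  have "(\<lambda>n. \<integral>\<^sup>+x. ennreal ((norm (fs n x - f x))\<^sup>2) \<partial>lborel) \<longlonglongrightarrow> (\<integral>\<^sup>+(x::real^'n). 0 \<partial>lborel)"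
  proof (rule nn_integral_dominated_convergence[where w="\<lambda>x. ennreal ((norm (g x))\<^sup>2)"])
    show "AE x in lborel. ennreal ((norm (fs n x - f x))\<^sup>2) \<le> ennreal ((norm (g x))\<^sup>2)" for n
      using le[of n] by eventually_elim (intro ennreal_leI power_mono, auto)
    show "(\<integral>\<^sup>+ x. ennreal ((norm (g x))\<^sup>2) \<partial>lborel) < \<infinity>"
      using L2_norm_less_top[OF g] unfolding L2_norm_less_top_iff .
    show "AE x in lborel. (\<lambda>n. ennreal ((norm (fs n x - f x))\<^sup>2)) \<longlonglongrightarrow> 0"
      using lim
    proof eventually_elim
      fix x assume "(\<lambda>n. fs n x) \<longlonglongrightarrow> f x"
      then have "(\<lambda>n. (norm (fs n x - f x))\<^sup>2) \<longlonglongrightarrow> 0\<^sup>2"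
        by (intro tendsto_power tendsto_norm_zero LIM_zero)
      then show "(\<lambda>n. ennreal ((norm (fs n x - f x))\<^sup>2)) \<longlonglongrightarrow> 0"
        using tendsto_ennrealI by fastforce
    qed
  qed measurable
  then show ?thesis unfolding L2_lim_def L2_norm_def by (intro ennreal_sqrt_tendsto_0) simp
qed

text \<open>Cutting off in space and in height at once leaves a bounded function of bounded support.
  So every Borel function, in particular one in a mixed space, has square-integrable approximations
  that converge to it at every point.\<close>

definition trunc :: "nat \<Rightarrow> ('a::real_normed_vector \<Rightarrow> 'b::real_normed_vector) \<Rightarrow> 'a \<Rightarrow> 'b" where
  "trunc l f x = (if norm x \<le> real l \<and> norm (f x) \<le> real l then f x else 0)"

lemma measurable_trunc [measurable]:
  fixes f :: "real ^ 'n::finite \<Rightarrow> 'b::{banach, second_countable_topology}"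
  assumes [measurable]: "f \<in> borel_measurable borel"
  shows "trunc l f \<in> borel_measurable borel"
  unfolding trunc_def[abs_def] by measurable

lemma norm_trunc_le: "norm (trunc l f x) \<le> norm (f x)"
  by (simp add: trunc_def)

lemma norm_trunc_diff_le: "norm (trunc l f x - f x) \<le> norm (f x)"
  by (simp add: trunc_def)

lemma trunc_tendsto: "(\<lambda>l. trunc l f x) \<longlonglongrightarrow> f x"
proof -
  obtain N where N: "norm x \<le> real N" "norm (f x) \<le> real N"
    by (metis dual_order.trans linear real_arch_simple of_nat_mono)
  have "\<forall>\<^sub>F l in sequentially. trunc l f x = f x"
    using eventually_ge_at_top[of N] by eventually_elim (use N in \<open>auto simp: trunc_def\<close>)
  then show ?thesis by (rule tendsto_eventually)
qed

lemma indicator_cball_L2: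
  fixes c :: "'b::{banach, second_countable_topology}"
  shows "(\<lambda>x::real^'a. indicator (cball 0 r) x *\<^sub>R c) \<in> L2"
proof (rule L2I)
  have "(\<integral>\<^sup>+x. ennreal ((norm (indicator (cball 0 r) x *\<^sub>R c))\<^sup>2) \<partial>(lborel::(real^'a) measure))
    = (\<integral>\<^sup>+x. ennreal ((norm c)\<^sup>2) * indicator (cball (0::real^'a) r) x \<partial>lborel)"
    by (rule nn_integral_cong) (auto simp: indicator_def)
  also have "\<dots> < \<infinity>"
    using emeasure_lborel_cball_finite[of "0::real^'a" r] by (subst nn_integral_cmult_indicator) (auto simp: ennreal_mult_less_top)
  finally show "L2_norm lborel (\<lambda>x::real^'a. indicator (cball 0 r) x *\<^sub>R c) < \<infinity>" unfolding L2_norm_less_top_iff .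
qed (auto intro!: borel_measurable_scaleR borel_measurable_indicator)

lemma indicator_cball_integrable: "integrable lborel (\<lambda>x::real^'n. indicator (cball 0 r) x * (c::real))"
  using emeasure_lborel_cball_finite[of "0::real^'n" r]
  by (intro integrable_mult_left) (auto intro!: integrable_real_indicator simp: less_top)

lemma trunc_L2:
  fixes f :: "real ^ 'n::finite \<Rightarrow> 'b::{banach, second_countable_topology}"
  assumes [measurable]: "f \<in> borel_measurable borel"
  shows "trunc l f \<in> L2"
  by (rule L2_bound[OF indicator_cball_L2[of "real l" "real l"], where K=1]) (auto simp: trunc_def indicator_def)

lemma trunc_L2_lim:
  fixes f :: "real ^ 'n::finite \<Rightarrow> 'b::{banach, second_countable_topology}"
  assumes "f \<in> L2"
  shows "L2_lim lborel (\<lambda>l. trunc l f) f"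
  using assms by (intro L2_lim_dominated[of _ _ f]) (auto intro!: measurable_trunc norm_trunc_diff_le trunc_tendsto AE_I2)

section \<open>Translations and their continuity in L2\<close>

lemma nn_integral_translate:
  fixes f :: "'a::euclidean_space \<Rightarrow> ennreal"
  assumes [measurable]: "f \<in> borel_measurable borel"
  shows "(\<integral>\<^sup>+x. f (x + h) \<partial>lborel) = (\<integral>\<^sup>+x. f x \<partial>lborel)"
  by (subst (2) lborel_distr_plus[of h, symmetric], subst nn_integral_distr) (auto simp: add.commute)

lemma integral_translate:
  fixes f :: "'a::euclidean_space \<Rightarrow> 'b::{banach, second_countable_topology}"
  assumes [measurable]: "f \<in> borel_measurable borel"
  shows "(LINT x|lborel. f (x + h)) = (LINT x|lborel. f x)"
  by (subst (2) lborel_distr_plus[of h, symmetric], subst integral_distr) (auto simp: add.commute)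

lemma L2_norm_translate:
  fixes f :: "real ^ 'n::finite \<Rightarrow> 'b::{banach, second_countable_topology}"
  assumes [measurable]: "f \<in> borel_measurable borel"
  shows "L2_norm lborel (\<lambda>x. f (x + h)) = L2_norm lborel f"
  unfolding L2_norm_def using nn_integral_translate[of "\<lambda>x. ennreal ((norm (f x))\<^sup>2)" h] by simp

lemma L2_translate:
  assumes "f \<in> L2"
  shows "(\<lambda>x. f (x + h)) \<in> L2"
proof -
  have [measurable]: "f \<in> borel_measurable borel" using assms by auto
  show ?thesis using L2_norm_translate[of f h] L2_norm_less_top[OF assms] by (intro L2I) auto
qed

text \<open>Three thirds of \<open>e\<close>: translations are isometries, so replacing
  \<open>f\<close> by \<open>fs k\<close> costs the same before and after the shift, and
  \<open>k\<close> can be fixed before the shift tends to 0.\<close>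

lemma L2_lim_translate_closed:
  fixes f :: "real ^ 'n::finite \<Rightarrow> 'b::{banach, second_countable_topology}"
  assumes fs: "L2_lim lborel fs f" "\<And>k. fs k \<in> L2" "f \<in> L2"
    and *: "\<And>k. L2_lim lborel (\<lambda>n x. fs k (x + h n)) (fs k)"
  shows "L2_lim lborel (\<lambda>n x. f (x + h n)) f"
  unfolding L2_lim_def ennreal_tendsto_0_iff
proof (intro allI impI)
  have [measurable]: "f \<in> borel_measurable borel" "fs k \<in> borel_measurable borel" for k using fs by auto
  fix e :: real assume e: "e > 0"
  have "\<forall>\<^sub>F k in sequentially. L2_norm lborel (\<lambda>x. fs k x - f x) \<le> ennreal (e/3)"
    using fs(1) e unfolding L2_lim_def ennreal_tendsto_0_iff by simp
  then obtain k where k: "L2_norm lborel (\<lambda>x. fs k x - f x) \<le> ennreal (e/3)"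
    by (auto dest: eventually_happens'[OF sequentially_bot])
  have "\<forall>\<^sub>F n in sequentially. L2_norm lborel (\<lambda>x. fs k (x + h n) - fs k x) \<le> ennreal (e/3)"
    using *[of k] e unfolding L2_lim_def ennreal_tendsto_0_iff by simp
  then show "\<forall>\<^sub>F n in sequentially. L2_norm lborel (\<lambda>x. f (x + h n) - f x) \<le> ennreal e"
  proof eventually_elim
    fix n assume n: "L2_norm lborel (\<lambda>x. fs k (x + h n) - fs k x) \<le> ennreal (e/3)"
    have k': "L2_norm lborel (\<lambda>x. f (x + h n) - fs k (x + h n)) \<le> ennreal (e/3)"
      using k L2_norm_translate[of "\<lambda>x. f x - fs k x" "h n"] by (simp add: L2_norm_minus_commute)
    have "L2_norm lborel (\<lambda>x. f (x + h n) - f x) \<le> L2_norm lborel (\<lambda>x. f (x + h n) - fs k (x + h n))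
      + L2_norm lborel (\<lambda>x. fs k (x + h n) - f x)"
      by (intro L2_norm_diff_triangle) auto
    also have "L2_norm lborel (\<lambda>x. fs k (x + h n) - f x) \<le>
        L2_norm lborel (\<lambda>x. fs k (x + h n) - fs k x) + L2_norm lborel (\<lambda>x. fs k x - f x)"
      by (intro L2_norm_diff_triangle) auto
    finally have "L2_norm lborel (\<lambda>x. f (x + h n) - f x) \<le> ennreal (e/3) + (ennreal (e/3) + ennreal (e/3))"
      using n k k' by (meson add_mono order_trans order_refl)
    also have "\<dots> = ennreal e" using e by (simp flip: ennreal_plus)
    finally show "L2_norm lborel (\<lambda>x. f (x + h n) - f x) \<le> ennreal e" .
  qed
qed

lemma L2_lim_translate_continuous:
  fixes f :: "real ^ 'n::finite \<Rightarrow> complex"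
  assumes cont: "continuous_on UNIV f" and supp: "\<And>x. norm x > r \<Longrightarrow> f x = 0"
    and bdd: "\<And>x. norm (f x) \<le> K" and h: "h \<longlonglongrightarrow> 0"
  shows "L2_lim lborel (\<lambda>n x. f (x + h n)) f"
proof -
  \<comment> \<open>\<open>B\<close> bounds all the shifts. Hence \<open>f\<close> and all its
    translates live on the ball of radius \<open>r + B\<close>, which carries the dominating
    constant \<open>2 * K\<close>.\<close>
  obtain B where B: "\<And>n. norm (h n) \<le> B"
    using convergent_imp_Bseq[of h] h by (auto simp: convergent_def Bseq_def)
  have K: "K \<ge> 0" using bdd[of 0] norm_ge_zero order_trans by blast
  have [measurable]: "f \<in> borel_measurable borel" using cont by (rule borel_measurable_continuous_onI)
  show ?thesis
  proof (rule L2_lim_dominated[OF _ _ indicator_cball_L2[of "r + B" "2 * K"]])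
    show "AE x in lborel. norm (f (x + h n) - f x) \<le> norm (indicator (cball 0 (r + B)) x *\<^sub>R (2 * K))" for n
    proof (rule AE_I2)
      fix x
      have "f (x + h n) = 0" "f x = 0" if "x \<notin> cball 0 (r + B)"
      proof -
        have "norm x > r + B" using that by simp
        moreover have "norm x \<le> norm (x + h n) + norm (h n)"
          using norm_triangle_ineq4[of "x + h n" "h n"] by simp
        moreover have "B \<ge> 0" using B[of 0] norm_ge_zero order_trans by blast
        ultimately show "f (x + h n) = 0" "f x = 0" using B[of n] by (auto intro!: supp)
      qed
      moreover have "norm (f (x + h n) - f x) \<le> 2 * K"
        using norm_triangle_ineq4[of "f (x + h n)" "f x"] bdd[of x] bdd[of "x + h n"] by linarith
      ultimately show "norm (f (x + h n) - f x) \<le> norm (indicator (cball 0 (r + B)) x *\<^sub>R (2 * K))"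
        using K by (cases "x \<in> cball 0 (r + B)") auto
    qed
    show "AE x in lborel. (\<lambda>n. f (x + h n)) \<longlonglongrightarrow> f x"
    proof (rule AE_I2)
      fix x
      have "(\<lambda>n. x + h n) \<longlonglongrightarrow> x" using tendsto_add[OF tendsto_const[of x] h] by simp
      then show "(\<lambda>n. f (x + h n)) \<longlonglongrightarrow> f x"
        using cont by (auto simp: continuous_on_def intro: tendsto_compose)
    qed
  qed measurable
qed

text \<open>Two approximations, each passed on by the closedness lemma: \<open>f\<close> by its
  truncations, and a truncation by continuous functions. The latter come from Lebesgue measurability
  as an almost-everywhere limit without a common bound or support, so they are first cut down to
  make domination available.\<close>

lemma L2_lim_translate:
  fixes f :: "real ^ 'n::finite \<Rightarrow> complex"
  assumes f: "f \<in> L2" and h: "h \<longlonglongrightarrow> 0"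
  shows "L2_lim lborel (\<lambda>n x. f (x + h n)) f"
proof (rule L2_lim_translate_closed[OF trunc_L2_lim[OF f] _ f])
  have [measurable]: "f \<in> borel_measurable borel" using f by auto
  show "trunc k f \<in> L2" for k by (rule trunc_L2) measurable
  fix k
  define K where "K = real k + 1"
  have K: "K > 0" by (simp add: K_def)
  have "trunc k f \<in> borel_measurable lebesgue"
    by (rule measurable_completion) measurable
  then have "trunc k f measurable_on UNIV" by (rule lebesgue_measurable_imp_measurable_on) auto
  then obtain N g where N: "negligible N" and g: "\<And>n. continuous_on UNIV (g n)"
    and lim: "\<And>x. x \<notin> N \<Longrightarrow> (\<lambda>n. g n x) \<longlonglongrightarrow> trunc k f x"
    unfolding measurable_on_def by auto
  \<comment> \<open>The first factor is a continuous ramp, equal to 1 up to radius \<open>k\<close>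
    and to 0 from \<open>K = k + 1\<close> on; the second factor retracts the values onto the disc
    of radius \<open>K\<close>. Both act as the identity on the truncation, which is bounded by
    \<open>k\<close> and vanishes beyond radius \<open>k\<close>, so the pointwise limit is
    unchanged.\<close>
  define \<phi> where "\<phi> n x = of_real (max 0 (min 1 (K - norm x))) * (g n x * of_real (K / max K (norm (g n x))))" for n x
  have cont: "continuous_on UNIV (\<phi> n)" for n
    unfolding \<phi>_def using K g[of n] by (auto intro!: continuous_intros)
  have supp: "\<phi> n x = 0" if "norm x > K" for n x using that by (simp add: \<phi>_def)
  have bdd: "norm (\<phi> n x) \<le> K" for n x
  proof -
    have "norm (g n x * of_real (K / max K (norm (g n x)))) \<le> K"
      using K by (auto simp: norm_mult norm_divide max_def field_simps)
    moreover have "norm (of_real (max 0 (min 1 (K - norm x))) :: complex) \<le> 1" by simp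
    ultimately have "norm (\<phi> n x) \<le> 1 * K"
      unfolding \<phi>_def norm_mult[of "of_real _ :: complex" "_ * _"] by (intro mult_mono) auto
    then show ?thesis by simp
  qed
  have [measurable]: "\<phi> n \<in> borel_measurable borel" for n using cont by (rule borel_measurable_continuous_onI)
  have AE: "AE x in lborel. x \<notin> N"
    using N AE_completion_iff[of "\<lambda>x. x \<notin> N" lborel] by (auto simp: negligible_iff_null_sets AE_not_in)
  have "L2_lim lborel \<phi> (trunc k f)"
  proof (rule L2_lim_dominated[OF _ _ indicator_cball_L2[of K "2 * K"]])
    show "AE x in lborel. norm (\<phi> n x - trunc k f x) \<le> norm (indicator (cball 0 K) x *\<^sub>R (2 * K))" for n
    proof (rule AE_I2)
      fix x
      have "norm (\<phi> n x - trunc k f x) \<le> K + K"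
        using norm_triangle_ineq4[of "\<phi> n x" "trunc k f x"] bdd[of n x]
        by (auto simp: trunc_def K_def split: if_splits)
      moreover have "\<phi> n x = 0 \<and> trunc k f x = 0" if "x \<notin> cball 0 K"
        using that supp[of x n] by (auto simp: trunc_def K_def)
      ultimately show "norm (\<phi> n x - trunc k f x) \<le> norm (indicator (cball 0 K) x *\<^sub>R (2 * K))"
        using K by (cases "x \<in> cball 0 K") auto
    qed
    show "AE x in lborel. (\<lambda>n. \<phi> n x) \<longlonglongrightarrow> trunc k f x"
      using AE
    proof eventually_elim
      fix x assume "x \<notin> N"
      from lim[OF this] have "(\<lambda>n. \<phi> n x) \<longlonglongrightarrow> of_real (max 0 (min 1 (K - norm x))) *
          (trunc k f x * of_real (K / max K (norm (trunc k f x))))"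
        unfolding \<phi>_def using K by (intro tendsto_intros) auto
      also have "of_real (max 0 (min 1 (K - norm x))) * (trunc k f x * of_real (K / max K (norm (trunc k f x)))) = trunc k f x"
        using K by (auto simp: trunc_def max_def min_def) (auto simp: K_def)
      finally show "(\<lambda>n. \<phi> n x) \<longlonglongrightarrow> trunc k f x" .
    qed
  qed measurable
  then show "L2_lim lborel (\<lambda>n x. trunc k f (x + h n)) (trunc k f)"
  proof (rule L2_lim_translate_closed)
    show "\<phi> n \<in> L2" for n
      by (rule L2_bound[OF indicator_cball_L2[of K K], where K=1]) (use bdd supp K in \<open>auto simp: indicator_def not_le\<close>)
    show "trunc k f \<in> L2" by (rule trunc_L2) measurable
    show "L2_lim lborel (\<lambda>n x. \<phi> k (x + h n)) (\<phi> k)" for k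
      by (rule L2_lim_translate_continuous[OF cont supp bdd h])
  qed
qed

section \<open>Integrals of coordinate products and the Gaussian\<close>

lemma
  fixes g :: "'n::finite \<Rightarrow> real \<Rightarrow> 'b::{real_normed_field, banach, second_countable_topology}"
  assumes g: "\<And>i. integrable lborel (g i)"
  shows integrable_prod_coord: "integrable lborel (\<lambda>x::real^'n. \<Prod>i\<in>UNIV. g i (x $ i))"
    and integral_prod_coord: "(LINT x|lborel. (\<Prod>i\<in>UNIV. g i ((x::real^'n) $ i))) = (\<Prod>i\<in>UNIV. LINT t|lborel. g i t)"
proof -
  interpret product_sigma_finite "\<lambda>_::'n. lborel :: real measure" by standard
  have [measurable]: "g i \<in> borel_measurable borel" for i using g[of i] by auto
  have [measurable]: "(\<lambda>x::real^'n. \<Prod>i\<in>UNIV. g i (x $ i)) \<in> borel_measurable borel" by measurable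
  have 1: "integrable (Pi\<^sub>M UNIV (\<lambda>_. lborel)) (\<lambda>y. \<Prod>i\<in>UNIV. g i (y i))"
    by (intro product_integrable_prod g) auto
  have 2: "integral\<^sup>L (Pi\<^sub>M UNIV (\<lambda>_. lborel)) (\<lambda>y. \<Prod>i\<in>UNIV. g i (y i)) = (\<Prod>i\<in>UNIV. LINT t|lborel. g i t)"
    by (intro product_integral_prod g) auto
  show "integrable lborel (\<lambda>x::real^'n. \<Prod>i\<in>UNIV. g i (x $ i))"
    using 1 by (subst lborel_vec_PiM[symmetric], subst integrable_distr_eq) auto
  show "(LINT x|lborel. (\<Prod>i\<in>UNIV. g i ((x::real^'n) $ i))) = (\<Prod>i\<in>UNIV. LINT t|lborel. g i t)"
    using 2 by (subst lborel_vec_PiM[symmetric], subst integral_distr) auto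
qed

text \<open>Read off from the characteristic function of the standard normal distribution, whose
  density carries the factor 1 / sqrt (2 pi).\<close>

lemma gauss_1d:
  fixes s :: real
  shows "integrable lborel (\<lambda>t. cis (- (t * s)) * of_real (exp (- t\<^sup>2 / 2)))"
    and "(LINT t|lborel. cis (- (t * s)) * of_real (exp (- t\<^sup>2 / 2))) = of_real (sqrt (2 * pi) * exp (- s\<^sup>2 / 2))"
proof -
  have eq: "cis (- (t * s)) * of_real (exp (- t\<^sup>2 / 2)) = of_real (sqrt (2 * pi)) * (std_normal_density t *\<^sub>R iexp ((- s) * t))" for t
    by (simp add: normal_density_def cis_conv_exp scaleR_conv_of_real mult_ac flip: of_real_mult)
  have i: "integrable lborel (\<lambda>t. std_normal_density t *\<^sub>R iexp ((- s) * t))"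
  proof (rule Bochner_Integration.integrable_bound)
    show "integrable lborel std_normal_density" by simp
  qed (auto simp: normal_density_nonneg)
  show "integrable lborel (\<lambda>t. cis (- (t * s)) * of_real (exp (- t\<^sup>2 / 2)))"
    unfolding eq by (intro integrable_mult_right i)
  have "char std_normal_distribution (- s) = (LINT t|lborel. std_normal_density t *\<^sub>R iexp ((- s) * t))"
    unfolding char_def by (subst integral_density) (auto simp: normal_density_nonneg)
  then have "(LINT t|lborel. std_normal_density t *\<^sub>R iexp ((- s) * t)) = of_real (exp (- s\<^sup>2 / 2))"
    by (simp add: char_std_normal_distribution)
  then show "(LINT t|lborel. cis (- (t * s)) * of_real (exp (- t\<^sup>2 / 2))) = of_real (sqrt (2 * pi) * exp (- s\<^sup>2 / 2))"
    unfolding eq integral_mult_right_zero by simp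
qed

lemma
  fixes s :: "real ^ 'n::finite"
  shows gauss_integrable: "integrable lborel (\<lambda>x. cis (- (x \<bullet> s)) * of_real (exp (- (norm x)\<^sup>2 / 2)))"
    and gauss_integral: "(LINT x|lborel. cis (- (x \<bullet> s)) * of_real (exp (- (norm x)\<^sup>2 / 2)))
      = of_real ((2 * pi) powr (real CARD('n) / 2) * exp (- (norm s)\<^sup>2 / 2))"
proof -
  have norm2: "(norm (x::real^'n))\<^sup>2 = (\<Sum>i\<in>UNIV. (x $ i)\<^sup>2)" for x
    by (simp add: norm_vec_def L2_set_def sum_nonneg)
  have eq: "cis (- (x \<bullet> s)) * of_real (exp (- (norm x)\<^sup>2 / 2))
    = (\<Prod>i\<in>UNIV. cis (- (x $ i * s $ i)) * of_real (exp (- (x $ i)\<^sup>2 / 2)))" for x :: "real^'n"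
  proof -
    have "cis (- (x \<bullet> s)) * of_real (exp (- (norm x)\<^sup>2 / 2))
      = exp (\<Sum>i\<in>UNIV. \<i> * of_real (- (x $ i * s $ i)) + of_real (- (x $ i)\<^sup>2 / 2))"
      by (simp add: cis_conv_exp exp_of_real[symmetric] exp_add[symmetric] norm2 inner_vec_def sum.distrib
          sum_distrib_left sum_negf sum_divide_distrib sum_subtractf)
    also have "\<dots> = (\<Prod>i\<in>UNIV. cis (- (x $ i * s $ i)) * of_real (exp (- (x $ i)\<^sup>2 / 2)))"
      by (simp only: exp_sum[OF finite] cis_conv_exp exp_add exp_of_real)
    finally show ?thesis .
  qed
  show "integrable lborel (\<lambda>x. cis (- (x \<bullet> s)) * of_real (exp (- (norm x)\<^sup>2 / 2)))"
    unfolding eq by (intro integrable_prod_coord[of "\<lambda>i t. cis (- (t * s $ i)) * of_real (exp (- t\<^sup>2 / 2))"] gauss_1d)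
  have "(LINT x|lborel. cis (- (x \<bullet> s)) * of_real (exp (- (norm x)\<^sup>2 / 2)))
    = (\<Prod>i\<in>UNIV. of_real (sqrt (2 * pi) * exp (- (s $ i)\<^sup>2 / 2)))"
    unfolding eq
    by (subst integral_prod_coord[of "\<lambda>i t. cis (- (t * s $ i)) * of_real (exp (- t\<^sup>2 / 2))"]) (simp_all only: gauss_1d)
  also have "\<dots> = of_real ((\<Prod>i\<in>(UNIV::'n set). sqrt (2 * pi)) * exp (- (norm s)\<^sup>2 / 2))"
    by (simp add: prod.distrib norm2 exp_sum sum_divide_distrib flip: sum_negf of_real_prod)
  also have "(\<Prod>i\<in>(UNIV::'n set). sqrt (2 * pi)) = (2 * pi) powr (real CARD('n) / 2)"
    by (simp add: powr_half_sqrt[symmetric] powr_powr flip: powr_realpow)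
  finally show "(LINT x|lborel. cis (- (x \<bullet> s)) * of_real (exp (- (norm x)\<^sup>2 / 2)))
      = of_real ((2 * pi) powr (real CARD('n) / 2) * exp (- (norm s)\<^sup>2 / 2))" .
qed

section \<open>Plancherel theorem\<close>

lemma borel_measurable_cnj [measurable (raw)]:
  "f \<in> borel_measurable M \<Longrightarrow> (\<lambda>x. cnj (f x)) \<in> borel_measurable M"
  by (rule borel_measurable_continuous_on[OF continuous_on_cnj]) auto

lemma fourier_int_measurable [measurable]:
  fixes f :: "real ^ 'n::finite \<Rightarrow> complex"
  assumes [measurable]: "f \<in> borel_measurable borel"
  shows "fourier_int f \<in> borel_measurable borel"
proof -
  have "(\<lambda>\<xi>. LINT x|lborel. cis (- (x \<bullet> \<xi>)) * f x) \<in> borel_measurable borel"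
    unfolding cis_conv_exp by (rule lborel.borel_measurable_lebesgue_integral) measurable
  then show ?thesis unfolding fourier_int_def[abs_def] by measurable
qed

lemma integrable_cis_mult:
  fixes f :: "real ^ 'n::finite \<Rightarrow> complex"
  assumes f: "integrable lborel f"
  shows "integrable lborel (\<lambda>x. cis (- (x \<bullet> \<xi>)) * f x)"
proof (rule Bochner_Integration.integrable_bound[OF f])
  have [measurable]: "f \<in> borel_measurable borel" using f by auto
  show "(\<lambda>x. cis (- (x \<bullet> \<xi>)) * f x) \<in> borel_measurable lborel"
    unfolding cis_conv_exp by measurable
qed (auto simp: norm_mult)

lemma fourier_int_add:
  assumes "integrable lborel f" "integrable lborel g"
  shows "fourier_int (\<lambda>x. f x + g x) \<xi> = fourier_int f \<xi> + fourier_int g \<xi>"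
  unfolding fourier_int_def
  using integrable_cis_mult[OF assms(1), of \<xi>] integrable_cis_mult[OF assms(2), of \<xi>]
  by (simp add: algebra_simps)

lemma fourier_int_cmult: "fourier_int (\<lambda>x. a * f x) \<xi> = a * fourier_int f \<xi>"
  unfolding fourier_int_def by (simp add: mult.left_commute flip: integral_mult_right_zero)

lemma fourier_int_diff:
  assumes "integrable lborel f" "integrable lborel g"
  shows "fourier_int (\<lambda>x. f x - g x) \<xi> = fourier_int f \<xi> - fourier_int g \<xi>"
  unfolding fourier_int_def
  using integrable_cis_mult[OF assms(1), of \<xi>] integrable_cis_mult[OF assms(2), of \<xi>]
  by (simp add: algebra_simps)

lemma norm_fourier_int_le:
  assumes f: "integrable lborel f"
  shows "norm (fourier_int f (\<xi> :: real ^ 'n::finite)) \<le> (2 * pi) powr (- real CARD('n) / 2) * (LINT x|lborel. norm (f x))"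
proof -
  have "norm (LINT x|lborel. cis (- (x \<bullet> \<xi>)) * f x) \<le> (LINT x|lborel. norm (cis (- (x \<bullet> \<xi>)) * f x))"
    by (rule integral_norm_bound)
  then show ?thesis unfolding fourier_int_def norm_mult by (simp add: mult_left_mono)
qed

lemma fourier_int_translate:
  fixes f :: "real ^ 'n::finite \<Rightarrow> complex"
  assumes [measurable]: "f \<in> borel_measurable borel"
  shows "fourier_int (\<lambda>x. f (x + h)) \<xi> = cis (h \<bullet> \<xi>) * fourier_int f \<xi>"
proof -
  have m: "(\<lambda>x. cis (- ((x - h) \<bullet> \<xi>)) * f x) \<in> borel_measurable borel"
    unfolding cis_conv_exp by measurable
  have "(LINT x|lborel. cis (- (x \<bullet> \<xi>)) * f (x + h)) = (LINT x|lborel. cis (- ((x - h) \<bullet> \<xi>)) * f x)"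
    using integral_translate[OF m, of h] by simp
  also have "\<dots> = (LINT x|lborel. cis (h \<bullet> \<xi>) * (cis (- (x \<bullet> \<xi>)) * f x))"
    by (rule arg_cong[where f="integral\<^sup>L lborel"]) (auto simp: cis_mult inner_diff_left algebra_simps simp flip: mult.assoc)
  finally show ?thesis by (simp add: fourier_int_def)
qed

lemma lborel_pair_integrableI:
  fixes f :: "'a::euclidean_space \<Rightarrow> 'b::euclidean_space \<Rightarrow> 'c::{banach, second_countable_topology}"
  assumes [measurable]: "case_prod f \<in> borel_measurable (borel \<Otimes>\<^sub>M borel)"
    and "(\<integral>\<^sup>+y. \<integral>\<^sup>+x. ennreal (norm (f x y)) \<partial>lborel \<partial>lborel) < \<infinity>"
  shows "integrable (lborel \<Otimes>\<^sub>M lborel) (case_prod f)"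
proof (rule integrableI_bounded)
  have [measurable]: "case_prod f \<in> borel_measurable (lborel \<Otimes>\<^sub>M lborel)"
    using assms(1) by (simp cong: measurable_cong_sets)
  show "case_prod f \<in> borel_measurable (lborel \<Otimes>\<^sub>M lborel)" by measurable
  have "(\<integral>\<^sup>+y. \<integral>\<^sup>+x. ennreal (norm (f x y)) \<partial>lborel \<partial>lborel) = (\<integral>\<^sup>+p. ennreal (norm (case_prod f p)) \<partial>(lborel \<Otimes>\<^sub>M lborel))"
    by (subst lborel_pair.nn_integral_snd[symmetric]) auto
  then show "(\<integral>\<^sup>+p. ennreal (norm (case_prod f p)) \<partial>(lborel \<Otimes>\<^sub>M lborel)) < \<infinity>" using assms(2) by simp
qed

lemma fourier_int_duality:
  fixes f g :: "real ^ 'n::finite \<Rightarrow> complex"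
  assumes f: "integrable lborel f" and g: "integrable lborel g"
  shows "(LINT \<xi>|lborel. fourier_int f \<xi> * g \<xi>) = (LINT x|lborel. f x * fourier_int g x)"
proof -
  have [measurable]: "f \<in> borel_measurable borel" "g \<in> borel_measurable borel" using f g by auto
  have "integrable (lborel \<Otimes>\<^sub>M lborel) (\<lambda>(x, \<xi>). cis (- (x \<bullet> \<xi>)) * f x * g \<xi>)"
  proof (rule lborel_pair_integrableI)
    show "(\<lambda>(x, \<xi>). cis (- (x \<bullet> \<xi>)) * f x * g \<xi>) \<in> borel_measurable (borel \<Otimes>\<^sub>M borel)"
      unfolding cis_conv_exp by measurable
    have "(\<integral>\<^sup>+\<xi>. \<integral>\<^sup>+x. ennreal (norm (cis (- (x \<bullet> \<xi>)) * f x * g \<xi>)) \<partial>lborel \<partial>lborel)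
      = (\<integral>\<^sup>+x. ennreal (norm (f x)) \<partial>lborel) * (\<integral>\<^sup>+\<xi>. ennreal (norm (g \<xi>)) \<partial>lborel)"
      by (simp add: norm_mult ennreal_mult nn_integral_multc nn_integral_cmult)
    also have "\<dots> < \<infinity>" using f g by (simp add: integrable_iff_bounded ennreal_mult_less_top)
    finally show "(\<integral>\<^sup>+\<xi>. \<integral>\<^sup>+x. ennreal (norm (cis (- (x \<bullet> \<xi>)) * f x * g \<xi>)) \<partial>lborel \<partial>lborel) < \<infinity>" .
  qed
  note fub = lborel_pair.Fubini_integral[OF this]
  have "(LINT \<xi>|lborel. fourier_int f \<xi> * g \<xi>)
      = of_real ((2 * pi) powr (- real CARD('n) / 2)) * (LINT \<xi>|lborel. LINT x|lborel. cis (- (x \<bullet> \<xi>)) * f x * g \<xi>)"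
    unfolding fourier_int_def by (simp add: mult.assoc flip: integral_mult_right_zero integral_mult_left_zero)
  also have "\<dots> = of_real ((2 * pi) powr (- real CARD('n) / 2)) * (LINT x|lborel. LINT \<xi>|lborel. cis (- (x \<bullet> \<xi>)) * f x * g \<xi>)"
    by (simp only: fub)
  also have "\<dots> = (LINT x|lborel. f x * fourier_int g x)"
    unfolding fourier_int_def by (simp add: mult_ac inner_commute flip: integral_mult_right_zero integral_mult_left_zero)
  finally show ?thesis .
qed

lemma
  assumes t: "t > 0"
  shows integral_scale: "\<And>f :: real ^ 'n::finite \<Rightarrow> complex. f \<in> borel_measurable borel \<Longrightarrow> integrable lborel f \<Longrightarrow>
    (LINT x|lborel. f x) = of_real (t ^ CARD('n)) * (LINT x|lborel. f (t *\<^sub>R x))"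
proof -
  fix f :: "real ^ 'n \<Rightarrow> complex" assume [measurable]: "f \<in> borel_measurable borel" and "integrable lborel f"
  have "(LINT x|lborel. f x) = (LINT x|density (distr lborel borel (\<lambda>x. 0 + t *\<^sub>R x)) (\<lambda>_. ennreal (\<bar>t\<bar>^DIM(real^'n))). f x)"
    using t lborel_affine[of t "0::real^'n"] by (simp add: ennreal_power)
  also have "\<dots> = t ^ CARD('n) *\<^sub>R (LINT x|lborel. f (t *\<^sub>R x))"
    using t by (subst integral_density) (auto simp: integral_distr)
  finally show "(LINT x|lborel. f x) = of_real (t ^ CARD('n)) * (LINT x|lborel. f (t *\<^sub>R x))"
    by (simp add: scaleR_conv_of_real)
qed

text \<open>The parameter is an inverse width. As \<open>t\<close> decreases to 0 the function
  increases to 1, while \<open>t ^ CARD('n)\<close> times its transform is a Gaussian of width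
  \<open>t\<close> that concentrates at the origin.\<close>

definition gauss :: "real \<Rightarrow> real ^ 'n::finite \<Rightarrow> real" where
  "gauss t x = exp (- (norm (t *\<^sub>R x))\<^sup>2 / 2)"

lemma gauss_measurable [measurable]: "gauss t \<in> borel_measurable borel"
  unfolding gauss_def[abs_def] by measurable

lemma gauss_integrable_1: "integrable lborel (gauss 1 :: real ^ 'n::finite \<Rightarrow> real)"
proof -
  have "integrable lborel (\<lambda>x::real^'n. complex_of_real (gauss 1 x))"
    using gauss_integrable[of "0::real^'n"] by (simp add: gauss_def)
  then show ?thesis by (simp only: complex_of_real_integrable_eq)
qed

lemma gauss_integral_1: "(LINT x|lborel. gauss 1 (x :: real ^ 'n::finite)) = (2 * pi) powr (real CARD('n) / 2)"
proof -
  have "complex_of_real (LINT x|lborel. gauss 1 (x::real^'n)) = of_real ((2 * pi) powr (real CARD('n) / 2))"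
    using gauss_integral[of "0::real^'n"] by (simp add: gauss_def flip: integral_complex_of_real)
  then show ?thesis by (simp only: of_real_eq_iff)
qed

lemma gauss_integrable_t:
  assumes t: "t > 0"
  shows "integrable lborel (gauss t :: real ^ 'n::finite \<Rightarrow> real)"
proof (rule integrableI_nonneg)
  have "(\<integral>\<^sup>+x. ennreal (gauss 1 (x::real^'n)) \<partial>lborel) = (\<integral>\<^sup>+x. ennreal (gauss 1 (x::real^'n))
      \<partial>density (distr lborel borel (\<lambda>x. 0 + t *\<^sub>R x)) (\<lambda>_. ennreal (\<bar>t\<bar>^DIM(real^'n))))"
    using t lborel_affine[of t "0::real^'n"] by (simp add: ennreal_power)
  also have "\<dots> = ennreal (t ^ CARD('n)) * (\<integral>\<^sup>+x. ennreal (gauss t (x::real^'n)) \<partial>lborel)"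
    using t by (subst nn_integral_density) (auto simp: nn_integral_distr nn_integral_cmult gauss_def)
  finally have "ennreal (t ^ CARD('n)) * (\<integral>\<^sup>+x. ennreal (gauss t (x::real^'n)) \<partial>lborel) < \<infinity>"
    using gauss_integrable_1[where 'n='n] by (simp add: integrable_iff_bounded gauss_def)
  then show "(\<integral>\<^sup>+x. ennreal (gauss t (x::real^'n)) \<partial>lborel) < \<infinity>"
    using t by (auto simp: ennreal_mult_less_top less_top[symmetric] ennreal_mult_eq_top_iff)
qed (auto simp: gauss_def)

lemma fourier_int_gauss:
  fixes h :: "real ^ 'n::finite"
  assumes t: "t > 0"
  shows "of_real (t ^ CARD('n)) * fourier_int (\<lambda>x. of_real (gauss t x)) h = of_real (gauss (1/t) h)"
proof -
  have c: "(2 * pi) powr (- real CARD('n) / 2) * (2 * pi) powr (real CARD('n) / 2) = 1"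
    by (simp flip: powr_add)
  have "(LINT x|lborel. cis (- (x \<bullet> ((1/t) *\<^sub>R h))) * of_real (exp (- (norm x)\<^sup>2 / 2)))
    = of_real (t ^ CARD('n)) * (LINT x|lborel. cis (- ((t *\<^sub>R x) \<bullet> ((1/t) *\<^sub>R h))) * of_real (exp (- (norm (t *\<^sub>R x))\<^sup>2 / 2)))"
    by (rule integral_scale[OF t _ gauss_integrable]) (simp add: cis_conv_exp)
  then have "of_real (t ^ CARD('n)) * (LINT x|lborel. cis (- (x \<bullet> h)) * of_real (gauss t x))
    = of_real ((2 * pi) powr (real CARD('n) / 2) * exp (- (norm ((1/t) *\<^sub>R h))\<^sup>2 / 2))"
    using t unfolding gauss_integral by (simp add: gauss_def)
  then have "of_real (t ^ CARD('n)) * fourier_int (\<lambda>x. of_real (gauss t x)) h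
    = of_real ((2 * pi) powr (- real CARD('n) / 2) * ((2 * pi) powr (real CARD('n) / 2) * exp (- (norm ((1/t) *\<^sub>R h))\<^sup>2 / 2)))"
    unfolding fourier_int_def by (simp add: mult_ac)
  also have "\<dots> = of_real (gauss (1/t) h)"
    unfolding mult.assoc[symmetric] c by (simp add: gauss_def)
  finally show ?thesis .
qed

text \<open>Its transform is a multiple of the squared modulus of the transform of \<open>f\<close>,
  and its value at 0 is the squared norm of \<open>f\<close>. Plancherel's identity is thus Fourier
  inversion for this function at the origin.\<close>

definition autocorr :: "(real ^ 'n::finite \<Rightarrow> complex) \<Rightarrow> real ^ 'n \<Rightarrow> complex" where
  "autocorr f h = (LINT x|lborel. f (x + h) * cnj (f x))"

lemma autocorr_measurable [measurable]:
  assumes [measurable]: "f \<in> borel_measurable borel"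
  shows "autocorr f \<in> borel_measurable borel"
  unfolding autocorr_def[abs_def] by (rule lborel.borel_measurable_lebesgue_integral) measurable

lemma norm_autocorr_le:
  assumes f: "f \<in> L2"
  shows "norm (autocorr f h) \<le> (enn2real (L2_norm lborel f))\<^sup>2"
proof -
  have [measurable]: "f \<in> borel_measurable borel" using f by auto
  have "ennreal (norm (autocorr f h)) \<le> L2_norm lborel f * L2_norm lborel f"
    unfolding autocorr_def
    using L2_mult_integrable(2)[OF L2_translate[OF f, of h] L2_cnj[OF f]] by (simp add: L2_norm_translate)
  also have "\<dots> = ennreal ((enn2real (L2_norm lborel f))\<^sup>2)"
    using L2_norm_less_top[OF f] by (simp add: power2_eq_square ennreal_mult)
  finally show ?thesis by (simp add: ennreal_le_iff)
qed

lemma autocorr_0: "f \<in> L2 \<Longrightarrow> autocorr f 0 = of_real ((enn2real (L2_norm lborel f))\<^sup>2)"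
  unfolding autocorr_def using L2_norm_square_integral by simp

lemma autocorr_tendsto:
  assumes f: "f \<in> L2" and h: "h \<longlonglongrightarrow> 0"
  shows "(\<lambda>n. autocorr f (h n)) \<longlonglongrightarrow> autocorr f 0"
  unfolding autocorr_def
  using L2_lim_mult_integral[OF L2_lim_translate[OF f h] f L2_translate[OF f], of "\<lambda>_ x. cnj (f x)" "\<lambda>x. cnj (f x)"] f L2_cnj[OF f]
  by (simp add: L2_lim_def)

lemma
  fixes f :: "real ^ 'n::finite \<Rightarrow> complex"
  assumes f: "integrable lborel f"
  shows autocorr_integrable: "integrable lborel (autocorr f)"
    and fourier_int_autocorr: "fourier_int f \<xi> * cnj (fourier_int f \<xi>)
      = of_real ((2 * pi) powr (- real CARD('n) / 2)) * fourier_int (autocorr f) \<xi>"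
proof -
  have [measurable]: "f \<in> borel_measurable borel" using f by auto
  define c where "c = (2 * pi) powr (- real CARD('n) / 2)"
  have int: "integrable (lborel \<Otimes>\<^sub>M lborel) (\<lambda>(h, x). cis (- (h \<bullet> \<xi>)) * (f (x + h) * cnj (f x)))" for \<xi>
  proof (rule lborel_pair_integrableI)
    show "(\<lambda>(h, x). cis (- (h \<bullet> \<xi>)) * (f (x + h) * cnj (f x))) \<in> borel_measurable (borel \<Otimes>\<^sub>M borel)"
      unfolding cis_conv_exp by measurable
    have "(\<integral>\<^sup>+x. \<integral>\<^sup>+h. ennreal (norm (cis (- (h \<bullet> \<xi>)) * (f (x + h) * cnj (f x)))) \<partial>lborel \<partial>lborel)
      = (\<integral>\<^sup>+x. (\<integral>\<^sup>+h. ennreal (norm (f (h + x))) \<partial>lborel) * ennreal (norm (f x)) \<partial>lborel)"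
      by (intro nn_integral_cong) (simp add: norm_mult ennreal_mult nn_integral_multc add.commute)
    also have "\<dots> = (\<integral>\<^sup>+x. ennreal (norm (f x)) \<partial>lborel) * (\<integral>\<^sup>+\<xi>. ennreal (norm (f \<xi>)) \<partial>lborel)"
      by (simp add: nn_integral_cmult nn_integral_translate[of "\<lambda>x. ennreal (norm (f x))"])
    also have "\<dots> < \<infinity>" using f by (simp add: integrable_iff_bounded ennreal_mult_less_top)
    finally show "(\<integral>\<^sup>+x. \<integral>\<^sup>+h. ennreal (norm (cis (- (h \<bullet> \<xi>)) * (f (x + h) * cnj (f x)))) \<partial>lborel \<partial>lborel) < \<infinity>" .
  qed
  show "integrable lborel (autocorr f)"
    using lborel_pair.integrable_fst[OF int[of 0]] by (simp add: autocorr_def[abs_def])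
  have trans: "cis (x \<bullet> \<xi>) * (LINT h|lborel. cis (- (h \<bullet> \<xi>)) * f h) = (LINT h|lborel. cis (- (h \<bullet> \<xi>)) * f (h + x))" for x
  proof -
    have "fourier_int (\<lambda>h. f (h + x)) \<xi> = cis (x \<bullet> \<xi>) * fourier_int f \<xi>" by (rule fourier_int_translate) measurable
    then show ?thesis by (simp add: fourier_int_def)
  qed
  have "cnj (LINT x|lborel. cis (- (x \<bullet> \<xi>)) * f x) = (LINT x|lborel. cnj (cis (- (x \<bullet> \<xi>)) * f x))"
    by (rule Bochner_Integration.integral_cnj[symmetric])
  then have "fourier_int f \<xi> * cnj (fourier_int f \<xi>)
     = of_real (c\<^sup>2) * ((LINT h|lborel. cis (- (h \<bullet> \<xi>)) * f h) * (LINT x|lborel. cnj (cis (- (x \<bullet> \<xi>)) * f x)))"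
    unfolding fourier_int_def c_def[symmetric] by (simp only: complex_cnj_mult complex_cnj_complex_of_real of_real_mult power2_eq_square mult_ac)
  also have "\<dots> = of_real (c\<^sup>2) * (LINT x|lborel. (LINT h|lborel. cis (- (h \<bullet> \<xi>)) * (f (x + h) * cnj (f x))))"
  proof -
    have "(LINT h|lborel. cis (- (h \<bullet> \<xi>)) * (f (x + h) * cnj (f x)))
      = (LINT h|lborel. cis (- (h \<bullet> \<xi>)) * f h) * cnj (cis (- (x \<bullet> \<xi>)) * f x)" for x
    proof -
      have "(LINT h|lborel. cis (- (h \<bullet> \<xi>)) * (f (x + h) * cnj (f x))) = (LINT h|lborel. cis (- (h \<bullet> \<xi>)) * f (h + x)) * cnj (f x)"
        by (simp add: add.commute mult.assoc flip: integral_mult_left_zero)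
      then show ?thesis unfolding trans[symmetric] by (simp add: cis_cnj mult_ac)
    qed
    then show ?thesis by (simp only: integral_mult_right_zero)
  qed
  also have "\<dots> = of_real (c\<^sup>2) * (LINT h|lborel. (LINT x|lborel. cis (- (h \<bullet> \<xi>)) * (f (x + h) * cnj (f x))))"
    by (simp only: lborel_pair.Fubini_integral[OF int])
  also have "\<dots> = of_real c * fourier_int (autocorr f) \<xi>"
    by (simp add: fourier_int_def autocorr_def c_def power2_eq_square)
  finally show "fourier_int f \<xi> * cnj (fourier_int f \<xi>) = of_real ((2 * pi) powr (- real CARD('n) / 2)) * fourier_int (autocorr f) \<xi>"
    by (simp add: c_def)
qed

text \<open>Smoothing by a Gaussian: the left side increases to the squared norm of the transform and the
  right side tends to \<^term>\<open>autocorr f 0\<close> as \<open>t\<close> decreases to \<open>0\<close>.\<close>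

lemma fourier_int_gauss_smoothing:
  fixes f :: "real ^ 'n::finite \<Rightarrow> complex"
  assumes f: "integrable lborel f" and f2: "f \<in> L2" and t: "t > 0"
  shows "(LINT \<xi>|lborel. of_real ((norm (fourier_int f \<xi>))\<^sup>2 * gauss t \<xi>))
    = of_real ((2 * pi) powr (- real CARD('n) / 2)) * (LINT s|lborel. autocorr f (t *\<^sub>R s) * of_real (gauss 1 s))"
proof -
  have [measurable]: "f \<in> borel_measurable borel" using f by auto
  define c where "c = (2 * pi) powr (- real CARD('n) / 2)"
  let ?g = "\<lambda>x::real^'n. complex_of_real (gauss t x)"
  have g: "integrable lborel ?g" using gauss_integrable_t[OF t, where 'n='n] by simp
  have "(LINT \<xi>|lborel. of_real ((norm (fourier_int f \<xi>))\<^sup>2 * gauss t \<xi>)) = (LINT \<xi>|lborel. of_real c * (fourier_int (autocorr f) \<xi> * ?g \<xi>))"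
    by (rule arg_cong[where f="integral\<^sup>L lborel"])
       (auto simp: complex_norm_square fourier_int_autocorr[OF f] c_def simp del: of_real_power)
  also have "\<dots> = of_real c * (LINT h|lborel. autocorr f h * fourier_int ?g h)"
    by (simp add: fourier_int_duality[OF autocorr_integrable[OF f] g])
  also have "(LINT h|lborel. autocorr f h * fourier_int ?g h)
    = of_real (t ^ CARD('n)) * (LINT s|lborel. autocorr f (t *\<^sub>R s) * fourier_int ?g (t *\<^sub>R s))"
  proof (rule integral_scale[OF t])
    show "integrable lborel (\<lambda>h. autocorr f h * fourier_int ?g h)"
    proof (rule Bochner_Integration.integrable_bound)
      show "integrable lborel (\<lambda>h. of_real (c * (LINT x|lborel. norm (?g x))) * autocorr f h)"
        using autocorr_integrable[OF f] by (rule integrable_mult_right)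
      have "norm (fourier_int ?g h) \<le> \<bar>c * (LINT x|lborel. norm (?g x))\<bar>" for h
        using norm_fourier_int_le[OF g, of h] by (simp add: c_def)
      then show "AE h in lborel. norm (autocorr f h * fourier_int ?g h) \<le> norm (of_real (c * (LINT x|lborel. norm (?g x))) * autocorr f h)"
        unfolding norm_mult[of "of_real _ :: complex"] norm_mult[of "autocorr _ _"] norm_of_real
        by (intro AE_I2) (simp only: mult.commute[of "norm (autocorr f _)"] mult_right_mono norm_ge_zero)
    qed measurable
  qed measurable
  also have "\<dots> = (LINT s|lborel. autocorr f (t *\<^sub>R s) * (of_real (t ^ CARD('n)) * fourier_int ?g (t *\<^sub>R s)))"
    by (simp add: mult_ac flip: integral_mult_right_zero)
  also have "\<dots> = (LINT s|lborel. autocorr f (t *\<^sub>R s) * of_real (gauss 1 s))"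
    unfolding fourier_int_gauss[OF t] using t by (simp add: gauss_def)
  finally show ?thesis by (simp add: c_def)
qed

text \<open>The smoothed identity passes to the limit by a different theorem on each side: monotone
  convergence for the transform, whose square is not yet known to be integrable, and dominated
  convergence for the autocorrelation, which is bounded by the squared norm and continuous at
  0.\<close>

lemma L2_norm_fourier_int:
  fixes f :: "real ^ 'n::finite \<Rightarrow> complex"
  assumes f: "integrable lborel f" and f2: "f \<in> L2"
  shows "L2_norm lborel (fourier_int f) = L2_norm lborel f"
proof -
  have [measurable]: "f \<in> borel_measurable borel" using f by auto
  define c where "c = (2 * pi) powr (- real CARD('n) / 2)"
  define a where "a = (enn2real (L2_norm lborel f))\<^sup>2"
  define t where "t k = 1 / real (Suc k)" for k
  have t0: "t k > 0" for k by (simp add: t_def)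
  have t_lim: "t \<longlonglongrightarrow> 0" unfolding t_def by (rule LIMSEQ_Suc[OF lim_1_over_n])
  have t_dec: "t (Suc k) \<le> t k" for k by (simp add: t_def field_simps)
  let ?G = "\<lambda>k \<xi>. (norm (fourier_int f \<xi>))\<^sup>2 * gauss (t k) \<xi>"
  have lim1: "(\<lambda>k. LINT s|lborel. autocorr f (t k *\<^sub>R s) * of_real (gauss 1 s)) \<longlonglongrightarrow> (LINT s|lborel. autocorr f 0 * of_real (gauss 1 (s::real^'n)))"
  proof (rule integral_dominated_convergence[where w="\<lambda>s. a * gauss 1 s"])
    show "integrable lborel (\<lambda>s::real^'n. a * gauss 1 s)" by (intro integrable_mult_right gauss_integrable_1)
    show "AE s in lborel. (\<lambda>k. autocorr f (t k *\<^sub>R s) * of_real (gauss 1 s)) \<longlonglongrightarrow> autocorr f 0 * of_real (gauss 1 s)"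
    proof (rule AE_I2)
      fix s :: "real^'n"
      have "(\<lambda>k. t k *\<^sub>R s) \<longlonglongrightarrow> 0" using tendsto_scaleR[OF t_lim tendsto_const[of s]] by simp
      then show "(\<lambda>k. autocorr f (t k *\<^sub>R s) * of_real (gauss 1 s)) \<longlonglongrightarrow> autocorr f 0 * of_real (gauss 1 s)"
        by (intro tendsto_intros autocorr_tendsto f2)
    qed
    show "AE s in lborel. norm (autocorr f (t k *\<^sub>R s) * of_real (gauss 1 s)) \<le> a * gauss 1 s" for k
      using norm_autocorr_le[OF f2] by (auto simp: norm_mult gauss_def a_def intro!: mult_right_mono)
  qed measurable
  have int1: "(LINT s|lborel. autocorr f 0 * of_real (gauss 1 (s::real^'n))) = of_real (a * (2 * pi) powr (real CARD('n) / 2))"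
    by (simp add: autocorr_0[OF f2] gauss_integral_1 a_def)
  \<comment> \<open>The normalization in \<open>fourier_int\<close> cancels the total mass of the
    standard Gaussian; this is what makes the transform an isometry rather than a multiple of
    one.\<close>
  have c: "c * (2 * pi) powr (real CARD('n) / 2) = 1"
    by (simp add: c_def flip: powr_add)
  have "(\<lambda>k. LINT \<xi>|lborel. complex_of_real (?G k \<xi>)) \<longlonglongrightarrow> of_real c * of_real (a * (2 * pi) powr (real CARD('n) / 2))"
    unfolding fourier_int_gauss_smoothing[OF f f2 t0] c_def[symmetric] int1[symmetric]
    by (intro tendsto_intros lim1)
  also have "complex_of_real c * of_real (a * (2 * pi) powr (real CARD('n) / 2)) = of_real a"
    using c by (simp flip: of_real_mult add: mult.left_commute)
  finally have "(\<lambda>k. LINT \<xi>|lborel. ?G k \<xi>) \<longlonglongrightarrow> a"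
    unfolding integral_complex_of_real tendsto_of_real_iff .
  then have "(\<lambda>k. ennreal (LINT \<xi>|lborel. ?G k \<xi>)) \<longlonglongrightarrow> ennreal a" by (rule tendsto_ennrealI)
  moreover have "ennreal (LINT \<xi>|lborel. ?G k \<xi>) = (\<integral>\<^sup>+\<xi>. ennreal (?G k \<xi>) \<partial>lborel)" for k
  proof (rule nn_integral_eq_integral[symmetric])
    define K where "K = c * (LINT x|lborel. norm (f x))"
    show "integrable lborel (?G k)"
    proof (rule Bochner_Integration.integrable_bound)
      show "integrable lborel (\<lambda>\<xi>::real^'n. K\<^sup>2 * gauss (t k) \<xi>)" by (intro integrable_mult_right gauss_integrable_t t0)
      show "AE \<xi> in lborel. norm (?G k \<xi>) \<le> norm (K\<^sup>2 * gauss (t k) \<xi>)"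
        using norm_fourier_int_le[OF f] by (auto simp: norm_mult gauss_def K_def c_def intro!: mult_right_mono power_mono)
    qed measurable
  qed (auto simp: gauss_def)
  moreover have "(\<lambda>k. \<integral>\<^sup>+\<xi>. ennreal (?G k \<xi>) \<partial>lborel) \<longlonglongrightarrow> (\<integral>\<^sup>+\<xi>. ennreal ((norm (fourier_int f \<xi>))\<^sup>2) \<partial>lborel)"
  proof (rule nn_integral_LIMSEQ)
    show "incseq (\<lambda>k \<xi>. ennreal (?G k \<xi>))"
    proof (intro incseq_SucI le_funI ennreal_leI mult_left_mono)
      fix k and \<xi> :: "real^'n"
      have "(t (Suc k) * norm \<xi>)\<^sup>2 \<le> (t k * norm \<xi>)\<^sup>2"
        using t0[of k] t0[of "Suc k"] t_dec[of k] by (intro power_mono mult_right_mono) auto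
      then show "gauss (t k) \<xi> \<le> gauss (t (Suc k)) \<xi>"
        using t0 by (simp add: gauss_def abs_of_pos)
    qed auto
    show "(\<lambda>k. ennreal (?G k \<xi>)) \<longlonglongrightarrow> ennreal ((norm (fourier_int f \<xi>))\<^sup>2)" for \<xi>
    proof -
      have "(\<lambda>k. ?G k \<xi>) \<longlonglongrightarrow> (norm (fourier_int f \<xi>))\<^sup>2 * exp (- (norm (0 *\<^sub>R \<xi>))\<^sup>2 / 2)"
        unfolding gauss_def by (intro tendsto_intros t_lim) auto
      then show ?thesis by (intro tendsto_ennrealI) simp
    qed
  qed measurable
  ultimately have "(\<integral>\<^sup>+\<xi>. ennreal ((norm (fourier_int f \<xi>))\<^sup>2) \<partial>lborel) = ennreal a"
    using LIMSEQ_unique by fastforce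
  then have "(L2_norm lborel (fourier_int f))\<^sup>2 = (L2_norm lborel f)\<^sup>2"
    using L2_norm_less_top[OF f2] unfolding L2_norm_square[of lborel "fourier_int f"]
    by (simp add: a_def flip: ennreal_power)
  then show ?thesis by (simp add: ennreal_power2_eq_iff)
qed

section \<open>The transform on all of L2\<close>

lemma L2_lim_isometry:
  fixes f :: "'x \<Rightarrow> 'b::{real_normed_vector, second_countable_topology}"
    and g :: "'y \<Rightarrow> 'c::{real_normed_vector, second_countable_topology}"
  assumes [measurable]: "\<And>n. fs n \<in> borel_measurable M" "f \<in> borel_measurable M"
      "\<And>n. gs n \<in> borel_measurable N" "g \<in> borel_measurable N"
    and "L2_lim M fs f" "L2_lim N gs g" and le: "\<And>n. L2_norm M (fs n) \<le> L2_norm N (gs n)"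
  shows "L2_norm M f \<le> L2_norm N g"
proof -
  have "(\<lambda>n. L2_norm N g + (L2_norm N (\<lambda>x. gs n x - g x) + L2_norm M (\<lambda>x. fs n x - f x))) \<longlonglongrightarrow> L2_norm N g + (0 + 0)"
    using assms unfolding L2_lim_def by (intro tendsto_add tendsto_const)
  moreover have "L2_norm M f \<le> L2_norm N g + (L2_norm N (\<lambda>x. gs n x - g x) + L2_norm M (\<lambda>x. fs n x - f x))" for n
  proof -
    have "L2_norm M f \<le> L2_norm M (fs n) + L2_norm M (\<lambda>x. f x - fs n x)"
      using L2_norm_add_le[of "fs n" M "\<lambda>x. f x - fs n x"] by simp
    also have "\<dots> \<le> L2_norm N (gs n) + L2_norm M (\<lambda>x. fs n x - f x)"
      using le[of n] by (subst L2_norm_minus_commute) (rule add_right_mono)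
    also have "L2_norm N (gs n) \<le> L2_norm N g + L2_norm N (\<lambda>x. gs n x - g x)"
      using L2_norm_add_le[of g N "\<lambda>x. gs n x - g x"] by simp
    finally show ?thesis by (simp add: add.assoc add_right_mono)
  qed
  ultimately show ?thesis by (intro LIMSEQ_le_const[of _ "L2_norm N g"]) auto
qed

text \<open>The cutoff that occurs in the definition of \<open>fourier\<close>. It makes a
  square-integrable function integrable, as its product with another square-integrable function, the
  indicator of a ball.\<close>

definition cut_ball :: "nat \<Rightarrow> (real ^ 'n::finite \<Rightarrow> complex) \<Rightarrow> real ^ 'n \<Rightarrow> complex" where
  "cut_ball l f x = indicator (ball 0 (real l)) x * f x"

lemma indicator_ball_L2: "(\<lambda>x::real^'n::finite. indicator (ball 0 r) x :: complex) \<in> L2"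
  by (rule L2_bound[OF indicator_cball_L2[of r "1::complex"], where K=1]) (auto simp: indicator_def)

lemma cut_ball_L2:
  assumes "f \<in> L2" shows "cut_ball l f \<in> L2" "integrable lborel (cut_ball l f)" "L2_lim lborel (\<lambda>l. cut_ball l f) f"
proof -
  have [measurable]: "f \<in> borel_measurable borel" using assms by auto
  have m[measurable]: "cut_ball l f \<in> borel_measurable borel" for l
    unfolding cut_ball_def[abs_def] by (auto intro!: borel_measurable_times borel_measurable_indicator)
  show "cut_ball l f \<in> L2" for l
    by (rule L2_bound[OF assms, where K=1]) (auto simp: cut_ball_def indicator_def)
  show "integrable lborel (cut_ball l f)"
    unfolding cut_ball_def[abs_def] by (rule L2_mult_integrable[OF indicator_ball_L2 assms])
  show "L2_lim lborel (\<lambda>l. cut_ball l f) f"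
  proof (rule L2_lim_dominated[OF m _ assms])
    show "AE x in lborel. (\<lambda>l. cut_ball l f x) \<longlonglongrightarrow> f x"
    proof (rule AE_I2)
      fix x :: "real^'a"
      obtain N where N: "norm x < real N" using reals_Archimedean2 by blast
      have "\<forall>\<^sub>F l in sequentially. cut_ball l f x = f x"
        using eventually_ge_at_top[of N] by eventually_elim (use N in \<open>auto simp: cut_ball_def\<close>)
      then show "(\<lambda>l. cut_ball l f x) \<longlonglongrightarrow> f x" by (rule tendsto_eventually)
    qed
  qed (auto simp: cut_ball_def indicator_def)
qed

lemma fourier_ex:
  assumes f: "f \<in> L2"
  shows "\<exists>g. g \<in> L2 \<and> L2_lim lborel (\<lambda>l. fourier_int (cut_ball l f)) g"
proof -
  note c = cut_ball_L2[OF f]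
  have F: "fourier_int (cut_ball l f) \<in> L2" for l
    using L2_norm_fourier_int[OF c(2,1)] L2_norm_less_top[OF c(1)] c(1)[of l] by (intro L2I) auto
  have N: "L2_norm lborel (\<lambda>x. fourier_int (cut_ball i f) x - fourier_int (cut_ball j f) x)
      = L2_norm lborel (\<lambda>x. cut_ball i f x - cut_ball j f x)" for i j
    using L2_norm_fourier_int[OF _ L2_diff[OF c(1) c(1)], of i j] c(2)
    by (simp add: fourier_int_diff[OF c(2) c(2), abs_def])
  have "\<exists>N. \<forall>i\<ge>N. \<forall>j\<ge>N. L2_norm lborel (\<lambda>x. fourier_int (cut_ball i f) x - fourier_int (cut_ball j f) x) \<le> ennreal e"
    if "e > 0" for e
  proof -
    have [measurable]: "f \<in> borel_measurable borel" "cut_ball l f \<in> borel_measurable borel" for l using f c(1)[of l] by auto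
    have "\<forall>\<^sub>F n in sequentially. L2_norm lborel (\<lambda>x. cut_ball n f x - f x) \<le> ennreal (e/2)"
      using c(3) that unfolding L2_lim_def ennreal_tendsto_0_iff by simp
    then obtain N where N': "\<And>n. n \<ge> N \<Longrightarrow> L2_norm lborel (\<lambda>x. cut_ball n f x - f x) \<le> ennreal (e/2)"
      unfolding eventually_sequentially by blast
    have "L2_norm lborel (\<lambda>x. cut_ball i f x - cut_ball j f x) \<le> ennreal e" if "i \<ge> N" "j \<ge> N" for i j
    proof -
      have "L2_norm lborel (\<lambda>x. cut_ball i f x - cut_ball j f x) \<le> L2_norm lborel (\<lambda>x. cut_ball i f x - f x) + L2_norm lborel (\<lambda>x. f x - cut_ball j f x)"
        by (rule L2_norm_diff_triangle) auto
      also have "\<dots> \<le> ennreal (e/2) + ennreal (e/2)"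
        using N'[OF that(1)] N'[OF that(2)] by (subst (2) L2_norm_minus_commute) (rule add_mono)
      also have "\<dots> = ennreal e" using \<open>e > 0\<close> by (simp flip: ennreal_plus)
      finally show ?thesis .
    qed
    then show ?thesis unfolding N by blast
  qed
  then obtain g where "g \<in> L2" "L2_lim lborel (\<lambda>l. fourier_int (cut_ball l f)) g"
    by (rule L2_complete[OF F])
  then show ?thesis by blast
qed

lemma
  assumes f: "f \<in> L2"
  shows fourier_L2: "fourier f \<in> L2"
    and fourier_cut_ball: "L2_lim lborel (\<lambda>l. fourier_int (cut_ball l f)) (fourier f)"
proof -
  have "fourier f = (SOME g. g \<in> L2 \<and> L2_lim lborel (\<lambda>l. fourier_int (cut_ball l f)) g)"
    unfolding fourier_def L2_lim_def cut_ball_def[abs_def] ..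
  then show "fourier f \<in> L2" "L2_lim lborel (\<lambda>l. fourier_int (cut_ball l f)) (fourier f)"
    using someI_ex[OF fourier_ex[OF f]] by auto
qed

lemma fourier_int_L2:
  assumes "f \<in> L2" "integrable lborel f" shows "fourier_int f \<in> L2"
  using L2_norm_fourier_int[OF assms(2,1)] L2_norm_less_top[OF assms(1)] assms(1) by (intro L2I) auto

lemma L2_lim_diff:
  fixes f :: "'x \<Rightarrow> 'b::{real_normed_vector, second_countable_topology}"
  assumes [measurable]: "\<And>n. fs n \<in> borel_measurable M" "f \<in> borel_measurable M"
    "\<And>n. gs n \<in> borel_measurable M" "g \<in> borel_measurable M"
    and lim: "L2_lim M fs f" "L2_lim M gs g"
  shows "L2_lim M (\<lambda>n x. fs n x - gs n x) (\<lambda>x. f x - g x)"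
proof -
  have "L2_lim M (\<lambda>n x. - gs n x) (\<lambda>x. - g x)"
    by (rule L2_lim_bound[OF lim(2), where K=1]) (auto simp: norm_minus_commute)
  from L2_lim_add[OF _ _ _ _ lim(1) this] show ?thesis by simp
qed

text \<open>Every approximating sequence computes the transform: the difference of two of them tends
  to 0 in mean square and, by Plancherel for integrable functions, so does the difference of the
  transforms. Linearity, translation and the agreement with \<open>fourier_int\<close> follow by
  suitable choices of the sequence.\<close>

lemma fourier_unique:
  assumes f: "f \<in> L2" and fs: "\<And>n. fs n \<in> L2" "\<And>n. integrable lborel (fs n)" "L2_lim lborel fs f"
    and g: "g \<in> borel_measurable borel" "L2_lim lborel (\<lambda>n. fourier_int (fs n)) g"
  shows "AE \<xi> in lborel. fourier f \<xi> = g \<xi>"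
proof -
  note c = cut_ball_L2[OF f]
  have [measurable]: "f \<in> borel_measurable borel" "cut_ball l f \<in> borel_measurable borel" "fs l \<in> borel_measurable borel"
    "g \<in> borel_measurable borel" "fourier f \<in> borel_measurable borel" for l
    using f c(1)[of l] fs(1)[of l] fourier_L2[OF f] g(1) by auto
  have 1: "L2_lim lborel (\<lambda>l \<xi>. fourier_int (\<lambda>x. cut_ball l f x - fs l x) \<xi>) (\<lambda>\<xi>. fourier f \<xi> - g \<xi>)"
    using L2_lim_diff[OF _ _ _ _ fourier_cut_ball[OF f] g(2)] c fs by (simp add: fourier_int_diff)
  have 2: "L2_lim lborel (\<lambda>l x. cut_ball l f x - fs l x) (\<lambda>x. f x - f x)"
    by (rule L2_lim_diff[OF _ _ _ _ c(3) fs(3)]) auto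
  have "L2_norm lborel (\<lambda>\<xi>. fourier f \<xi> - g \<xi>) \<le> L2_norm lborel (\<lambda>x. f x - f x)"
  proof (rule L2_lim_isometry[OF _ _ _ _ 1 2])
    show "L2_norm lborel (fourier_int (\<lambda>x. cut_ball n f x - fs n x)) \<le> L2_norm lborel (\<lambda>x. cut_ball n f x - fs n x)" for n
      by (rule eq_refl, rule L2_norm_fourier_int) (auto intro!: L2_diff c fs)
  qed auto
  then have "L2_norm lborel (\<lambda>\<xi>. fourier f \<xi> - g \<xi>) = 0" by simp
  then show ?thesis by (subst (asm) L2_norm_eq_0_iff) auto
qed

lemma fourier_eq_fourier_int:
  assumes "f \<in> L2" "integrable lborel f"
  shows "AE \<xi> in lborel. fourier f \<xi> = fourier_int f \<xi>"
  by (rule fourier_unique[OF assms(1), of "\<lambda>_. f"]) (use assms in \<open>auto simp: L2_lim_def\<close>)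

lemma L2_norm_fourier:
  assumes f: "f \<in> L2" shows "L2_norm lborel (fourier f) = L2_norm lborel f"
proof -
  note c = cut_ball_L2[OF f]
  have [measurable]: "f \<in> borel_measurable borel" "cut_ball l f \<in> borel_measurable borel" "fourier f \<in> borel_measurable borel" for l
    using f c(1)[of l] fourier_L2[OF f] by auto
  show ?thesis
    by (intro antisym L2_lim_isometry[OF _ _ _ _ fourier_cut_ball[OF f] c(3)] L2_lim_isometry[OF _ _ _ _ c(3) fourier_cut_ball[OF f]])
       (auto simp: L2_norm_fourier_int c)
qed

lemma fourier_add:
  assumes "f \<in> L2" "g \<in> L2"
  shows "AE \<xi> in lborel. fourier (\<lambda>x. f x + g x) \<xi> = fourier f \<xi> + fourier g \<xi>"
proof (rule fourier_unique[OF L2_add[OF assms]])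
  note c = cut_ball_L2[OF assms(1)] note d = cut_ball_L2[OF assms(2)]
  show "(\<lambda>x. cut_ball n f x + cut_ball n g x) \<in> L2" for n by (intro L2_add c d)
  show "integrable lborel (\<lambda>x. cut_ball n f x + cut_ball n g x)" for n using c d by auto
  have m: "cut_ball n f \<in> borel_measurable borel" "cut_ball n g \<in> borel_measurable borel" "f \<in> borel_measurable borel"
    "g \<in> borel_measurable borel" "fourier f \<in> borel_measurable borel" "fourier g \<in> borel_measurable borel" for n
    using c(1)[of n] d(1)[of n] assms fourier_L2[OF assms(1)] fourier_L2[OF assms(2)] by auto
  then show "(\<lambda>\<xi>. fourier f \<xi> + fourier g \<xi>) \<in> borel_measurable borel" by auto
  show "L2_lim lborel (\<lambda>n x. cut_ball n f x + cut_ball n g x) (\<lambda>x. f x + g x)"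
    using m by (intro L2_lim_add c d) auto
  have "L2_lim lborel (\<lambda>n \<xi>. fourier_int (cut_ball n f) \<xi> + fourier_int (cut_ball n g) \<xi>) (\<lambda>\<xi>. fourier f \<xi> + fourier g \<xi>)"
    using m by (intro L2_lim_add fourier_cut_ball assms) auto
  then show "L2_lim lborel (\<lambda>n. fourier_int (\<lambda>x. cut_ball n f x + cut_ball n g x)) (\<lambda>\<xi>. fourier f \<xi> + fourier g \<xi>)"
    by (simp add: fourier_int_add[OF c(2) d(2), abs_def])
qed

lemma fourier_cmult:
  assumes "f \<in> L2"
  shows "AE \<xi> in lborel. fourier (\<lambda>x. a * f x) \<xi> = a * fourier f \<xi>"
proof (rule fourier_unique[OF L2_cmult[OF assms]])
  note c = cut_ball_L2[OF assms]
  have m: "cut_ball n f \<in> borel_measurable borel" "f \<in> borel_measurable borel"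
    "fourier f \<in> borel_measurable borel" for n
    using c(1)[of n] assms fourier_L2[OF assms] by auto
  show "(\<lambda>x. a * cut_ball n f x) \<in> L2" for n by (intro L2_cmult c)
  show "integrable lborel (\<lambda>x. a * cut_ball n f x)" for n using c by auto
  show "(\<lambda>\<xi>. a * fourier f \<xi>) \<in> borel_measurable borel" using m by auto
  show "L2_lim lborel (\<lambda>n x. a * cut_ball n f x) (\<lambda>x. a * f x)"
    by (rule L2_lim_bound[OF c(3), where K="norm a"]) (use m in \<open>auto simp: norm_mult simp flip: right_diff_distrib\<close>)
  show "L2_lim lborel (\<lambda>n. fourier_int (\<lambda>x. a * cut_ball n f x)) (\<lambda>\<xi>. a * fourier f \<xi>)"
    by (rule L2_lim_bound[OF fourier_cut_ball[OF assms], where K="norm a"])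
       (use m in \<open>auto simp: fourier_int_cmult norm_mult simp flip: right_diff_distrib\<close>)
qed

lemma fourier_diff:
  assumes "f \<in> L2" "g \<in> L2"
  shows "AE \<xi> in lborel. fourier (\<lambda>x. f x - g x) \<xi> = fourier f \<xi> - fourier g \<xi>"
  using fourier_add[OF assms(1) L2_cmult[OF assms(2), of "- 1"]] fourier_cmult[OF assms(2), of "- 1"] by auto

lemma fourier_zero: "AE \<xi> in lborel. fourier (\<lambda>x. 0) \<xi> = 0"
  using fourier_eq_fourier_int[OF L2_zero] by (simp add: fourier_int_def)

lemma fourier_sum:
  assumes "\<And>i. i \<in> I \<Longrightarrow> f i \<in> L2"
  shows "AE \<xi> in lborel. fourier (\<lambda>x. \<Sum>i\<in>I. f i x) \<xi> = (\<Sum>i\<in>I. fourier (f i) \<xi>)"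
  using assms
proof (induction I rule: infinite_finite_induct)
  case (insert i I)
  have "AE \<xi> in lborel. fourier (\<lambda>x. f i x + (\<Sum>i\<in>I. f i x)) \<xi> = fourier (f i) \<xi> + fourier (\<lambda>x. \<Sum>i\<in>I. f i x) \<xi>"
    using insert by (intro fourier_add L2_sum) auto
  with insert show ?case by (auto elim: eventually_elim2)
qed (auto simp: fourier_zero)

lemma fourier_eq_0_iff:
  assumes "f \<in> L2"
  shows "(AE \<xi> in lborel. fourier f \<xi> = 0) \<longleftrightarrow> (AE x in lborel. f x = 0)"
  using L2_norm_fourier[OF assms] L2_norm_eq_0_iff[of f lborel] L2_norm_eq_0_iff[of "fourier f" lborel] fourier_L2[OF assms] assms
  by (auto simp: L2_def)

lemma fourier_eq_iff:
  assumes "f \<in> L2" "g \<in> L2"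
  shows "(AE \<xi> in lborel. fourier f \<xi> = fourier g \<xi>) \<longleftrightarrow> (AE x in lborel. f x = g x)"
proof -
  have "(AE \<xi> in lborel. fourier f \<xi> = fourier g \<xi>) \<longleftrightarrow> (AE \<xi> in lborel. fourier (\<lambda>x. f x - g x) \<xi> = 0)"
    using fourier_diff[OF assms]
    by (intro iffI) (erule (1) eventually_elim2, simp)+
  then show ?thesis using fourier_eq_0_iff[OF L2_diff[OF assms]] by simp
qed

lemma fourier_L2_lim_iff:
  assumes "\<And>n. fs n \<in> L2" "f \<in> L2"
  shows "L2_lim lborel (\<lambda>n. fourier (fs n)) (fourier f) \<longleftrightarrow> L2_lim lborel fs f"
proof -
  have "L2_norm lborel (\<lambda>\<xi>. fourier (fs n) \<xi> - fourier f \<xi>) = L2_norm lborel (\<lambda>x. fs n x - f x)" for n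
  proof -
    have "L2_norm lborel (\<lambda>\<xi>. fourier (fs n) \<xi> - fourier f \<xi>) = L2_norm lborel (fourier (\<lambda>x. fs n x - f x))"
      using fourier_diff[OF assms(1)[of n] assms(2)] by (intro L2_norm_cong_AE) auto
    also have "\<dots> = L2_norm lborel (\<lambda>x. fs n x - f x)" by (rule L2_norm_fourier[OF L2_diff[OF assms]])
    finally show ?thesis .
  qed
  then show ?thesis by (simp add: L2_lim_def)
qed

section \<open>Duality, Parseval and inversion\<close>

lemma fourier_duality:
  assumes f: "f \<in> L2" and g: "g \<in> L2"
  shows "(LINT \<xi>|lborel. fourier f \<xi> * g \<xi>) = (LINT x|lborel. f x * fourier g x)"
proof (rule LIMSEQ_unique)
  note c = cut_ball_L2[OF f] note d = cut_ball_L2[OF g]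
  show "(\<lambda>n. LINT \<xi>|lborel. fourier_int (cut_ball n f) \<xi> * cut_ball n g \<xi>) \<longlonglongrightarrow> (LINT \<xi>|lborel. fourier f \<xi> * g \<xi>)"
    by (intro L2_lim_mult_integral fourier_cut_ball fourier_L2 fourier_int_L2 c d f g)
  show "(\<lambda>n. LINT \<xi>|lborel. fourier_int (cut_ball n f) \<xi> * cut_ball n g \<xi>) \<longlonglongrightarrow> (LINT x|lborel. f x * fourier g x)"
    unfolding fourier_int_duality[OF c(2) d(2)]
    by (intro L2_lim_mult_integral fourier_cut_ball fourier_L2 fourier_int_L2 c d f g)
qed

text \<open>Polarization. \<open>B\<close> is the defect in Parseval's identity; it is sesquilinear
  and vanishes on the diagonal by Plancherel. Expanding it at \<open>f + a * g\<close> with a = 1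
  and a = i gives two linear equations for \<open>B f g\<close> and \<open>B g f\<close> whose only
  solution is 0.\<close>

lemma fourier_Parseval:
  assumes f: "f \<in> L2" and g: "g \<in> L2"
  shows "(LINT \<xi>|lborel. fourier f \<xi> * cnj (fourier g \<xi>)) = (LINT x|lborel. f x * cnj (g x))"
proof -
  define B where "B f g = (LINT \<xi>|lborel. fourier f \<xi> * cnj (fourier g \<xi>)) - (LINT x|lborel. f x * cnj (g x))" for f g :: "real ^ 'a \<Rightarrow> complex"
  have diag: "B f f = 0" if "f \<in> L2" for f
    unfolding B_def using that L2_norm_square_integral[OF that] L2_norm_square_integral[OF fourier_L2[OF that]]
    by (simp add: L2_norm_fourier)
  have int: "integrable lborel (\<lambda>x. f x * cnj (g x))" if "f \<in> L2" "g \<in> L2" for f g :: "real ^ 'a \<Rightarrow> complex"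
    using that L2_mult_integrable L2_cnj by blast
  have m: "fourier f \<in> borel_measurable borel" if "f \<in> L2" for f :: "real ^ 'a \<Rightarrow> complex"
    using fourier_L2[OF that] by auto
  have expand: "B (\<lambda>x. f x + a * g x) (\<lambda>x. f x + a * g x) = B f f + cnj a * B f g + a * B g f + a * cnj a * B g g"
    if f: "f \<in> L2" and g: "g \<in> L2" for f g a
  proof -
    have ex: "(LINT x|lborel. (f x + a * g x) * cnj (f x + a * g x)) = (LINT x|lborel. f x * cnj (f x))
      + cnj a * (LINT x|lborel. f x * cnj (g x)) + a * (LINT x|lborel. g x * cnj (f x)) + a * cnj a * (LINT x|lborel. g x * cnj (g x))"
      if "f \<in> L2" "g \<in> L2" for f g :: "real ^ 'a \<Rightarrow> complex"
    proof -
      have "(LINT x|lborel. (f x + a * g x) * cnj (f x + a * g x)) =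
        (LINT x|lborel. f x * cnj (f x) + cnj a * (f x * cnj (g x)) + a * (g x * cnj (f x)) + a * cnj a * (g x * cnj (g x)))"
        by (rule arg_cong[where f="integral\<^sup>L lborel"]) (auto simp: algebra_simps)
      also have "\<dots> = (LINT x|lborel. f x * cnj (f x))
      + cnj a * (LINT x|lborel. f x * cnj (g x)) + a * (LINT x|lborel. g x * cnj (f x)) + a * cnj a * (LINT x|lborel. g x * cnj (g x))"
        using int[OF that(1) that(1)] int[OF that(1) that(2)] int[OF that(2) that(1)] int[OF that(2) that(2)] by simp
      finally show ?thesis .
    qed
    have AE: "AE \<xi> in lborel. fourier (\<lambda>x. f x + a * g x) \<xi> = fourier f \<xi> + a * fourier g \<xi>"
      using fourier_add[OF f L2_cmult[OF g, of a]] fourier_cmult[OF g, of a] by eventually_elim simp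
    have "(LINT \<xi>|lborel. fourier (\<lambda>x. f x + a * g x) \<xi> * cnj (fourier (\<lambda>x. f x + a * g x) \<xi>))
      = (LINT \<xi>|lborel. (fourier f \<xi> + a * fourier g \<xi>) * cnj (fourier f \<xi> + a * fourier g \<xi>))"
      using m[OF f] m[OF g] m[OF L2_add[OF f L2_cmult[OF g, of a]]]
      by (intro integral_cong_AE) (use AE in auto)
    then show ?thesis unfolding B_def ex[OF f g] ex[OF fourier_L2[OF f] fourier_L2[OF g]] by (simp add: algebra_simps)
  qed
  have 1: "B f g + B g f = 0" using expand[OF f g, of 1] diag f g L2_add[OF f L2_cmult[OF g, of 1]] by simp
  have 2: "- \<i> * B f g + \<i> * B g f = 0" using expand[OF f g, of \<i>] diag f g L2_add[OF f L2_cmult[OF g, of \<i>]] by simp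
  have "B g f = - B f g" using 1 by (simp add: add_eq_0_iff)
  with 2 have "B f g = 0" by simp
  then show ?thesis by (simp add: B_def)
qed

text \<open>Inversion without an inverse integral: conjugating before and after the transform
  inverts it. Duality followed by Parseval shows that \<open>h\<close> and \<open>f\<close> have the
  same inner product with every \<open>g\<close>, and \<open>g = h - f\<close> forces them to agree.
  Surjectivity of the transform follows.\<close>

lemma cnj_fourier_cnj_fourier:
  assumes f: "f \<in> L2"
  shows "AE x in lborel. cnj (fourier (\<lambda>\<xi>. cnj (fourier f \<xi>)) x) = f x"
proof -
  define h where "h x = cnj (fourier (\<lambda>\<xi>. cnj (fourier f \<xi>)) x)" for x
  have h: "h \<in> L2" unfolding h_def by (intro L2_cnj fourier_L2 f)
  have d: "(\<lambda>x. h x - f x) \<in> L2" by (intro L2_diff h f)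
  have "(LINT x|lborel. h x * cnj (g x)) = (LINT x|lborel. f x * cnj (g x))" if g: "g \<in> L2" for g
  proof -
    have "(LINT x|lborel. h x * cnj (g x)) = cnj (LINT x|lborel. fourier (\<lambda>\<xi>. cnj (fourier f \<xi>)) x * g x)"
      by (subst Bochner_Integration.integral_cnj[symmetric]) (simp add: h_def)
    also have "\<dots> = cnj (LINT x|lborel. cnj (fourier f x) * fourier g x)"
      by (simp only: fourier_duality[OF L2_cnj[OF fourier_L2[OF f]] g])
    also have "\<dots> = (LINT x|lborel. f x * cnj (g x))"
      by (subst Bochner_Integration.integral_cnj[symmetric]) (simp add: fourier_Parseval[OF f g])
    finally show ?thesis .
  qed
  from this[OF d] have "(LINT x|lborel. (h x - f x) * cnj (h x - f x)) = 0"
    using L2_mult_integrable(1)[OF h L2_cnj[OF d]] L2_mult_integrable(1)[OF f L2_cnj[OF d]] by (simp add: left_diff_distrib)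
  then have "enn2real (L2_norm lborel (\<lambda>x. h x - f x)) = 0" using L2_norm_square_integral[OF d] by simp
  then have "L2_norm lborel (\<lambda>x. h x - f x) = 0" using L2_norm_less_top[OF d] by (auto simp: enn2real_eq_0_iff)
  then have "AE x in lborel. h x - f x = 0" using d by (subst (asm) L2_norm_eq_0_iff) auto
  then show ?thesis by (simp add: h_def)
qed

lemma fourier_surj:
  assumes h: "h \<in> L2"
  shows "\<exists>f. f \<in> L2 \<and> (AE \<xi> in lborel. fourier f \<xi> = h \<xi>)"
proof (intro exI conjI)
  show "(\<lambda>x. cnj (fourier (\<lambda>\<xi>. cnj (h \<xi>)) x)) \<in> L2" by (intro L2_cnj fourier_L2 h)
  show "AE \<xi> in lborel. fourier (\<lambda>x. cnj (fourier (\<lambda>\<xi>. cnj (h \<xi>)) x)) \<xi> = h \<xi>"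
    using cnj_fourier_cnj_fourier[OF L2_cnj[OF h]] by eventually_elim (metis complex_cnj_cnj)
qed

lemma
  assumes h: "h \<in> L2"
  shows inv_fourier_L2: "inv_fourier h \<in> L2"
    and fourier_inv_fourier: "AE \<xi> in lborel. fourier (inv_fourier h) \<xi> = h \<xi>"
  using someI_ex[OF fourier_surj[OF h]] unfolding inv_fourier_def by auto

lemma fourier_translate:
  assumes f: "f \<in> L2"
  shows "AE \<xi> in lborel. fourier (\<lambda>x. f (x + h)) \<xi> = cis (h \<bullet> \<xi>) * fourier f \<xi>"
proof (rule fourier_unique[OF L2_translate[OF f], of "\<lambda>n x. cut_ball n f (x + h)"])
  note c = cut_ball_L2[OF f]
  have m[measurable]: "cut_ball n f \<in> borel_measurable borel" "f \<in> borel_measurable borel"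
    "fourier f \<in> borel_measurable borel" for n
    using c(1)[of n] f fourier_L2[OF f] by auto
  show "(\<lambda>x. cut_ball n f (x + h)) \<in> L2" for n by (intro L2_translate c)
  show "integrable lborel (\<lambda>x. cut_ball n f (x + h))" for n
    using c(2)[of n] nn_integral_translate[of "\<lambda>x. ennreal (norm (cut_ball n f x))" h] by (simp add: integrable_iff_bounded)
  show "L2_lim lborel (\<lambda>n x. cut_ball n f (x + h)) (\<lambda>x. f (x + h))"
    using c(3) L2_norm_translate[of "\<lambda>x. cut_ball _ f x - f x" h] by (simp add: L2_lim_def)
  show "(\<lambda>\<xi>. cis (h \<bullet> \<xi>) * fourier f \<xi>) \<in> borel_measurable borel" unfolding cis_conv_exp by measurable
  show "L2_lim lborel (\<lambda>n. fourier_int (\<lambda>x. cut_ball n f (x + h))) (\<lambda>\<xi>. cis (h \<bullet> \<xi>) * fourier f \<xi>)"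
    by (rule L2_lim_bound[OF fourier_cut_ball[OF f], where K=1])
       (auto simp: fourier_int_translate norm_mult simp flip: right_diff_distrib)
qed

section \<open>Weak derivatives on the Fourier side\<close>

text \<open>A single term of the exponential series. With u = 1/a it shows that exp (-1/a) beats
  every power of 1/a as a decreases to 0.\<close>

lemma power_le_fact_mult_exp:
  fixes u :: real
  assumes "u \<ge> 0"
  shows "u ^ k \<le> fact k * exp u"
proof -
  have s: "summable (\<lambda>n. u ^ n / fact n)"
    using summable_exp[of u] by (simp add: field_simps)
  have "(\<Sum>n\<in>{k}. u ^ n / fact n) \<le> (\<Sum>n. u ^ n / fact n)"
    using assms by (intro sum_le_suminf s) auto
  also have "\<dots> = exp u" by (simp add: exp_def divide_inverse mult.commute scaleR_conv_of_real)
  finally show ?thesis by (simp add: field_simps)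
qed

text \<open>For fixed \<open>\<rho>\<close> this class of functions is closed under differentiation, and so is the class of
  products of such functions of the separate coordinates.\<close>

definition bump :: "real \<Rightarrow> real poly \<Rightarrow> nat \<Rightarrow> real \<Rightarrow> real" where
  "bump \<rho> P j t = (if \<bar>t\<bar> < \<rho> then poly P t / (\<rho>\<^sup>2 - t\<^sup>2) ^ j * exp (- 1 / (\<rho>\<^sup>2 - t\<^sup>2)) else 0)"

text \<open>With s = \<rho>^2 - t^2, differentiating P / s^j * exp (-1/s) gives the factor s^2 P' +
  2 j t s P - 2 t P over s^(j + 2), again times exp (-1/s). The polynomial is this numerator, and
  \<open>[:\<rho>\<^sup>2, 0, -1:]\<close> is s.\<close>

definition bump_deriv :: "real \<Rightarrow> real poly \<Rightarrow> nat \<Rightarrow> real poly" where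
  "bump_deriv \<rho> P j = [:\<rho>\<^sup>2, 0, -1:]\<^sup>2 * pderiv P + [:0, 2 * real j:] * [:\<rho>\<^sup>2, 0, -1:] * P - [:0, 2:] * P"

text \<open>Needed at the end points of the support, where no formula can be differentiated:
  quadratic smallness makes the difference quotient there tend to 0, and 0 is also the value that
  the derived bump takes.\<close>

lemma bump_quadratic_bound:
  assumes "\<rho> > 0"
  obtains K where "K \<ge> 0" "\<And>t s. \<bar>s\<bar> = \<rho> \<Longrightarrow> \<bar>bump \<rho> P j t\<bar> \<le> K * (t - s)\<^sup>2"
proof -
  have "continuous_on {-\<rho>..\<rho>} (poly P)" by (intro continuous_intros)
  then have "compact (poly P ` {-\<rho>..\<rho>})" by (rule compact_continuous_image) simp
  then have "bounded (poly P ` {-\<rho>..\<rho>})" by (rule compact_imp_bounded)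
  then obtain M where "\<forall>x\<in>poly P ` {-\<rho>..\<rho>}. \<bar>x\<bar> \<le> M" unfolding bounded_real by (elim exE)
  then have M: "\<bar>poly P t\<bar> \<le> M" if "t \<in> {-\<rho>..\<rho>}" for t using that by simp
  have M0: "M \<ge> 0" using M[of 0] assms by auto
  define K where "K = M * fact (j + 2) * (2 * \<rho>)\<^sup>2"
  have "\<bar>bump \<rho> P j t\<bar> \<le> K * (t - s)\<^sup>2" if s: "\<bar>s\<bar> = \<rho>" for t s
  proof (cases "\<bar>t\<bar> < \<rho>")
    case True
    define a where "a = \<rho>\<^sup>2 - t\<^sup>2"
    have a: "a > 0" using power_strict_mono[of "\<bar>t\<bar>" \<rho> 2] True by (simp add: a_def)
    \<comment> \<open>Of the \<open>j + 2\<close> powers, \<open>j\<close> absorb the denominator of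
      the bump and two remain to produce the factor a^2, which is at most a multiple of (t -
      s)^2.\<close>
    have "(1 / a) ^ (j + 2) \<le> fact (j + 2) * exp (1 / a)"
      using a by (intro power_le_fact_mult_exp) auto
    then have "exp (- 1 / a) / a ^ j \<le> fact (j + 2) * a\<^sup>2"
      using a by (simp add: exp_minus field_simps power_add power2_eq_square)
    moreover have "a \<le> 2 * \<rho> * \<bar>t - s\<bar>"
    proof -
      have "a = (s - t) * (s + t)" using s by (auto simp: a_def power2_eq_square algebra_simps abs_if split: if_splits)
      then have "a \<le> \<bar>s - t\<bar> * \<bar>s + t\<bar>" using a by (simp flip: abs_mult)
      also have "\<dots> \<le> \<bar>s - t\<bar> * (2 * \<rho>)" using True s by (intro mult_left_mono) auto
      finally show ?thesis by (simp add: abs_minus_commute mult_ac)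
    qed
    then have "a\<^sup>2 \<le> (2 * \<rho> * \<bar>t - s\<bar>)\<^sup>2" using a by (intro power_mono) auto
    ultimately have "exp (- 1 / a) / a ^ j \<le> fact (j + 2) * (2 * \<rho> * \<bar>t - s\<bar>)\<^sup>2"
      by (meson fact_ge_zero mult_left_mono order_trans)
    then have "\<bar>poly P t\<bar> * (exp (- 1 / a) / a ^ j) \<le> M * (fact (j + 2) * (2 * \<rho> * \<bar>t - s\<bar>)\<^sup>2)"
      using M[of t] True M0 a by (intro mult_mono) (auto simp: abs_less_iff)
    moreover have "\<bar>bump \<rho> P j t\<bar> = \<bar>poly P t\<bar> * (exp (- 1 / a) / a ^ j)"
      using True a by (simp add: bump_def a_def[symmetric] abs_mult)
    ultimately show ?thesis by (simp add: K_def power_mult_distrib mult_ac)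
  next
    case False
    then show ?thesis using M0 by (simp add: bump_def K_def)
  qed
  moreover have "K \<ge> 0" using M0 by (simp add: K_def)
  ultimately show thesis using that by blast
qed

lemma bump_has_derivative:
  assumes \<rho>: "\<rho> > 0"
  shows "(bump \<rho> P j has_real_derivative bump \<rho> (bump_deriv \<rho> P j) (j + 2) t) (at t)"
proof -
  consider "\<bar>t\<bar> < \<rho>" | "\<bar>t\<bar> > \<rho>" | "\<bar>t\<bar> = \<rho>" by linarith
  then show ?thesis
  proof cases
    case 1
    have pos: "\<rho>\<^sup>2 - x\<^sup>2 > 0" if "x \<in> {-\<rho><..<\<rho>}" for x
      using that power_strict_mono[of "\<bar>x\<bar>" \<rho> 2] by (auto simp: abs_less_iff)
    have a: "\<rho>\<^sup>2 - t\<^sup>2 > 0" using 1 by (intro pos) auto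
    have "((\<lambda>t. poly P t / (\<rho>\<^sup>2 - t\<^sup>2) ^ j * exp (- 1 / (\<rho>\<^sup>2 - t\<^sup>2))) has_real_derivative bump \<rho> (bump_deriv \<rho> P j) (j + 2) t) (at t)"
    proof -
      define s where "s = \<rho>\<^sup>2 - t\<^sup>2"
      have s: "s \<noteq> 0" using a by (simp add: s_def)
      have d1: "((\<lambda>t. 1 / (\<rho>\<^sup>2 - t\<^sup>2) ^ j) has_real_derivative (real j * 2 * t / s ^ Suc j)) (at t)"
      proof (cases j)
        case (Suc i)
        show ?thesis
          by (rule derivative_eq_intros refl | use s in \<open>simp add: s_def; fail\<close>)+
             (use s in \<open>simp add: Suc s_def[symmetric] field_simps\<close>)
      qed simp
      have d2: "((\<lambda>t. exp (- 1 / (\<rho>\<^sup>2 - t\<^sup>2))) has_real_derivative (exp (- 1 / s) * (- 2 * t / s\<^sup>2))) (at t)"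
        by (rule derivative_eq_intros refl | use s in \<open>simp add: s_def; fail\<close>)+
           (use s in \<open>simp add: s_def power2_eq_square\<close>)
      have d: "((\<lambda>t. poly P t * (1 / (\<rho>\<^sup>2 - t\<^sup>2) ^ j) * exp (- 1 / (\<rho>\<^sup>2 - t\<^sup>2))) has_real_derivative
          ((poly (pderiv P) t * (1 / s ^ j) + real j * 2 * t / s ^ Suc j * poly P t) * exp (- 1 / s)
           + exp (- 1 / s) * (- 2 * t / s\<^sup>2) * (poly P t * (1 / s ^ j)))) (at t)"
        using DERIV_mult[OF DERIV_mult[OF poly_DERIV[of P t] d1] d2] by (simp add: s_def)
      have p: "poly (bump_deriv \<rho> P j) t = s\<^sup>2 * poly (pderiv P) t + 2 * real j * t * s * poly P t - 2 * t * poly P t"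
        by (simp add: bump_deriv_def s_def power2_eq_square algebra_simps)
      have "((poly (pderiv P) t * (1 / s ^ j) + real j * 2 * t / s ^ Suc j * poly P t) * exp (- 1 / s)
           + exp (- 1 / s) * (- 2 * t / s\<^sup>2) * (poly P t * (1 / s ^ j))) = bump \<rho> (bump_deriv \<rho> P j) (j + 2) t"
      proof -
        have b: "bump \<rho> (bump_deriv \<rho> P j) (j + 2) t = poly (bump_deriv \<rho> P j) t / s ^ (j + 2) * exp (- 1 / s)"
          using 1 by (simp add: bump_def s_def)
        show ?thesis unfolding b p using s by (simp add: field_simps power2_eq_square power_add)
      qed
      then show ?thesis using d by simp
    qed
    then show ?thesis
      by (rule has_field_derivative_transform_within_open[where S="{-\<rho><..<\<rho>}"]) (use 1 in \<open>auto simp: bump_def\<close>)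
  next
    case 2
    have "((\<lambda>_. 0) has_real_derivative 0) (at t)" by simp
    then have "(bump \<rho> P j has_real_derivative 0) (at t)"
      by (rule has_field_derivative_transform_within_open[where S="{..<-\<rho>} \<union> {\<rho><..}"]) (use 2 in \<open>auto simp: bump_def\<close>)
    then show ?thesis using 2 by (simp add: bump_def)
  next
    case 3
    obtain K where K: "K \<ge> 0" "\<And>t s. \<bar>s\<bar> = \<rho> \<Longrightarrow> \<bar>bump \<rho> P j t\<bar> \<le> K * (t - s)\<^sup>2"
      using bump_quadratic_bound[OF \<rho>] by metis
    have "(bump \<rho> P j has_real_derivative 0) (at t)"
      unfolding DERIV_def
    proof (rule tendsto_0_le)
      show "((\<lambda>h. K * h) \<longlongrightarrow> 0) (at 0)" by (auto intro!: tendsto_eq_intros)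
      show "\<forall>\<^sub>F h in at 0. norm ((bump \<rho> P j (t + h) - bump \<rho> P j t) / h) \<le> norm (K * h) * 1"
      proof (rule eventually_at_filter[THEN iffD2], rule always_eventually, intro allI impI)
        fix h :: real assume "h \<noteq> 0"
        have "\<bar>bump \<rho> P j (t + h)\<bar> \<le> K * (\<bar>h\<bar> * \<bar>h\<bar>)" using K(2)[OF 3, of "t + h"] by (simp add: power2_eq_square abs_mult_self_eq)
        then show "norm ((bump \<rho> P j (t + h) - bump \<rho> P j t) / h) \<le> norm (K * h) * 1"
          using \<open>h \<noteq> 0\<close> 3 K(1) by (simp add: bump_def[of _ _ _ t] abs_mult field_simps)
      qed
    qed
    then show ?thesis using 3 by (simp add: bump_def)
  qed
qed

definition bump_prod :: "real \<Rightarrow> real ^ 'n::finite \<Rightarrow> ('n \<Rightarrow> real poly) \<Rightarrow> ('n \<Rightarrow> nat) \<Rightarrow> real ^ 'n \<Rightarrow> real" where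
  "bump_prod \<rho> b P j x = (\<Prod>i\<in>UNIV. bump \<rho> (P i) (j i) (x $ i - b $ i))"

lemma bump_prod_has_derivative:
  assumes \<rho>: "\<rho> > 0"
  shows "(bump_prod \<rho> b P j has_derivative
    (\<lambda>y. \<Sum>k\<in>UNIV. y $ k * bump_prod \<rho> b (P(k := bump_deriv \<rho> (P k) (j k))) (j(k := j k + 2)) x)) (at x)"
proof -
  have "((\<lambda>x. bump \<rho> (P i) (j i) (x $ i - b $ i)) has_derivative
      (\<lambda>y. y $ i * bump \<rho> (bump_deriv \<rho> (P i) (j i)) (j i + 2) (x $ i - b $ i))) (at x)" for i
  proof -
    have "((\<lambda>x. x $ i - b $ i) has_derivative (\<lambda>y. y $ i)) (at x)"
      by (auto intro!: derivative_eq_intros bounded_linear_imp_has_derivative bounded_linear_vec_nth)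
    from has_derivative_compose[OF this, of "bump \<rho> (P i) (j i)"]
    show ?thesis using bump_has_derivative[OF \<rho>, of "P i" "j i" "x $ i - b $ i"]
      unfolding has_field_derivative_def mult.commute[of _ "bump _ _ _ _"] by blast
  qed
  from has_derivative_prod[of UNIV, OF this]
  have "(bump_prod \<rho> b P j has_derivative
    (\<lambda>y. \<Sum>i\<in>UNIV. y $ i * bump \<rho> (bump_deriv \<rho> (P i) (j i)) (j i + 2) (x $ i - b $ i) * (\<Prod>l\<in>UNIV - {i}. bump \<rho> (P l) (j l) (x $ l - b $ l)))) (at x)"
    unfolding bump_prod_def[abs_def] by simp
  moreover have "bump \<rho> (bump_deriv \<rho> (P i) (j i)) (j i + 2) (x $ i - b $ i) * (\<Prod>l\<in>UNIV - {i}. bump \<rho> (P l) (j l) (x $ l - b $ l))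
     = bump_prod \<rho> b (P(i := bump_deriv \<rho> (P i) (j i))) (j(i := j i + 2)) x" for i
    unfolding bump_prod_def by (subst prod.remove[of UNIV i]) auto
  ultimately show ?thesis by (simp add: mult.assoc)
qed

lemma pd_bump_prod:
  assumes \<rho>: "\<rho> > 0"
  shows "pd k (bump_prod \<rho> b P j) = bump_prod \<rho> b (P(k := bump_deriv \<rho> (P k) (j k))) (j(k := j k + 2))"
proof
  fix x
  have "pd k (bump_prod \<rho> b P j) x
    = (\<Sum>i\<in>UNIV. axis k 1 $ i * bump_prod \<rho> b (P(i := bump_deriv \<rho> (P i) (j i))) (j(i := j i + 2)) x)"
    unfolding pd_def frechet_derivative_at[OF bump_prod_has_derivative[OF \<rho>], symmetric] ..
  also have "\<dots> = bump_prod \<rho> b (P(k := bump_deriv \<rho> (P k) (j k))) (j(k := j k + 2)) x"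
    by (subst sum.remove[of UNIV k]) (auto simp: axis_def)
  finally show "pd k (bump_prod \<rho> b P j) x = bump_prod \<rho> b (P(k := bump_deriv \<rho> (P k) (j k))) (j(k := j k + 2)) x" .
qed

lemma test_function_bump_prod:
  assumes \<rho>: "\<rho> > 0"
  shows "test_function (bump_prod \<rho> b P j)"
proof -
  have diff: "bump_prod \<rho> b P j differentiable_on UNIV" for P j
    unfolding differentiable_on_def differentiable_def using bump_prod_has_derivative[OF \<rho>] by blast
  have "Ck_on l UNIV (bump_prod \<rho> b P j)" for l P j
    by (induction l arbitrary: P j)
       (auto simp: pd_bump_prod[OF \<rho>] diff differentiable_imp_continuous_on)
  moreover have "compact (closure {x. bump_prod \<rho> b P j x \<noteq> 0})"
  proof -
    have "bounded {x. bump_prod \<rho> b P j x \<noteq> 0}"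
    proof (rule bounded_subset)
      show "bounded (cbox (b - (\<chi> i. \<rho>)) (b + (\<chi> i. \<rho>)))" by simp
      show "{x. bump_prod \<rho> b P j x \<noteq> 0} \<subseteq> cbox (b - (\<chi> i. \<rho>)) (b + (\<chi> i. \<rho>))"
      proof
        fix x assume "x \<in> {x. bump_prod \<rho> b P j x \<noteq> 0}"
        then have "\<bar>x $ i - b $ i\<bar> < \<rho>" for i by (auto simp: bump_prod_def bump_def split: if_splits)
        then show "x \<in> cbox (b - (\<chi> i. \<rho>)) (b + (\<chi> i. \<rho>))"
          by (auto simp: mem_box_cart abs_less_iff) (smt (verit))+
      qed
    qed
    then show ?thesis by simp
  qed
  ultimately show ?thesis by (simp add: test_function_def smooth_on_def)
qed

abbreviation std_bump :: "real \<Rightarrow> real ^ 'n::finite \<Rightarrow> real ^ 'n \<Rightarrow> real" where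
  "std_bump \<rho> b \<equiv> bump_prod \<rho> b (\<lambda>_. 1) (\<lambda>_. 0)"

lemma std_bump_translate: "std_bump \<rho> b x = std_bump \<rho> 0 (x + - b)"
  by (simp add: bump_prod_def)

lemma pd_std_bump_translate: "\<rho> > 0 \<Longrightarrow> pd k (std_bump \<rho> b) x = pd k (std_bump \<rho> 0) (x + - b)"
  unfolding pd_bump_prod by (simp add: bump_prod_def)

section \<open>Difference quotients and derivatives in L2\<close>

definition diff_quot :: "'n \<Rightarrow> real \<Rightarrow> (real ^ 'n::finite \<Rightarrow> complex) \<Rightarrow> real ^ 'n \<Rightarrow> complex" where
  "diff_quot k h f x = (f (x + h *\<^sub>R axis k 1) - f x) / of_real h"

lemma test_function_facts:
  fixes \<phi> :: "real ^ 'n::finite \<Rightarrow> real"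
  assumes "test_function \<phi>"
  obtains r K where "r \<ge> 0" "K \<ge> 0" "\<And>x. norm x > r \<Longrightarrow> \<phi> x = 0" "\<And>x. \<bar>\<phi> x\<bar> \<le> K" "\<phi> \<in> borel_measurable borel"
    "pd k \<phi> \<in> borel_measurable borel" "\<And>x. norm x > r \<Longrightarrow> pd k \<phi> x = 0" "\<And>x. \<bar>pd k \<phi> x\<bar> \<le> K"
    "\<And>x. \<phi> differentiable (at x)"
proof -
  have C: "Ck_on l UNIV \<phi>" for l using assms by (simp add: test_function_def smooth_on_def)
  have cont: "continuous_on UNIV \<phi>" using C[of 0] by simp
  have diff: "\<phi> differentiable (at x)" for x using C[of 1] by (auto simp: differentiable_on_def)
  have contd: "continuous_on UNIV (pd k \<phi>)" using C[of 1] by simp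
  have "bounded (closure {x. \<phi> x \<noteq> 0})" using assms compact_imp_bounded by (auto simp: test_function_def)
  then obtain r where r: "r > 0" "\<And>x. x \<in> closure {x. \<phi> x \<noteq> 0} \<Longrightarrow> norm x \<le> r" by (auto simp: bounded_pos)
  have z: "\<phi> x = 0" if "norm x > r" for x
  proof (rule ccontr)
    assume "\<phi> x \<noteq> 0"
    then have "x \<in> closure {x. \<phi> x \<noteq> 0}" by (intro closure_subset[THEN subsetD]) simp
    from r(2)[OF this] \<open>norm x > r\<close> show False by simp
  qed
  have zd: "pd k \<phi> x = 0" if x: "norm x > r" for x
  proof -
    have "((\<lambda>_. 0) has_derivative (\<lambda>_. 0)) (at x)" by simp
    then have "(\<phi> has_derivative (\<lambda>_. 0)) (at x)"
      by (rule has_derivative_transform_within_open[where s="- cball 0 r"]) (use x z in auto)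
    then show ?thesis unfolding pd_def by (simp flip: frechet_derivative_at)
  qed
  have "\<exists>K. \<forall>x\<in>cball 0 r. \<bar>g x\<bar> \<le> K" if "continuous_on UNIV g" for g :: "real ^ 'n \<Rightarrow> real"
  proof -
    have "compact (g ` cball 0 r)" using that by (intro compact_continuous_image continuous_on_subset[OF that]) auto
    then have "bounded (g ` cball 0 r)" by (rule compact_imp_bounded)
    then show ?thesis by (auto simp: bounded_real)
  qed
  from this[OF cont] this[OF contd]
  obtain K1 K2 where "\<forall>x\<in>cball 0 r. \<bar>\<phi> x\<bar> \<le> K1" "\<forall>x\<in>cball 0 r. \<bar>pd k \<phi> x\<bar> \<le> K2"
    by (elim exE)
  then have K: "\<bar>\<phi> x\<bar> \<le> K1" "\<bar>pd k \<phi> x\<bar> \<le> K2" if "x \<in> cball 0 r" for x using that by simp_all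
  have K0: "K1 \<ge> 0" "K2 \<ge> 0" using K[of 0] r by auto
  show thesis
  proof (rule that[of r "max K1 K2"])
    show "\<bar>\<phi> x\<bar> \<le> max K1 K2" for x using K(1)[of x] z[of x] K0 by (cases "norm x \<le> r") auto
    show "\<bar>pd k \<phi> x\<bar> \<le> max K1 K2" for x using K(2)[of x] zd[of x] K0 by (cases "norm x \<le> r") auto
  qed (use r z zd diff K0 cont contd borel_measurable_continuous_onI in \<open>auto\<close>)
qed

lemma test_function_L2:
  fixes \<phi> :: "real ^ 'n::finite \<Rightarrow> real"
  assumes "test_function \<phi>"
  shows "(\<lambda>x. complex_of_real (\<phi> x)) \<in> L2" "integrable lborel (\<lambda>x. complex_of_real (\<phi> x))"
    and "(\<lambda>x. complex_of_real (pd k \<phi> x)) \<in> L2" "integrable lborel (\<lambda>x. complex_of_real (pd k \<phi> x))"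
proof -
  obtain r K where *: "r \<ge> 0" "K \<ge> 0" "\<And>x. norm x > r \<Longrightarrow> \<phi> x = 0" "\<And>x. \<bar>\<phi> x\<bar> \<le> K" and [measurable]: "\<phi> \<in> borel_measurable borel"
    "pd k \<phi> \<in> borel_measurable borel" and "\<And>x. norm x > r \<Longrightarrow> pd k \<phi> x = 0" "\<And>x. \<bar>pd k \<phi> x\<bar> \<le> K"
    using test_function_facts[OF assms, of k] by metis
  have le: "norm (complex_of_real (\<phi> x)) \<le> 1 * norm (indicator (cball 0 r) x *\<^sub>R complex_of_real K)"
    "norm (complex_of_real (pd k \<phi> x)) \<le> 1 * norm (indicator (cball 0 r) x *\<^sub>R complex_of_real K)" for x
    using * \<open>\<And>x. norm x > r \<Longrightarrow> pd k \<phi> x = 0\<close> \<open>\<And>x. \<bar>pd k \<phi> x\<bar> \<le> K\<close> by (auto simp: indicator_def not_le)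
  show "(\<lambda>x. complex_of_real (\<phi> x)) \<in> L2" "(\<lambda>x. complex_of_real (pd k \<phi> x)) \<in> L2"
    by (rule L2_bound[OF indicator_cball_L2 AE_I2[OF le(1)]] L2_bound[OF indicator_cball_L2 AE_I2[OF le(2)]]; measurable)+
  show "integrable lborel (\<lambda>x. complex_of_real (\<phi> x))" "integrable lborel (\<lambda>x. complex_of_real (pd k \<phi> x))"
    by (rule Bochner_Integration.integrable_bound[OF indicator_cball_integrable[of r K]]; use le in \<open>auto simp: abs_mult\<close>)+
qed

lemma seq_1_over_Suc: "(\<lambda>n. 1 / real (Suc n)) \<longlonglongrightarrow> 0"
  by (rule LIMSEQ_Suc[OF lim_1_over_n])

text \<open>The mean value theorem bounds all the quotients by the maximum \<open>K\<close> of the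
  derivative, and steps of length at most 1 keep their supports in the ball of radius
  \<open>r + 1\<close>. Pointwise convergence therefore becomes mean-square convergence.\<close>

lemma pd_test_function_L2_lim:
  fixes \<phi> :: "real ^ 'n::finite \<Rightarrow> real"
  assumes \<phi>: "test_function \<phi>"
  shows "L2_lim lborel (\<lambda>n. diff_quot k (1 / real (Suc n)) (\<lambda>x. of_real (\<phi> x))) (\<lambda>x. of_real (pd k \<phi> x))"
proof -
  obtain r K where *: "r \<ge> 0" "K \<ge> 0" "\<And>x. norm x > r \<Longrightarrow> \<phi> x = 0" and [measurable]: "\<phi> \<in> borel_measurable borel"
    "pd k \<phi> \<in> borel_measurable borel" and "\<And>x. norm x > r \<Longrightarrow> pd k \<phi> x = 0" and K: "\<And>x. \<bar>pd k \<phi> x\<bar> \<le> K"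
    and diff: "\<And>x. \<phi> differentiable (at x)"
    using test_function_facts[OF \<phi>, of k] by metis
  define e where "e = (axis k 1 :: real ^ 'n)"
  have ne: "norm e = 1" by (simp add: e_def)
  have deriv: "((\<lambda>t. \<phi> (x + t *\<^sub>R e)) has_real_derivative pd k \<phi> (x + t *\<^sub>R e)) (at t)" for x t
  proof -
    have "(\<phi> has_derivative frechet_derivative \<phi> (at (x + t *\<^sub>R e))) (at (x + t *\<^sub>R e))"
      using diff frechet_derivative_works by blast
    moreover have "((\<lambda>t. x + t *\<^sub>R e) has_derivative (\<lambda>s. s *\<^sub>R e)) (at t)" by (auto intro!: derivative_eq_intros)
    ultimately have "((\<lambda>t. \<phi> (x + t *\<^sub>R e)) has_derivative (\<lambda>s. frechet_derivative \<phi> (at (x + t *\<^sub>R e)) (s *\<^sub>R e))) (at t)"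
      by (rule has_derivative_compose[rotated])
    moreover have "frechet_derivative \<phi> (at y) (s *\<^sub>R e) = pd k \<phi> y * s" for s y
      using linear_frechet_derivative[OF diff[of y]] by (simp add: pd_def e_def linear_cmul)
    ultimately show ?thesis by (simp add: has_field_derivative_def)
  qed
  have bound: "\<bar>\<phi> (x + h *\<^sub>R e) - \<phi> x\<bar> \<le> K * h" if h: "h > 0" for x h
  proof -
    obtain t where "\<phi> (x + h *\<^sub>R e) - \<phi> (x + 0 *\<^sub>R e) = (h - 0) * pd k \<phi> (x + t *\<^sub>R e)"
      using MVT2[OF h, of "\<lambda>t. \<phi> (x + t *\<^sub>R e)" "\<lambda>t. pd k \<phi> (x + t *\<^sub>R e)"] deriv by auto
    then show ?thesis using K[of "x + t *\<^sub>R e"] h by (simp add: abs_mult mult_ac)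
  qed
  show ?thesis
  proof (rule L2_lim_dominated[OF _ _ indicator_cball_L2[of "r + 1" "2 * K"]])
    show "diff_quot k (1 / real (Suc n)) (\<lambda>x. complex_of_real (\<phi> x)) \<in> borel_measurable borel" for n
      unfolding diff_quot_def[abs_def] by measurable
    show "AE x in lborel. norm (diff_quot k (1 / real (Suc n)) (\<lambda>x. complex_of_real (\<phi> x)) x - complex_of_real (pd k \<phi> x))
      \<le> norm (indicator (cball 0 (r + 1)) x *\<^sub>R (2 * K))" for n
    proof (rule AE_I2)
      fix x :: "real ^ 'n"
      define h where "h = 1 / real (Suc n)"
      have h: "h > 0" "h \<le> 1" by (auto simp: h_def)
      have eq: "diff_quot k h (\<lambda>x. complex_of_real (\<phi> x)) x - complex_of_real (pd k \<phi> x) = of_real ((\<phi> (x + h *\<^sub>R e) - \<phi> x) / h - pd k \<phi> x)"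
        by (simp add: diff_quot_def e_def)
      have "\<bar>(\<phi> (x + h *\<^sub>R e) - \<phi> x) / h\<bar> \<le> K"
        using bound[of h x] h by (simp add: abs_divide divide_le_eq)
      then have le: "\<bar>(\<phi> (x + h *\<^sub>R e) - \<phi> x) / h - pd k \<phi> x\<bar> \<le> 2 * K"
        using K[of x] by linarith
      have z: "(\<phi> (x + h *\<^sub>R e) - \<phi> x) / h - pd k \<phi> x = 0" if "x \<notin> cball 0 (r + 1)"
      proof -
        have "norm x > r + 1" using that by simp
        moreover have "norm x \<le> norm (x + h *\<^sub>R e) + norm (h *\<^sub>R e)"
          using norm_triangle_ineq4[of "x + h *\<^sub>R e" "h *\<^sub>R e"] by simp
        ultimately have "norm (x + h *\<^sub>R e) > r" "norm x > r" using h ne by auto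
        then show ?thesis using *(3) \<open>\<And>x. norm x > r \<Longrightarrow> pd k \<phi> x = 0\<close> by simp
      qed
      show "norm (diff_quot k (1 / real (Suc n)) (\<lambda>x. complex_of_real (\<phi> x)) x - complex_of_real (pd k \<phi> x))
      \<le> norm (indicator (cball 0 (r + 1)) x *\<^sub>R (2 * K))"
        unfolding h_def[symmetric] eq norm_of_real using le z by (cases "x \<in> cball 0 (r + 1)") auto
    qed
    show "AE x in lborel. (\<lambda>n. diff_quot k (1 / real (Suc n)) (\<lambda>x. complex_of_real (\<phi> x)) x) \<longlonglongrightarrow> complex_of_real (pd k \<phi> x)"
    proof (rule AE_I2)
      fix x :: "real ^ 'n"
      have "((\<lambda>h. (\<phi> (x + h *\<^sub>R e) - \<phi> x) / h) \<longlongrightarrow> pd k \<phi> x) (at 0)"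
        using deriv[of x 0] by (simp add: DERIV_def)
      moreover have "filterlim (\<lambda>n. 1 / real (Suc n)) (at 0) sequentially"
        using seq_1_over_Suc by (auto simp: filterlim_at)
      ultimately have "(\<lambda>n. (\<phi> (x + (1 / real (Suc n)) *\<^sub>R e) - \<phi> x) / (1 / real (Suc n))) \<longlonglongrightarrow> pd k \<phi> x"
        by (rule filterlim_compose)
      then have "(\<lambda>n. complex_of_real ((\<phi> (x + (1 / real (Suc n)) *\<^sub>R e) - \<phi> x) / (1 / real (Suc n)))) \<longlonglongrightarrow> complex_of_real (pd k \<phi> x)"
        by (rule tendsto_of_real)
      then show "(\<lambda>n. diff_quot k (1 / real (Suc n)) (\<lambda>x. complex_of_real (\<phi> x)) x) \<longlonglongrightarrow> complex_of_real (pd k \<phi> x)"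
        by (simp add: diff_quot_def e_def)
    qed
  qed measurable
qed

lemma diff_quot_L2: "f \<in> L2 \<Longrightarrow> diff_quot k h f \<in> L2"
  unfolding diff_quot_def[abs_def] divide_inverse mult.commute[of _ "inverse _"]
  by (intro L2_cmult L2_diff L2_translate)

lemma fourier_diff_quot:
  assumes f: "f \<in> L2"
  shows "AE \<xi> in lborel. fourier (diff_quot k h f) \<xi> = (cis (h * \<xi> $ k) - 1) / of_real h * fourier f \<xi>"
proof -
  have "AE \<xi> in lborel. fourier (\<lambda>x. inverse (of_real h) * (f (x + h *\<^sub>R axis k 1) - f x)) \<xi>
    = inverse (of_real h) * fourier (\<lambda>x. f (x + h *\<^sub>R axis k 1) - f x) \<xi>"
    by (intro fourier_cmult L2_diff L2_translate f)
  moreover have "AE \<xi> in lborel. fourier (\<lambda>x. f (x + h *\<^sub>R axis k 1) - f x) \<xi> = fourier (\<lambda>x. f (x + h *\<^sub>R axis k 1)) \<xi> - fourier f \<xi>"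
    by (intro fourier_diff L2_translate f)
  moreover have "AE \<xi> in lborel. fourier (\<lambda>x. f (x + h *\<^sub>R axis k 1)) \<xi> = cis ((h *\<^sub>R axis k 1) \<bullet> \<xi>) * fourier f \<xi>"
    by (rule fourier_translate[OF f])
  ultimately show ?thesis
    unfolding diff_quot_def[abs_def] divide_inverse mult.commute[of _ "inverse _"]
    by eventually_elim (simp add: inner_axis' algebra_simps)
qed

lemma cis_diff_quot_tendsto:
  assumes h: "h \<longlonglongrightarrow> 0" "\<And>n. h n \<noteq> 0"
  shows "(\<lambda>n. (cis (h n * s) - 1) / of_real (h n)) \<longlonglongrightarrow> \<i> * of_real s"
proof (rule LIM_zero_cancel, rule tendsto_0_le)
  show "(\<lambda>n. h n * s\<^sup>2) \<longlonglongrightarrow> 0"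
    using tendsto_mult[OF h(1) tendsto_const[of "s\<^sup>2"]] by simp
  show "\<forall>\<^sub>F n in sequentially. norm ((cis (h n * s) - 1) / of_real (h n) - \<i> * of_real s) \<le> norm (h n * s\<^sup>2) * 1"
  proof (rule always_eventually, rule allI)
    fix n
    have "norm (cis (h n * s) - 1 - \<i> * of_real (h n * s)) \<le> (h n * s)\<^sup>2 / 2"
      using iexp_approx1[of "h n * s" 1] by (simp add: cis_conv_exp power2_eq_square diff_diff_eq)
    also have "\<dots> \<le> (h n * s)\<^sup>2" by simp
    finally have "norm (cis (h n * s) - 1 - \<i> * of_real (h n * s)) / \<bar>h n\<bar> \<le> (h n * s)\<^sup>2 / \<bar>h n\<bar>"
      by (rule divide_right_mono) simp
    also have "norm (cis (h n * s) - 1 - \<i> * of_real (h n * s)) / \<bar>h n\<bar> = norm ((cis (h n * s) - 1 - \<i> * of_real (h n * s)) / of_real (h n))"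
      by (simp add: norm_divide)
    also have "(cis (h n * s) - 1 - \<i> * of_real (h n * s)) / of_real (h n) = (cis (h n * s) - 1) / of_real (h n) - \<i> * of_real s"
      using h(2)[of n] by (simp add: field_simps)
    also have "(h n * s)\<^sup>2 / \<bar>h n\<bar> = norm (h n * s\<^sup>2) * 1"
      using h(2)[of n] by (simp add: power2_eq_square abs_mult field_simps)
    finally show "norm ((cis (h n * s) - 1) / of_real (h n) - \<i> * of_real s) \<le> norm (h n * s\<^sup>2) * 1" .
  qed
qed

lemma norm_cis_diff_quot_le:
  assumes "h \<noteq> 0"
  shows "norm ((cis (h * s) - 1) / of_real h) \<le> \<bar>s\<bar>"
proof -
  have "norm (cis (h * s) - 1) \<le> \<bar>h * s\<bar>"
    using iexp_approx1[of "h * s" 0] by (simp add: cis_conv_exp)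
  then show ?thesis using assms by (simp add: norm_divide divide_le_eq abs_mult mult.commute)
qed

text \<open>The Fourier-side counterpart of \<open>has_weak_pd\<close>. It determines
  \<open>v\<close> up to a null set, and it can be checked one frequency at a time.\<close>

definition is_L2_pd :: "'n \<Rightarrow> (real ^ 'n::finite \<Rightarrow> complex) \<Rightarrow> (real ^ 'n \<Rightarrow> complex) \<Rightarrow> bool" where
  "is_L2_pd k u v \<longleftrightarrow> (AE \<xi> in lborel. fourier v \<xi> = \<i> * of_real (\<xi> $ k) * fourier u \<xi>)"

text \<open>On the Fourier side the quotient is multiplication by (exp (i h s) - 1) / h with s the
  k-th frequency, which tends to i s and has modulus at most |s|. Given the symbol relation, twice
  the transform of \<open>v\<close> dominates the error; conversely, an almost-everywhere convergent
  subsequence identifies the limit.\<close>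

lemma diff_quot_L2_lim_iff:
  assumes u: "u \<in> L2" and v: "v \<in> L2" and h: "h \<longlonglongrightarrow> 0" "\<And>n. h n \<noteq> 0"
  shows "L2_lim lborel (\<lambda>n. diff_quot k (h n) u) v \<longleftrightarrow> is_L2_pd k u v"
proof -
  have [measurable]: "fourier u \<in> borel_measurable borel" "fourier v \<in> borel_measurable borel"
    using fourier_L2[OF u] fourier_L2[OF v] by auto
  let ?D = "\<lambda>n \<xi>. (cis (h n * \<xi> $ k) - 1) / of_real (h n) * fourier u \<xi>"
  have m[measurable]: "?D n \<in> borel_measurable borel" for n
    unfolding cis_conv_exp by measurable
  have D_lim: "(\<lambda>n. ?D n \<xi>) \<longlonglongrightarrow> \<i> * of_real (\<xi> $ k) * fourier u \<xi>" for \<xi>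
    by (intro tendsto_mult cis_diff_quot_tendsto h tendsto_const)
  have "L2_lim lborel (\<lambda>n. diff_quot k (h n) u) v \<longleftrightarrow> L2_lim lborel (\<lambda>n. fourier (diff_quot k (h n) u)) (fourier v)"
    by (rule fourier_L2_lim_iff[symmetric]) (intro diff_quot_L2 u v)+
  also have "\<dots> \<longleftrightarrow> L2_lim lborel ?D (fourier v)"
    by (rule L2_lim_cong_AE[OF fourier_diff_quot[OF u]]) simp
  also have "\<dots> \<longleftrightarrow> is_L2_pd k u v"
  proof
    assume L: "L2_lim lborel ?D (fourier v)"
    have m': "?D n \<in> borel_measurable lborel" "fourier v \<in> borel_measurable lborel" for n by measurable
    obtain r where r: "strict_mono (r::nat\<Rightarrow>nat)" "AE \<xi> in lborel. (\<lambda>n. ?D (r n) \<xi>) \<longlonglongrightarrow> fourier v \<xi>"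
      by (rule L2_lim_AE_subseq[of ?D lborel "fourier v", OF m' L])
    show "is_L2_pd k u v"
      unfolding is_L2_pd_def using r(2)
    proof eventually_elim
      fix \<xi> assume "(\<lambda>n. ?D (r n) \<xi>) \<longlonglongrightarrow> fourier v \<xi>"
      moreover have "(\<lambda>n. ?D (r n) \<xi>) \<longlonglongrightarrow> \<i> * of_real (\<xi> $ k) * fourier u \<xi>"
        using LIMSEQ_subseq_LIMSEQ[OF D_lim r(1)] by (simp add: comp_def)
      ultimately show "fourier v \<xi> = \<i> * of_real (\<xi> $ k) * fourier u \<xi>" by (rule LIMSEQ_unique)
    qed
  next
    assume pd: "is_L2_pd k u v"
    show "L2_lim lborel ?D (fourier v)"
    proof (rule L2_lim_dominated[where g="\<lambda>\<xi>. 2 * fourier v \<xi>"])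
      show "AE \<xi> in lborel. (\<lambda>n. ?D n \<xi>) \<longlonglongrightarrow> fourier v \<xi>"
        using pd D_lim unfolding is_L2_pd_def by (auto elim: eventually_mono)
      show "AE \<xi> in lborel. norm (?D n \<xi> - fourier v \<xi>) \<le> norm (2 * fourier v \<xi>)" for n
        using pd unfolding is_L2_pd_def
      proof eventually_elim
        fix \<xi> assume eq: "fourier v \<xi> = \<i> * of_real (\<xi> $ k) * fourier u \<xi>"
        have "norm (?D n \<xi>) \<le> \<bar>\<xi> $ k\<bar> * norm (fourier u \<xi>)"
          unfolding norm_mult[of _ "fourier u \<xi>"] by (intro mult_right_mono norm_cis_diff_quot_le h) auto
        then have "norm (?D n \<xi>) \<le> norm (fourier v \<xi>)" by (simp add: eq norm_mult)
        then show "norm (?D n \<xi> - fourier v \<xi>) \<le> norm (2 * fourier v \<xi>)"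
          using norm_triangle_ineq4[of "?D n \<xi>" "fourier v \<xi>"] by (simp add: norm_mult)
      qed
      show "(\<lambda>\<xi>. 2 * fourier v \<xi>) \<in> L2" by (intro L2_cmult fourier_L2 v)
    qed (rule m, measurable)
  qed
  finally show ?thesis .
qed

lemma is_L2_pd_test_function:
  assumes "test_function \<phi>"
  shows "is_L2_pd k (\<lambda>x. of_real (\<phi> x)) (\<lambda>x. of_real (pd k \<phi> x))"
  using pd_test_function_L2_lim[OF assms, of k]
    diff_quot_L2_lim_iff[OF test_function_L2(1)[OF assms] test_function_L2(3)[OF assms] seq_1_over_Suc] by simp

text \<open>Discrete integration by parts: translation invariance moves the quotient with step h
  from the test function to the quotient with step -h of \<open>u\<close>, at the cost of a sign.
  Both quotients converge in mean square, so the identity survives the limit.\<close>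

lemma is_L2_pd_imp_has_weak_pd:
  assumes u: "u \<in> L2" and v: "v \<in> L2" and pd: "is_L2_pd k u v"
  shows "has_weak_pd k u v"
  unfolding has_weak_pd_def
proof (intro allI impI)
  fix \<phi> :: "real ^ 'a \<Rightarrow> real" assume \<phi>: "test_function \<phi>"
  note t = test_function_L2[OF \<phi>]
  have [measurable]: "u \<in> borel_measurable borel" "(\<lambda>x. complex_of_real (\<phi> x)) \<in> borel_measurable borel" using u t(1) by auto
  define h where "h n = 1 / real (Suc n)" for n
  have h: "h \<longlonglongrightarrow> 0" "h n \<noteq> 0" for n using seq_1_over_Suc by (auto simp: h_def[abs_def])
  have h': "(\<lambda>n. - h n) \<longlonglongrightarrow> 0" "- h n \<noteq> 0" for n using tendsto_minus[OF h(1)] h(2) by auto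
  have "(\<lambda>n. LINT x|lborel. diff_quot k (h n) (\<lambda>x. of_real (\<phi> x)) x * u x) \<longlonglongrightarrow> (LINT x|lborel. of_real (pd k \<phi> x) * u x)"
  proof (rule L2_lim_mult_integral)
    show "L2_lim lborel (\<lambda>n. diff_quot k (h n) (\<lambda>x. of_real (\<phi> x))) (\<lambda>x. of_real (pd k \<phi> x))"
      unfolding h_def by (rule pd_test_function_L2_lim[OF \<phi>])
  qed (auto intro: t u diff_quot_L2 simp: L2_lim_def)
  moreover have "(\<lambda>n. LINT x|lborel. of_real (\<phi> x) * diff_quot k (- h n) u x) \<longlonglongrightarrow> (LINT x|lborel. of_real (\<phi> x) * v x)"
    by (rule L2_lim_mult_integral) (use diff_quot_L2_lim_iff[OF u v h', of k] pd in \<open>auto intro: t u v diff_quot_L2 simp: L2_lim_def\<close>)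
  moreover have "(LINT x|lborel. diff_quot k (h n) (\<lambda>x. of_real (\<phi> x)) x * u x) = - (LINT x|lborel. of_real (\<phi> x) * diff_quot k (- h n) u x)" for n
  proof -
    let ?e = "h n *\<^sub>R axis k (1::real)" and ?\<Phi> = "\<lambda>x. complex_of_real (\<phi> x)"
    have i: "integrable lborel (\<lambda>x. ?\<Phi> (x + ?e) * u x)" "integrable lborel (\<lambda>x. ?\<Phi> x * u x)" "integrable lborel (\<lambda>x. ?\<Phi> x * u (x + - ?e))"
      by (intro L2_mult_integrable(1) L2_translate[OF t(1)] L2_translate[OF u] t u)+
    have "(LINT x|lborel. ?\<Phi> (x + ?e) * u x) = (LINT x|lborel. ?\<Phi> x * u (x + - ?e))"
      using integral_translate[of "\<lambda>x. ?\<Phi> x * u (x + - ?e)" ?e] by simp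
    moreover have "(LINT x|lborel. diff_quot k (h n) ?\<Phi> x * u x) = ((LINT x|lborel. ?\<Phi> (x + ?e) * u x) - (LINT x|lborel. ?\<Phi> x * u x)) / of_real (h n)"
      unfolding diff_quot_def times_divide_eq_left left_diff_distrib using i by simp
    moreover have "(LINT x|lborel. ?\<Phi> x * diff_quot k (- h n) u x) = ((LINT x|lborel. ?\<Phi> x * u (x + - ?e)) - (LINT x|lborel. ?\<Phi> x * u x)) / of_real (- h n)"
      unfolding diff_quot_def times_divide_eq_right right_diff_distrib scaleR_minus_left using i by simp
    ultimately show ?thesis by simp
  qed
  ultimately have "(LINT x|lborel. of_real (pd k \<phi> x) * u x) = - (LINT x|lborel. of_real (\<phi> x) * v x)"
    by (simp only:) (rule LIMSEQ_unique, assumption, rule tendsto_minus)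
  then show "(LINT x|lborel. pd k \<phi> x *\<^sub>R u x) = - (LINT x|lborel. \<phi> x *\<^sub>R v x)"
    by (simp add: scaleR_conv_of_real)
qed

section \<open>From the weak formulation back to the symbol\<close>

lemma box_vec_not_null:
  assumes "\<And>i. a $ i < b $ i"
  shows "emeasure lborel (box a (b :: real ^ 'n::finite)) > 0"
proof -
  have "emeasure lborel (box a b) = (\<Prod>e\<in>Basis. (b - a) \<bullet> e)"
    using assms by (subst emeasure_lborel_box_eq) (auto simp: Basis_vec_def inner_axis less_imp_le)
  moreover have "(\<Prod>e\<in>Basis. (b - a) \<bullet> e) > 0"
    using assms by (intro prod_pos) (auto simp: Basis_vec_def inner_axis)
  ultimately show ?thesis by simp
qed

text \<open>On the support of the bump the phase satisfies
  \<open>\<bar>x \<bullet> \<xi>\<bar> \<le> 1\<close>, so its cosine is at least cos 1 > 0. The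
  real part of the transform is then the integral of a nonnegative function that is positive on a
  box.\<close>

lemma fourier_int_std_bump_nonzero:
  fixes \<xi> :: "real ^ 'n::finite"
  assumes \<rho>: "\<rho> > 0" and le: "\<rho> * (\<Sum>i\<in>UNIV. \<bar>\<xi> $ i\<bar>) \<le> 1"
  shows "fourier_int (\<lambda>x. of_real (std_bump \<rho> 0 x)) \<xi> \<noteq> 0"
proof
  let ?\<phi> = "std_bump \<rho> (0 :: real ^ 'n)"
  assume z: "fourier_int (\<lambda>x. of_real (?\<phi> x)) \<xi> = 0"
  have t: "test_function ?\<phi>" by (rule test_function_bump_prod[OF \<rho>])
  note i = test_function_L2(2)[OF t]
  have [measurable]: "?\<phi> \<in> borel_measurable borel" by (rule test_function_facts[OF t])
  have nn: "?\<phi> x \<ge> 0" for x by (auto simp: bump_prod_def bump_def intro!: prod_nonneg)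
  have supp: "\<bar>x $ i\<bar> < \<rho>" if "?\<phi> x \<noteq> 0" for x i using that by (auto simp: bump_prod_def bump_def split: if_splits)
  have cos1: "cos (1::real) > 0" by (rule cos_gt_zero) (use pi_gt3 in auto)
  have ge: "cos (x \<bullet> \<xi>) * ?\<phi> x \<ge> cos 1 * ?\<phi> x" for x
  proof (cases "?\<phi> x = 0")
    case False
    have "\<bar>x \<bullet> \<xi>\<bar> \<le> (\<Sum>i\<in>UNIV. \<bar>x $ i * \<xi> $ i\<bar>)" by (simp add: inner_vec_def sum_abs)
    also have "\<dots> \<le> (\<Sum>i\<in>UNIV. \<rho> * \<bar>\<xi> $ i\<bar>)" unfolding abs_mult by (intro sum_mono mult_right_mono less_imp_le[OF supp[OF False]]) auto
    also have "\<dots> \<le> 1" using le by (simp add: sum_distrib_left)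
    finally have "\<bar>x \<bullet> \<xi>\<bar> \<le> 1" .
    then have "cos \<bar>x \<bullet> \<xi>\<bar> \<ge> cos 1" using pi_gt3 by (subst cos_mono_le_eq) auto
    then show ?thesis using nn by (simp add: mult_right_mono cos_abs_real)
  qed simp
  have "(LINT x|lborel. cis (- (x \<bullet> \<xi>)) * of_real (?\<phi> x)) = 0" using z by (simp add: fourier_int_def)
  then have "0 = Re (LINT x|lborel. cis (- (x \<bullet> \<xi>)) * of_real (?\<phi> x))" by simp
  also have "\<dots> = (LINT x|lborel. Re (cis (- (x \<bullet> \<xi>)) * of_real (?\<phi> x)))"
    by (rule integral_Re[OF integrable_cis_mult[OF i], symmetric])
  also have "\<dots> = (LINT x|lborel. cos (x \<bullet> \<xi>) * ?\<phi> x)" by simp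
  finally have int0: "(LINT x|lborel. cos (x \<bullet> \<xi>) * ?\<phi> x) = 0" by simp
  have "integrable lborel (\<lambda>x. Re (cis (- (x \<bullet> \<xi>)) * of_real (?\<phi> x)))"
    by (rule integrable_Re[OF integrable_cis_mult[OF i]])
  then have "integrable lborel (\<lambda>x. cos (x \<bullet> \<xi>) * ?\<phi> x)" by simp
  then have AE: "AE x in lborel. cos (x \<bullet> \<xi>) * ?\<phi> x = 0"
    using ge nn cos1 int0 by (subst (asm) integral_nonneg_eq_0_iff_AE) (auto intro!: AE_I2 order_trans[OF _ ge])
  then have "AE x in lborel. x \<notin> box (\<chi> i. - \<rho>) (\<chi> i. \<rho> :: real ^ 'n)"
  proof eventually_elim
    fix x :: "real ^ 'n" assume *: "cos (x \<bullet> \<xi>) * ?\<phi> x = 0"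
    show "x \<notin> box (\<chi> i. - \<rho>) (\<chi> i. \<rho> :: real ^ 'n)"
    proof
      assume "x \<in> box (\<chi> i. - \<rho>) (\<chi> i. \<rho> :: real ^ 'n)"
      then have "\<bar>x $ i\<bar> < \<rho>" for i by (auto simp: mem_box_cart abs_less_iff) (smt (verit))
      then have "?\<phi> x > 0" by (auto simp: bump_prod_def bump_def intro!: prod_pos)
      then have "cos (x \<bullet> \<xi>) * ?\<phi> x > 0" using ge[of x] cos1 by (meson less_le_trans mult_pos_pos)
      then show False using * by simp
    qed
  qed
  then have "emeasure lborel (box (\<chi> i. - \<rho>) (\<chi> i. \<rho> :: real ^ 'n)) = 0"
    by (subst (asm) AE_iff_measurable[OF _ refl]) auto
  moreover have "emeasure lborel (box (\<chi> i. - \<rho>) (\<chi> i. \<rho> :: real ^ 'n)) > 0"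
    using \<rho> by (intro box_vec_not_null) auto
  ultimately show False by simp
qed

lemma fourier_int_zero_imp_zero:
  fixes g :: "real ^ 'n::finite \<Rightarrow> complex"
  assumes g: "g \<in> L2" "integrable lborel g" and z: "\<And>\<xi>. fourier_int g \<xi> = 0"
  shows "AE x in lborel. g x = 0"
  using fourier_eq_0_iff[OF g(1)] fourier_eq_fourier_int[OF g] by (simp add: z)

text \<open>Testing against all translates of a bump and transforming in the translation parameter yields
  the identity multiplied by the transform of the bump; a bump of small support has a transform
  without zeros on any given ball.\<close>

lemma has_weak_pd_imp_is_L2_pd:
  fixes u v :: "real ^ 'n::finite \<Rightarrow> complex"
  assumes u: "u \<in> L2" and v: "v \<in> L2" and pd: "has_weak_pd k u v"
  shows "is_L2_pd k u v"
proof -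
  have *: "AE \<xi> in lborel. fourier_int (\<lambda>x. of_real (std_bump \<rho> 0 x)) \<xi> \<noteq> 0 \<longrightarrow> fourier v \<xi> = \<i> * of_real (\<xi> $ k) * fourier u \<xi>"
    if \<rho>: "\<rho> > 0" for \<rho>
  proof -
    let ?\<phi> = "\<lambda>b. std_bump \<rho> (b :: real ^ 'n)"
    define \<Phi> where "\<Phi> b x = complex_of_real (?\<phi> b x)" for b x
    define \<Psi> where "\<Psi> b x = complex_of_real (pd k (?\<phi> b) x)" for b x
    have t: "test_function (?\<phi> b)" for b by (rule test_function_bump_prod[OF \<rho>])
    have \<Phi>: "\<Phi> b \<in> L2" "integrable lborel (\<Phi> b)" and \<Psi>: "\<Psi> b \<in> L2" "integrable lborel (\<Psi> b)" for b
      using test_function_L2[OF t] unfolding \<Phi>_def[abs_def] \<Psi>_def[abs_def] by auto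
    \<comment> \<open>By Parseval, the weak identity tested with the bump centred at
      \<open>b\<close> says that the transform of \<open>G\<close> at \<open>- b\<close> is 0, since
      moving the bump only inserts the phase. \<open>G\<close> is also integrable, as a sum of
      products of square-integrable functions, so its integral transform is defined at every
      point.\<close>
    define G where "G \<xi> = fourier v \<xi> * cnj (fourier_int (\<Phi> 0) \<xi>) + fourier u \<xi> * cnj (fourier_int (\<Psi> 0) \<xi>)" for \<xi>
    have bd: "norm (cnj (fourier_int f \<xi>)) \<le> (2 * pi) powr (- real CARD('n) / 2) * (LINT x|lborel. norm (f x))"
      if "integrable lborel f" for f and \<xi> :: "real ^ 'n"
      using norm_fourier_int_le[OF that] by simp
    have [measurable]: "\<Phi> b \<in> borel_measurable borel" "\<Psi> b \<in> borel_measurable borel" for b using \<Phi>(1)[of b] \<Psi>(1)[of b] by auto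
    have Fi: "fourier_int (\<Phi> b) \<in> L2" "fourier_int (\<Psi> b) \<in> L2" for b by (intro fourier_int_L2 \<Phi> \<Psi>)+
    have G2: "G \<in> L2"
      unfolding G_def[abs_def] mult.commute[of "fourier _ _"]
      by (intro L2_add L2_mult_bounded[OF fourier_L2[OF v] AE_I2[OF bd[OF \<Phi>(2)]]] L2_mult_bounded[OF fourier_L2[OF u] AE_I2[OF bd[OF \<Psi>(2)]]]) measurable
    have G1: "integrable lborel G"
      unfolding G_def[abs_def] by (intro Bochner_Integration.integrable_add L2_mult_integrable L2_cnj Fi fourier_L2 u v)
    have G_zero: "fourier_int G (- b) = 0" for b
    proof -
      have w: "(LINT x|lborel. u x * cnj (\<Psi> b x)) = - (LINT x|lborel. v x * cnj (\<Phi> b x))"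
        using pd t[of b] unfolding has_weak_pd_def \<Phi>_def \<Psi>_def by (simp add: scaleR_conv_of_real mult.commute)
      have tr: "fourier_int (\<Phi> b) \<xi> = cis (- (b \<bullet> \<xi>)) * fourier_int (\<Phi> 0) \<xi>" "fourier_int (\<Psi> b) \<xi> = cis (- (b \<bullet> \<xi>)) * fourier_int (\<Psi> 0) \<xi>" for \<xi>
      proof -
        have "\<Phi> b = (\<lambda>x. \<Phi> 0 (x + - b))" "\<Psi> b = (\<lambda>x. \<Psi> 0 (x + - b))"
          unfolding \<Phi>_def[abs_def] \<Psi>_def[abs_def] std_bump_translate[of \<rho> b] pd_std_bump_translate[OF \<rho>, of k b] by auto
        then show "fourier_int (\<Phi> b) \<xi> = cis (- (b \<bullet> \<xi>)) * fourier_int (\<Phi> 0) \<xi>" "fourier_int (\<Psi> b) \<xi> = cis (- (b \<bullet> \<xi>)) * fourier_int (\<Psi> 0) \<xi>"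
          using fourier_int_translate[of "\<Phi> 0" "- b" \<xi>] fourier_int_translate[of "\<Psi> 0" "- b" \<xi>] by auto
      qed
      have P: "(LINT x|lborel. f x * cnj (g x)) = (LINT \<xi>|lborel. fourier f \<xi> * cnj (fourier_int g \<xi>))"
        if "f \<in> L2" "g \<in> L2" "integrable lborel g" for f g
      proof -
        have [measurable]: "fourier f \<in> borel_measurable borel" "fourier g \<in> borel_measurable borel" "g \<in> borel_measurable borel"
          using fourier_L2[OF that(1)] fourier_L2[OF that(2)] that(2) by auto
        show ?thesis
          unfolding fourier_Parseval[OF that(1,2), symmetric]
          by (rule integral_cong_AE) (use fourier_eq_fourier_int[OF that(2,3)] in auto)
      qed
      have "0 = (LINT x|lborel. v x * cnj (\<Phi> b x)) + (LINT x|lborel. u x * cnj (\<Psi> b x))" using w by simp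
      also have "\<dots> = (LINT \<xi>|lborel. fourier v \<xi> * cnj (fourier_int (\<Phi> b) \<xi>)) + (LINT \<xi>|lborel. fourier u \<xi> * cnj (fourier_int (\<Psi> b) \<xi>))"
        by (simp only: P[OF v \<Phi>] P[OF u \<Psi>])
      also have "\<dots> = (LINT \<xi>|lborel. fourier v \<xi> * cnj (fourier_int (\<Phi> b) \<xi>) + fourier u \<xi> * cnj (fourier_int (\<Psi> b) \<xi>))"
        by (intro Bochner_Integration.integral_add[symmetric] L2_mult_integrable L2_cnj Fi fourier_L2 u v)
      also have "\<dots> = (LINT \<xi>|lborel. cis (b \<bullet> \<xi>) * G \<xi>)"
        by (rule arg_cong[where f="integral\<^sup>L lborel"]) (auto simp: tr G_def cis_cnj algebra_simps)
      finally have "(LINT \<xi>|lborel. cis (- (\<xi> \<bullet> (- b))) * G \<xi>) = 0" by (simp add: inner_commute)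
      then show ?thesis unfolding fourier_int_def by simp
    qed
    have "fourier_int G \<xi> = 0" for \<xi> using G_zero[of "- \<xi>"] by simp
    from fourier_int_zero_imp_zero[OF G2 G1 this]
    have "AE \<xi> in lborel. G \<xi> = 0" .
    moreover have "AE \<xi> in lborel. fourier_int (\<Psi> 0) \<xi> = \<i> * of_real (\<xi> $ k) * fourier_int (\<Phi> 0) \<xi>"
      using is_L2_pd_test_function[OF t[of 0], of k] fourier_eq_fourier_int[OF \<Phi>[of 0]] fourier_eq_fourier_int[OF \<Psi>[of 0]]
      unfolding is_L2_pd_def \<Phi>_def[symmetric, abs_def] \<Psi>_def[symmetric, abs_def] by eventually_elim simp
    ultimately show ?thesis
    proof eventually_elim
      fix \<xi> assume G0: "G \<xi> = 0" and eq: "fourier_int (\<Psi> 0) \<xi> = \<i> * of_real (\<xi> $ k) * fourier_int (\<Phi> 0) \<xi>"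
      \<comment> \<open>Conjugation turns the factor i xi_k of the differentiated bump into -i xi_k.
        This is why the sum in \<open>G\<close> factors into the defect of the desired identity and
        the conjugated transform of the bump.\<close>
      have "G \<xi> = (fourier v \<xi> - \<i> * of_real (\<xi> $ k) * fourier u \<xi>) * cnj (fourier_int (\<Phi> 0) \<xi>)"
        unfolding G_def eq by (simp add: algebra_simps)
      then show "fourier_int (\<lambda>x. of_real (std_bump \<rho> 0 x)) \<xi> \<noteq> 0 \<longrightarrow> fourier v \<xi> = \<i> * of_real (\<xi> $ k) * fourier u \<xi>"
        using G0 unfolding \<Phi>_def[abs_def] by auto
    qed
  qed
  \<comment> \<open>Countably many widths keep the exceptional set null, and every frequency is
    served by one of them: width 1 / (n + 1) works as soon as n is at least the sum of the absolute
    coordinates.\<close>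
  have "AE \<xi> in lborel. \<forall>n. fourier_int (\<lambda>x. of_real (std_bump (1 / real (Suc n)) 0 x)) \<xi> \<noteq> 0 \<longrightarrow> fourier v \<xi> = \<i> * of_real (\<xi> $ k) * fourier u \<xi>"
    unfolding AE_all_countable by (intro allI *) simp
  then show ?thesis
    unfolding is_L2_pd_def
  proof eventually_elim
    fix \<xi> :: "real ^ 'n"
    assume *: "\<forall>n. fourier_int (\<lambda>x. of_real (std_bump (1 / real (Suc n)) 0 x)) \<xi> \<noteq> 0 \<longrightarrow> fourier v \<xi> = \<i> * of_real (\<xi> $ k) * fourier u \<xi>"
    obtain n where "(\<Sum>i\<in>UNIV. \<bar>\<xi> $ i\<bar>) \<le> real n" using real_arch_simple by blast
    then have "1 / real (Suc n) * (\<Sum>i\<in>UNIV. \<bar>\<xi> $ i\<bar>) \<le> 1" by (simp add: field_simps)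
    then have "fourier_int (\<lambda>x. of_real (std_bump (1 / real (Suc n)) 0 x)) \<xi> \<noteq> 0"
      by (intro fourier_int_std_bump_nonzero) auto
    with * show "fourier v \<xi> = \<i> * of_real (\<xi> $ k) * fourier u \<xi>" by blast
  qed
qed

lemma has_weak_pd_iff_is_L2_pd:
  "u \<in> L2 \<Longrightarrow> v \<in> L2 \<Longrightarrow> has_weak_pd k u v \<longleftrightarrow> is_L2_pd k u v"
  using is_L2_pd_imp_has_weak_pd has_weak_pd_imp_is_L2_pd by blast

section \<open>Mixed norms\<close>

abbreviation rest_measure :: "'n::finite \<Rightarrow> ('n \<Rightarrow> real) measure" where
  "rest_measure j \<equiv> Pi\<^sub>M (- {j}) (\<lambda>_. lborel)"

lemma sigma_finite_rest_measure: "sigma_finite_measure (rest_measure j)"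
proof -
  interpret product_sigma_finite "\<lambda>_::'a. lborel :: real measure" by standard
  interpret finite_product_sigma_finite "\<lambda>_::'a. lborel :: real measure" "- {j}" by standard simp
  show ?thesis by (rule sigma_finite_measure_axioms)
qed

lemma measurable_section [measurable]:
  fixes f :: "real ^ 'n::finite \<Rightarrow> 'b::topological_space"
  assumes [measurable]: "f \<in> borel_measurable borel"
  shows "(\<lambda>y. f (insert_coord j t y)) \<in> borel_measurable (rest_measure j)"
  by measurable

lemma slice_norm_measurable [measurable]:
  fixes f :: "real ^ 'n::finite \<Rightarrow> 'b::{real_normed_vector, second_countable_topology}"
  assumes [measurable]: "f \<in> borel_measurable borel"
  shows "slice_norm j f \<in> borel_measurable borel"
proof -
  interpret sigma_finite_measure "rest_measure j" by (rule sigma_finite_rest_measure)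
  have "(\<lambda>t. \<integral>\<^sup>+y. ennreal ((norm (f (insert_coord j t y)))\<^sup>2) \<partial>rest_measure j) \<in> borel_measurable borel"
    by (rule borel_measurable_nn_integral) measurable
  then show ?thesis unfolding slice_norm_def[abs_def] L2_norm_def by measurable
qed

lemma slice_norm_mono_AE:
  assumes "AE x in lborel. norm (f x) \<le> norm (g x)"
  shows "AE t in lborel. slice_norm j f t \<le> slice_norm j g t"
  using AE_insert_coord[OF assms, of j]
  by eventually_elim (auto simp: slice_norm_def intro: L2_norm_mono_AE)

lemma slice_norm_add_le:
  fixes f g :: "real ^ 'n::finite \<Rightarrow> 'b::{real_normed_vector, second_countable_topology}"
  assumes [measurable]: "f \<in> borel_measurable borel" "g \<in> borel_measurable borel"
  shows "slice_norm j (\<lambda>x. f x + g x) t \<le> slice_norm j f t + slice_norm j g t"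
  unfolding slice_norm_def by (rule L2_norm_add_le) measurable

lemma L1L2_norm_mono_AE:
  assumes "AE x in lborel. norm (f x) \<le> norm (g x)"
  shows "L1L2_norm j f \<le> L1L2_norm j g"
  unfolding L1L2_norm_def by (intro nn_integral_mono_AE slice_norm_mono_AE assms)

lemma L1L2_norm_add_le:
  fixes f g :: "real ^ 'n::finite \<Rightarrow> 'b::{real_normed_vector, second_countable_topology}"
  assumes [measurable]: "f \<in> borel_measurable borel" "g \<in> borel_measurable borel"
  shows "L1L2_norm j (\<lambda>x. f x + g x) \<le> L1L2_norm j f + L1L2_norm j g"
proof -
  have "L1L2_norm j (\<lambda>x. f x + g x) \<le> (\<integral>\<^sup>+t. slice_norm j f t + slice_norm j g t \<partial>lborel)"
    unfolding L1L2_norm_def by (intro nn_integral_mono slice_norm_add_le assms)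
  also have "\<dots> = L1L2_norm j f + L1L2_norm j g"
    unfolding L1L2_norm_def by (rule nn_integral_add) measurable
  finally show ?thesis .
qed

lemma LinfL2_norm_mono_AE:
  fixes f :: "real ^ 'n::finite \<Rightarrow> 'b::{real_normed_vector, second_countable_topology}"
  assumes "AE x in lborel. norm (f x) \<le> norm (g x)" "f \<in> borel_measurable borel"
  shows "LinfL2_norm j f \<le> LinfL2_norm j g"
  unfolding LinfL2_norm_def using assms by (intro esssup_AE_mono slice_norm_mono_AE) auto

lemma LinfL2_norm_cong_AE:
  fixes f :: "real ^ 'n::finite \<Rightarrow> 'b::{real_normed_vector, second_countable_topology}"
    and g :: "real ^ 'n::finite \<Rightarrow> 'c::{real_normed_vector, second_countable_topology}"
  assumes "AE x in lborel. norm (f x) = norm (g x)" "f \<in> borel_measurable borel" "g \<in> borel_measurable borel"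
  shows "LinfL2_norm j f = LinfL2_norm j g"
  using assms by (intro antisym LinfL2_norm_mono_AE) auto

lemma LinfL2_norm_add_le:
  fixes f g :: "real ^ 'n::finite \<Rightarrow> 'b::{real_normed_vector, second_countable_topology}"
  assumes [measurable]: "f \<in> borel_measurable borel" "g \<in> borel_measurable borel"
  shows "LinfL2_norm j (\<lambda>x. f x + g x) \<le> LinfL2_norm j f + LinfL2_norm j g"
  unfolding LinfL2_norm_def
proof (rule esssup_I)
  show "AE t in lborel. slice_norm j (\<lambda>x. f x + g x) t \<le> esssup lborel (slice_norm j f) + esssup lborel (slice_norm j g)"
    using esssup_AE[of "slice_norm j f" lborel] esssup_AE[of "slice_norm j g" lborel]
    by eventually_elim (rule order_trans[OF slice_norm_add_le[OF assms] add_mono])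
qed measurable

lemma LinfL2_norm_zero [simp]: "LinfL2_norm j (\<lambda>x. 0 :: 'b::real_normed_vector) = 0"
proof -
  have "slice_norm j (\<lambda>x. 0 :: 'b) = (\<lambda>t. 0)" by (simp add: slice_norm_def fun_eq_iff)
  then show ?thesis by (simp add: LinfL2_norm_def esssup_const)
qed

lemma LinfL2_norm_sum_le:
  fixes f :: "'i \<Rightarrow> real ^ 'n::finite \<Rightarrow> 'b::{real_normed_vector, second_countable_topology}"
  assumes "\<And>i. i \<in> I \<Longrightarrow> f i \<in> borel_measurable borel"
  shows "LinfL2_norm j (\<lambda>x. \<Sum>i\<in>I. f i x) \<le> (\<Sum>i\<in>I. LinfL2_norm j (f i))"
  using assms
proof (induction I rule: infinite_finite_induct)
  case (insert i I)
  then have "LinfL2_norm j (\<lambda>x. f i x + (\<Sum>i\<in>I. f i x)) \<le> LinfL2_norm j (f i) + LinfL2_norm j (\<lambda>x. \<Sum>i\<in>I. f i x)"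
    by (intro LinfL2_norm_add_le) auto
  with insert show ?case by (auto intro: order_trans add_left_mono)
qed auto

lemma LinfL2_norm_scale_le:
  fixes f :: "real ^ 'n::finite \<Rightarrow> 'b::{real_normed_vector, second_countable_topology}"
    and g :: "real ^ 'n::finite \<Rightarrow> 'c::{real_normed_vector, second_countable_topology}"
  assumes "AE x in lborel. norm (f x) \<le> c * norm (g x)" "c \<ge> 0"
    and [measurable]: "f \<in> borel_measurable borel" "g \<in> borel_measurable borel"
  shows "LinfL2_norm j f \<le> ennreal c * LinfL2_norm j g"
  unfolding LinfL2_norm_def
proof (rule esssup_I)
  have "AE x in lborel. norm (f x) \<le> norm (c *\<^sub>R g x)" using assms(1,2) by auto
  from slice_norm_mono_AE[OF this, of j] esssup_AE[of "slice_norm j g" lborel]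
  show "AE t in lborel. slice_norm j f t \<le> ennreal c * esssup lborel (slice_norm j g)"
  proof eventually_elim
    fix t assume "slice_norm j f t \<le> slice_norm j (\<lambda>x. c *\<^sub>R g x) t" "slice_norm j g t \<le> esssup lborel (slice_norm j g)"
    moreover have "slice_norm j (\<lambda>x. c *\<^sub>R g x) t = ennreal c * slice_norm j g t"
      unfolding slice_norm_def by (rule L2_norm_scale) (use assms in auto)
    ultimately show "slice_norm j f t \<le> ennreal c * esssup lborel (slice_norm j g)"
      by (metis mult_left_mono order_trans zero_le)
  qed
qed measurable

section \<open>Mixed norms of vector-valued functions\<close>

lemma borel_measurable_complex_vec_nth [measurable (raw)]:
  fixes u :: "'x \<Rightarrow> complex ^ 's::finite"
  shows "u \<in> borel_measurable M \<Longrightarrow> (\<lambda>x. u x $ a) \<in> borel_measurable M"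
  by (rule borel_measurable_continuous_on[where f="\<lambda>v. v $ a"]) (auto intro!: continuous_intros)

lemma slice_norm_component:
  fixes u :: "real ^ 'n::finite \<Rightarrow> complex ^ 's::finite"
  assumes [measurable]: "u \<in> borel_measurable borel"
  shows "(slice_norm j u t)\<^sup>2 = (\<Sum>a\<in>UNIV. (slice_norm j (\<lambda>x. u x $ a) t)\<^sup>2)"
proof -
  have "(slice_norm j u t)\<^sup>2 = (\<integral>\<^sup>+y. (\<Sum>a\<in>UNIV. ennreal ((norm (u (insert_coord j t y) $ a))\<^sup>2)) \<partial>rest_measure j)"
    unfolding slice_norm_def L2_norm_square
    by (intro nn_integral_cong) (simp add: norm_vec_def L2_set_def sum_nonneg sum_ennreal)
  also have "\<dots> = (\<Sum>a\<in>UNIV. (slice_norm j (\<lambda>x. u x $ a) t)\<^sup>2)"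
    unfolding slice_norm_def L2_norm_square by (rule nn_integral_sum) measurable
  finally show ?thesis .
qed

lemma sum_Cauchy_Schwarz_ennreal:
  fixes a b :: "'i::finite \<Rightarrow> ennreal"
  shows "(\<Sum>i\<in>UNIV. a i * b i) \<le> ennreal_sqrt (\<Sum>i\<in>UNIV. (a i)\<^sup>2) * ennreal_sqrt (\<Sum>i\<in>UNIV. (b i)\<^sup>2)"
  using nn_integral_Cauchy_Schwarz_sqrt[of a "count_space UNIV" b]
  by (simp add: nn_integral_count_space_finite)

text \<open>Self-duality of the Euclidean norm: the square of the left side N is the integral of the
  sum of \<open>I i * s i x\<close>, which Cauchy-Schwarz bounds by N times the right side.
  Cancelling N requires it to be finite, so an infinite \<open>I i\<close> is treated first.\<close>

lemma nn_integral_Minkowski_sum: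
  fixes s :: "'i::finite \<Rightarrow> 'x \<Rightarrow> ennreal"
  assumes [measurable]: "\<And>i. s i \<in> borel_measurable M"
  shows "ennreal_sqrt (\<Sum>i\<in>UNIV. (\<integral>\<^sup>+x. s i x \<partial>M)\<^sup>2) \<le> (\<integral>\<^sup>+x. ennreal_sqrt (\<Sum>i\<in>UNIV. (s i x)\<^sup>2) \<partial>M)"
proof -
  define I where "I i = (\<integral>\<^sup>+x. s i x \<partial>M)" for i
  define N where "N = ennreal_sqrt (\<Sum>i\<in>UNIV. (I i)\<^sup>2)"
  let ?J = "\<integral>\<^sup>+x. ennreal_sqrt (\<Sum>i\<in>UNIV. (s i x)\<^sup>2) \<partial>M"
  have le: "I i \<le> ?J" for i
    unfolding I_def
  proof (rule nn_integral_mono)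
    fix x
    have "(s i x)\<^sup>2 \<le> (\<Sum>i\<in>UNIV. (s i x)\<^sup>2)" by (rule member_le_sum) auto
    then have "ennreal_sqrt ((s i x)\<^sup>2) \<le> ennreal_sqrt (\<Sum>i\<in>UNIV. (s i x)\<^sup>2)" by (rule ennreal_sqrt_mono)
    then show "s i x \<le> ennreal_sqrt (\<Sum>i\<in>UNIV. (s i x)\<^sup>2)" by simp
  qed
  have "N \<le> ?J"
  proof (cases "\<exists>i. I i = \<infinity>")
    case True
    then have "?J = \<infinity>" using le by (metis infinity_ennreal_def neq_top_trans)
    then show ?thesis by simp
  next
    case False
    then have "(\<Sum>i\<in>UNIV. (I i)\<^sup>2) < \<infinity>" by (auto simp: less_top[symmetric] power2_eq_square ennreal_mult_eq_top_iff)
    then have fin: "N < \<infinity>" unfolding N_def by (simp only: ennreal_sqrt_less_top_iff)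
    have "N * N = (\<Sum>i\<in>UNIV. (I i)\<^sup>2)" by (simp add: N_def flip: power2_eq_square)
    also have "\<dots> = (\<Sum>i\<in>UNIV. \<integral>\<^sup>+x. I i * s i x \<partial>M)"
      by (simp add: power2_eq_square nn_integral_cmult I_def)
    also have "\<dots> = (\<integral>\<^sup>+x. (\<Sum>i\<in>UNIV. I i * s i x) \<partial>M)"
      by (rule nn_integral_sum[symmetric]) measurable
    also have "\<dots> \<le> (\<integral>\<^sup>+x. N * ennreal_sqrt (\<Sum>i\<in>UNIV. (s i x)\<^sup>2) \<partial>M)"
      unfolding N_def by (intro nn_integral_mono sum_Cauchy_Schwarz_ennreal)
    also have "\<dots> = N * ?J" by (rule nn_integral_cmult) measurable
    finally have "N * N \<le> N * ?J" .
    then show ?thesis using fin by (cases "N = 0") (auto simp: ennreal_mult_le_mult_iff less_top)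
  qed
  then show ?thesis by (simp add: N_def I_def)
qed

lemma L1L2_norm_component:
  fixes f :: "real ^ 'n::finite \<Rightarrow> complex ^ 's::finite"
  assumes [measurable]: "f \<in> borel_measurable borel"
  shows "ennreal_sqrt (\<Sum>a\<in>UNIV. (L1L2_norm j (\<lambda>x. f x $ a))\<^sup>2) \<le> L1L2_norm j f"
proof -
  have "ennreal_sqrt (\<Sum>a\<in>UNIV. (L1L2_norm j (\<lambda>x. f x $ a))\<^sup>2)
    \<le> (\<integral>\<^sup>+t. ennreal_sqrt (\<Sum>a\<in>UNIV. (slice_norm j (\<lambda>x. f x $ a) t)\<^sup>2) \<partial>lborel)"
    unfolding L1L2_norm_def by (rule nn_integral_Minkowski_sum) measurable
  also have "\<dots> = L1L2_norm j f"
    unfolding L1L2_norm_def by (simp add: flip: slice_norm_component)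
  finally show ?thesis .
qed

lemma LinfL2_norm_component:
  fixes u :: "real ^ 'n::finite \<Rightarrow> complex ^ 's::finite"
  assumes [measurable]: "u \<in> borel_measurable borel"
  shows "LinfL2_norm j u \<le> ennreal_sqrt (\<Sum>a\<in>UNIV. (LinfL2_norm j (\<lambda>x. u x $ a))\<^sup>2)"
  unfolding LinfL2_norm_def
proof (rule esssup_I)
  have "AE t in lborel. \<forall>a\<in>UNIV. slice_norm j (\<lambda>x. u x $ a) t \<le> esssup lborel (slice_norm j (\<lambda>x. u x $ a))"
    by (rule AE_finite_allI) (auto intro: esssup_AE)
  then show "AE t in lborel. slice_norm j u t \<le> ennreal_sqrt (\<Sum>a\<in>UNIV. (esssup lborel (slice_norm j (\<lambda>x. u x $ a)))\<^sup>2)"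
  proof eventually_elim
    fix t assume "\<forall>a\<in>UNIV. slice_norm j (\<lambda>x. u x $ a) t \<le> esssup lborel (slice_norm j (\<lambda>x. u x $ a))"
    then have "(slice_norm j u t)\<^sup>2 \<le> (\<Sum>a\<in>UNIV. (esssup lborel (slice_norm j (\<lambda>x. u x $ a)))\<^sup>2)"
      unfolding slice_norm_component[OF assms] by (intro sum_mono power_mono) auto
    then have "ennreal_sqrt ((slice_norm j u t)\<^sup>2) \<le> ennreal_sqrt (\<Sum>a\<in>UNIV. (esssup lborel (slice_norm j (\<lambda>x. u x $ a)))\<^sup>2)"
      by (rule ennreal_sqrt_mono)
    then show "slice_norm j u t \<le> ennreal_sqrt (\<Sum>a\<in>UNIV. (esssup lborel (slice_norm j (\<lambda>x. u x $ a)))\<^sup>2)" by simp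
  qed
qed measurable

lemma LinfL2_norm_le_componentwise:
  fixes u f :: "real ^ 'n::finite \<Rightarrow> complex ^ 's::finite"
  assumes "u \<in> borel_measurable borel" "f \<in> borel_measurable borel"
    and le: "\<And>a. LinfL2_norm j (\<lambda>x. u x $ a) \<le> K * L1L2_norm j (\<lambda>x. f x $ a)"
  shows "LinfL2_norm j u \<le> K * L1L2_norm j f"
proof -
  have "LinfL2_norm j u \<le> ennreal_sqrt (\<Sum>a\<in>UNIV. (LinfL2_norm j (\<lambda>x. u x $ a))\<^sup>2)"
    by (rule LinfL2_norm_component) fact
  also have "\<dots> \<le> ennreal_sqrt (\<Sum>a\<in>UNIV. (K * L1L2_norm j (\<lambda>x. f x $ a))\<^sup>2)"
    by (intro ennreal_sqrt_mono sum_mono power_mono le) auto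
  also have "\<dots> = K * ennreal_sqrt (\<Sum>a\<in>UNIV. (L1L2_norm j (\<lambda>x. f x $ a))\<^sup>2)"
    by (simp add: power_mult_distrib ennreal_sqrt_mult flip: sum_distrib_left)
  also have "\<dots> \<le> K * L1L2_norm j f"
    by (intro mult_left_mono L1L2_norm_component assms) auto
  finally show ?thesis .
qed

lemma L1L2_norm_component_le: "L1L2_norm j (\<lambda>x. f x $ a) \<le> L1L2_norm j f"
  by (rule L1L2_norm_mono_AE) (simp add: Finite_Cartesian_Product.norm_nth_le)

text \<open>Dominated convergence twice: inside almost every slice, where the slice norm of
  \<open>f\<close> is finite, and then in \<open>t\<close> with that slice norm as the
  majorant.\<close>

lemma trunc_L1L2_tendsto:
  fixes f :: "real ^ 'n::finite \<Rightarrow> 'b::{banach, second_countable_topology}"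
  assumes f: "f \<in> L1L2 j"
  shows "(\<lambda>l. L1L2_norm j (\<lambda>x. trunc l f x - f x)) \<longlonglongrightarrow> 0"
proof -
  have [measurable]: "f \<in> borel_measurable borel" and fin: "L1L2_norm j f < \<infinity>" using f by (auto simp: L1L2_def)
  have "AE t in lborel. slice_norm j f t \<noteq> \<infinity>"
    using fin unfolding L1L2_norm_def by (intro nn_integral_PInf_AE) auto
  then have lim: "AE t in lborel. (\<lambda>l. slice_norm j (\<lambda>x. trunc l f x - f x) t) \<longlonglongrightarrow> 0"
  proof eventually_elim
    fix t assume t: "slice_norm j f t \<noteq> \<infinity>"
    have "(\<lambda>l. \<integral>\<^sup>+y. ennreal ((norm (trunc l f (insert_coord j t y) - f (insert_coord j t y)))\<^sup>2) \<partial>rest_measure j)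
       \<longlonglongrightarrow> (\<integral>\<^sup>+y. 0 \<partial>rest_measure j)"
    proof (rule nn_integral_dominated_convergence[where w="\<lambda>y. ennreal ((norm (f (insert_coord j t y)))\<^sup>2)"])
      show "AE y in rest_measure j. ennreal ((norm (trunc l f (insert_coord j t y) - f (insert_coord j t y)))\<^sup>2)
        \<le> ennreal ((norm (f (insert_coord j t y)))\<^sup>2)" for l
        by (intro AE_I2 ennreal_leI power_mono norm_trunc_diff_le norm_ge_zero)
      show "(\<integral>\<^sup>+y. ennreal ((norm (f (insert_coord j t y)))\<^sup>2) \<partial>rest_measure j) < \<infinity>"
        using t unfolding slice_norm_def L2_norm_less_top_iff[symmetric] by (auto simp: less_top)
      show "AE y in rest_measure j. (\<lambda>l. ennreal ((norm (trunc l f (insert_coord j t y) - f (insert_coord j t y)))\<^sup>2)) \<longlonglongrightarrow> 0"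
      proof (rule AE_I2)
        fix y
        have "(\<lambda>l. (norm (trunc l f (insert_coord j t y) - f (insert_coord j t y)))\<^sup>2) \<longlonglongrightarrow> 0\<^sup>2"
          by (intro tendsto_power tendsto_norm_zero LIM_zero trunc_tendsto)
        then show "(\<lambda>l. ennreal ((norm (trunc l f (insert_coord j t y) - f (insert_coord j t y)))\<^sup>2)) \<longlonglongrightarrow> 0"
          using tendsto_ennrealI by fastforce
      qed
    qed measurable
    then show "(\<lambda>l. slice_norm j (\<lambda>x. trunc l f x - f x) t) \<longlonglongrightarrow> 0"
      unfolding slice_norm_def L2_norm_def by (intro ennreal_sqrt_tendsto_0) simp
  qed
  have "(\<lambda>l. \<integral>\<^sup>+t. slice_norm j (\<lambda>x. trunc l f x - f x) t \<partial>lborel) \<longlonglongrightarrow> (\<integral>\<^sup>+(t::real). 0 \<partial>lborel)"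
  proof (rule nn_integral_dominated_convergence[where w="slice_norm j f"])
    show "AE t in lborel. slice_norm j (\<lambda>x. trunc l f x - f x) t \<le> slice_norm j f t" for l
      by (intro slice_norm_mono_AE AE_I2 norm_trunc_diff_le)
    show "(\<integral>\<^sup>+t. slice_norm j f t \<partial>lborel) < \<infinity>" using fin by (simp add: L1L2_norm_def)
  qed (use lim in auto)
  then show ?thesis by (simp add: L1L2_norm_def)
qed

section \<open>The norm of the intersection space\<close>

lemma X_norm_ge: "L1L2_norm j f \<le> X_norm f"
  unfolding X_norm_def by (rule Max_ge) auto

lemma X_norm_le_sum: "X_norm f \<le> (\<Sum>j\<in>UNIV. L1L2_norm j f)"
  unfolding X_norm_def by (rule Max.boundedI) (auto intro!: member_le_sum)

lemma trunc_X_tendsto: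
  fixes f :: "real ^ 'n::finite \<Rightarrow> 'b::{banach, second_countable_topology}"
  assumes f: "f \<in> X_space"
  shows "(\<lambda>l. X_norm (\<lambda>x. trunc l f x - f x)) \<longlonglongrightarrow> 0"
proof (rule ennreal_tendsto_0_le[OF _ X_norm_le_sum])
  have "(\<lambda>l. \<Sum>j\<in>UNIV. L1L2_norm j (\<lambda>x. trunc l f x - f x)) \<longlonglongrightarrow> (\<Sum>j\<in>(UNIV::'n set). 0)"
    using f by (intro tendsto_sum trunc_L1L2_tendsto) (auto simp: X_space_def)
  then show "(\<lambda>l. \<Sum>j\<in>UNIV. L1L2_norm j (\<lambda>x. trunc l f x - f x)) \<longlonglongrightarrow> 0" by simp
qed

lemma X_norm_less_top: "f \<in> X_space \<Longrightarrow> X_norm f < \<infinity>"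
  using X_norm_le_sum[of f] by (auto simp: X_space_def L1L2_def less_top intro: le_less_trans)

section \<open>The weighted bound for the transform\<close>

lemma insert_coord_translate: "insert_coord j t y + s *\<^sub>R axis j 1 = insert_coord j (t + s) y"
  by (auto simp: insert_coord_def vec_eq_iff axis_def)

lemma norm_autocorr_slice_le:
  fixes g :: "real ^ 'n::finite \<Rightarrow> complex"
  assumes g: "g \<in> L2"
  shows "ennreal (norm (autocorr g (s *\<^sub>R axis j 1))) \<le> (\<integral>\<^sup>+t. slice_norm j g (t + s) * slice_norm j g t \<partial>lborel)"
proof -
  have [measurable]: "g \<in> borel_measurable borel" using g by auto
  have "ennreal (norm (autocorr g (s *\<^sub>R axis j 1))) \<le> (\<integral>\<^sup>+x. ennreal (norm (g (x + s *\<^sub>R axis j 1) * cnj (g x))) \<partial>lborel)"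
    unfolding autocorr_def by (intro integral_norm_bound_ennreal L2_mult_integrable L2_translate L2_cnj g)
  also have "\<dots> = (\<integral>\<^sup>+t. \<integral>\<^sup>+y. ennreal (norm (g (insert_coord j (t + s) y))) * ennreal (norm (g (insert_coord j t y))) \<partial>rest_measure j \<partial>lborel)"
    by (subst nn_integral_insert_coord[where j=j]) (auto simp: insert_coord_translate norm_mult ennreal_mult)
  also have "\<dots> \<le> (\<integral>\<^sup>+t. slice_norm j g (t + s) * slice_norm j g t \<partial>lborel)"
  proof (rule nn_integral_mono)
    fix t
    show "(\<integral>\<^sup>+y. ennreal (norm (g (insert_coord j (t + s) y))) * ennreal (norm (g (insert_coord j t y))) \<partial>rest_measure j)
      \<le> slice_norm j g (t + s) * slice_norm j g t"
      unfolding slice_norm_def L2_norm_def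
      using nn_integral_Cauchy_Schwarz_sqrt[of "\<lambda>y. ennreal (norm (g (insert_coord j (t + s) y)))" "rest_measure j" "\<lambda>y. ennreal (norm (g (insert_coord j t y)))"]
      by (simp add: ennreal_power)
  qed
  finally show ?thesis .
qed

text \<open>The integrand is exp (-c s) on the half-line with c = 1 - i a. The exponential density
  dominates it, and -exp (-c s) / c is an antiderivative that vanishes at infinity because c has
  real part 1.\<close>

lemma exp_cis_integral:
  fixes a :: real
  shows "integrable lborel (\<lambda>s. indicator {0<..} s *\<^sub>R (of_real (exp (- s)) * cis (s * a)))"
    and "(LINT s|lborel. indicator {0<..} s *\<^sub>R (of_real (exp (- s)) * cis (s * a))) = 1 / (1 - \<i> * of_real a)"
proof -
  define c where "c = 1 - \<i> * of_real a"
  have c0: "c \<noteq> 0" by (auto simp: c_def complex_eq_iff)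
  have eq: "of_real (exp (- s)) * cis (s * a) = exp (- c * of_real s)" for s
    by (simp add: c_def cis_conv_exp exp_of_real[symmetric] exp_add[symmetric] algebra_simps)
  have int: "integrable lborel (\<lambda>s. indicator {0<..} s *\<^sub>R exp (- c * of_real s))"
  proof (rule Bochner_Integration.integrable_bound)
    interpret prob_space "density lborel (exponential_density 1)" by (rule prob_space_exponential_density) simp
    have "(\<integral>\<^sup>+x. ennreal (exponential_density 1 x) \<partial>lborel) = 1"
      using emeasure_space_1 by (simp add: emeasure_density)
    then show "integrable lborel (exponential_density 1)"
      by (intro integrableI_nonneg) (auto intro!: AE_I2 exponential_density_nonneg)
    show "(\<lambda>s. indicator {0<..} s *\<^sub>R exp (- c * of_real s)) \<in> borel_measurable lborel"
      by (intro borel_measurable_scaleR borel_measurable_indicator) auto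
    show "AE s in lborel. norm (indicator {0<..} s *\<^sub>R exp (- c * of_real s)) \<le> norm (exponential_density 1 s)"
      unfolding eq[symmetric] by (intro AE_I2) (auto simp: exponential_density_def indicator_def norm_mult)
  qed
  then show "integrable lborel (\<lambda>s. indicator {0<..} s *\<^sub>R (of_real (exp (- s)) * cis (s * a)))"
    unfolding eq .
  let ?F = "\<lambda>s. - (exp (- c * of_real s) / c)"
  have "(LBINT s=0..\<infinity>. exp (- c * complex_of_real s)) = 0 - (- (1 / c))"
  proof (rule interval_integral_FTC_integrable[where F="?F"])
    show "(?F has_vector_derivative exp (- c * complex_of_real s)) (at s)" for s
    proof -
      have "((\<lambda>z. - (exp (- c * z) / c)) has_field_derivative exp (- c * of_real s)) (at (complex_of_real s))"
        using c0 by (auto intro!: derivative_eq_intros)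
      from has_vector_derivative_real_field[OF this] show ?thesis by (simp add: o_def)
    qed
    show "isCont (\<lambda>s. exp (- c * complex_of_real s)) s" for s by (intro continuous_intros)
    show "set_integrable lborel (einterval 0 \<infinity>) (\<lambda>s. exp (- c * complex_of_real s))"
      using int by (simp add: set_integrable_def zero_ereal_def)
    have "((\<lambda>s. ?F s) \<longlongrightarrow> ?F 0) (at_right 0)"
      by (intro tendsto_intros c0)
    then show "((?F \<circ> real_of_ereal) \<longlongrightarrow> - (1 / c)) (at_right 0)"
      unfolding zero_ereal_def ereal_tendsto_simps by simp
    have "((\<lambda>s. ?F s) \<longlongrightarrow> 0) at_top"
    proof (rule tendsto_0_le)
      show "((\<lambda>s::real. exp (- s)) \<longlongrightarrow> 0) at_top" by (rule filterlim_compose[OF exp_at_bot filterlim_uminus_at_bot_at_top])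
      show "\<forall>\<^sub>F s in at_top. norm (?F s) \<le> norm (exp (- s)) * (1 / norm c)"
        unfolding eq[symmetric] by (simp add: norm_mult norm_divide)
    qed
    then show "((?F \<circ> real_of_ereal) \<longlongrightarrow> 0) (at_left \<infinity>)"
      unfolding ereal_tendsto_simps by simp
  qed auto
  then have "(LINT s|lborel. indicator {0<..} s *\<^sub>R exp (- c * of_real s)) = 1 / c"
    unfolding interval_lebesgue_integral_0_infty set_lebesgue_integral_def by simp
  then show "(LINT s|lborel. indicator {0<..} s *\<^sub>R (of_real (exp (- s)) * cis (s * a))) = 1 / (1 - \<i> * of_real a)"
    unfolding eq by (simp add: c_def)
qed

text \<open>Parseval applied to \<open>g\<close> and a translate of it. It holds for every
  square-integrable \<open>g\<close>, whereas \<open>fourier_int_autocorr\<close> needs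
  integrability.\<close>

lemma autocorr_fourier:
  fixes g :: "real ^ 'n::finite \<Rightarrow> complex"
  assumes g: "g \<in> L2"
  shows "autocorr g h = (LINT \<xi>|lborel. of_real ((norm (fourier g \<xi>))\<^sup>2) * cis (h \<bullet> \<xi>))"
proof -
  have [measurable]: "fourier g \<in> borel_measurable borel" "fourier (\<lambda>x. g (x + h)) \<in> borel_measurable borel"
    using fourier_L2[OF g] fourier_L2[OF L2_translate[OF g, of h]] by auto
  have "autocorr g h = (LINT \<xi>|lborel. fourier (\<lambda>x. g (x + h)) \<xi> * cnj (fourier g \<xi>))"
    unfolding autocorr_def by (rule fourier_Parseval[symmetric, OF L2_translate[OF g] g])
  also have "\<dots> = (LINT \<xi>|lborel. of_real ((norm (fourier g \<xi>))\<^sup>2) * cis (h \<bullet> \<xi>))"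
  proof (rule integral_cong_AE)
    show "(\<lambda>\<xi>. of_real ((norm (fourier g \<xi>))\<^sup>2) * cis (h \<bullet> \<xi>)) \<in> borel_measurable lborel"
      unfolding cis_conv_exp by measurable
    show "AE \<xi> in lborel. fourier (\<lambda>x. g (x + h)) \<xi> * cnj (fourier g \<xi>) = of_real ((norm (fourier g \<xi>))\<^sup>2) * cis (h \<bullet> \<xi>)"
      using fourier_translate[OF g, of h] by eventually_elim (simp add: complex_norm_square del: of_real_power)
  qed measurable
  finally show ?thesis .
qed

text \<open>With \<open>1 / (1 + \<xi>\<^sub>j\<^sup>2) = Re (\<integral>\<^sub>0\<^sup>\<infinity> exp (- s + i s \<xi>\<^sub>j) ds)\<close> the left side becomes an average of
  autocorrelations of \<open>g\<close> in the direction \<open>j\<close>, each of which Cauchy-Schwarz on slices bounds.\<close>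

lemma fourier_weighted_bound:
  fixes g :: "real ^ 'n::finite \<Rightarrow> complex"
  assumes g: "g \<in> L2"
  shows "(\<integral>\<^sup>+\<xi>. ennreal ((norm (fourier g \<xi>))\<^sup>2 / (1 + (\<xi> $ j)\<^sup>2)) \<partial>lborel) \<le> (L1L2_norm j g)\<^sup>2"
proof -
  have [measurable]: "fourier g \<in> borel_measurable borel" "g \<in> borel_measurable borel" using fourier_L2[OF g] g by auto
  define W where "W \<xi> = (norm (fourier g \<xi>))\<^sup>2" for \<xi>
  have [measurable]: "W \<in> borel_measurable borel" unfolding W_def[abs_def] by measurable
  have W0: "W \<xi> \<ge> 0" for \<xi> by (simp add: W_def)
  have W: "(\<integral>\<^sup>+\<xi>. ennreal (W \<xi>) \<partial>lborel) < \<infinity>"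
    using L2_norm_less_top[OF fourier_L2[OF g]] unfolding L2_norm_less_top_iff W_def .
  let ?k = "\<lambda>s \<xi>. indicator {0<..} s *\<^sub>R (of_real (exp (- s)) * cis (s * \<xi> $ j))"
  let ?f = "\<lambda>(\<xi>::real^'n) s. complex_of_real (W \<xi>) * ?k s \<xi>"
  have nnexp: "(\<integral>\<^sup>+s. ennreal (norm (?k s \<xi>)) \<partial>lborel) < \<infinity>" for \<xi>
    using exp_cis_integral(1)[of "\<xi> $ j"] by (simp add: integrable_iff_bounded)
  have int: "integrable (lborel \<Otimes>\<^sub>M lborel) (case_prod ?f)"
  proof (rule lborel_pair_integrableI)
    have [measurable]: "(indicator {0<..} :: real \<Rightarrow> real) \<in> borel_measurable borel" by simp
    show "case_prod ?f \<in> borel_measurable (borel \<Otimes>\<^sub>M borel)"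
    proof -
      have "(\<lambda>p. snd p * fst p $ j) \<in> borel_measurable (borel \<Otimes>\<^sub>M borel :: ((real ^ 'n) \<times> real) measure)"
        by (intro borel_measurable_times measurable_snd measurable_compose[OF measurable_fst borel_measurable_nth])
      then have "(\<lambda>p. cis (snd p * fst p $ j)) \<in> borel_measurable (borel \<Otimes>\<^sub>M borel :: ((real ^ 'n) \<times> real) measure)"
        by (intro borel_measurable_continuous_on[where f=cis]) (auto intro!: continuous_intros)
      moreover have "(\<lambda>p. complex_of_real (W (fst p))) \<in> borel_measurable (borel \<Otimes>\<^sub>M borel :: ((real ^ 'n) \<times> real) measure)"
        by (intro borel_measurable_of_real measurable_compose[OF measurable_fst]) measurable
      moreover have "(\<lambda>p. complex_of_real (exp (- snd p))) \<in> borel_measurable (borel \<Otimes>\<^sub>M borel :: ((real ^ 'n) \<times> real) measure)"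
        by (intro borel_measurable_of_real measurable_compose[OF measurable_snd]) measurable
      moreover have "(\<lambda>p. indicator {0<..} (snd p) :: real) \<in> borel_measurable (borel \<Otimes>\<^sub>M borel :: ((real ^ 'n) \<times> real) measure)"
        by (intro measurable_compose[OF measurable_snd]) simp
      ultimately show ?thesis
        unfolding case_prod_unfold by (intro borel_measurable_times borel_measurable_scaleR)
    qed
    have "(\<integral>\<^sup>+s. \<integral>\<^sup>+\<xi>. ennreal (norm (?f \<xi> s)) \<partial>lborel \<partial>lborel)
      = (\<integral>\<^sup>+s. (\<integral>\<^sup>+\<xi>. ennreal (W \<xi>) \<partial>lborel) * ennreal (norm (?k s 0)) \<partial>lborel)"
      by (intro nn_integral_cong, subst nn_integral_multc[symmetric]) (auto simp: norm_mult ennreal_mult W0 abs_of_nonneg mult_ac)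
    also have "\<dots> = (\<integral>\<^sup>+\<xi>. ennreal (W \<xi>) \<partial>lborel) * (\<integral>\<^sup>+s. ennreal (norm (?k s 0)) \<partial>lborel)"
      by (rule nn_integral_cmult) (auto simp: norm_mult)
    also have "\<dots> < \<infinity>" using W nnexp[of 0] by (simp add: ennreal_mult_less_top)
    finally show "(\<integral>\<^sup>+s. \<integral>\<^sup>+\<xi>. ennreal (norm (?f \<xi> s)) \<partial>lborel \<partial>lborel) < \<infinity>" .
  qed
  have inner1: "(LINT s|lborel. ?f \<xi> s) = of_real (W \<xi>) * (1 / (1 - \<i> * of_real (\<xi> $ j)))" for \<xi>
    by (subst integral_mult_right_zero) (simp only: exp_cis_integral(2))
  have inner2: "(LINT \<xi>|lborel. ?f \<xi> s) = indicator {0<..} s *\<^sub>R (of_real (exp (- s)) * autocorr g (s *\<^sub>R axis j 1))" for s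
  proof -
    have i: "(s *\<^sub>R axis j 1) \<bullet> \<xi> = s * \<xi> $ j" for \<xi> :: "real ^ 'n" by (simp add: inner_axis')
    show ?thesis unfolding autocorr_fourier[OF g] W_def i
      by (simp add: scaleR_conv_of_real mult_ac flip: integral_mult_right_zero)
  qed
  have re: "Re (of_real (W \<xi>) * (1 / (1 - \<i> * of_real (\<xi> $ j)))) = W \<xi> / (1 + (\<xi> $ j)\<^sup>2)" for \<xi>
    by (simp add: Re_divide power2_eq_square)
  have int1: "integrable lborel (\<lambda>\<xi>. of_real (W \<xi>) * (1 / (1 - \<i> * complex_of_real (\<xi> $ j))))"
    using lborel_pair.integrable_fst[OF int] unfolding inner1 .
  have intR: "integrable lborel (\<lambda>\<xi>. W \<xi> / (1 + (\<xi> $ j)\<^sup>2))"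
    using integrable_Re[OF int1] unfolding re .
  have "(\<integral>\<^sup>+\<xi>. ennreal (W \<xi> / (1 + (\<xi> $ j)\<^sup>2)) \<partial>lborel) = ennreal (LINT \<xi>|lborel. W \<xi> / (1 + (\<xi> $ j)\<^sup>2))"
    by (rule nn_integral_eq_integral[OF intR]) (auto simp: W0)
  also have "(LINT \<xi>|lborel. W \<xi> / (1 + (\<xi> $ j)\<^sup>2)) = Re (LINT \<xi>|lborel. LINT s|lborel. ?f \<xi> s)"
    unfolding inner1 re[symmetric] by (rule integral_Re[OF int1])
  also have "(LINT \<xi>|lborel. LINT s|lborel. ?f \<xi> s) = (LINT s|lborel. LINT \<xi>|lborel. ?f \<xi> s)"
    by (rule lborel_pair.Fubini_integral[OF int, symmetric])
  also have "ennreal (Re (LINT s|lborel. LINT \<xi>|lborel. ?f \<xi> s)) \<le> ennreal (norm (LINT s|lborel. LINT \<xi>|lborel. ?f \<xi> s))"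
    by (intro ennreal_leI complex_Re_le_cmod)
  also have "\<dots> \<le> (\<integral>\<^sup>+s. ennreal (norm (LINT \<xi>|lborel. ?f \<xi> s)) \<partial>lborel)"
    by (rule integral_norm_bound_ennreal[OF lborel_pair.integrable_snd[OF int]])
  \<comment> \<open>The weight exp (-s) on the half-line is at most 1 and is dropped. Integrating
    over all shifts \<open>s\<close> then separates the two slice norms by translation invariance
    and yields the square of the mixed norm.\<close>
  also have "\<dots> \<le> (\<integral>\<^sup>+s. ennreal (norm (autocorr g (s *\<^sub>R axis j 1))) \<partial>lborel)"
    unfolding inner2
    by (intro nn_integral_mono ennreal_leI) (auto simp: norm_mult indicator_def intro!: mult_left_le_one_le)
  also have "\<dots> \<le> (\<integral>\<^sup>+s. \<integral>\<^sup>+t. slice_norm j g (t + s) * slice_norm j g t \<partial>lborel \<partial>lborel)"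
    by (intro nn_integral_mono norm_autocorr_slice_le g)
  also have "\<dots> = (\<integral>\<^sup>+t. \<integral>\<^sup>+s. slice_norm j g (s + t) * slice_norm j g t \<partial>lborel \<partial>lborel)"
    by (subst lborel_pair.Fubini') (auto simp: add.commute)
  also have "\<dots> = (\<integral>\<^sup>+t. L1L2_norm j g * slice_norm j g t \<partial>lborel)"
    by (simp add: nn_integral_multc nn_integral_translate[of "slice_norm j g"] L1L2_norm_def)
  also have "\<dots> = (L1L2_norm j g)\<^sup>2"
    by (simp add: nn_integral_cmult power2_eq_square L1L2_norm_def)
  finally show ?thesis by (simp add: W_def)
qed

text \<open>The form in which the weighted bound is applied: a symbol of size at most K / sqrt (1 +
  xi_j^2) sends data controlled by \<open>L1L2_norm j\<close> to L2.\<close>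

lemma L2_norm_weighted_fourier_le:
  fixes g :: "real ^ 'n::finite \<Rightarrow> complex" and h :: "real ^ 'n \<Rightarrow> 'b::real_normed_vector"
  assumes g: "g \<in> L2" and le: "AE \<xi> in lborel. norm (h \<xi>) * sqrt (1 + (\<xi> $ j)\<^sup>2) \<le> K * norm (fourier g \<xi>)" and K: "K \<ge> 0"
  shows "L2_norm lborel h \<le> ennreal K * L1L2_norm j g"
proof -
  have [measurable]: "fourier g \<in> borel_measurable borel" using fourier_L2[OF g] by auto
  have "(\<integral>\<^sup>+\<xi>. ennreal ((norm (h \<xi>))\<^sup>2) \<partial>lborel) \<le> (\<integral>\<^sup>+\<xi>. ennreal (K\<^sup>2) * ennreal ((norm (fourier g \<xi>))\<^sup>2 / (1 + (\<xi> $ j)\<^sup>2)) \<partial>lborel)"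
    using le
  proof (intro nn_integral_mono_AE, eventually_elim)
    fix \<xi> assume "norm (h \<xi>) * sqrt (1 + (\<xi> $ j)\<^sup>2) \<le> K * norm (fourier g \<xi>)"
    then have "(norm (h \<xi>) * sqrt (1 + (\<xi> $ j)\<^sup>2))\<^sup>2 \<le> (K * norm (fourier g \<xi>))\<^sup>2" by (intro power_mono) auto
    moreover have "1 + (\<xi> $ j)\<^sup>2 > 0" by (simp add: add_pos_nonneg)
    ultimately have "(norm (h \<xi>))\<^sup>2 \<le> K\<^sup>2 * ((norm (fourier g \<xi>))\<^sup>2 / (1 + (\<xi> $ j)\<^sup>2))"
      by (simp add: power_mult_distrib field_simps)
    then show "ennreal ((norm (h \<xi>))\<^sup>2) \<le> ennreal (K\<^sup>2) * ennreal ((norm (fourier g \<xi>))\<^sup>2 / (1 + (\<xi> $ j)\<^sup>2))"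
      by (simp add: ennreal_leI flip: ennreal_mult)
  qed
  also have "\<dots> \<le> ennreal (K\<^sup>2) * (L1L2_norm j g)\<^sup>2"
    by (subst nn_integral_cmult) (auto intro!: mult_left_mono fourier_weighted_bound g)
  also have "\<dots> = (ennreal K * L1L2_norm j g)\<^sup>2" using K by (simp add: power_mult_distrib ennreal_power)
  finally show ?thesis by (simp add: L2_norm_le_iff)
qed

section \<open>Vector-valued functions and Sobolev spaces by components\<close>

lemma borel_measurable_vec_lambda [measurable (raw)]:
  fixes f :: "'s::finite \<Rightarrow> 'x \<Rightarrow> complex"
  assumes "\<And>a. f a \<in> borel_measurable M"
  shows "(\<lambda>x. \<chi> a. f a x) \<in> borel_measurable M"
proof (rule borel_measurable_euclidean_space[THEN iffD2], intro ballI)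
  fix b :: "complex ^ 's" assume "b \<in> Basis"
  then obtain a c where b: "b = axis a c" by (auto simp: Basis_vec_def)
  have "(\<lambda>x. f a x \<bullet> c) \<in> borel_measurable M" using assms[of a] by measurable
  then show "(\<lambda>x. (\<chi> a. f a x) \<bullet> b) \<in> borel_measurable M" by (simp add: b inner_axis)
qed

lemma borel_measurable_vec_iff:
  fixes f :: "'x \<Rightarrow> complex ^ 's::finite"
  shows "f \<in> borel_measurable M \<longleftrightarrow> (\<forall>a. (\<lambda>x. f x $ a) \<in> borel_measurable M)"
  using borel_measurable_vec_lambda[of "\<lambda>a x. f x $ a" M] borel_measurable_complex_vec_nth[of f M] by (simp only: vec_lambda_eta) metis

lemma L2_norm_vec:
  fixes f :: "'x \<Rightarrow> complex ^ 's::finite"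
  assumes [measurable]: "f \<in> borel_measurable M"
  shows "(L2_norm M f)\<^sup>2 = (\<Sum>a\<in>UNIV. (L2_norm M (\<lambda>x. f x $ a))\<^sup>2)"
proof -
  have "(L2_norm M f)\<^sup>2 = (\<integral>\<^sup>+x. (\<Sum>a\<in>UNIV. ennreal ((norm (f x $ a))\<^sup>2)) \<partial>M)"
    unfolding L2_norm_square
    by (intro nn_integral_cong) (simp add: norm_vec_def L2_set_def sum_nonneg sum_ennreal)
  also have "\<dots> = (\<Sum>a\<in>UNIV. (L2_norm M (\<lambda>x. f x $ a))\<^sup>2)"
    unfolding L2_norm_square by (rule nn_integral_sum) measurable
  finally show ?thesis .
qed

lemma L2_norm_vec_le:
  fixes f :: "'x \<Rightarrow> complex ^ 's::finite"
  assumes "f \<in> borel_measurable M"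
  shows "L2_norm M f \<le> (\<Sum>a\<in>UNIV. L2_norm M (\<lambda>x. f x $ a))"
proof -
  have "L2_norm M f \<le> L2_norm M (\<lambda>x. \<Sum>a\<in>UNIV. of_real (norm (f x $ a)) :: complex)"
  proof (rule L2_norm_mono_AE, rule AE_I2)
    fix x
    have "norm (f x) \<le> (\<Sum>a\<in>UNIV. norm (f x $ a))" unfolding norm_vec_def by (rule L2_set_le_sum) auto
    then show "norm (f x) \<le> norm (\<Sum>a\<in>UNIV. of_real (norm (f x $ a)) :: complex)"
      by (simp add: sum_nonneg flip: of_real_sum)
  qed
  also have "\<dots> \<le> (\<Sum>a\<in>UNIV. L2_norm M (\<lambda>x. of_real (norm (f x $ a)) :: complex))"
    using assms by (intro L2_norm_sum_le) auto
  also have "\<dots> = (\<Sum>a\<in>UNIV. L2_norm M (\<lambda>x. f x $ a))" by (intro sum.cong L2_norm_cong_AE) auto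
  finally show ?thesis .
qed

lemma L2_vec_iff:
  fixes f :: "real ^ 'n::finite \<Rightarrow> complex ^ 's::finite"
  shows "f \<in> L2 \<longleftrightarrow> (\<forall>a. (\<lambda>x. f x $ a) \<in> L2)"
proof
  assume f: "f \<in> L2"
  show "\<forall>a. (\<lambda>x. f x $ a) \<in> L2"
  proof
    fix a
    have "f \<in> borel_measurable borel" using f by auto
    then show "(\<lambda>x. f x $ a) \<in> L2"
      by (intro L2_bound[OF f, where K=1]) (auto simp: Finite_Cartesian_Product.norm_nth_le)
  qed
next
  assume *: "\<forall>a. (\<lambda>x. f x $ a) \<in> L2"
  then have m: "f \<in> borel_measurable borel" unfolding borel_measurable_vec_iff using L2_D by blast
  have "L2_norm lborel f \<le> (\<Sum>a\<in>UNIV. L2_norm lborel (\<lambda>x. f x $ a))" using m by (intro L2_norm_vec_le) auto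
  also have "\<dots> < \<infinity>" using * L2_norm_less_top by (auto simp: less_top)
  finally show "f \<in> L2" using m by (intro L2I)
qed

lemma L2_lim_vec_iff:
  fixes f :: "'x \<Rightarrow> complex ^ 's::finite"
  assumes [measurable]: "\<And>n. fs n \<in> borel_measurable M" "f \<in> borel_measurable M"
  shows "L2_lim M fs f \<longleftrightarrow> (\<forall>a. L2_lim M (\<lambda>n x. fs n x $ a) (\<lambda>x. f x $ a))"
proof
  assume lim: "L2_lim M fs f"
  show "\<forall>a. L2_lim M (\<lambda>n x. fs n x $ a) (\<lambda>x. f x $ a)"
  proof
    fix a show "L2_lim M (\<lambda>n x. fs n x $ a) (\<lambda>x. f x $ a)"
      by (rule L2_lim_bound[OF lim, where K=1])
         (auto simp: Finite_Cartesian_Product.norm_nth_le simp flip: vector_minus_component)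
  qed
next
  assume *: "\<forall>a. L2_lim M (\<lambda>n x. fs n x $ a) (\<lambda>x. f x $ a)"
  show "L2_lim M fs f"
    unfolding L2_lim_def
  proof (rule ennreal_tendsto_0_le)
    show "L2_norm M (\<lambda>x. fs n x - f x) \<le> (\<Sum>a\<in>UNIV. L2_norm M (\<lambda>x. (fs n x - f x) $ a))" for n
      by (rule L2_norm_vec_le) measurable
    have "(\<lambda>n. \<Sum>a\<in>UNIV. L2_norm M (\<lambda>x. (fs n x - f x) $ a)) \<longlonglongrightarrow> (\<Sum>a\<in>(UNIV::'s set). 0)"
      using * by (intro tendsto_sum) (auto simp: L2_lim_def)
    then show "(\<lambda>n. \<Sum>a\<in>UNIV. L2_norm M (\<lambda>x. (fs n x - f x) $ a)) \<longlonglongrightarrow> 0" by simp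
  qed
qed

lemma L2_scaleR_test_integrable:
  fixes u :: "real ^ 'n::finite \<Rightarrow> 'b::{banach, second_countable_topology}"
  assumes p: "(\<lambda>x. complex_of_real (p x)) \<in> L2" and [measurable]: "p \<in> borel_measurable borel" and u: "u \<in> L2"
  shows "integrable lborel (\<lambda>x. p x *\<^sub>R u x)"
proof (rule Bochner_Integration.integrable_bound)
  have [measurable]: "u \<in> borel_measurable borel" using u by auto
  have "(\<lambda>x. complex_of_real (norm (u x))) \<in> L2" by (rule L2_bound[OF u, where K=1]) auto
  from L2_mult_integrable(1)[OF p this] show "integrable lborel (\<lambda>x. complex_of_real (p x) * complex_of_real (norm (u x)))" .
qed (use u in \<open>auto simp: norm_mult\<close>)

lemma has_weak_pd_vec_iff:
  fixes u v :: "real ^ 'n::finite \<Rightarrow> complex ^ 's::finite"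
  assumes u: "u \<in> L2" and v: "v \<in> L2"
  shows "has_weak_pd k u v \<longleftrightarrow> (\<forall>a. has_weak_pd k (\<lambda>x. u x $ a) (\<lambda>x. v x $ a))"
proof -
  have comp: "(LINT x|lborel. p x *\<^sub>R w x) $ a = (LINT x|lborel. p x *\<^sub>R w x $ a)"
    if "(\<lambda>x. complex_of_real (p x)) \<in> L2" "p \<in> borel_measurable borel" "w \<in> L2"
    for p :: "real ^ 'n \<Rightarrow> real" and w :: "real ^ 'n \<Rightarrow> complex ^ 's" and a
    using integral_bounded_linear[OF bounded_linear_vec_nth L2_scaleR_test_integrable[OF that], of a] by simp
  have "((LINT x|lborel. pd k \<phi> x *\<^sub>R u x) = - (LINT x|lborel. \<phi> x *\<^sub>R v x)) \<longleftrightarrow>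
    (\<forall>a. (LINT x|lborel. pd k \<phi> x *\<^sub>R u x $ a) = - (LINT x|lborel. \<phi> x *\<^sub>R v x $ a))" if \<phi>: "test_function \<phi>" for \<phi>
  proof -
    have m: "\<phi> \<in> borel_measurable borel" "pd k \<phi> \<in> borel_measurable borel"
      by (rule test_function_facts[OF \<phi>, of k]; simp)+
    show ?thesis
      unfolding vec_eq_iff vector_uminus_component comp[OF test_function_L2(1)[OF \<phi>] m(1) v] comp[OF test_function_L2(3)[OF \<phi>] m(2) u] ..
  qed
  then show ?thesis unfolding has_weak_pd_def by blast
qed

lemma wpd_spec:
  assumes "u \<in> H1" shows "wpd k u \<in> L2" "has_weak_pd k u (wpd k u)"
proof -
  have "\<exists>v. v \<in> L2 \<and> has_weak_pd k u v" using assms by (auto simp: H1_def)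
  from someI_ex[OF this] show "wpd k u \<in> L2" "has_weak_pd k u (wpd k u)" by (auto simp: wpd_def)
qed

lemma H1_L2: "u \<in> H1 \<Longrightarrow> u \<in> L2"
  by (simp add: H1_def)

lemma is_L2_pd_unique:
  assumes "is_L2_pd k u v" "is_L2_pd k u v'" "v \<in> L2" "v' \<in> L2"
  shows "AE x in lborel. v x = v' x"
proof -
  have "AE \<xi> in lborel. fourier v \<xi> = fourier v' \<xi>"
    using assms(1,2) unfolding is_L2_pd_def by eventually_elim simp
  then show ?thesis using fourier_eq_iff[OF assms(3,4)] by blast
qed

lemma H1_iff:
  fixes u :: "real ^ 'n::finite \<Rightarrow> complex"
  shows "u \<in> H1 \<longleftrightarrow> u \<in> L2 \<and> (\<forall>k. \<exists>v\<in>L2. is_L2_pd k u v)"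
  unfolding H1_def using has_weak_pd_iff_is_L2_pd[of u] by blast

lemma wpd_is_L2_pd:
  fixes u :: "real ^ 'n::finite \<Rightarrow> complex"
  assumes "u \<in> H1" shows "is_L2_pd k u (wpd k u)"
  using wpd_spec[OF assms, of k] has_weak_pd_iff_is_L2_pd[OF H1_L2[OF assms]] by blast

lemma H1_vec_iff:
  fixes u :: "real ^ 'n::finite \<Rightarrow> complex ^ 's::finite"
  shows "u \<in> H1 \<longleftrightarrow> (\<forall>a. (\<lambda>x. u x $ a) \<in> H1)"
proof
  assume u: "u \<in> H1"
  show "\<forall>a. (\<lambda>x. u x $ a) \<in> H1"
    unfolding H1_def
  proof (safe)
    fix a k
    show "(\<lambda>x. u x $ a) \<in> L2" using H1_L2[OF u] by (auto simp: L2_vec_iff[of u])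
    have "(\<lambda>x. wpd k u x $ a) \<in> L2" using wpd_spec(1)[OF u, of k] by (auto simp: L2_vec_iff[of "wpd k u"])
    moreover have "has_weak_pd k (\<lambda>x. u x $ a) (\<lambda>x. wpd k u x $ a)"
      using wpd_spec[OF u, of k] has_weak_pd_vec_iff[OF H1_L2[OF u] wpd_spec(1)[OF u, of k], of k] by blast
    ultimately show "\<exists>v\<in>L2. has_weak_pd k (\<lambda>x. u x $ a) v" by blast
  qed
next
  assume *: "\<forall>a. (\<lambda>x. u x $ a) \<in> H1"
  then have u: "u \<in> L2" by (auto simp: L2_vec_iff[of u] H1_L2)
  have "\<exists>v\<in>L2. has_weak_pd k u v" for k
  proof
    show v: "(\<lambda>x. \<chi> a. wpd k (\<lambda>x. u x $ a) x) \<in> L2"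
      using * wpd_spec(1) by (subst L2_vec_iff) auto
    show "has_weak_pd k u (\<lambda>x. \<chi> a. wpd k (\<lambda>x. u x $ a) x)"
      using * wpd_spec(2) by (subst has_weak_pd_vec_iff[OF u v]) auto
  qed
  then show "u \<in> H1" using u by (simp add: H1_def)
qed

text \<open>\<open>wpd\<close> chooses its representative for the vector and for the component
  independently, so the two agree only almost everywhere, by uniqueness on the Fourier side.\<close>

lemma wpd_vec_component:
  fixes u :: "real ^ 'n::finite \<Rightarrow> complex ^ 's::finite"
  assumes u: "u \<in> H1"
  shows "AE x in lborel. wpd k u x $ a = wpd k (\<lambda>x. u x $ a) x"
proof (rule is_L2_pd_unique)
  have ua: "(\<lambda>x. u x $ a) \<in> H1" using u H1_vec_iff by blast
  show "is_L2_pd k (\<lambda>x. u x $ a) (wpd k (\<lambda>x. u x $ a))" by (rule wpd_is_L2_pd[OF ua])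
  show w: "(\<lambda>x. wpd k u x $ a) \<in> L2" using wpd_spec(1)[OF u, of k] by (auto simp: L2_vec_iff[of "wpd k u"])
  have "has_weak_pd k (\<lambda>x. u x $ a) (\<lambda>x. wpd k u x $ a)"
    using wpd_spec[OF u, of k] has_weak_pd_vec_iff[OF H1_L2[OF u] wpd_spec(1)[OF u, of k], of k] by blast
  then show "is_L2_pd k (\<lambda>x. u x $ a) (\<lambda>x. wpd k u x $ a)"
    using has_weak_pd_iff_is_L2_pd[OF H1_L2[OF ua] w] by blast
  show "wpd k (\<lambda>x. u x $ a) \<in> L2" by (rule wpd_spec(1)[OF ua])
qed

lemma is_L2_pd_lincomb:
  assumes "\<And>i. i \<in> I \<Longrightarrow> is_L2_pd k (u i) (v i)" "\<And>i. i \<in> I \<Longrightarrow> u i \<in> L2" "\<And>i. i \<in> I \<Longrightarrow> v i \<in> L2"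
  shows "is_L2_pd k (\<lambda>x. \<Sum>i\<in>I. c i * u i x) (\<lambda>x. \<Sum>i\<in>I. c i * v i x)"
proof (cases "finite I")
  case True
  have "AE \<xi> in lborel. \<forall>i\<in>I. fourier (\<lambda>x. c i * u i x) \<xi> = c i * fourier (u i) \<xi> \<and> fourier (\<lambda>x. c i * v i x) \<xi> = c i * fourier (v i) \<xi>
      \<and> fourier (v i) \<xi> = \<i> * of_real (\<xi> $ k) * fourier (u i) \<xi>"
    using True assms by (intro AE_finite_allI AE_conjI fourier_cmult) (auto simp: is_L2_pd_def)
  moreover have "AE \<xi> in lborel. fourier (\<lambda>x. \<Sum>i\<in>I. c i * u i x) \<xi> = (\<Sum>i\<in>I. fourier (\<lambda>x. c i * u i x) \<xi>)"
    using assms by (intro fourier_sum L2_cmult) auto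
  moreover have "AE \<xi> in lborel. fourier (\<lambda>x. \<Sum>i\<in>I. c i * v i x) \<xi> = (\<Sum>i\<in>I. fourier (\<lambda>x. c i * v i x) \<xi>)"
    using assms by (intro fourier_sum L2_cmult) auto
  ultimately show ?thesis
    unfolding is_L2_pd_def by eventually_elim (simp add: sum_distrib_left mult_ac cong: sum.cong)
next
  case False
  then show ?thesis using fourier_zero by (auto simp: is_L2_pd_def)
qed

lemma H1_lincomb:
  fixes u :: "'i \<Rightarrow> real ^ 'n::finite \<Rightarrow> complex"
  assumes "\<And>i. i \<in> I \<Longrightarrow> u i \<in> H1"
  shows "(\<lambda>x. \<Sum>i\<in>I. c i * u i x) \<in> H1"
  unfolding H1_iff
proof (intro conjI allI)
  show "(\<lambda>x. \<Sum>i\<in>I. c i * u i x) \<in> L2" using assms by (intro L2_sum L2_cmult H1_L2)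
  show "\<exists>v\<in>L2. is_L2_pd k (\<lambda>x. \<Sum>i\<in>I. c i * u i x) v" for k
  proof
    show "is_L2_pd k (\<lambda>x. \<Sum>i\<in>I. c i * u i x) (\<lambda>x. \<Sum>i\<in>I. c i * wpd k (u i) x)"
      using assms by (intro is_L2_pd_lincomb wpd_is_L2_pd H1_L2 wpd_spec)
    show "(\<lambda>x. \<Sum>i\<in>I. c i * wpd k (u i) x) \<in> L2" using assms by (intro L2_sum L2_cmult wpd_spec)
  qed
qed

lemma H1_add: "u \<in> H1 \<Longrightarrow> v \<in> H1 \<Longrightarrow> (\<lambda>x. u x + v x :: complex) \<in> H1"
  using H1_lincomb[of "UNIV :: bool set" "\<lambda>b. if b then u else v" "\<lambda>_. 1"] by (simp add: UNIV_bool add.commute)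

lemma H1_cmult: "u \<in> H1 \<Longrightarrow> (\<lambda>x. c * u x :: complex) \<in> H1"
  using H1_lincomb[of "{()}" "\<lambda>_. u" "\<lambda>_. c"] by simp

lemma H1_sum: "(\<And>i. i \<in> I \<Longrightarrow> u i \<in> H1) \<Longrightarrow> (\<lambda>x. \<Sum>i\<in>I. u i x :: complex) \<in> H1"
  using H1_lincomb[of I u "\<lambda>_. 1"] by simp

section \<open>Resolvents on square-integrable functions\<close>

text \<open>For t up to 2|w| + 1 the positive distance \<open>d\<close> from \<open>w\<close> to the
  closed half-line suffices. Beyond that, |t - w| is at least t - |w|, which exceeds (1 + t) / 2.
  The two entries of the maximum \<open>K\<close> belong to these two ranges.\<close>

lemma resolvent_symbol_bound:
  assumes "w \<notin> complex_of_real ` {0..}"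
  obtains K where "K > 0" "\<And>t. t \<ge> 0 \<Longrightarrow> 1 + t \<le> K * cmod (of_real t - w)"
proof -
  have "closed (complex_of_real ` {0..})"
    by (rule closed_injective_linear_image) (auto intro: bounded_linear.linear bounded_linear_of_real simp: inj_on_def)
  from separate_point_closed[OF this assms] obtain d where d: "d > 0" "\<And>t. t \<ge> 0 \<Longrightarrow> d \<le> cmod (of_real t - w)"
    by (auto simp: dist_norm norm_minus_commute)
  define K where "K = max 2 ((2 * cmod w + 2) / d)"
  have K: "K \<ge> 2" "K \<ge> (2 * cmod w + 2) / d" by (auto simp: K_def)
  have "1 + t \<le> K * cmod (of_real t - w)" if t: "t \<ge> 0" for t
  proof (cases "t \<le> 2 * cmod w + 1")
    case True
    then have "1 + t \<le> (2 * cmod w + 2) / d * d" using d(1) by simp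
    also have "\<dots> \<le> K * cmod (of_real t - w)" using d(2)[OF t] K d(1) by (intro mult_mono) auto
    finally show ?thesis .
  next
    case False
    have "cmod (of_real t) - cmod w \<le> cmod (of_real t - w)" by (rule norm_triangle_ineq2)
    then have "1 + t \<le> 2 * cmod (of_real t - w)" using False t by simp
    also have "\<dots> \<le> K * cmod (of_real t - w)" using K by (intro mult_right_mono) auto
    finally show ?thesis .
  qed
  moreover have "K > 0" using K by linarith
  ultimately show thesis using that by blast
qed

lemma norm_square_vec: "(norm (x :: real ^ 'n::finite))\<^sup>2 = (\<Sum>i\<in>UNIV. (x $ i)\<^sup>2)"
  by (simp add: norm_vec_def L2_set_def sum_nonneg)

lemma vec_nth_square_le: "(\<xi> $ k)\<^sup>2 \<le> (norm (\<xi> :: real ^ 'n::finite))\<^sup>2"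
  unfolding norm_square_vec by (rule member_le_sum) auto

lemma abs_vec_nth_mult_le: "\<bar>\<xi> $ k * \<xi> $ l\<bar> \<le> (norm (\<xi> :: real ^ 'n::finite))\<^sup>2"
proof -
  have "\<bar>\<xi> $ k\<bar> * \<bar>\<xi> $ l\<bar> \<le> norm \<xi> * norm \<xi>"
    by (intro mult_mono component_le_norm_cart) auto
  then show ?thesis by (simp add: abs_mult power2_eq_square)
qed

lemma abs_vec_nth_le: "\<bar>\<xi> $ k\<bar> \<le> 1 + (norm (\<xi> :: real ^ 'n::finite))\<^sup>2"
proof -
  have "2 * \<bar>\<xi> $ k\<bar> \<le> 1 + \<bar>\<xi> $ k\<bar>\<^sup>2" using sum_squares_bound[of 1 "\<bar>\<xi> $ k\<bar>"] by simp
  then show ?thesis using vec_nth_square_le[of \<xi> k] by simp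
qed

lemma L2_symbol_mult:
  fixes f :: "real ^ 'n::finite \<Rightarrow> complex"
  assumes "f \<in> L2" "\<And>\<xi>. norm (s \<xi>) \<le> K" "s \<in> borel_measurable borel"
  shows "(\<lambda>\<xi>. s \<xi> * fourier f \<xi>) \<in> L2"
  using assms by (intro L2_mult_bounded[where K=K] fourier_L2) auto

lemma H1_fourierI:
  fixes u :: "real ^ 'n::finite \<Rightarrow> complex"
  assumes "u \<in> L2" "\<And>k. (\<lambda>\<xi>. \<i> * of_real (\<xi> $ k) * fourier u \<xi>) \<in> L2"
  shows "u \<in> H1"
  unfolding H1_iff is_L2_pd_def using assms inv_fourier_L2 fourier_inv_fourier by blast

lemma L2_cong_AE_measurable:
  assumes "f \<in> L2" "AE x in lborel. g x = f x" "g \<in> borel_measurable borel"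
  shows "g \<in> L2"
  by (rule L2_cong_AE[OF assms(1)]) (use assms in \<open>auto elim: eventually_mono\<close>)

lemma fourier_wpd: "u \<in> H1 \<Longrightarrow> AE \<xi> in lborel. fourier (wpd k u) \<xi> = \<i> * of_real (\<xi> $ k) * fourier u \<xi>"
  using wpd_is_L2_pd by (simp add: is_L2_pd_def)

lemma H2_D: "u \<in> H2 \<Longrightarrow> u \<in> H1" "u \<in> H2 \<Longrightarrow> wpd k u \<in> H1"
  by (auto simp: H2_def)

lemma helmholtz_fourier:
  fixes u :: "real ^ 'n::finite \<Rightarrow> complex"
  assumes u: "u \<in> H2"
  shows "(\<lambda>x. - (\<Sum>k\<in>UNIV. wpd k (wpd k u) x) - w * u x) \<in> L2" (is "?f \<in> L2")
    and "AE \<xi> in lborel. fourier (\<lambda>x. - (\<Sum>k\<in>UNIV. wpd k (wpd k u) x) - w * u x) \<xi> = (of_real ((norm \<xi>)\<^sup>2) - w) * fourier u \<xi>"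
proof -
  have k: "wpd k u \<in> H1" "wpd k (wpd k u) \<in> L2" for k using H2_D[OF u] wpd_spec by auto
  have S: "(\<lambda>x. \<Sum>k\<in>UNIV. wpd k (wpd k u) x) \<in> L2" by (intro L2_sum k)
  have uL: "u \<in> L2" using H1_L2[OF H2_D(1)[OF u]] .
  show "?f \<in> L2" by (intro L2_diff L2_uminus S L2_cmult uL)
  have "AE \<xi> in lborel. \<forall>k\<in>UNIV. fourier (wpd k (wpd k u)) \<xi> = \<i> * of_real (\<xi> $ k) * fourier (wpd k u) \<xi>
      \<and> fourier (wpd k u) \<xi> = \<i> * of_real (\<xi> $ k) * fourier u \<xi>"
    by (intro AE_finite_allI AE_conjI fourier_wpd k H2_D[OF u]) auto
  moreover have "AE \<xi> in lborel. fourier ?f \<xi> = fourier (\<lambda>x. - (\<Sum>k\<in>UNIV. wpd k (wpd k u) x)) \<xi> - fourier (\<lambda>x. w * u x) \<xi>"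
    by (intro fourier_diff L2_uminus S L2_cmult uL)
  moreover have "AE \<xi> in lborel. fourier (\<lambda>x. (- 1) * (\<Sum>k\<in>UNIV. wpd k (wpd k u) x)) \<xi> = (- 1) * fourier (\<lambda>x. \<Sum>k\<in>UNIV. wpd k (wpd k u) x) \<xi>"
    by (rule fourier_cmult[OF S])
  moreover have "AE \<xi> in lborel. fourier (\<lambda>x. w * u x) \<xi> = w * fourier u \<xi>"
    by (rule fourier_cmult[OF uL])
  moreover have "AE \<xi> in lborel. fourier (\<lambda>x. \<Sum>k\<in>UNIV. wpd k (wpd k u) x) \<xi> = (\<Sum>k\<in>UNIV. fourier (wpd k (wpd k u)) \<xi>)"
    by (rule fourier_sum[OF k(2)])
  ultimately show "AE \<xi> in lborel. fourier ?f \<xi> = (of_real ((norm \<xi>)\<^sup>2) - w) * fourier u \<xi>"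
  proof eventually_elim
    fix \<xi> :: "real ^ 'n"
    assume a: "\<forall>k\<in>UNIV. fourier (wpd k (wpd k u)) \<xi> = \<i> * of_real (\<xi> $ k) * fourier (wpd k u) \<xi>
      \<and> fourier (wpd k u) \<xi> = \<i> * of_real (\<xi> $ k) * fourier u \<xi>"
      and b: "fourier ?f \<xi> = fourier (\<lambda>x. - (\<Sum>k\<in>UNIV. wpd k (wpd k u) x)) \<xi> - fourier (\<lambda>x. w * u x) \<xi>"
      and c: "fourier (\<lambda>x. (- 1) * (\<Sum>k\<in>UNIV. wpd k (wpd k u) x)) \<xi> = (- 1) * fourier (\<lambda>x. \<Sum>k\<in>UNIV. wpd k (wpd k u) x) \<xi>"
      and d: "fourier (\<lambda>x. w * u x) \<xi> = w * fourier u \<xi>"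
      and e: "fourier (\<lambda>x. \<Sum>k\<in>UNIV. wpd k (wpd k u) x) \<xi> = (\<Sum>k\<in>UNIV. fourier (wpd k (wpd k u)) \<xi>)"
    have kk: "fourier (wpd k (wpd k u)) \<xi> = - (of_real ((\<xi> $ k)\<^sup>2) * fourier u \<xi>)" for k
    proof -
      have "fourier (wpd k (wpd k u)) \<xi> = (\<i> * \<i>) * (of_real (\<xi> $ k) * of_real (\<xi> $ k)) * fourier u \<xi>"
        using a[rule_format, of k] by (simp add: mult_ac)
      then show ?thesis by (simp add: power2_eq_square)
    qed
    have "fourier ?f \<xi> = - (\<Sum>k\<in>UNIV. - (of_real ((\<xi> $ k)\<^sup>2) * fourier u \<xi>)) - w * fourier u \<xi>"
      using b c d unfolding e kk by simp
    also have "\<dots> = (of_real ((norm \<xi>)\<^sup>2) - w) * fourier u \<xi>"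
      by (simp add: norm_square_vec sum_negf left_diff_distrib flip: sum_distrib_right)
    finally show "fourier ?f \<xi> = (of_real ((norm \<xi>)\<^sup>2) - w) * fourier u \<xi>" .
  qed
qed

lemma laplace_res_graph_fourier:
  fixes u :: "real ^ 'n::finite \<Rightarrow> complex"
  assumes "laplace_res_graph w f u"
  shows "AE \<xi> in lborel. (of_real ((norm \<xi>)\<^sup>2) - w) * fourier u \<xi> = fourier f \<xi>"
proof -
  have f: "f \<in> L2" and u: "u \<in> H2" and eq: "AE x in lborel. - (\<Sum>k\<in>UNIV. wpd k (wpd k u) x) - w * u x = f x"
    using assms by (auto simp: laplace_res_graph_def)
  have "AE \<xi> in lborel. fourier (\<lambda>x. - (\<Sum>k\<in>UNIV. wpd k (wpd k u) x) - w * u x) \<xi> = fourier f \<xi>"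
    using fourier_eq_iff[OF helmholtz_fourier(1)[OF u] f] eq by blast
  with helmholtz_fourier(2)[OF u, of w] show ?thesis by eventually_elim simp
qed

text \<open>One constant serves for all coefficients of size up to 1 + |xi|^2 over the Helmholtz
  symbol: derivatives of order 0, 1 and 2 of the Laplace resolvent.\<close>

lemma helmholtz_symbol_facts:
  fixes w :: complex
  assumes "w \<notin> complex_of_real ` {0..}"
  obtains K where "K > 0" "\<And>\<xi> :: real ^ 'n::finite. 1 + (norm \<xi>)\<^sup>2 \<le> K * cmod (of_real ((norm \<xi>)\<^sup>2) - w)"
    "\<And>\<xi> :: real ^ 'n. of_real ((norm \<xi>)\<^sup>2) - w \<noteq> 0"
    "\<And>(\<xi> :: real ^ 'n) c. norm c \<le> 1 + (norm \<xi>)\<^sup>2 \<Longrightarrow> norm (c / (of_real ((norm \<xi>)\<^sup>2) - w)) \<le> K"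
proof -
  obtain K where K: "K > 0" "\<And>t. t \<ge> 0 \<Longrightarrow> 1 + t \<le> K * cmod (of_real t - w)"
    using resolvent_symbol_bound[OF assms] by blast
  have 1: "1 + (norm \<xi>)\<^sup>2 \<le> K * cmod (of_real ((norm \<xi>)\<^sup>2) - w)" for \<xi> :: "real ^ 'n"
    by (rule K(2)) simp
  have 2: "of_real ((norm \<xi>)\<^sup>2) - w \<noteq> 0" for \<xi> :: "real ^ 'n"
  proof
    assume "of_real ((norm \<xi>)\<^sup>2) - w = 0"
    then have "K * cmod (of_real ((norm \<xi>)\<^sup>2) - w) = 0" by (simp only: norm_zero mult_zero_right)
    moreover have "(norm \<xi>)\<^sup>2 \<ge> 0" by simp
    ultimately show False using 1[of \<xi>] by linarith
  qed
  have 3: "norm (c / (of_real ((norm \<xi>)\<^sup>2) - w)) \<le> K" if "norm c \<le> 1 + (norm \<xi>)\<^sup>2" for \<xi> :: "real ^ 'n" and c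
  proof -
    have "cmod (of_real ((norm \<xi>)\<^sup>2) - w) > 0" using 2[of \<xi>] by simp
    then show ?thesis unfolding norm_divide using 1[of \<xi>] that by (simp add: divide_le_eq del: of_real_power)
  qed
  show thesis using that[OF K(1) 1 2 3] .
qed

text \<open>The solution is prescribed by its transform. The symbols 1, i xi_k and -xi_k xi_l are
  all at most 1 + |xi|^2, so after division by |xi|^2 - w they are bounded, which places the
  solution in \<open>H2\<close>.\<close>

lemma laplace_res_graph_ex:
  fixes f :: "real ^ 'n::finite \<Rightarrow> complex"
  assumes w: "w \<notin> complex_of_real ` {0..}" and f: "f \<in> L2"
  shows "\<exists>u. laplace_res_graph w f u"
proof -
  obtain K where K: "K > 0" and nz: "\<And>\<xi> :: real ^ 'n. of_real ((norm \<xi>)\<^sup>2) - w \<noteq> 0"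
    and le: "\<And>(\<xi> :: real ^ 'n) c. norm c \<le> 1 + (norm \<xi>)\<^sup>2 \<Longrightarrow> norm (c / (of_real ((norm \<xi>)\<^sup>2) - w)) \<le> K"
    using helmholtz_symbol_facts[OF w] by metis
  let ?q = "\<lambda>\<xi>::real^'n. of_real ((norm \<xi>)\<^sup>2) - w"
  have S: "(\<lambda>\<xi>. c \<xi> / ?q \<xi> * fourier f \<xi>) \<in> L2" if "\<And>\<xi>. norm (c \<xi>) \<le> 1 + (norm \<xi>)\<^sup>2" "c \<in> borel_measurable borel" for c
    using that by (intro L2_symbol_mult[OF f le]) auto
  have S1: "(\<lambda>\<xi>. 1 / ?q \<xi> * fourier f \<xi>) \<in> L2" by (intro S) auto
  define u where "u = inv_fourier (\<lambda>\<xi>. 1 / ?q \<xi> * fourier f \<xi>)"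
  have u: "u \<in> L2" and uF: "AE \<xi> in lborel. fourier u \<xi> = 1 / ?q \<xi> * fourier f \<xi>"
    unfolding u_def using inv_fourier_L2[OF S1] fourier_inv_fourier[OF S1] by auto
  have [measurable]: "fourier u \<in> borel_measurable borel" using fourier_L2[OF u] by auto
  have u1: "u \<in> H1"
  proof (rule H1_fourierI[OF u])
    fix k
    have "(\<lambda>\<xi>. (\<i> * of_real (\<xi> $ k)) / ?q \<xi> * fourier f \<xi>) \<in> L2"
      by (rule S) (auto simp: norm_mult abs_vec_nth_le)
    then show "(\<lambda>\<xi>. \<i> * of_real (\<xi> $ k) * fourier u \<xi>) \<in> L2"
    proof (rule L2_cong_AE_measurable)
      show "AE \<xi> in lborel. \<i> * of_real (\<xi> $ k) * fourier u \<xi> = (\<i> * of_real (\<xi> $ k)) / ?q \<xi> * fourier f \<xi>"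
        using uF by eventually_elim (simp del: of_real_power)
    qed measurable
  qed
  have u2: "u \<in> H2"
    unfolding H2_def
  proof (safe intro!: u1)
    fix l
    note v = wpd_spec(1)[OF u1, of l]
    have [measurable]: "fourier (wpd l u) \<in> borel_measurable borel" using fourier_L2[OF v] by auto
    show "wpd l u \<in> H1"
    proof (rule H1_fourierI[OF v])
      fix k
      have "(\<lambda>\<xi>. (- of_real (\<xi> $ k * \<xi> $ l)) / ?q \<xi> * fourier f \<xi>) \<in> L2"
        by (rule S) (auto intro: order_trans[OF abs_vec_nth_mult_le] simp del: of_real_mult)
      then show "(\<lambda>\<xi>. \<i> * of_real (\<xi> $ k) * fourier (wpd l u) \<xi>) \<in> L2"
      proof (rule L2_cong_AE_measurable)
        show "AE \<xi> in lborel. \<i> * of_real (\<xi> $ k) * fourier (wpd l u) \<xi> = (- of_real (\<xi> $ k * \<xi> $ l)) / ?q \<xi> * fourier f \<xi>"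
          using uF fourier_wpd[OF u1, of l]
        proof eventually_elim
          fix \<xi> :: "real ^ 'n" assume a: "fourier u \<xi> = 1 / ?q \<xi> * fourier f \<xi>" and b: "fourier (wpd l u) \<xi> = \<i> * of_real (\<xi> $ l) * fourier u \<xi>"
          have "\<i> * of_real (\<xi> $ k) * fourier (wpd l u) \<xi> = (\<i> * \<i>) * of_real (\<xi> $ k * \<xi> $ l) * (1 / ?q \<xi> * fourier f \<xi>)"
            unfolding b a[symmetric] by (simp add: mult_ac)
          then show "\<i> * of_real (\<xi> $ k) * fourier (wpd l u) \<xi> = (- of_real (\<xi> $ k * \<xi> $ l)) / ?q \<xi> * fourier f \<xi>"
            by (simp del: of_real_power)
        qed
      qed measurable
    qed
  qed
  have "AE \<xi> in lborel. fourier (\<lambda>x. - (\<Sum>k\<in>UNIV. wpd k (wpd k u) x) - w * u x) \<xi> = fourier f \<xi>"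
    using helmholtz_fourier(2)[OF u2, of w] uF
    by eventually_elim (simp only: mult.assoc[symmetric] times_divide_eq_right mult_1_right divide_self[OF nz] mult_1_left)
  then have "AE x in lborel. - (\<Sum>k\<in>UNIV. wpd k (wpd k u) x) - w * u x = f x"
    using fourier_eq_iff[OF helmholtz_fourier(1)[OF u2] f] by blast
  then show ?thesis using f u2 by (auto simp: laplace_res_graph_def)
qed

section \<open>The transform of vectors and the symbol of the Dirac operator\<close>

definition vfourier :: "(real ^ 'n::finite \<Rightarrow> complex ^ 's::finite) \<Rightarrow> real ^ 'n \<Rightarrow> complex ^ 's" where
  "vfourier f \<xi> = (\<chi> a. fourier (\<lambda>x. f x $ a) \<xi>)"

lemma L2_component: "f \<in> L2 \<Longrightarrow> (\<lambda>x. f x $ a :: complex) \<in> L2"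
  using L2_vec_iff by blast

lemma vfourier_L2: "f \<in> L2 \<Longrightarrow> vfourier f \<in> L2"
  unfolding L2_vec_iff[of "vfourier f"] by (simp add: vfourier_def fourier_L2 L2_component)

lemma L2_norm_vfourier:
  assumes f: "f \<in> L2" shows "L2_norm lborel (vfourier f) = L2_norm lborel f"
proof -
  have "(L2_norm lborel (vfourier f))\<^sup>2 = (L2_norm lborel f)\<^sup>2"
    using L2_norm_vec[of f lborel] L2_norm_vec[of "vfourier f" lborel] f vfourier_L2[OF f]
    by (simp add: vfourier_def L2_norm_fourier L2_component)
  then show ?thesis by (simp add: ennreal_power2_eq_iff)
qed

lemma AE_vec_eq_iff:
  fixes f g :: "'x \<Rightarrow> 'b ^ 's::finite"
  shows "(AE x in M. f x = g x) \<longleftrightarrow> (\<forall>a. AE x in M. f x $ a = g x $ a)"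
  unfolding vec_eq_iff by (simp add: AE_all_countable)

lemma vfourier_eq_iff:
  assumes "f \<in> L2" "g \<in> L2"
  shows "(AE \<xi> in lborel. vfourier f \<xi> = vfourier g \<xi>) \<longleftrightarrow> (AE x in lborel. f x = g x)"
  unfolding AE_vec_eq_iff using fourier_eq_iff[OF L2_component[OF assms(1)] L2_component[OF assms(2)]]
  by (simp add: vfourier_def)

lemma vfourier_add:
  assumes "f \<in> L2" "g \<in> L2"
  shows "AE \<xi> in lborel. vfourier (\<lambda>x. f x + g x) \<xi> = vfourier f \<xi> + vfourier g \<xi>"
  unfolding AE_vec_eq_iff by (simp add: vfourier_def fourier_add L2_component assms)

lemma vfourier_diff:
  assumes "f \<in> L2" "g \<in> L2"
  shows "AE \<xi> in lborel. vfourier (\<lambda>x. f x - g x) \<xi> = vfourier f \<xi> - vfourier g \<xi>"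
  unfolding AE_vec_eq_iff by (simp add: vfourier_def fourier_diff L2_component assms)

lemma vfourier_cmult:
  assumes "f \<in> L2"
  shows "AE \<xi> in lborel. vfourier (\<lambda>x. c *s f x) \<xi> = c *s vfourier f \<xi>"
  unfolding AE_vec_eq_iff by (simp add: vfourier_def fourier_cmult L2_component assms)

lemma vfourier_sum:
  assumes "\<And>i. i \<in> I \<Longrightarrow> f i \<in> L2"
  shows "AE \<xi> in lborel. vfourier (\<lambda>x. \<Sum>i\<in>I. f i x) \<xi> = (\<Sum>i\<in>I. vfourier (f i) \<xi>)"
  unfolding AE_vec_eq_iff by (simp add: vfourier_def fourier_sum L2_component assms)

lemma vfourier_matrix:
  fixes A :: "complex ^ 's::finite ^ 's"
  assumes f: "f \<in> L2"
  shows "AE \<xi> in lborel. vfourier (\<lambda>x. A *v f x) \<xi> = A *v vfourier f \<xi>"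
  unfolding AE_vec_eq_iff
proof
  fix a
  have "AE \<xi> in lborel. fourier (\<lambda>x. \<Sum>b\<in>UNIV. A $ a $ b * f x $ b) \<xi> = (\<Sum>b\<in>UNIV. fourier (\<lambda>x. A $ a $ b * f x $ b) \<xi>)"
    by (intro fourier_sum L2_cmult L2_component f)
  moreover have "AE \<xi> in lborel. \<forall>b\<in>UNIV. fourier (\<lambda>x. A $ a $ b * f x $ b) \<xi> = A $ a $ b * fourier (\<lambda>x. f x $ b) \<xi>"
    by (intro AE_finite_allI fourier_cmult L2_component f) auto
  ultimately show "AE \<xi> in lborel. vfourier (\<lambda>x. A *v f x) \<xi> $ a = (A *v vfourier f \<xi>) $ a"
    by eventually_elim (simp add: vfourier_def matrix_vector_mult_def)
qed

lemma L2_matrix: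
  fixes A :: "complex ^ 's::finite ^ 's"
  assumes f: "f \<in> L2"
  shows "(\<lambda>x. A *v f x) \<in> L2"
  unfolding L2_vec_iff[of "\<lambda>x. A *v f x"] by (auto simp: matrix_vector_mult_def intro!: L2_sum L2_cmult L2_component f)

lemma L2_vec_cmult: "f \<in> L2 \<Longrightarrow> (\<lambda>x. c *s (f x :: complex ^ 's::finite)) \<in> L2"
  unfolding L2_vec_iff[of "\<lambda>x. c *s f x"] by (auto intro!: L2_cmult L2_component)

lemma vfourier_wpd:
  fixes u :: "real ^ 'n::finite \<Rightarrow> complex ^ 's::finite"
  assumes u: "u \<in> H1"
  shows "AE \<xi> in lborel. vfourier (wpd k u) \<xi> = (\<i> * of_real (\<xi> $ k)) *s vfourier u \<xi>"
  unfolding AE_vec_eq_iff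
proof
  fix a
  have ua: "(\<lambda>x. u x $ a) \<in> H1" using u H1_vec_iff by blast
  have "AE \<xi> in lborel. fourier (\<lambda>x. wpd k u x $ a) \<xi> = fourier (wpd k (\<lambda>x. u x $ a)) \<xi>"
    using fourier_eq_iff[OF L2_component[OF wpd_spec(1)[OF u]] wpd_spec(1)[OF ua]] wpd_vec_component[OF u] by blast
  with fourier_wpd[OF ua, of k] show "AE \<xi> in lborel. vfourier (wpd k u) \<xi> $ a = ((\<i> * of_real (\<xi> $ k)) *s vfourier u \<xi>) $ a"
    by eventually_elim (simp add: vfourier_def)
qed

text \<open>The mass acts as the frequency belonging to index 0, so that the symbol is a single sum
  over \<open>'n option\<close> and one anticommutation rule handles all its terms.\<close>

definition dirac_coeff :: "real \<Rightarrow> real ^ 'n::finite \<Rightarrow> 'n option \<Rightarrow> real" where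
  "dirac_coeff m \<xi> i = (case i of None \<Rightarrow> m | Some k \<Rightarrow> \<xi> $ k)"

definition dirac_symbol :: "('n::finite option \<Rightarrow> complex ^ 's ^ 's::finite) \<Rightarrow> real \<Rightarrow> real ^ 'n \<Rightarrow> complex ^ 's \<Rightarrow> complex ^ 's" where
  "dirac_symbol \<alpha> m \<xi> v = (\<Sum>i\<in>UNIV. of_real (dirac_coeff m \<xi> i) *s (\<alpha> i *v v))"

lemma sum_option_UNIV:
  fixes g :: "'n::finite option \<Rightarrow> 'b::comm_monoid_add"
  shows "(\<Sum>i\<in>UNIV. g i) = g None + (\<Sum>k\<in>UNIV. g (Some k))"
  unfolding UNIV_option_conv by (subst sum.insert) (auto simp: sum.reindex)

lemma dirac_symbol_eq: "dirac_symbol \<alpha> m \<xi> v = (\<Sum>k\<in>UNIV. of_real (\<xi> $ k) *s (\<alpha> (Some k) *v v)) + of_real m *s (\<alpha> None *v v)"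
  by (simp add: dirac_symbol_def sum_option_UNIV dirac_coeff_def)

lemma matrix_vector_smult: "(A :: complex ^ 's::finite ^ 's) *v (c *s v) = c *s (A *v v)"
  by (simp add: vec_eq_iff matrix_vector_mult_def sum_distrib_left mult_ac)

lemma matrix_vector_mult_sum:
  fixes A :: "complex ^ 's::finite ^ 's"
  shows "A *v (\<Sum>i\<in>I. f i) = (\<Sum>i\<in>I. A *v f i)"
  by (induction I rule: infinite_finite_induct) (simp_all add: matrix_vector_right_distrib)

lemma dirac_symbol_add: "dirac_symbol \<alpha> m \<xi> (u + v) = dirac_symbol \<alpha> m \<xi> u + dirac_symbol \<alpha> m \<xi> v"
  by (simp add: dirac_symbol_def matrix_vector_right_distrib vector_add_ldistrib sum.distrib)

lemma dirac_symbol_smult: "dirac_symbol \<alpha> m \<xi> (c *s v) = c *s dirac_symbol \<alpha> m \<xi> v"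
  by (simp add: dirac_symbol_def matrix_vector_smult vec_eq_iff sum_distrib_left mult_ac)

lemma dirac_symbol_diff: "dirac_symbol \<alpha> m \<xi> (u - v) = dirac_symbol \<alpha> m \<xi> u - dirac_symbol \<alpha> m \<xi> v"
proof -
  have e: "u - v = u + (- 1) *s v" by (simp add: vec_eq_iff)
  show ?thesis unfolding e dirac_symbol_add dirac_symbol_smult by (simp add: vec_eq_iff)
qed

text \<open>The double sum is added to its transpose, so that only anticommutators appear. The
  off-diagonal ones vanish, and the diagonal leaves twice the sum of the squared
  coefficients.\<close>

lemma dirac_symbol_square:
  fixes \<alpha> :: "'n::finite option \<Rightarrow> complex ^ 's ^ 's::finite"
  assumes ac: "\<And>j k. \<alpha> j ** \<alpha> k + \<alpha> k ** \<alpha> j = (if j = k then mat 2 else 0)"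
  shows "dirac_symbol \<alpha> m \<xi> (dirac_symbol \<alpha> m \<xi> v) = of_real ((norm \<xi>)\<^sup>2 + m\<^sup>2) *s v"
proof -
  define c where "c i = complex_of_real (dirac_coeff m \<xi> i)" for i
  define D where "D = dirac_symbol \<alpha> m \<xi> (dirac_symbol \<alpha> m \<xi> v)"
  have D1: "D = (\<Sum>i\<in>UNIV. \<Sum>j\<in>UNIV. (c i * c j) *s ((\<alpha> i ** \<alpha> j) *v v))"
  proof -
    have "\<alpha> i *v (\<Sum>j\<in>UNIV. c j *s (\<alpha> j *v v)) = (\<Sum>j\<in>UNIV. c j *s ((\<alpha> i ** \<alpha> j) *v v))" for i
      by (simp add: matrix_vector_mult_sum matrix_vector_smult matrix_vector_mul_assoc)
    then show ?thesis
      unfolding D_def dirac_symbol_def c_def[symmetric]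
      by (simp add: vec_eq_iff sum_distrib_left mult.assoc)
  qed
  have D2: "D = (\<Sum>i\<in>UNIV. \<Sum>j\<in>UNIV. (c i * c j) *s ((\<alpha> j ** \<alpha> i) *v v))"
    unfolding D1 by (subst sum.swap) (simp add: mult.commute)
  have "D + D = (\<Sum>i\<in>UNIV. \<Sum>j\<in>UNIV. (c i * c j) *s ((\<alpha> i ** \<alpha> j + \<alpha> j ** \<alpha> i) *v v))"
    by (subst (1) D1, subst D2) (simp add: sum.distrib[symmetric] matrix_vector_mult_add_rdistrib vector_add_ldistrib)
  also have "\<dots> = (\<Sum>i\<in>UNIV. \<Sum>j\<in>UNIV. if j = i then (c i * c j) *s (2 *s v) else 0)"
  proof (intro sum.cong refl)
    fix i j
    have "mat 2 *v v = 2 *s v" by (simp add: vec_eq_iff mat_def matrix_vector_mult_def if_distrib[where f="\<lambda>x. x * _"] cong: if_cong)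
    then show "(c i * c j) *s ((\<alpha> i ** \<alpha> j + \<alpha> j ** \<alpha> i) *v v) = (if j = i then (c i * c j) *s (2 *s v) else 0)"
      unfolding ac by auto
  qed
  also have "\<dots> = (\<Sum>i\<in>UNIV. (c i * c i) *s (2 *s v))" by simp
  also have "\<dots> = 2 *s ((\<Sum>i\<in>UNIV. c i * c i) *s v)"
    by (simp add: vec_eq_iff sum_distrib_left sum_distrib_right mult_ac)
  finally have "2 *s D = 2 *s ((\<Sum>i\<in>UNIV. c i * c i) *s v)" by (simp add: vec_eq_iff)
  then have "D = (\<Sum>i\<in>UNIV. c i * c i) *s v" by (simp add: vec_eq_iff)
  also have "(\<Sum>i\<in>UNIV. c i * c i) = of_real ((norm \<xi>)\<^sup>2 + m\<^sup>2)"
    unfolding norm_square_vec by (simp add: c_def sum_option_UNIV dirac_coeff_def power2_eq_square)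
  finally show ?thesis by (simp add: D_def)
qed

text \<open>A Hermitian involution is unitary: moving one factor across the inner product leaves
  \<open>A ** A\<close>.\<close>

lemma norm_unitary_matrix:
  fixes A :: "complex ^ 's ^ 's::finite"
  assumes sq: "A ** A = mat 1" and herm: "\<And>a b. A $ a $ b = cnj (A $ b $ a)"
  shows "norm (A *v v) = norm v"
proof -
  have n: "of_real ((norm v)\<^sup>2) = (\<Sum>a\<in>UNIV. v $ a * cnj (v $ a))" for v :: "complex ^ 's"
    by (simp add: norm_vec_def L2_set_def sum_nonneg complex_norm_square flip: of_real_power)
  have "of_real ((norm (A *v v))\<^sup>2) = (\<Sum>a\<in>UNIV. (A *v v) $ a * (\<Sum>b\<in>UNIV. A $ b $ a * cnj (v $ b)))"
    unfolding n by (intro sum.cong refl) (simp add: matrix_vector_mult_def, subst herm, simp)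
  also have "\<dots> = (\<Sum>b\<in>UNIV. (A *v (A *v v)) $ b * cnj (v $ b))"
    unfolding matrix_vector_mult_def[of A "A *v v"] by (simp add: sum_distrib_left sum_distrib_right, subst sum.swap) (simp add: mult_ac)
  also have "\<dots> = of_real ((norm v)\<^sup>2)" unfolding n by (simp add: matrix_vector_mul_assoc sq)
  finally show ?thesis by (simp only: of_real_eq_iff) simp
qed

lemma dirac_L2:
  assumes u: "u \<in> H1"
  shows "dirac \<alpha> m u \<in> L2"
  unfolding dirac_def[abs_def]
  by (intro L2_add L2_vec_cmult L2_sum L2_matrix wpd_spec(1)[OF u] H1_L2[OF u])

lemma vfourier_dirac:
  fixes \<alpha> :: "'n::finite option \<Rightarrow> complex ^ 's ^ 's::finite"
  assumes u: "u \<in> H1"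
  shows "AE \<xi> in lborel. vfourier (dirac \<alpha> m u) \<xi> = dirac_symbol \<alpha> m \<xi> (vfourier u \<xi>)"
proof -
  note w = wpd_spec(1)[OF u] and l = H1_L2[OF u]
  let ?g = "\<lambda>x. \<Sum>k\<in>UNIV. \<alpha> (Some k) *v wpd k u x"
  have g: "?g \<in> L2" by (intro L2_sum L2_matrix w)
  have "AE \<xi> in lborel. vfourier (dirac \<alpha> m u) \<xi> = vfourier (\<lambda>x. (- \<i>) *s ?g x) \<xi> + vfourier (\<lambda>x. of_real m *s (\<alpha> None *v u x)) \<xi>"
    unfolding dirac_def[abs_def] by (intro vfourier_add L2_vec_cmult g L2_matrix l)
  moreover have "AE \<xi> in lborel. vfourier (\<lambda>x. (- \<i>) *s ?g x) \<xi> = (- \<i>) *s vfourier ?g \<xi>"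
    by (rule vfourier_cmult[OF g])
  moreover have "AE \<xi> in lborel. vfourier ?g \<xi> = (\<Sum>k\<in>UNIV. vfourier (\<lambda>x. \<alpha> (Some k) *v wpd k u x) \<xi>)"
    by (intro vfourier_sum L2_matrix w)
  moreover have "AE \<xi> in lborel. \<forall>k\<in>UNIV. vfourier (\<lambda>x. \<alpha> (Some k) *v wpd k u x) \<xi> = \<alpha> (Some k) *v vfourier (wpd k u) \<xi>
      \<and> vfourier (wpd k u) \<xi> = (\<i> * of_real (\<xi> $ k)) *s vfourier u \<xi>"
    by (intro AE_finite_allI AE_conjI vfourier_matrix vfourier_wpd u w) auto
  moreover have "AE \<xi> in lborel. vfourier (\<lambda>x. of_real m *s (\<alpha> None *v u x)) \<xi> = of_real m *s vfourier (\<lambda>x. \<alpha> None *v u x) \<xi>"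
    by (intro vfourier_cmult L2_matrix l)
  moreover have "AE \<xi> in lborel. vfourier (\<lambda>x. \<alpha> None *v u x) \<xi> = \<alpha> None *v vfourier u \<xi>"
    by (rule vfourier_matrix[OF l])
  ultimately show ?thesis
  proof eventually_elim
    fix \<xi> :: "real ^ 'n"
    assume eqs: "vfourier (dirac \<alpha> m u) \<xi> = vfourier (\<lambda>x. (- \<i>) *s ?g x) \<xi> + vfourier (\<lambda>x. of_real m *s (\<alpha> None *v u x)) \<xi>"
      "vfourier (\<lambda>x. (- \<i>) *s ?g x) \<xi> = (- \<i>) *s vfourier ?g \<xi>"
      "vfourier ?g \<xi> = (\<Sum>k\<in>UNIV. vfourier (\<lambda>x. \<alpha> (Some k) *v wpd k u x) \<xi>)"
      and k: "\<forall>k\<in>UNIV. vfourier (\<lambda>x. \<alpha> (Some k) *v wpd k u x) \<xi> = \<alpha> (Some k) *v vfourier (wpd k u) \<xi>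
      \<and> vfourier (wpd k u) \<xi> = (\<i> * of_real (\<xi> $ k)) *s vfourier u \<xi>"
      and eqs2: "vfourier (\<lambda>x. of_real m *s (\<alpha> None *v u x)) \<xi> = of_real m *s vfourier (\<lambda>x. \<alpha> None *v u x) \<xi>"
      "vfourier (\<lambda>x. \<alpha> None *v u x) \<xi> = \<alpha> None *v vfourier u \<xi>"
    have "vfourier (\<lambda>x. \<alpha> (Some k) *v wpd k u x) \<xi> = (\<i> * of_real (\<xi> $ k)) *s (\<alpha> (Some k) *v vfourier u \<xi>)" for k
      using k[rule_format, of k] by (simp add: matrix_vector_smult)
    then have "vfourier (dirac \<alpha> m u) \<xi> = (- \<i>) *s (\<Sum>k\<in>UNIV. (\<i> * of_real (\<xi> $ k)) *s (\<alpha> (Some k) *v vfourier u \<xi>))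
        + of_real m *s (\<alpha> None *v vfourier u \<xi>)"
      unfolding eqs eqs2 by simp
    also have "\<dots> = dirac_symbol \<alpha> m \<xi> (vfourier u \<xi>)"
      unfolding dirac_symbol_eq by (simp add: vec_eq_iff sum_distrib_left sum_negf flip: mult.assoc)
    finally show "vfourier (dirac \<alpha> m u) \<xi> = dirac_symbol \<alpha> m \<xi> (vfourier u \<xi>)" .
  qed
qed

lemma dirac_shift_L2: "u \<in> H1 \<Longrightarrow> (\<lambda>x. dirac \<alpha> m u x - z *s u x) \<in> L2"
  by (intro L2_diff dirac_L2 L2_vec_cmult H1_L2)

lemma vfourier_dirac_shift:
  assumes u: "u \<in> H1"
  shows "AE \<xi> in lborel. vfourier (\<lambda>x. dirac \<alpha> m u x - z *s u x) \<xi> = dirac_symbol \<alpha> m \<xi> (vfourier u \<xi>) - z *s vfourier u \<xi>"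
  using vfourier_diff[OF dirac_L2[OF u, of \<alpha> m] L2_vec_cmult[OF H1_L2[OF u], of z]] vfourier_dirac[OF u, of \<alpha> m] vfourier_cmult[OF H1_L2[OF u], of z]
  by eventually_elim simp

lemma dirac_res_graph_iff_fourier:
  assumes f: "f \<in> L2" and u: "u \<in> H1"
  shows "dirac_res_graph \<alpha> m z f u \<longleftrightarrow> (AE \<xi> in lborel. dirac_symbol \<alpha> m \<xi> (vfourier u \<xi>) - z *s vfourier u \<xi> = vfourier f \<xi>)"
proof -
  have "dirac_res_graph \<alpha> m z f u \<longleftrightarrow> (AE \<xi> in lborel. vfourier (\<lambda>x. dirac \<alpha> m u x - z *s u x) \<xi> = vfourier f \<xi>)"
    unfolding dirac_res_graph_def vfourier_eq_iff[OF dirac_shift_L2[OF u] f] using f u by simp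
  also have "\<dots> \<longleftrightarrow> (AE \<xi> in lborel. dirac_symbol \<alpha> m \<xi> (vfourier u \<xi>) - z *s vfourier u \<xi> = vfourier f \<xi>)"
    using vfourier_dirac_shift[OF u, of \<alpha> m z] by (intro iffI) (erule (1) eventually_elim2, simp)+
  finally show ?thesis .
qed

section \<open>The Dirac resolvent equation, frequency by frequency\<close>

lemma dirac_matricesD:
  assumes "dirac_matrices \<alpha>"
  shows "\<alpha> j ** \<alpha> k + \<alpha> k ** \<alpha> j = (if j = k then mat 2 else 0)"
    and "\<alpha> j $ a $ b = cnj (\<alpha> j $ b $ a)"
    and "\<alpha> None = (\<chi> a b. if a = b then (case a of Inl _ \<Rightarrow> 1 | Inr _ \<Rightarrow> -1) else 0)"
    and "norm (\<alpha> j *v v) = norm v"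
proof -
  show ac: "\<alpha> j ** \<alpha> k + \<alpha> k ** \<alpha> j = (if j = k then mat 2 else 0)" for j k
    using assms unfolding dirac_matrices_def by blast
  show h: "\<alpha> j $ a $ b = cnj (\<alpha> j $ b $ a)" for a b
    using assms unfolding dirac_matrices_def by blast
  show "\<alpha> None = (\<chi> a b. if a = b then (case a of Inl _ \<Rightarrow> 1 | Inr _ \<Rightarrow> -1) else 0)"
    using assms unfolding dirac_matrices_def by blast
  have "\<alpha> j ** \<alpha> j = mat 1"
    using ac[of j j] by (auto simp: vec_eq_iff mat_def split: if_splits)
  then show "norm (\<alpha> j *v v) = norm v" using h by (rule norm_unitary_matrix)
qed

text \<open>Apply the symbol plus \<open>z\<close> to both sides. The square of the symbol is
  scalar, so the matrix equation turns into division by a scalar Helmholtz symbol.\<close>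

lemma dirac_symbol_shift_solve:
  fixes \<alpha> :: "'n::finite option \<Rightarrow> complex ^ 's ^ 's::finite"
  assumes ac: "\<And>j k. \<alpha> j ** \<alpha> k + \<alpha> k ** \<alpha> j = (if j = k then mat 2 else 0)"
    and eq: "dirac_symbol \<alpha> m \<xi> U - z *s U = F"
  shows "(of_real ((norm \<xi>)\<^sup>2) - (z\<^sup>2 - (of_real m)\<^sup>2)) *s U = dirac_symbol \<alpha> m \<xi> F + z *s F"
proof -
  have "dirac_symbol \<alpha> m \<xi> F + z *s F = of_real ((norm \<xi>)\<^sup>2 + m\<^sup>2) *s U - z *s (z *s U)"
    unfolding eq[symmetric] dirac_symbol_diff dirac_symbol_smult dirac_symbol_square[OF ac] by (simp add: vec_eq_iff algebra_simps)
  then show ?thesis by (simp add: vec_eq_iff algebra_simps power2_eq_square)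
qed

lemma norm_vector_smult: "norm (c *s (v :: complex ^ 's::finite)) = norm c * norm v"
  by (simp add: norm_vec_def L2_set_def norm_mult power_mult_distrib real_sqrt_mult flip: sum_distrib_left)

lemma norm_dirac_symbol_le:
  fixes \<alpha> :: "'n::finite option \<Rightarrow> complex ^ 's ^ 's::finite"
  assumes "\<And>j v. norm (\<alpha> j *v v) = norm v"
  shows "norm (dirac_symbol \<alpha> m \<xi> v) \<le> (\<Sum>i\<in>UNIV. \<bar>dirac_coeff m \<xi> i\<bar>) * norm v"
proof -
  have "norm (dirac_symbol \<alpha> m \<xi> v) \<le> (\<Sum>i\<in>UNIV. norm (of_real (dirac_coeff m \<xi> i) *s (\<alpha> i *v v)))"
    unfolding dirac_symbol_def by (rule norm_sum)
  then show ?thesis by (simp add: norm_vector_smult assms sum_distrib_right)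
qed

lemma norm_dirac_symbol_shift_le:
  fixes \<alpha> :: "'n::finite option \<Rightarrow> complex ^ 's ^ 's::finite"
  assumes "\<And>j v. norm (\<alpha> j *v v) = norm v" "m \<ge> 0"
  shows "norm (dirac_symbol \<alpha> m \<xi> v + z *s v) \<le> (real CARD('n) + m + norm z) * (1 + (norm \<xi>)\<^sup>2) * norm v"
proof -
  have "(\<Sum>i\<in>UNIV. \<bar>dirac_coeff m \<xi> i\<bar>) \<le> m + (\<Sum>k\<in>(UNIV::'n set). 1 + (norm \<xi>)\<^sup>2)"
    unfolding sum_option_UNIV using assms(2) by (intro add_mono sum_mono) (auto simp: dirac_coeff_def abs_vec_nth_le)
  also have "\<dots> = m * 1 + real CARD('n) * (1 + (norm \<xi>)\<^sup>2)" by simp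
  also have "\<dots> \<le> m * (1 + (norm \<xi>)\<^sup>2) + real CARD('n) * (1 + (norm \<xi>)\<^sup>2)"
    using assms(2) by (intro add_right_mono mult_left_mono) auto
  finally have 1: "(\<Sum>i\<in>UNIV. \<bar>dirac_coeff m \<xi> i\<bar>) \<le> (m + real CARD('n)) * (1 + (norm \<xi>)\<^sup>2)" by (simp add: distrib_right)
  have 2: "0 \<le> norm z * (norm \<xi>)\<^sup>2" by simp
  have "norm (dirac_symbol \<alpha> m \<xi> v + z *s v) \<le> (\<Sum>i\<in>UNIV. \<bar>dirac_coeff m \<xi> i\<bar>) * norm v + norm z * norm v"
    using norm_triangle_ineq[of "dirac_symbol \<alpha> m \<xi> v" "z *s v"] norm_dirac_symbol_le[of \<alpha> m \<xi> v] assms(1) by (simp add: norm_vector_smult)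
  also have "\<dots> = ((\<Sum>i\<in>UNIV. \<bar>dirac_coeff m \<xi> i\<bar>) + norm z) * norm v" by (simp add: distrib_right)
  also have "\<dots> \<le> ((real CARD('n) + m + norm z) * (1 + (norm \<xi>)\<^sup>2)) * norm v"
  proof (rule mult_right_mono)
    show "(\<Sum>i\<in>UNIV. \<bar>dirac_coeff m \<xi> i\<bar>) + norm z \<le> (real CARD('n) + m + norm z) * (1 + (norm \<xi>)\<^sup>2)"
      using add_mono[OF 1 2] by (simp add: algebra_simps)
  qed simp
  finally show ?thesis .
qed

text \<open>If z^2 - m^2 were some t >= 0, then \<open>z\<close> would be one of the two real
  numbers +-sqrt (t + m^2), both of modulus at least \<open>m\<close>. So the Laplace resolvent is
  available at z^2 - m^2.\<close>

lemma spectrum_square: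
  assumes "z \<notin> of_real ` {\<zeta>. \<bar>\<zeta>\<bar> \<ge> m}" "m \<ge> 0"
  shows "z\<^sup>2 - (of_real m)\<^sup>2 \<notin> complex_of_real ` {0..}"
proof
  assume "z\<^sup>2 - (of_real m)\<^sup>2 \<in> complex_of_real ` {0..}"
  then obtain t where t: "t \<ge> 0" "z\<^sup>2 - (of_real m)\<^sup>2 = of_real t" by auto
  define s where "s = sqrt (t + m\<^sup>2)"
  have s: "s \<ge> m" unfolding s_def using t assms(2) by (intro real_le_rsqrt) auto
  have "z\<^sup>2 = of_real (t + m\<^sup>2)" using t(2) by (simp add: algebra_simps)
  also have "\<dots> = (of_real s)\<^sup>2" using t(1) by (simp add: s_def flip: of_real_power)
  finally have "z = of_real s \<or> z = of_real (- s)" by (simp add: power2_eq_iff)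
  then show False using assms s by auto
qed

lemma dirac_res_graph_AE_solve:
  fixes \<alpha> :: "'n::finite option \<Rightarrow> complex ^ ('h::finite + 'h) ^ ('h + 'h)"
  assumes \<alpha>: "dirac_matrices \<alpha>" and g: "dirac_res_graph \<alpha> m z f u"
  shows "AE \<xi> in lborel. (of_real ((norm \<xi>)\<^sup>2) - (z\<^sup>2 - (of_real m)\<^sup>2)) *s vfourier u \<xi> = dirac_symbol \<alpha> m \<xi> (vfourier f \<xi>) + z *s vfourier f \<xi>"
proof -
  have "f \<in> L2" "u \<in> H1" using g by (auto simp: dirac_res_graph_def)
  from g[unfolded dirac_res_graph_iff_fourier[OF this]] show ?thesis
    by eventually_elim (rule dirac_symbol_shift_solve[OF dirac_matricesD(1)[OF \<alpha>]])
qed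

lemma dirac_res_graph_diff:
  assumes "dirac_res_graph \<alpha> m z f u" "dirac_res_graph \<alpha> m z g v"
  shows "dirac_res_graph \<alpha> m z (\<lambda>x. f x - g x) (\<lambda>x. u x - v x)"
proof -
  have f: "f \<in> L2" "u \<in> H1" and g: "g \<in> L2" "v \<in> H1" using assms by (auto simp: dirac_res_graph_def)
  have d: "(\<lambda>x. f x - g x) \<in> L2" by (intro L2_diff f g)
  have "(\<lambda>x. (u x - v x) $ a) \<in> H1" for a
    using H1_add[of "\<lambda>x. u x $ a" "\<lambda>x. (- 1) * v x $ a"] H1_cmult[of "\<lambda>x. v x $ a" "- 1"] f(2) g(2) by (simp add: H1_vec_iff[of u] H1_vec_iff[of v])
  then have h: "(\<lambda>x. u x - v x) \<in> H1" unfolding H1_vec_iff[of "\<lambda>x. u x - v x"] by blast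
  show ?thesis
    unfolding dirac_res_graph_iff_fourier[OF d h]
    using assms(1)[unfolded dirac_res_graph_iff_fourier[OF f]] assms(2)[unfolded dirac_res_graph_iff_fourier[OF g]]
      vfourier_diff[OF f(1) g(1)] vfourier_diff[OF H1_L2[OF f(2)] H1_L2[OF g(2)]]
    by eventually_elim (simp add: dirac_symbol_diff vector_ssub_ldistrib diff_eq_eq)
qed

text \<open>The symbol plus \<open>z\<close> grows at most like 1 + |xi|^2, which the Helmholtz
  denominator absorbs. This one pointwise inequality gives both uniqueness and boundedness of the
  Dirac resolvent.\<close>

lemma dirac_res_graph_weighted_bound:
  fixes \<alpha> :: "'n::finite option \<Rightarrow> complex ^ ('h::finite + 'h) ^ ('h + 'h)"
  assumes \<alpha>: "dirac_matrices \<alpha>" and m: "m \<ge> 0" and z: "z \<notin> of_real ` {\<zeta>. \<bar>\<zeta>\<bar> \<ge> m}"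
  obtains c where "c > 0" "\<And>f u. dirac_res_graph \<alpha> m z f u \<Longrightarrow> AE \<xi> in lborel. norm (vfourier u \<xi>) \<le> c * norm (vfourier f \<xi>)"
proof -
  obtain K where K: "K > 0" and nz: "\<And>\<xi> :: real ^ 'n. of_real ((norm \<xi>)\<^sup>2) - (z\<^sup>2 - (of_real m)\<^sup>2) \<noteq> 0"
    and le: "\<And>\<xi> :: real ^ 'n. 1 + (norm \<xi>)\<^sup>2 \<le> K * cmod (of_real ((norm \<xi>)\<^sup>2) - (z\<^sup>2 - (of_real m)\<^sup>2))"
    using helmholtz_symbol_facts[OF spectrum_square[OF z m]] by metis
  define B where "B = real CARD('n) + m + norm z"
  have B: "B > 0" using m by (simp add: B_def add_pos_nonneg)
  have "AE \<xi> in lborel. norm (vfourier u \<xi>) \<le> B * K * norm (vfourier f \<xi>)" if g: "dirac_res_graph \<alpha> m z f u" for f u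
    using dirac_res_graph_AE_solve[OF \<alpha> g]
  proof eventually_elim
    fix \<xi> :: "real ^ 'n"
    let ?q = "of_real ((norm \<xi>)\<^sup>2) - (z\<^sup>2 - (of_real m)\<^sup>2)"
    assume eq: "?q *s vfourier u \<xi> = dirac_symbol \<alpha> m \<xi> (vfourier f \<xi>) + z *s vfourier f \<xi>"
    have "cmod ?q * norm (vfourier u \<xi>) = norm (dirac_symbol \<alpha> m \<xi> (vfourier f \<xi>) + z *s vfourier f \<xi>)"
      unfolding eq[symmetric] norm_vector_smult ..
    also have "\<dots> \<le> B * (1 + (norm \<xi>)\<^sup>2) * norm (vfourier f \<xi>)"
      unfolding B_def by (rule norm_dirac_symbol_shift_le[OF dirac_matricesD(4)[OF \<alpha>] m])
    also have "\<dots> \<le> B * (K * cmod ?q) * norm (vfourier f \<xi>)"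
      using B by (intro mult_right_mono mult_left_mono le) auto
    finally have "cmod ?q * norm (vfourier u \<xi>) \<le> cmod ?q * (B * K * norm (vfourier f \<xi>))" by (simp only: mult_ac)
    then show "norm (vfourier u \<xi>) \<le> B * K * norm (vfourier f \<xi>)"
      using nz[of \<xi>] by (subst (asm) mult_le_cancel_left_pos) (auto simp del: of_real_power)
  qed
  moreover have "B * K > 0" using B K by simp
  ultimately show thesis using that by blast
qed

lemma dirac_res_graph_unique:
  fixes \<alpha> :: "'n::finite option \<Rightarrow> complex ^ ('h::finite + 'h) ^ ('h + 'h)"
  assumes \<alpha>: "dirac_matrices \<alpha>" and m: "m \<ge> 0" and z: "z \<notin> of_real ` {\<zeta>. \<bar>\<zeta>\<bar> \<ge> m}"
    and "dirac_res_graph \<alpha> m z f u" "dirac_res_graph \<alpha> m z f v"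
  shows "AE x in lborel. u x = v x"
proof -
  obtain c where c: "\<And>f u. dirac_res_graph \<alpha> m z f u \<Longrightarrow> AE \<xi> in lborel. norm (vfourier u \<xi>) \<le> c * norm (vfourier f \<xi>)"
    using dirac_res_graph_weighted_bound[OF \<alpha> m z] by metis
  have u: "u \<in> L2" "v \<in> L2" using assms(4,5) by (auto simp: dirac_res_graph_def H1_L2)
  have "vfourier (\<lambda>x::real^'n. 0 :: complex ^ ('h + 'h)) = (\<lambda>\<xi>. \<chi> a. fourier (\<lambda>x. 0) \<xi>)" by (simp add: vfourier_def fun_eq_iff)
  then have "AE \<xi> in lborel. vfourier (\<lambda>x::real^'n. 0 :: complex ^ ('h + 'h)) \<xi> = 0"
    using fourier_zero by (auto simp: vec_eq_iff elim: eventually_mono)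
  with c[OF dirac_res_graph_diff[OF assms(4,5)]] vfourier_diff[OF u]
  have "AE \<xi> in lborel. vfourier u \<xi> = vfourier v \<xi>"
    by eventually_elim simp
  then show ?thesis using vfourier_eq_iff[OF u] by blast
qed

text \<open>\<open>(D\<^sub>0 - z)\<^sup>-\<^sup>1 = (D\<^sub>0 + z) (- \<Delta> - (z\<^sup>2 - m\<^sup>2))\<^sup>-\<^sup>1\<close>, with \<open>dl k = \<partial>\<^sub>k l\<close>.\<close>

definition dirac_of_laplace ::
    "('n::finite option \<Rightarrow> complex ^ 's ^ 's::finite) \<Rightarrow> real \<Rightarrow> complex \<Rightarrow> ('s \<Rightarrow> real ^ 'n \<Rightarrow> complex) \<Rightarrow>
     ('n \<Rightarrow> 's \<Rightarrow> real ^ 'n \<Rightarrow> complex) \<Rightarrow> real ^ 'n \<Rightarrow> complex ^ 's" where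
  "dirac_of_laplace \<alpha> m z l dl x =
    (\<Sum>k\<in>UNIV. (- \<i>) *s (\<alpha> (Some k) *v (\<chi> a. dl k a x)))
    + (of_real m *s (\<alpha> None *v (\<chi> a. l a x)) + z *s (\<chi> a. l a x))"

lemma dirac_of_laplace_component:
  "dirac_of_laplace \<alpha> m z l dl x $ a =
    (\<Sum>k\<in>UNIV. \<Sum>b\<in>UNIV. (- \<i> * \<alpha> (Some k) $ a $ b) * dl k b x)
    + ((\<Sum>b\<in>UNIV. (of_real m * \<alpha> None $ a $ b) * l b x) + z * l a x)"
  by (simp add: dirac_of_laplace_def matrix_vector_mult_def sum_distrib_left mult.assoc sum_negf)

text \<open>Of the two derivatives that the Laplace solutions possess, one is spent on the Dirac
  operator and the other leaves the result in \<open>H1\<close>. The equation itself is checked on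
  the Fourier side, where the symbol minus \<open>z\<close> times the symbol plus \<open>z\<close>
  is the scalar |xi|^2 + m^2 - z^2.\<close>

lemma dirac_of_laplace_res_graph:
  fixes \<alpha> :: "'n::finite option \<Rightarrow> complex ^ ('h::finite + 'h) ^ ('h + 'h)"
  assumes \<alpha>: "dirac_matrices \<alpha>" and f: "f \<in> L2"
    and l: "\<And>a. laplace_res_graph (z\<^sup>2 - (of_real m)\<^sup>2) (\<lambda>x. f x $ a) (l a)"
  shows "dirac_res_graph \<alpha> m z f (dirac_of_laplace \<alpha> m z l (\<lambda>k a. wpd k (l a)))" (is "dirac_res_graph \<alpha> m z f ?u")
proof -
  have l2: "l a \<in> H2" for a using l[of a] by (simp add: laplace_res_graph_def)
  note l1 = H2_D(1)[OF l2]
  define L where "L x = (\<chi> a. l a x)" for x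
  have L: "L \<in> H1" unfolding H1_vec_iff[of L] by (simp add: L_def l1)
  have u: "?u \<in> H1"
    unfolding H1_vec_iff[of ?u] dirac_of_laplace_component
    by (intro allI H1_add H1_sum H1_cmult l1 H2_D(2)[OF l2])
  have "AE x in lborel. \<forall>k\<in>UNIV. \<forall>a\<in>UNIV. wpd k L x $ a = wpd k (l a) x"
    using wpd_vec_component[OF L] by (intro AE_finite_allI) (auto simp: L_def)
  \<comment> \<open>The plus sign is written as a shift by \<open>- z\<close>, so that the transform
    formula already proved for the Dirac operator minus a scalar applies to \<open>L\<close> as
    well.\<close>
  then have eq: "AE x in lborel. ?u x = dirac \<alpha> m L x - (- z) *s L x"
  proof eventually_elim
    fix x assume "\<forall>k\<in>UNIV. \<forall>a\<in>UNIV. wpd k L x $ a = wpd k (l a) x"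
    then have "(\<chi> a. wpd k (l a) x) = wpd k L x" for k by (simp add: vec_eq_iff)
    then show "?u x = dirac \<alpha> m L x - (- z) *s L x"
      by (simp add: dirac_of_laplace_def dirac_def L_def[symmetric] vec_eq_iff sum_distrib_left sum_negf)
  qed
  have "AE \<xi> in lborel. vfourier ?u \<xi> = vfourier (\<lambda>x. dirac \<alpha> m L x - (- z) *s L x) \<xi>"
    using vfourier_eq_iff[OF H1_L2[OF u] dirac_shift_L2[OF L]] eq by blast
  moreover have "AE \<xi> in lborel. \<forall>a\<in>UNIV. (of_real ((norm \<xi>)\<^sup>2) - (z\<^sup>2 - (of_real m)\<^sup>2)) * fourier (l a) \<xi> = fourier (\<lambda>x. f x $ a) \<xi>"
    by (intro AE_finite_allI laplace_res_graph_fourier l) auto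
  moreover note vfourier_dirac_shift[OF L, of \<alpha> m "- z"]
  ultimately have "AE \<xi> in lborel. dirac_symbol \<alpha> m \<xi> (vfourier ?u \<xi>) - z *s vfourier ?u \<xi> = vfourier f \<xi>"
  proof eventually_elim
    fix \<xi> :: "real ^ 'n"
    assume a: "vfourier ?u \<xi> = vfourier (\<lambda>x. dirac \<alpha> m L x - (- z) *s L x) \<xi>"
      and b: "\<forall>a\<in>UNIV. (of_real ((norm \<xi>)\<^sup>2) - (z\<^sup>2 - (of_real m)\<^sup>2)) * fourier (l a) \<xi> = fourier (\<lambda>x. f x $ a) \<xi>"
      and c: "vfourier (\<lambda>x. dirac \<alpha> m L x - (- z) *s L x) \<xi> = dirac_symbol \<alpha> m \<xi> (vfourier L \<xi>) - (- z) *s vfourier L \<xi>"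
    have "dirac_symbol \<alpha> m \<xi> (vfourier ?u \<xi>) - z *s vfourier ?u \<xi>
      = of_real ((norm \<xi>)\<^sup>2 + m\<^sup>2) *s vfourier L \<xi> - z *s (z *s vfourier L \<xi>)"
      unfolding a c dirac_symbol_diff dirac_symbol_smult dirac_symbol_square[OF dirac_matricesD(1)[OF \<alpha>]]
      by (simp add: vec_eq_iff algebra_simps)
    also have "\<dots> = (of_real ((norm \<xi>)\<^sup>2) - (z\<^sup>2 - (of_real m)\<^sup>2)) *s vfourier L \<xi>"
      by (simp add: vec_eq_iff algebra_simps power2_eq_square)
    also have "\<dots> = vfourier f \<xi>"
      using b by (simp only: vec_eq_iff vector_smult_component vfourier_def L_def vec_lambda_beta) simp
    finally show "dirac_symbol \<alpha> m \<xi> (vfourier ?u \<xi>) - z *s vfourier ?u \<xi> = vfourier f \<xi>" .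
  qed
  then show ?thesis using dirac_res_graph_iff_fourier[OF f u] by blast
qed

text \<open>Existence comes from the Laplace resolvents of the components, and the operator bound is
  the pointwise bound of the transforms read through Plancherel.\<close>

lemma dirac_resolvent_set_supset:
  fixes \<alpha> :: "'n::finite option \<Rightarrow> complex ^ ('h::finite + 'h) ^ ('h + 'h)"
  assumes \<alpha>: "dirac_matrices \<alpha>" and m: "m \<ge> 0" and z: "z \<notin> of_real ` {\<zeta>. \<bar>\<zeta>\<bar> \<ge> m}"
  shows "z \<in> dirac_resolvent_set \<alpha> m"
proof -
  obtain c where c0: "c > 0" and c: "\<And>f u. dirac_res_graph \<alpha> m z f u \<Longrightarrow> AE \<xi> in lborel. norm (vfourier u \<xi>) \<le> c * norm (vfourier f \<xi>)"
    using dirac_res_graph_weighted_bound[OF \<alpha> m z] by metis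
  have "\<exists>u. dirac_res_graph \<alpha> m z f u" if f: "f \<in> L2" for f
  proof -
    have "\<forall>a. \<exists>u. laplace_res_graph (z\<^sup>2 - (of_real m)\<^sup>2) (\<lambda>x. f x $ a) u"
      by (intro allI laplace_res_graph_ex spectrum_square z m L2_component f)
    then obtain l where "\<And>a. laplace_res_graph (z\<^sup>2 - (of_real m)\<^sup>2) (\<lambda>x. f x $ a) (l a)" by metis
    from dirac_of_laplace_res_graph[OF \<alpha> f this] show ?thesis by blast
  qed
  moreover have "L2_norm lborel u \<le> ennreal c * L2_norm lborel f" if g: "dirac_res_graph \<alpha> m z f u" for f u
  proof -
    have fu: "f \<in> L2" "u \<in> L2" using g by (auto simp: dirac_res_graph_def H1_L2)
    have [measurable]: "vfourier f \<in> borel_measurable borel" using vfourier_L2[OF fu(1)] by auto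
    have "L2_norm lborel (vfourier u) \<le> L2_norm lborel (\<lambda>\<xi>. c *\<^sub>R vfourier f \<xi>)"
      using c[OF g] c0 by (intro L2_norm_mono_AE) auto
    also have "\<dots> = ennreal c * L2_norm lborel (vfourier f)"
      by (rule L2_norm_scale) (use c0 in auto)
    finally show ?thesis by (simp add: L2_norm_vfourier fu)
  qed
  ultimately show ?thesis
    unfolding dirac_resolvent_set_def using dirac_res_graph_unique[OF \<alpha> m z] by blast
qed

text \<open>Placing the frequency on axis \<open>k\<close> with |xi|^2 = zeta^2 - m^2 makes the
  square of the symbol equal to zeta^2, so the symbol plus zeta maps every vector to a solution of
  the eigenvalue equation. If it kills \<open>v0\<close>, then \<open>v0\<close> belongs to -zeta;
  the matrix of a second direction \<open>l\<close>, whose coefficient is 0, anticommutes with the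
  symbol and carries \<open>v0\<close> to an eigenvector for zeta.\<close>

lemma dirac_symbol_eigenvector:
  fixes \<alpha> :: "'n::finite option \<Rightarrow> complex ^ ('h::finite + 'h) ^ ('h + 'h)"
  assumes \<alpha>: "dirac_matrices \<alpha>" and card: "CARD('n) \<ge> 2" and m: "m \<ge> 0" and \<zeta>: "\<bar>\<zeta>\<bar> \<ge> m"
  obtains \<xi> v where "v \<noteq> 0" "dirac_symbol \<alpha> m \<xi> v = of_real \<zeta> *s v"
proof -
  obtain k l :: 'n where kl: "k \<noteq> l"
  proof -
    have "\<not> (\<forall>x y :: 'n. x = y)" using card card_1_singleton_iff[of "UNIV :: 'n set"]
      by (metis (full_types) UNIV_eq_I card_1_singleton_iff insertI1 not_less_eq_eq numeral_2_eq_2 order_refl One_nat_def singletonI)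
    then show thesis using that by blast
  qed
  note ac = dirac_matricesD(1)[OF \<alpha>] and unit = dirac_matricesD(4)[OF \<alpha>]
  define \<xi> where "\<xi> = sqrt (\<zeta>\<^sup>2 - m\<^sup>2) *\<^sub>R axis k (1::real)"
  have "\<zeta>\<^sup>2 \<ge> m\<^sup>2" using \<zeta> m by (metis abs_le_square_iff abs_of_nonneg)
  then have n: "(norm \<xi>)\<^sup>2 + m\<^sup>2 = \<zeta>\<^sup>2" by (simp add: \<xi>_def power_mult_distrib)
  let ?D = "dirac_symbol \<alpha> m \<xi>"
  have sq: "?D (?D v) = of_real (\<zeta>\<^sup>2) *s v" for v using dirac_symbol_square[OF ac, of m \<xi> v] n by simp
  define v0 :: "complex ^ ('h + 'h)" where "v0 = axis undefined 1"
  have v0: "v0 \<noteq> 0" by (simp add: v0_def axis_eq_0_iff)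
  show thesis
  proof (cases "?D v0 + of_real \<zeta> *s v0 = 0")
    case False
    have "?D (?D v0 + of_real \<zeta> *s v0) = of_real \<zeta> *s (?D v0 + of_real \<zeta> *s v0)"
      unfolding dirac_symbol_add dirac_symbol_smult sq by (simp add: vec_eq_iff algebra_simps power2_eq_square)
    then show thesis using that False by blast
  next
    case True
    then have Dv0: "?D v0 = - (of_real \<zeta> *s v0)" by (simp add: eq_neg_iff_add_eq_0)
    have anti: "?D (\<alpha> (Some l) *v v) = - (\<alpha> (Some l) *v ?D v)" for v
    proof -
      have "of_real (dirac_coeff m \<xi> i) *s (\<alpha> i *v (\<alpha> (Some l) *v v)) = - (\<alpha> (Some l) *v (of_real (dirac_coeff m \<xi> i) *s (\<alpha> i *v v)))" for i
      proof (cases "i = Some l")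
        case True
        then show ?thesis using kl by (simp add: dirac_coeff_def \<xi>_def axis_def)
      next
        case False
        then have "\<alpha> i ** \<alpha> (Some l) = - (\<alpha> (Some l) ** \<alpha> i)" using ac[of i "Some l"] by (simp add: eq_neg_iff_add_eq_0)
        then have "\<alpha> i *v (\<alpha> (Some l) *v v) = - (\<alpha> (Some l) *v (\<alpha> i *v v))"
          by (simp add: matrix_vector_mul_assoc) (simp add: vec_eq_iff matrix_vector_mult_def sum_negf)
        then show ?thesis by (simp add: matrix_vector_smult vec_eq_iff)
      qed
      then show ?thesis unfolding dirac_symbol_def matrix_vector_mult_sum by (simp add: sum_negf)
    qed
    have "?D (\<alpha> (Some l) *v v0) = of_real \<zeta> *s (\<alpha> (Some l) *v v0)"
      unfolding anti Dv0 by (simp add: vec_eq_iff matrix_vector_mult_def sum_distrib_left sum_negf mult_ac)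
    moreover have "\<alpha> (Some l) *v v0 \<noteq> 0" using unit[of "Some l" v0] v0 by auto
    ultimately show thesis using that by blast
  qed
qed

text \<open>A function with transform a constant eigenvector on a small box around a frequency where \<open>\<zeta>\<close> is
  an eigenvalue of the symbol contradicts the resolvent bound.\<close>

lemma dirac_resolvent_set_subset:
  fixes \<alpha> :: "'n::finite option \<Rightarrow> complex ^ ('h::finite + 'h) ^ ('h + 'h)"
  assumes \<alpha>: "dirac_matrices \<alpha>" and card: "CARD('n) \<ge> 2" and m: "m \<ge> 0" and \<zeta>: "\<bar>\<zeta>\<bar> \<ge> m"
  shows "of_real \<zeta> \<notin> dirac_resolvent_set \<alpha> m"
proof
  assume "of_real \<zeta> \<in> dirac_resolvent_set \<alpha> m"
  then obtain c where c: "\<And>f u. dirac_res_graph \<alpha> m (of_real \<zeta>) f u \<Longrightarrow> L2_norm lborel u \<le> ennreal c * L2_norm lborel f"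
    unfolding dirac_resolvent_set_def by blast
  obtain \<xi>0 v where v: "v \<noteq> 0" and eig: "dirac_symbol \<alpha> m \<xi>0 v = of_real \<zeta> *s v"
    using dirac_symbol_eigenvector[OF \<alpha> card m \<zeta>] by blast
  \<comment> \<open>On a box of half-width \<open>e\<close> the symbol deviates from its value at
    the centre by at most n e. The choice makes |c| n e at most 1/2, so that the resolvent bound
    would give that the norm of \<open>u\<close> is at most half of itself.\<close>
  define e where "e = 1 / (2 * real CARD('n) * (\<bar>c\<bar> + 1))"
  have e: "e > 0" by (simp add: e_def)
  have "real CARD('n) * e = 1 / (2 * (\<bar>c\<bar> + 1))" by (simp add: e_def)
  then have ce: "\<bar>c\<bar> * (real CARD('n) * e) \<le> 1 / 2"
    using abs_add_one_gt_zero[of c] by (simp add: divide_le_eq add.commute)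
  define B where "B = box (\<xi>0 - (\<chi> i. e)) (\<xi>0 + (\<chi> i. e))"
  have B: "\<bar>\<xi> $ i - \<xi>0 $ i\<bar> < e" if "\<xi> \<in> B" for \<xi> i
    using that by (auto simp: B_def mem_box_cart abs_less_iff) (smt (verit))+
  have "bounded B" by (simp add: B_def)
  then obtain r where r: "B \<subseteq> cball 0 r" by (auto simp: bounded_iff subset_eq)
  have [measurable]: "B \<in> sets borel" by (simp add: B_def)
  have ind: "(\<lambda>\<xi>. indicator B \<xi> * s \<xi>) \<in> L2" if "\<And>\<xi>. \<xi> \<in> B \<Longrightarrow> norm (s \<xi>) \<le> K" "s \<in> borel_measurable borel" for s :: "real ^ 'n \<Rightarrow> complex" and K
    by (rule L2_bound[OF indicator_cball_L2[of r "1::complex"], where K="\<bar>K\<bar>"])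
       (use that r in \<open>auto simp: indicator_def subset_eq intro!: AE_I2 order_trans[OF _ abs_ge_self]\<close>)
  define u :: "real ^ 'n \<Rightarrow> complex ^ ('h + 'h)" where "u x = (\<chi> a. inv_fourier (\<lambda>\<xi>. indicator B \<xi> * v $ a) x)" for x
  have i: "(\<lambda>\<xi>. indicator B \<xi> * v $ a) \<in> L2" for a by (rule ind[where K="norm (v $ a)"]) auto
  have ua: "(\<lambda>x. u x $ a) \<in> L2" "AE \<xi> in lborel. fourier (\<lambda>x. u x $ a) \<xi> = indicator B \<xi> * v $ a" for a
    unfolding u_def using inv_fourier_L2[OF i[of a]] fourier_inv_fourier[OF i[of a]] by auto
  have "(\<lambda>x. u x $ a) \<in> H1" for a
  proof (rule H1_fourierI[OF ua(1)])
    fix k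
    have "(\<lambda>\<xi>. indicator B \<xi> * (\<i> * of_real (\<xi> $ k) * v $ a)) \<in> L2"
    proof (rule ind[where K="(\<bar>\<xi>0 $ k\<bar> + e) * norm (v $ a)"])
      fix \<xi> assume "\<xi> \<in> B"
      then have "\<bar>\<xi> $ k\<bar> \<le> \<bar>\<xi>0 $ k\<bar> + e" using B[of \<xi> k] by linarith
      then show "norm (\<i> * of_real (\<xi> $ k) * v $ a) \<le> (\<bar>\<xi>0 $ k\<bar> + e) * norm (v $ a)"
        by (simp add: norm_mult mult_right_mono)
    qed measurable
    moreover have "AE \<xi> in lborel. \<i> * of_real (\<xi> $ k) * fourier (\<lambda>x. u x $ a) \<xi> = indicator B \<xi> * (\<i> * of_real (\<xi> $ k) * v $ a)"
      using ua(2)[of a] by eventually_elim simp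
    moreover have "(\<lambda>\<xi>. \<i> * of_real (\<xi> $ k) * fourier (\<lambda>x. u x $ a) \<xi>) \<in> borel_measurable borel"
      using fourier_L2[OF ua(1)[of a]] by measurable
    ultimately show "(\<lambda>\<xi>. \<i> * of_real (\<xi> $ k) * fourier (\<lambda>x. u x $ a) \<xi>) \<in> L2"
      by (rule L2_cong_AE_measurable)
  qed
  then have u: "u \<in> H1" unfolding H1_vec_iff[of u] by blast
  have U: "AE \<xi> in lborel. vfourier u \<xi> = indicator B \<xi> *s v"
    unfolding AE_vec_eq_iff using ua(2) by (simp add: vfourier_def)
  define f where "f x = dirac \<alpha> m u x - of_real \<zeta> *s u x" for x
  have f: "f \<in> L2" unfolding f_def[abs_def] by (rule dirac_shift_L2[OF u])
  have g: "dirac_res_graph \<alpha> m (of_real \<zeta>) f u" using f u by (simp add: dirac_res_graph_def f_def)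
  have [measurable]: "vfourier u \<in> borel_measurable borel" using vfourier_L2[OF H1_L2[OF u]] by auto
  have "AE \<xi> in lborel. norm (vfourier f \<xi>) \<le> norm ((real CARD('n) * e) *\<^sub>R vfourier u \<xi>)"
    using vfourier_dirac_shift[OF u, of \<alpha> m "of_real \<zeta>"] U
  proof eventually_elim
    fix \<xi> :: "real ^ 'n"
    assume a: "vfourier (\<lambda>x. dirac \<alpha> m u x - of_real \<zeta> *s u x) \<xi> = dirac_symbol \<alpha> m \<xi> (vfourier u \<xi>) - of_real \<zeta> *s vfourier u \<xi>"
      and b: "vfourier u \<xi> = indicator B \<xi> *s v"
    have F: "vfourier f \<xi> = indicator B \<xi> *s (dirac_symbol \<alpha> m \<xi> v - dirac_symbol \<alpha> m \<xi>0 v)"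
      unfolding f_def[abs_def] a b dirac_symbol_smult eig by (simp add: vec_eq_iff algebra_simps)
    \<comment> \<open>The mass terms cancel, so the difference of the symbols at two frequencies is
      the massless symbol at their difference, whose coefficients are below \<open>e\<close> on the
      box.\<close>
    have D: "dirac_symbol \<alpha> m \<xi> v - dirac_symbol \<alpha> m \<xi>0 v = dirac_symbol \<alpha> 0 (\<xi> - \<xi>0) v"
      by (simp add: dirac_symbol_eq vec_eq_iff algebra_simps sum_subtractf)
    show "norm (vfourier f \<xi>) \<le> norm ((real CARD('n) * e) *\<^sub>R vfourier u \<xi>)"
    proof (cases "\<xi> \<in> B")
      case True
      have "(\<Sum>i\<in>UNIV. \<bar>dirac_coeff 0 (\<xi> - \<xi>0) i\<bar>) \<le> 0 + (\<Sum>k\<in>(UNIV::'n set). e)"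
        unfolding sum_option_UNIV using B[OF True] by (intro add_mono sum_mono) (auto simp: dirac_coeff_def less_imp_le)
      then have "(\<Sum>i\<in>UNIV. \<bar>dirac_coeff 0 (\<xi> - \<xi>0) i\<bar>) * norm v \<le> (real CARD('n) * e) * norm v"
        by (intro mult_right_mono) auto
      then have "norm (dirac_symbol \<alpha> 0 (\<xi> - \<xi>0) v) \<le> (real CARD('n) * e) * norm v"
        by (rule order_trans[rotated]) (rule norm_dirac_symbol_le, rule dirac_matricesD(4)[OF \<alpha>])
      then show ?thesis unfolding F D b using True e by (simp add: norm_vector_smult)
    qed (simp add: F)
  qed
  then have "L2_norm lborel (vfourier f) \<le> L2_norm lborel (\<lambda>\<xi>. (real CARD('n) * e) *\<^sub>R vfourier u \<xi>)"
    by (rule L2_norm_mono_AE)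
  also have "\<dots> = ennreal (real CARD('n) * e) * L2_norm lborel (vfourier u)"
    by (rule L2_norm_scale) (use e in auto)
  finally have fN: "L2_norm lborel f \<le> ennreal (real CARD('n) * e) * L2_norm lborel u"
    by (simp add: L2_norm_vfourier f H1_L2[OF u])
  have fin: "L2_norm lborel u < \<infinity>" by (rule L2_norm_less_top[OF H1_L2[OF u]])
  have "L2_norm lborel u \<le> ennreal c * L2_norm lborel f" by (rule c[OF g])
  also have "\<dots> \<le> ennreal \<bar>c\<bar> * (ennreal (real CARD('n) * e) * L2_norm lborel u)"
    by (intro mult_mono fN ennreal_leI) auto
  also have "\<dots> = ennreal (\<bar>c\<bar> * (real CARD('n) * e)) * L2_norm lborel u"
    using e by (simp add: ennreal_mult mult.assoc)
  also have "\<dots> \<le> ennreal (1 / 2) * L2_norm lborel u" by (intro mult_right_mono ennreal_leI ce) auto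
  finally have half: "L2_norm lborel u \<le> ennreal (1 / 2) * L2_norm lborel u" .
  have "L2_norm lborel u = 0"
  proof -
    obtain x where x: "L2_norm lborel u = ennreal x" "x \<ge> 0" using fin by (cases "L2_norm lborel u") auto
    have "ennreal (1 / 2 * x) = ennreal (1 / 2) * ennreal x" using x(2) by (intro ennreal_mult) auto
    with half have "ennreal x \<le> ennreal (1 / 2 * x)" by (simp only: x(1))
    then have "x \<le> 1 / 2 * x" using x(2) by (subst (asm) ennreal_le_iff) auto
    then show ?thesis using x by simp
  qed
  then have "L2_norm lborel (vfourier u) = 0" by (simp add: L2_norm_vfourier H1_L2[OF u])
  then have "AE \<xi> in lborel. vfourier u \<xi> = 0" by (subst (asm) L2_norm_eq_0_iff) auto
  with U have "AE \<xi> in lborel. \<xi> \<notin> B"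
    by eventually_elim (use v in \<open>auto simp: indicator_def split: if_splits\<close>)
  then have "emeasure lborel B = 0" by (subst (asm) AE_iff_measurable[OF _ refl]) auto
  moreover have "emeasure lborel B > 0" unfolding B_def using e by (intro box_vec_not_null) auto
  ultimately show False by simp
qed

lemma dirac_resolvent_set_eq:
  fixes \<alpha> :: "'n::finite option \<Rightarrow> complex ^ ('h::finite + 'h) ^ ('h + 'h)"
  assumes "dirac_matrices \<alpha>" "CARD('n) \<ge> 2" "m \<ge> 0"
  shows "dirac_resolvent_set \<alpha> m = - (of_real ` {\<zeta>. \<bar>\<zeta>\<bar> \<ge> m})"
  using dirac_resolvent_set_supset[OF assms(1,3)] dirac_resolvent_set_subset[OF assms] by blast

section \<open>Continuous extension of the resolvents\<close>

text \<open>The two kinds of norm through which resolvents are extended, treated together. What the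
  arguments use of them is monotonicity, subadditivity, approximation by truncations and that they
  dominate \<open>L1L2_norm j\<close>.\<close>

definition mixed_or_X :: "((real ^ 'n::finite \<Rightarrow> 'b::{banach, second_countable_topology}) \<Rightarrow> ennreal) \<Rightarrow> 'n \<Rightarrow> bool" where
  "mixed_or_X nrm j \<longleftrightarrow> nrm = L1L2_norm j \<or> nrm = X_norm"

lemma mixed_or_X_ge: "mixed_or_X nrm j \<Longrightarrow> L1L2_norm j f \<le> nrm f"
  by (auto simp: mixed_or_X_def X_norm_ge)

lemma X_space_iff: "f \<in> X_space \<longleftrightarrow> f \<in> borel_measurable borel \<and> X_norm f < \<infinity>"
proof
  assume "f \<in> X_space"
  then show "f \<in> borel_measurable borel \<and> X_norm f < \<infinity>"
    using X_norm_less_top by (auto simp: X_space_def L1L2_def)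
next
  assume "f \<in> borel_measurable borel \<and> X_norm f < \<infinity>"
  then show "f \<in> X_space" using le_less_trans[OF X_norm_ge] by (auto simp: X_space_def L1L2_def)
qed

lemma X_norm_mono_AE:
  assumes "AE x in lborel. norm (f x) \<le> norm (g x)"
  shows "X_norm f \<le> X_norm g"
  unfolding X_norm_def[of f]
  by (rule Max.boundedI) (auto intro: order_trans[OF L1L2_norm_mono_AE[OF assms] X_norm_ge])

lemma mixed_or_X_mono_AE: "mixed_or_X nrm j \<Longrightarrow> AE x in lborel. norm (f x) \<le> norm (g x) \<Longrightarrow> nrm f \<le> nrm g"
  unfolding mixed_or_X_def using X_norm_mono_AE[of f g] L1L2_norm_mono_AE[of f g j] by blast

lemma mixed_or_X_add_le:
  assumes "mixed_or_X nrm j" "f \<in> borel_measurable borel" "g \<in> borel_measurable borel"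
  shows "nrm (\<lambda>x. f x + g x) \<le> nrm f + nrm g"
proof -
  have "X_norm (\<lambda>x. f x + g x) \<le> X_norm f + X_norm g"
    unfolding X_norm_def[of "\<lambda>x. f x + g x"]
    by (rule Max.boundedI) (auto intro!: order_trans[OF L1L2_norm_add_le[OF assms(2,3)]] add_mono X_norm_ge)
  then show ?thesis using assms(1) L1L2_norm_add_le[OF assms(2,3)] by (auto simp: mixed_or_X_def)
qed

lemma mixed_or_X_minus_commute: "mixed_or_X nrm j \<Longrightarrow> nrm (\<lambda>x. f x - g x) = nrm (\<lambda>x. g x - f x)"
  by (intro antisym mixed_or_X_mono_AE) (auto simp: norm_minus_commute)

lemma mixed_or_X_diff_triangle:
  assumes "mixed_or_X nrm j" "f \<in> borel_measurable borel" "g \<in> borel_measurable borel" "h \<in> borel_measurable borel"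
  shows "nrm (\<lambda>x. f x - h x) \<le> nrm (\<lambda>x. f x - g x) + nrm (\<lambda>x. h x - g x)"
  using mixed_or_X_add_le[OF assms(1), of "\<lambda>x. f x - g x" "\<lambda>x. g x - h x"] assms(2-4) mixed_or_X_minus_commute[OF assms(1), of g h] by simp

lemma mixed_or_X_trunc:
  assumes "mixed_or_X nrm j" "f \<in> borel_measurable borel" "nrm f < \<infinity>"
  shows "(\<lambda>l. nrm (\<lambda>x. trunc l f x - f x)) \<longlonglongrightarrow> 0" "nrm (trunc l f) < \<infinity>"
proof -
  show "(\<lambda>l. nrm (\<lambda>x. trunc l f x - f x)) \<longlonglongrightarrow> 0"
    using assms trunc_L1L2_tendsto[of f j] trunc_X_tendsto[of f] by (auto simp: mixed_or_X_def X_space_iff L1L2_def)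
  show "nrm (trunc l f) < \<infinity>"
    using mixed_or_X_mono_AE[OF assms(1), of "trunc l f" f] assms(3) by (auto simp: norm_trunc_le intro: le_less_trans)
qed

text \<open>The property by which \<open>extend_cont\<close> chooses its value, named so that the
  choice and its witness can be handled separately.\<close>

definition extends :: "((real ^ 'n::finite \<Rightarrow> 'b::{banach, second_countable_topology}) \<Rightarrow> ennreal) \<Rightarrow>
     ((real ^ 'n \<Rightarrow> 'b) \<Rightarrow> (real ^ 'n \<Rightarrow> 'b) \<Rightarrow> bool) \<Rightarrow> (real ^ 'n \<Rightarrow> 'b) \<Rightarrow> (real ^ 'n \<Rightarrow> 'b) \<Rightarrow> bool" where
  "extends nrm G f u \<longleftrightarrow> u \<in> L2 \<and> (\<exists>fs us. (\<forall>l. G (fs l) (us l) \<and> nrm (fs l) < \<infinity>) \<and>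
      (\<lambda>l. nrm (\<lambda>x. fs l x - f x)) \<longlonglongrightarrow> 0 \<and> L2_lim lborel us u)"

text \<open>The chosen value comes with an approximating sequence of its own. Since all such
  sequences lead to \<open>u\<close>, uniqueness of mean-square limits identifies the choice; the
  truncations of \<open>f\<close> show that there is something to choose.\<close>

lemma extend_cont_eq:
  assumes lim: "\<And>fs us. (\<And>l. G (fs l) (us l)) \<Longrightarrow> (\<And>l. nrm (fs l) < \<infinity>) \<Longrightarrow> (\<lambda>l. nrm (\<lambda>x. fs l x - f x)) \<longlonglongrightarrow> 0 \<Longrightarrow> L2_lim lborel us u"
    and u: "u \<in> L2" and G: "\<And>f u. G f u \<Longrightarrow> f \<in> L2 \<and> u \<in> L2" and ex: "\<And>f. f \<in> L2 \<Longrightarrow> \<exists>u. G f u"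
    and nrm: "mixed_or_X nrm j" and f: "f \<in> borel_measurable borel" "nrm f < \<infinity>"
  shows "extend_cont nrm G f \<in> L2" "AE x in lborel. extend_cont nrm G f x = u x"
proof -
  have "\<forall>l. \<exists>u. G (trunc l f) u" using ex trunc_L2[OF f(1)] by blast
  then obtain us where us: "\<And>l. G (trunc l f) (us l)" by metis
  note tr = mixed_or_X_trunc[of nrm j f, OF nrm f]
  have "L2_lim lborel us u" by (rule lim[of "\<lambda>l. trunc l f", OF us tr(2) tr(1)])
  then have "extends nrm G f u"
    unfolding extends_def
    by (intro conjI u exI[of _ "\<lambda>l. trunc l f"] exI[of _ us] allI us tr)
  moreover have "extend_cont nrm G f = (SOME u. extends nrm G f u)"
    unfolding extend_cont_def extends_def L2_lim_def ..
  ultimately have e: "extends nrm G f (extend_cont nrm G f)" 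
    using someI[of "extends nrm G f" u] by (simp only:)
  then show v: "extend_cont nrm G f \<in> L2" by (simp add: extends_def)
  from e obtain fs vs where "\<forall>l. G (fs l) (vs l) \<and> nrm (fs l) < \<infinity>" and lims: "(\<lambda>l. nrm (\<lambda>x. fs l x - f x)) \<longlonglongrightarrow> 0"
    "L2_lim lborel vs (extend_cont nrm G f)"
    unfolding extends_def by (elim conjE exE)
  then have *: "\<And>l. G (fs l) (vs l)" "\<And>l. nrm (fs l) < \<infinity>" "(\<lambda>l. nrm (\<lambda>x. fs l x - f x)) \<longlonglongrightarrow> 0"
    "L2_lim lborel vs (extend_cont nrm G f)" by simp_all
  have "vs l \<in> borel_measurable lborel" for l using G[OF *(1)[of l]] L2_D by auto
  moreover have "extend_cont nrm G f \<in> borel_measurable lborel" "u \<in> borel_measurable lborel" using u v L2_D by auto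
  ultimately show "AE x in lborel. extend_cont nrm G f x = u x"
    by (rule L2_lim_unique[OF _ _ _ *(4) lim[OF *(1-3)]])
qed

lemma L2_lim_from_bound:
  fixes us :: "nat \<Rightarrow> real ^ 'n::finite \<Rightarrow> 'b::{banach, second_countable_topology}"
  assumes us: "\<And>l. us l \<in> L2" and le: "\<And>l m. L2_norm lborel (\<lambda>x. us l x - us m x) \<le> ennreal K * (e l + e m)"
    and e: "e \<longlonglongrightarrow> 0" and K: "K \<ge> 0"
  obtains u where "u \<in> L2" "L2_lim lborel us u"
proof (rule L2_complete[OF us])
  fix d :: real assume d: "d > 0"
  have "(\<lambda>l. ennreal K * e l) \<longlonglongrightarrow> 0" using e by (intro ennreal_tendsto_0_cmult) auto
  then have "\<forall>\<^sub>F l in sequentially. ennreal K * e l \<le> ennreal (d/2)" using d by (simp add: ennreal_tendsto_0_iff)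
  then obtain N where N: "\<And>l. l \<ge> N \<Longrightarrow> ennreal K * e l \<le> ennreal (d/2)" unfolding eventually_sequentially by blast
  have "L2_norm lborel (\<lambda>x. us l x - us m x) \<le> ennreal d" if "l \<ge> N" "m \<ge> N" for l m
  proof -
    have "ennreal K * (e l + e m) \<le> ennreal (d/2) + ennreal (d/2)"
      unfolding distrib_left by (intro add_mono N that)
    also have "\<dots> = ennreal d" using d by (simp flip: ennreal_plus)
    finally show ?thesis using le[of l m] by (rule order_trans[rotated])
  qed
  then show "\<exists>N. \<forall>i\<ge>N. \<forall>j\<ge>N. L2_norm lborel (\<lambda>x. us i x - us j x) \<le> ennreal d" by blast
qed (use that in blast)

text \<open>The limit is taken in the weak formulation, where the derivative falls on a fixed test
  function and both sides are continuous in mean square.\<close>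

lemma is_L2_pd_lim:
  fixes u v :: "real ^ 'n::finite \<Rightarrow> complex"
  assumes us: "\<And>n. us n \<in> L2" "L2_lim lborel us u" "u \<in> L2" and vs: "\<And>n. vs n \<in> L2" "L2_lim lborel vs v" "v \<in> L2"
    and pd: "\<And>n. is_L2_pd k (us n) (vs n)"
  shows "is_L2_pd k u v"
proof -
  have "has_weak_pd k u v"
    unfolding has_weak_pd_def
  proof (intro allI impI)
    fix \<phi> :: "real ^ 'n \<Rightarrow> real" assume \<phi>: "test_function \<phi>"
    note t = test_function_L2[OF \<phi>]
    have c: "L2_lim lborel (\<lambda>_. f) f" for f :: "real ^ 'n \<Rightarrow> complex" by (simp add: L2_lim_def)
    have "(\<lambda>n. LINT x|lborel. of_real (pd k \<phi> x) * us n x) \<longlonglongrightarrow> (LINT x|lborel. of_real (pd k \<phi> x) * u x)"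
      by (rule L2_lim_mult_integral[OF c _ _ us(2,3,1)]) (rule t)+
    moreover have "(\<lambda>n. LINT x|lborel. of_real (\<phi> x) * vs n x) \<longlonglongrightarrow> (LINT x|lborel. of_real (\<phi> x) * v x)"
      by (rule L2_lim_mult_integral[OF c _ _ vs(2,3,1)]) (rule t)+
    moreover have "(LINT x|lborel. of_real (pd k \<phi> x) * us n x) = - (LINT x|lborel. of_real (\<phi> x) * vs n x)" for n
      using is_L2_pd_imp_has_weak_pd[OF us(1) vs(1) pd] \<phi> unfolding has_weak_pd_def by (simp add: scaleR_conv_of_real)
    ultimately have "(LINT x|lborel. of_real (pd k \<phi> x) * u x) = - (LINT x|lborel. of_real (\<phi> x) * v x)"
      by (simp only:) (rule LIMSEQ_unique, assumption, rule tendsto_minus)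
    then show "(LINT x|lborel. pd k \<phi> x *\<^sub>R u x) = - (LINT x|lborel. \<phi> x *\<^sub>R v x)" by (simp add: scaleR_conv_of_real)
  qed
  then show ?thesis by (rule has_weak_pd_imp_is_L2_pd[OF us(3) vs(3)])
qed

text \<open>Stated for differences, with a constant independent of the data and of both directions,
  because it is used as a Cauchy estimate along approximating sequences.\<close>

lemma laplace_res_graph_bounds:
  fixes w :: complex
  assumes w: "w \<notin> complex_of_real ` {0..}"
  shows "\<exists>K>0. \<forall>(f :: real ^ 'n::finite \<Rightarrow> complex) u g v j k. laplace_res_graph w f u \<longrightarrow> laplace_res_graph w g v \<longrightarrow>
      L2_norm lborel (\<lambda>x. u x - v x) \<le> ennreal K * L1L2_norm j (\<lambda>x. f x - g x) \<and>
      L2_norm lborel (\<lambda>x. wpd k u x - wpd k v x) \<le> ennreal K * L1L2_norm j (\<lambda>x. f x - g x)"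
proof -
  obtain K where K: "K > 0" "\<And>\<xi> :: real ^ 'n. 1 + (norm \<xi>)\<^sup>2 \<le> K * cmod (of_real ((norm \<xi>)\<^sup>2) - w)"
    "\<And>\<xi> :: real ^ 'n. of_real ((norm \<xi>)\<^sup>2) - w \<noteq> 0"
    using helmholtz_symbol_facts[OF w] by metis
  \<comment> \<open>\<open>c\<close> stands for 1 in the bound for the solution and for
    \<open>\<bar>\<xi> $ k\<bar>\<close> in the bound for its derivative. In both cases
    \<open>c\<close> and the weight are each at most sqrt (1 + |xi|^2), so their product is
    controlled by the Helmholtz symbol.\<close>
  have *: "c * norm a * sqrt (1 + (\<xi> $ j)\<^sup>2) \<le> K * norm b"
    if "(of_real ((norm \<xi>)\<^sup>2) - w) * a = b" "c\<^sup>2 \<le> 1 + (norm \<xi>)\<^sup>2" "c \<ge> 0" for \<xi> :: "real ^ 'n" and a b c j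
  proof -
    have "c * sqrt (1 + (\<xi> $ j)\<^sup>2) \<le> sqrt (1 + (norm \<xi>)\<^sup>2) * sqrt (1 + (norm \<xi>)\<^sup>2)"
      using that(2,3) vec_nth_square_le[of \<xi> j] by (intro mult_mono) (auto intro: real_le_rsqrt)
    also have "\<dots> = 1 + (norm \<xi>)\<^sup>2" by simp
    also have "\<dots> \<le> K * cmod (of_real ((norm \<xi>)\<^sup>2) - w)" by (rule K)
    finally have "c * sqrt (1 + (\<xi> $ j)\<^sup>2) * norm a \<le> K * cmod (of_real ((norm \<xi>)\<^sup>2) - w) * norm a"
      by (rule mult_right_mono) simp
    also have "\<dots> = K * norm b" unfolding that(1)[symmetric] norm_mult by simp
    finally show ?thesis by (simp add: mult_ac)
  qed
  have "L2_norm lborel (\<lambda>x. u x - v x) \<le> ennreal K * L1L2_norm j (\<lambda>x. f x - g x) \<and>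
    L2_norm lborel (\<lambda>x. wpd k u x - wpd k v x) \<le> ennreal K * L1L2_norm j (\<lambda>x. f x - g x)"
    if G: "laplace_res_graph w f u" "laplace_res_graph w g v" for f g u v :: "real ^ 'n \<Rightarrow> complex" and j k
  proof -
    have L: "f \<in> L2" "g \<in> L2" and H: "u \<in> H1" "v \<in> H1" using G by (auto simp: laplace_res_graph_def H2_D)
    note uv = H1_L2[OF H(1)] H1_L2[OF H(2)] and W = wpd_spec(1)[OF H(1), of k] wpd_spec(1)[OF H(2), of k]
    have eq: "AE \<xi> in lborel. (of_real ((norm \<xi>)\<^sup>2) - w) * (fourier u \<xi> - fourier v \<xi>) = fourier (\<lambda>x. f x - g x) \<xi>"
      using laplace_res_graph_fourier[OF G(1)] laplace_res_graph_fourier[OF G(2)] fourier_diff[OF L]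
      by eventually_elim (simp only: right_diff_distrib)
    have "AE \<xi> in lborel. norm (fourier (\<lambda>x. u x - v x) \<xi>) * sqrt (1 + (\<xi> $ j)\<^sup>2) \<le> K * norm (fourier (\<lambda>x. f x - g x) \<xi>)"
      using eq fourier_diff[OF uv]
    proof eventually_elim
      fix \<xi> :: "real ^ 'n" assume a: "(of_real ((norm \<xi>)\<^sup>2) - w) * (fourier u \<xi> - fourier v \<xi>) = fourier (\<lambda>x. f x - g x) \<xi>"
        and b: "fourier (\<lambda>x. u x - v x) \<xi> = fourier u \<xi> - fourier v \<xi>"
      show "norm (fourier (\<lambda>x. u x - v x) \<xi>) * sqrt (1 + (\<xi> $ j)\<^sup>2) \<le> K * norm (fourier (\<lambda>x. f x - g x) \<xi>)"
        unfolding b using *[OF a, of 1 j] by simp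
    qed
    from L2_norm_weighted_fourier_le[OF L2_diff[OF L] this]
    have 1: "L2_norm lborel (\<lambda>x. u x - v x) \<le> ennreal K * L1L2_norm j (\<lambda>x. f x - g x)"
      using K(1) by (simp add: L2_norm_fourier L2_diff[OF uv])
    have "AE \<xi> in lborel. norm (fourier (\<lambda>x. wpd k u x - wpd k v x) \<xi>) * sqrt (1 + (\<xi> $ j)\<^sup>2) \<le> K * norm (fourier (\<lambda>x. f x - g x) \<xi>)"
      using eq fourier_diff[OF W] fourier_wpd[OF H(1), of k] fourier_wpd[OF H(2), of k]
    proof eventually_elim
      fix \<xi> :: "real ^ 'n" assume a: "(of_real ((norm \<xi>)\<^sup>2) - w) * (fourier u \<xi> - fourier v \<xi>) = fourier (\<lambda>x. f x - g x) \<xi>"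
        and b: "fourier (\<lambda>x. wpd k u x - wpd k v x) \<xi> = fourier (wpd k u) \<xi> - fourier (wpd k v) \<xi>"
        "fourier (wpd k u) \<xi> = \<i> * of_real (\<xi> $ k) * fourier u \<xi>" "fourier (wpd k v) \<xi> = \<i> * of_real (\<xi> $ k) * fourier v \<xi>"
      have "fourier (\<lambda>x. wpd k u x - wpd k v x) \<xi> = \<i> * of_real (\<xi> $ k) * (fourier u \<xi> - fourier v \<xi>)"
        unfolding b by (simp only: right_diff_distrib)
      then have "norm (fourier (\<lambda>x. wpd k u x - wpd k v x) \<xi>) = \<bar>\<xi> $ k\<bar> * norm (fourier u \<xi> - fourier v \<xi>)"
        by (simp add: norm_mult)
      then show "norm (fourier (\<lambda>x. wpd k u x - wpd k v x) \<xi>) * sqrt (1 + (\<xi> $ j)\<^sup>2) \<le> K * norm (fourier (\<lambda>x. f x - g x) \<xi>)"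
        using *[OF a, of "\<bar>\<xi> $ k\<bar>" j] vec_nth_square_le[of \<xi> k] by simp
    qed
    from L2_norm_weighted_fourier_le[OF L2_diff[OF L] this]
    have 2: "L2_norm lborel (\<lambda>x. wpd k u x - wpd k v x) \<le> ennreal K * L1L2_norm j (\<lambda>x. f x - g x)"
      using K(1) by (simp add: L2_norm_fourier L2_diff[OF W])
    show ?thesis using 1 2 by blast
  qed
  then show ?thesis using K(1) by blast
qed

text \<open>The truncations of \<open>f\<close> give Cauchy sequences both of solutions and of their
  derivatives. Closedness of weak differentiation shows that the second limit is the derivative of
  the first. Thus differentiating the extended resolvent is the same as extending the differentiated
  one, which is what the hypothesis on derivatives is about.\<close>

lemma laplace_resolvent_limit:
  fixes f :: "real ^ 'n::finite \<Rightarrow> complex"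
  assumes w: "w \<notin> complex_of_real ` {0..}" and nrm: "mixed_or_X nrm j" and f: "f \<in> borel_measurable borel" "nrm f < \<infinity>"
  shows "laplace_resolvent nrm w f \<in> H1"
    and "\<And>fs us. (\<And>l. laplace_res_graph w (fs l) (us l)) \<Longrightarrow> (\<lambda>l. nrm (\<lambda>x. fs l x - f x)) \<longlonglongrightarrow> 0 \<Longrightarrow>
      L2_lim lborel us (laplace_resolvent nrm w f)"
    and "\<And>fs us k. (\<And>l. laplace_res_graph w (fs l) (us l)) \<Longrightarrow> (\<lambda>l. nrm (\<lambda>x. fs l x - f x)) \<longlonglongrightarrow> 0 \<Longrightarrow>
      L2_lim lborel (\<lambda>l. wpd k (us l)) (wpd k (laplace_resolvent nrm w f))"
proof -
  obtain K where K: "K > 0" and Kb: "\<forall>(f :: real ^ 'n \<Rightarrow> complex) u g v j k. laplace_res_graph w f u \<longrightarrow> laplace_res_graph w g v \<longrightarrow>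
      L2_norm lborel (\<lambda>x. u x - v x) \<le> ennreal K * L1L2_norm j (\<lambda>x. f x - g x) \<and>
      L2_norm lborel (\<lambda>x. wpd k u x - wpd k v x) \<le> ennreal K * L1L2_norm j (\<lambda>x. f x - g x)"
    using laplace_res_graph_bounds[OF w, where 'n='n] by (elim exE conjE)
  have K1: "L2_norm lborel (\<lambda>x. u x - v x) \<le> ennreal K * L1L2_norm j (\<lambda>x. f x - g x)"
    and K2: "L2_norm lborel (\<lambda>x. wpd k u x - wpd k v x) \<le> ennreal K * L1L2_norm j (\<lambda>x. f x - g x)"
    if "laplace_res_graph w f u" "laplace_res_graph w g v" for f g u v :: "real ^ 'n \<Rightarrow> complex" and j k
    using Kb that by simp_all
  have G: "f \<in> L2 \<and> u \<in> L2" "u \<in> H1" if "laplace_res_graph w f u" for f u :: "real ^ 'n \<Rightarrow> complex"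
    using that by (auto simp: laplace_res_graph_def H2_D H1_L2)
  have tri: "L1L2_norm j (\<lambda>x. f1 x - f2 x) \<le> nrm (\<lambda>x. f1 x - f x) + nrm (\<lambda>x. f2 x - f x)"
    if "f1 \<in> L2" "f2 \<in> L2" for f1 f2
    using order_trans[OF mixed_or_X_ge[OF nrm] mixed_or_X_diff_triangle[OF nrm _ f(1)]] that L2_D by blast
  have "\<forall>l. \<exists>u. laplace_res_graph w (trunc l f) u" using laplace_res_graph_ex[OF w trunc_L2[OF f(1)]] by blast
  then obtain ts where ts: "\<And>l. laplace_res_graph w (trunc l f) (ts l)" by metis
  define e where "e l = nrm (\<lambda>x. trunc l f x - f x)" for l
  have e: "e \<longlonglongrightarrow> 0" unfolding e_def by (rule mixed_or_X_trunc(1)[of nrm j f, OF nrm f])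
  obtain u where u: "u \<in> L2" "L2_lim lborel ts u"
  proof (rule L2_lim_from_bound[OF _ _ e])
    show "ts l \<in> L2" for l using G[OF ts] by blast
    show "L2_norm lborel (\<lambda>x. ts l x - ts m x) \<le> ennreal K * (e l + e m)" for l m
      unfolding e_def by (rule order_trans[OF K1[OF ts ts, where j=j]]) (intro mult_left_mono tri trunc_L2 f; simp)
  qed (use K that in auto)
  have "\<exists>v. v \<in> L2 \<and> L2_lim lborel (\<lambda>l. wpd k (ts l)) v" for k
  proof -
    obtain v where "v \<in> L2" "L2_lim lborel (\<lambda>l. wpd k (ts l)) v"
    proof (rule L2_lim_from_bound[OF _ _ e])
      show "wpd k (ts l) \<in> L2" for l by (rule wpd_spec(1)[OF G(2)[OF ts]])
      show "L2_norm lborel (\<lambda>x. wpd k (ts l) x - wpd k (ts m) x) \<le> ennreal K * (e l + e m)" for l m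
        unfolding e_def by (rule order_trans[OF K2[OF ts ts, where j=j]]) (intro mult_left_mono tri trunc_L2 f; simp)
    qed (use K that in auto)
    then show ?thesis by blast
  qed
  then obtain v where v: "\<And>k. v k \<in> L2" "\<And>k. L2_lim lborel (\<lambda>l. wpd k (ts l)) (v k)" by metis
  have tsL: "ts l \<in> L2" "wpd k (ts l) \<in> L2" for l k using G[OF ts[of l]] wpd_spec(1) by auto
  have uv: "is_L2_pd k u (v k)" for k
    by (rule is_L2_pd_lim[OF tsL(1) u(2,1) tsL(2) v(2,1) wpd_is_L2_pd[OF G(2)[OF ts]]])
  \<comment> \<open>An arbitrary approximating sequence is compared with the truncations: the
    solutions differ by at most \<open>K\<close> times the distance of the data, and both data
    converge to \<open>f\<close>. The statement leaves the limit \<open>a\<close> open so that it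
    covers the solutions and the derivatives alike.\<close>
  have close: "L2_lim lborel us a"
    if ts': "L2_lim lborel ts' a" "\<And>l. ts' l \<in> L2" "a \<in> L2" "\<And>l. us l \<in> L2"
      and le: "\<And>l. L2_norm lborel (\<lambda>x. us l x - ts' l x) \<le> ennreal K * L1L2_norm j (\<lambda>x. fs l x - trunc l f x)"
      and fs: "\<And>l. fs l \<in> L2" "(\<lambda>l. nrm (\<lambda>x. fs l x - f x)) \<longlonglongrightarrow> 0"
    for us ts' fs :: "nat \<Rightarrow> real ^ 'n \<Rightarrow> complex" and a
    unfolding L2_lim_def
  proof (rule ennreal_tendsto_0_le)
    have "(\<lambda>l. ennreal K * (nrm (\<lambda>x. fs l x - f x) + e l) + L2_norm lborel (\<lambda>x. ts' l x - a x)) \<longlonglongrightarrow> 0 + 0"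
      using tendsto_add[OF fs(2) e] ts'(1) unfolding L2_lim_def by (intro tendsto_add ennreal_tendsto_0_cmult) auto
    then show "(\<lambda>l. ennreal K * (nrm (\<lambda>x. fs l x - f x) + e l) + L2_norm lborel (\<lambda>x. ts' l x - a x)) \<longlonglongrightarrow> 0" by simp
    show "L2_norm lborel (\<lambda>x. us l x - a x) \<le> ennreal K * (nrm (\<lambda>x. fs l x - f x) + e l) + L2_norm lborel (\<lambda>x. ts' l x - a x)" for l
    proof -
      have "L2_norm lborel (\<lambda>x. us l x - a x) \<le> L2_norm lborel (\<lambda>x. us l x - ts' l x) + L2_norm lborel (\<lambda>x. ts' l x - a x)"
        using L2_D[OF ts'(2)[of l]] L2_D[OF ts'(3)] L2_D[OF ts'(4)[of l]] by (intro L2_norm_diff_triangle) auto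
      also have "L2_norm lborel (\<lambda>x. us l x - ts' l x) \<le> ennreal K * (nrm (\<lambda>x. fs l x - f x) + e l)"
        unfolding e_def by (rule order_trans[OF le]) (intro mult_left_mono tri trunc_L2 f fs; simp)
      finally show ?thesis by (simp add: add_right_mono)
    qed
  qed
  have lim_u: "L2_lim lborel us u"
    if "\<And>l. laplace_res_graph w (fs l) (us l)" "(\<lambda>l. nrm (\<lambda>x. fs l x - f x)) \<longlonglongrightarrow> 0" for fs us
    by (rule close[OF u(2) tsL(1) u(1) _ K1[OF that(1) ts] _ that(2)]) (use G[OF that(1)] in blast)+
  have lim_v: "L2_lim lborel (\<lambda>l. wpd k (us l)) (v k)"
    if "\<And>l. laplace_res_graph w (fs l) (us l)" "(\<lambda>l. nrm (\<lambda>x. fs l x - f x)) \<longlonglongrightarrow> 0" for fs us k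
    by (rule close[OF v(2) tsL(2) v(1) _ K2[OF that(1) ts] _ that(2)]) (use G[OF that(1)] wpd_spec(1) in blast)+
  have R: "laplace_resolvent nrm w f \<in> L2" "AE x in lborel. laplace_resolvent nrm w f x = u x"
    unfolding laplace_resolvent_def
    using extend_cont_eq[of "laplace_res_graph w" nrm f u j] lim_u u(1) G(1) laplace_res_graph_ex[OF w] nrm f by blast+
  have "AE \<xi> in lborel. fourier (laplace_resolvent nrm w f) \<xi> = fourier u \<xi>"
    using fourier_eq_iff[OF R(1) u(1)] R(2) by blast
  then have Rv: "is_L2_pd k (laplace_resolvent nrm w f) (v k)" for k
    using uv[of k] unfolding is_L2_pd_def by eventually_elim simp
  then show H: "laplace_resolvent nrm w f \<in> H1" unfolding H1_iff using R(1) v(1) by blast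
  have W: "AE x in lborel. wpd k (laplace_resolvent nrm w f) x = v k x" for k
    by (rule is_L2_pd_unique[OF wpd_is_L2_pd[OF H] Rv wpd_spec(1)[OF H] v(1)])
  show "L2_lim lborel us (laplace_resolvent nrm w f)"
    if "\<And>l. laplace_res_graph w (fs l) (us l)" "(\<lambda>l. nrm (\<lambda>x. fs l x - f x)) \<longlonglongrightarrow> 0" for fs us
    by (rule iffD2[OF L2_lim_cong_AE[OF _ R(2)] lim_u[OF that]]) simp
  show "L2_lim lborel (\<lambda>l. wpd k (us l)) (wpd k (laplace_resolvent nrm w f))"
    if "\<And>l. laplace_res_graph w (fs l) (us l)" "(\<lambda>l. nrm (\<lambda>x. fs l x - f x)) \<longlonglongrightarrow> 0" for fs us k
    by (rule iffD2[OF L2_lim_cong_AE[OF _ W] lim_v[OF that]]) simp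
qed

lemma L2_lim_cmult:
  fixes f :: "'x \<Rightarrow> complex"
  assumes "L2_lim M fs f" "\<And>n. fs n \<in> borel_measurable M" "f \<in> borel_measurable M"
  shows "L2_lim M (\<lambda>n x. c * fs n x) (\<lambda>x. c * f x)"
  by (rule L2_lim_bound[OF assms, where K="norm c"]) (auto simp: norm_mult simp flip: right_diff_distrib)

lemma dirac_of_laplace_measurable:
  assumes "\<And>a. l a \<in> borel_measurable M" "\<And>k a. dl k a \<in> borel_measurable M"
  shows "dirac_of_laplace \<alpha> m z l dl \<in> borel_measurable M"
  unfolding borel_measurable_vec_iff[of "dirac_of_laplace \<alpha> m z l dl"] dirac_of_laplace_component
  by (intro allI borel_measurable_add borel_measurable_sum borel_measurable_times borel_measurable_const assms)

lemma dirac_of_laplace_L2_lim: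
  assumes m: "\<And>n a. ls n a \<in> borel_measurable lborel" "\<And>n k a. dls n k a \<in> borel_measurable lborel"
      "\<And>a. l a \<in> borel_measurable lborel" "\<And>k a. dl k a \<in> borel_measurable lborel"
    and lim: "\<And>a. L2_lim lborel (\<lambda>n. ls n a) (l a)" "\<And>k a. L2_lim lborel (\<lambda>n. dls n k a) (dl k a)"
  shows "L2_lim lborel (\<lambda>n. dirac_of_laplace \<alpha> mass z (ls n) (dls n)) (dirac_of_laplace \<alpha> mass z l dl)"
proof (subst L2_lim_vec_iff)
  show "\<forall>a. L2_lim lborel (\<lambda>n x. dirac_of_laplace \<alpha> mass z (ls n) (dls n) x $ a) (\<lambda>x. dirac_of_laplace \<alpha> mass z l dl x $ a)"
    unfolding dirac_of_laplace_component
    by (intro allI L2_lim_add L2_lim_sum L2_lim_cmult lim m borel_measurable_add borel_measurable_sum borel_measurable_times borel_measurable_const)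
qed (intro dirac_of_laplace_measurable m)+

text \<open>Two norms occur because the Dirac resolvent acts on vectors and the Laplace resolvent on
  scalars; \<open>comp\<close> turns convergence of the vectors into convergence of every component.
  Along an approximating sequence the factorization holds in L2, and its right side converges since
  it is a finite combination of solutions and their first derivatives.\<close>

lemma dirac_resolvent_eq:
  fixes \<alpha> :: "'n::finite option \<Rightarrow> complex ^ ('h::finite + 'h) ^ ('h + 'h)"
    and f :: "real ^ 'n \<Rightarrow> complex ^ ('h + 'h)"
  assumes \<alpha>: "dirac_matrices \<alpha>" and m: "m \<ge> 0" and z: "z \<notin> of_real ` {\<zeta>. \<bar>\<zeta>\<bar> \<ge> m}"
    and nv: "mixed_or_X nrmv j" and ns: "mixed_or_X nrms j" and comp: "\<And>(f :: real ^ 'n \<Rightarrow> complex ^ ('h + 'h)) a. nrms (\<lambda>x. f x $ a) \<le> nrmv f"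
    and f: "f \<in> borel_measurable borel" "nrmv f < \<infinity>"
  defines "l \<equiv> \<lambda>a. laplace_resolvent nrms (z\<^sup>2 - (of_real m)\<^sup>2) (\<lambda>x. f x $ a)"
  shows "dirac_resolvent \<alpha> m nrmv z f \<in> L2"
    and "AE x in lborel. dirac_resolvent \<alpha> m nrmv z f x = dirac_of_laplace \<alpha> m z l (\<lambda>k a. wpd k (l a)) x"
    and "l a \<in> H1"
proof -
  let ?w = "z\<^sup>2 - (of_real m)\<^sup>2"
  have w: "?w \<notin> complex_of_real ` {0..}" by (rule spectrum_square[OF z m])
  have fa: "(\<lambda>x. f x $ a) \<in> borel_measurable borel" "nrms (\<lambda>x. f x $ a) < \<infinity>" for a
    using f comp[of f a] by (auto intro: le_less_trans)
  note R = laplace_resolvent_limit[of ?w nrms j, OF w ns fa]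
  have H: "l a \<in> H1" for a unfolding l_def by (rule R(1))
  then show "l a \<in> H1" .
  have lm: "l a \<in> borel_measurable lborel" "wpd k (l a) \<in> borel_measurable lborel" for k a
    using L2_D[OF H1_L2[OF H]] L2_D[OF wpd_spec(1)[OF H]] by auto
  let ?u = "dirac_of_laplace \<alpha> m z l (\<lambda>k a. wpd k (l a))"
  have lim: "L2_lim lborel us ?u"
    if G: "\<And>n. dirac_res_graph \<alpha> m z (fs n) (us n)" and fs: "(\<lambda>n. nrmv (\<lambda>x. fs n x - f x)) \<longlonglongrightarrow> 0" for fs us
  proof -
    have fsL: "fs n \<in> L2" for n using G[of n] by (simp add: dirac_res_graph_def)
    have "\<forall>n a. \<exists>v. laplace_res_graph ?w (\<lambda>x. fs n x $ a) v"
      by (intro allI laplace_res_graph_ex w L2_component fsL)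
    then obtain ls where ls: "\<And>n a. laplace_res_graph ?w (\<lambda>x. fs n x $ a) (ls n a)" by metis
    have lsH: "ls n a \<in> H1" for n a using ls[of n a] by (auto simp: laplace_res_graph_def H2_D)
    have lsm: "ls n a \<in> borel_measurable lborel" "wpd k (ls n a) \<in> borel_measurable lborel" for n k a
      using L2_D[OF H1_L2[OF lsH]] L2_D[OF wpd_spec(1)[OF lsH]] by auto
    have fsa: "(\<lambda>n. nrms (\<lambda>x. fs n x $ a - f x $ a)) \<longlonglongrightarrow> 0" for a
      using comp[of "\<lambda>x. fs _ x - f x" a] by (intro ennreal_tendsto_0_le[OF fs]) simp
    have "L2_lim lborel (\<lambda>n. dirac_of_laplace \<alpha> m z (ls n) (\<lambda>k a. wpd k (ls n a))) ?u"
    proof (rule dirac_of_laplace_L2_lim)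
      show "L2_lim lborel (\<lambda>n. ls n a) (l a)" for a
        unfolding l_def by (rule R(2)[OF ls fsa])
      show "L2_lim lborel (\<lambda>n. wpd k (ls n a)) (wpd k (l a))" for k a
        unfolding l_def by (rule R(3)[OF ls fsa])
    qed (rule lsm lm)+
    \<comment> \<open>The given solutions need not be built from the Laplace resolvent, but
      uniqueness of the resolvent equation makes them agree with those that are.\<close>
    moreover have "AE x in lborel. us n x = dirac_of_laplace \<alpha> m z (ls n) (\<lambda>k a. wpd k (ls n a)) x" for n
      by (rule dirac_res_graph_unique[OF \<alpha> m z G dirac_of_laplace_res_graph[OF \<alpha> fsL ls]])
    ultimately show ?thesis by (subst L2_lim_cong_AE) auto
  qed
  have uL: "?u \<in> L2"
    unfolding L2_vec_iff[of ?u] dirac_of_laplace_component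
    by (intro allI L2_add L2_sum L2_cmult H1_L2[OF H] wpd_spec(1)[OF H])
  have G2: "f \<in> L2 \<and> u \<in> L2" if "dirac_res_graph \<alpha> m z f u" for f u
    using that by (auto simp: dirac_res_graph_def H1_L2)
  have ex: "\<exists>u. dirac_res_graph \<alpha> m z f u" if "f \<in> L2" for f
    using dirac_resolvent_set_supset[OF \<alpha> m z] that unfolding dirac_resolvent_set_def by blast
  show "dirac_resolvent \<alpha> m nrmv z f \<in> L2"
    unfolding dirac_resolvent_def 
    by (rule extend_cont_eq(1)[of "dirac_res_graph \<alpha> m z" nrmv f ?u j]) (rule lim uL G2 ex nv f; assumption)+
  show "AE x in lborel. dirac_resolvent \<alpha> m nrmv z f x = ?u x"
    unfolding dirac_resolvent_def 
    by (rule extend_cont_eq(2)[of "dirac_res_graph \<alpha> m z" nrmv f ?u j]) (rule lim uL G2 ex nv f; assumption)+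
qed

lemma X_norm_component_le:
  fixes f :: "real ^ 'n::finite \<Rightarrow> complex ^ 's::finite"
  shows "X_norm (\<lambda>x. f x $ a) \<le> X_norm f"
  by (rule X_norm_mono_AE) (simp add: Finite_Cartesian_Product.norm_nth_le)

text \<open>The extension depends on the norm, and the estimate in direction \<open>j\<close> speaks
  about another extension than the operator norm on X. For \<open>f\<close> in X the truncations
  converge in both norms, so a common sequence of Laplace solutions leads to both values.\<close>

lemma dirac_resolvent_X_eq:
  fixes \<alpha> :: "'n::finite option \<Rightarrow> complex ^ ('h::finite + 'h) ^ ('h + 'h)"
    and f :: "real ^ 'n \<Rightarrow> complex ^ ('h + 'h)"
  assumes \<alpha>: "dirac_matrices \<alpha>" and m: "m \<ge> 0" and z: "z \<notin> of_real ` {\<zeta>. \<bar>\<zeta>\<bar> \<ge> m}" and f: "f \<in> X_space"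
  shows "AE x in lborel. dirac_resolvent \<alpha> m X_norm z f x = dirac_resolvent \<alpha> m (L1L2_norm j) z f x"
proof -
  let ?w = "z\<^sup>2 - (of_real m)\<^sup>2"
  have w: "?w \<notin> complex_of_real ` {0..}" by (rule spectrum_square[OF z m])
  have fX: "f \<in> borel_measurable borel" "X_norm f < \<infinity>" "L1L2_norm j f < \<infinity>"
    using f le_less_trans[OF X_norm_ge] by (auto simp: X_space_iff)
  have comp: "X_norm (\<lambda>x. f x $ a) \<le> X_norm f" "L1L2_norm j (\<lambda>x. f x $ a) \<le> L1L2_norm j f" for f :: "real ^ 'n \<Rightarrow> complex ^ ('h + 'h)" and a
    by (rule X_norm_component_le L1L2_norm_component_le)+
  have mixed_or_X: "mixed_or_X (X_norm :: (real ^ 'n \<Rightarrow> complex ^ ('h + 'h)) \<Rightarrow> ennreal) j"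
      "mixed_or_X (L1L2_norm j :: (real ^ 'n \<Rightarrow> complex ^ ('h + 'h)) \<Rightarrow> ennreal) j"
    and adms: "mixed_or_X (X_norm :: (real ^ 'n \<Rightarrow> complex) \<Rightarrow> ennreal) j" "mixed_or_X (L1L2_norm j :: (real ^ 'n \<Rightarrow> complex) \<Rightarrow> ennreal) j"
    by (auto simp: mixed_or_X_def)
  have fa: "(\<lambda>x. f x $ a) \<in> borel_measurable borel" "X_norm (\<lambda>x. f x $ a) < \<infinity>" "L1L2_norm j (\<lambda>x. f x $ a) < \<infinity>" for a
    using fX comp[of f a] by (auto intro: le_less_trans)
  define l l' where "l a = laplace_resolvent X_norm ?w (\<lambda>x. f x $ a)" and "l' a = laplace_resolvent (L1L2_norm j) ?w (\<lambda>x. f x $ a)" for a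
  note RX = laplace_resolvent_limit[of ?w X_norm j, OF w adms(1) fa(1,2)]
    and RL = laplace_resolvent_limit[of ?w "L1L2_norm j" j, OF w adms(2) fa(1,3)]
    and TX = mixed_or_X_trunc(1)[of X_norm j, OF adms(1) fa(1,2)] and TL = mixed_or_X_trunc(1)[of "L1L2_norm j" j, OF adms(2) fa(1,3)]
  have H: "l a \<in> H1" "l' a \<in> H1" for a
    unfolding l_def l'_def by (rule RX(1) RL(1))+
  have eq: "AE x in lborel. l a x = l' a x" for a
  proof -
    have "\<forall>n. \<exists>v. laplace_res_graph ?w (trunc n (\<lambda>x. f x $ a)) v"
      by (intro allI laplace_res_graph_ex w trunc_L2 fa)
    then obtain ts where ts: "\<And>n. laplace_res_graph ?w (trunc n (\<lambda>x. f x $ a)) (ts n)" by metis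
    have "L2_lim lborel ts (l a)" unfolding l_def by (rule RX(2)[OF ts TX])
    moreover have "L2_lim lborel ts (l' a)" unfolding l'_def by (rule RL(2)[OF ts TL])
    moreover have "ts n \<in> borel_measurable lborel" for n
      using ts[of n] L2_D[OF H1_L2[of "ts n"]] by (auto simp: laplace_res_graph_def H2_D)
    ultimately show ?thesis
      using L2_D[OF H1_L2[OF H(1)[of a]]] L2_D[OF H1_L2[OF H(2)[of a]]] by (intro L2_lim_unique[of ts lborel]) auto
  qed
  have weq: "AE x in lborel. wpd k (l a) x = wpd k (l' a) x" for k a
  proof (rule is_L2_pd_unique[OF wpd_is_L2_pd[OF H(1)] _ wpd_spec(1)[OF H(1)] wpd_spec(1)[OF H(2)]])
    have "AE \<xi> in lborel. fourier (l a) \<xi> = fourier (l' a) \<xi>"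
      using fourier_eq_iff[OF H1_L2[OF H(1)] H1_L2[OF H(2)]] eq by blast
    with wpd_is_L2_pd[OF H(2)[of a], of k] show "is_L2_pd k (l a) (wpd k (l' a))"
      unfolding is_L2_pd_def by eventually_elim simp
  qed
  have "AE x in lborel. \<forall>a\<in>UNIV. l a x = l' a x" "AE x in lborel. \<forall>k\<in>UNIV. \<forall>a\<in>UNIV. wpd k (l a) x = wpd k (l' a) x"
    by (intro AE_finite_allI eq weq; simp)+
  moreover have "AE x in lborel. dirac_resolvent \<alpha> m X_norm z f x = dirac_of_laplace \<alpha> m z l (\<lambda>k a. wpd k (l a)) x"
    unfolding l_def[abs_def] by (rule dirac_resolvent_eq(2)[of \<alpha> m z X_norm j X_norm, OF \<alpha> m z mixed_or_X(1) adms(1) comp(1) fX(1,2)])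
  moreover have "AE x in lborel. dirac_resolvent \<alpha> m (L1L2_norm j) z f x = dirac_of_laplace \<alpha> m z l' (\<lambda>k a. wpd k (l' a)) x"
    unfolding l'_def[abs_def] by (rule dirac_resolvent_eq(2)[of \<alpha> m z "L1L2_norm j" j "L1L2_norm j", OF \<alpha> m z mixed_or_X(2) adms(2) comp(2) fX(1,3)])
  ultimately show ?thesis
    by eventually_elim (simp add: dirac_of_laplace_def)
qed

section \<open>Fourier multipliers\<close>

lemma
  fixes f :: "real ^ 'n::finite \<Rightarrow> complex"
  assumes \<sigma>: "\<sigma> \<in> borel_measurable borel" "AE \<xi> in lborel. \<bar>\<sigma> \<xi>\<bar> \<le> K" and f: "f \<in> L2"
  shows multiplier_L2: "multiplier \<sigma> f \<in> L2"
    and fourier_multiplier: "AE \<xi> in lborel. fourier (multiplier \<sigma> f) \<xi> = of_real (\<sigma> \<xi>) * fourier f \<xi>"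
proof -
  have "(\<lambda>\<xi>. of_real (\<sigma> \<xi>) * fourier f \<xi>) \<in> L2"
    using \<sigma> by (intro L2_mult_bounded[where K=K] fourier_L2 f) auto
  from inv_fourier_L2[OF this] fourier_inv_fourier[OF this]
  show "multiplier \<sigma> f \<in> L2" "AE \<xi> in lborel. fourier (multiplier \<sigma> f) \<xi> = of_real (\<sigma> \<xi>) * fourier f \<xi>"
    by (auto simp: multiplier_def)
qed

context
  fixes \<sigma> :: "real ^ 'n::finite \<Rightarrow> real" and K :: real
  assumes \<sigma>: "\<sigma> \<in> borel_measurable borel" "AE \<xi> in lborel. \<bar>\<sigma> \<xi>\<bar> \<le> K"
begin

lemma multiplier_cong_AE:
  assumes "f \<in> L2" "g \<in> L2" "AE x in lborel. f x = g x"
  shows "AE x in lborel. multiplier \<sigma> f x = multiplier \<sigma> g x"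
proof -
  have "AE \<xi> in lborel. fourier f \<xi> = fourier g \<xi>" using fourier_eq_iff[OF assms(1,2)] assms(3) by blast
  with fourier_multiplier[OF \<sigma> assms(1)] fourier_multiplier[OF \<sigma> assms(2)]
  have "AE \<xi> in lborel. fourier (multiplier \<sigma> f) \<xi> = fourier (multiplier \<sigma> g) \<xi>" by eventually_elim simp
  then show ?thesis using fourier_eq_iff[OF multiplier_L2[OF \<sigma> assms(1)] multiplier_L2[OF \<sigma> assms(2)]] by blast
qed

lemma multiplier_add:
  assumes "f \<in> L2" "g \<in> L2"
  shows "AE x in lborel. multiplier \<sigma> (\<lambda>x. f x + g x) x = multiplier \<sigma> f x + multiplier \<sigma> g x"
proof -
  note a = L2_add[OF assms] and M = multiplier_L2[OF \<sigma> assms(1)] multiplier_L2[OF \<sigma> assms(2)]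
  have "AE \<xi> in lborel. fourier (multiplier \<sigma> (\<lambda>x. f x + g x)) \<xi> = fourier (\<lambda>x. multiplier \<sigma> f x + multiplier \<sigma> g x) \<xi>"
    using fourier_multiplier[OF \<sigma> a] fourier_multiplier[OF \<sigma> assms(1)] fourier_multiplier[OF \<sigma> assms(2)] fourier_add[OF assms] fourier_add[OF M]
    by eventually_elim (simp add: distrib_left)
  then show ?thesis using fourier_eq_iff[OF multiplier_L2[OF \<sigma> a] L2_add[OF M]] by blast
qed

lemma multiplier_cmult:
  assumes "f \<in> L2"
  shows "AE x in lborel. multiplier \<sigma> (\<lambda>x. c * f x) x = c * multiplier \<sigma> f x"
proof -
  note a = L2_cmult[OF assms, of c] and M = multiplier_L2[OF \<sigma> assms]
  have "AE \<xi> in lborel. fourier (multiplier \<sigma> (\<lambda>x. c * f x)) \<xi> = fourier (\<lambda>x. c * multiplier \<sigma> f x) \<xi>"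
    using fourier_multiplier[OF \<sigma> a] fourier_multiplier[OF \<sigma> assms(1)] fourier_cmult[OF assms, of c] fourier_cmult[OF M, of c]
    by eventually_elim simp
  then show ?thesis using fourier_eq_iff[OF multiplier_L2[OF \<sigma> a] L2_cmult[OF M]] by blast
qed

lemma multiplier_zero: "AE x in lborel. multiplier \<sigma> (\<lambda>x. 0) x = 0"
  using multiplier_cmult[OF L2_zero, of 0] by simp

lemma multiplier_sum:
  assumes "\<And>i. i \<in> I \<Longrightarrow> f i \<in> L2"
  shows "AE x in lborel. multiplier \<sigma> (\<lambda>x. \<Sum>i\<in>I. f i x) x = (\<Sum>i\<in>I. multiplier \<sigma> (f i) x)"
  using assms
proof (induction I rule: infinite_finite_induct)
  case (insert i I)
  have "AE x in lborel. multiplier \<sigma> (\<lambda>x. f i x + (\<Sum>i\<in>I. f i x)) x = multiplier \<sigma> (f i) x + multiplier \<sigma> (\<lambda>x. \<Sum>i\<in>I. f i x) x"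
    using insert by (intro multiplier_add L2_sum) auto
  moreover have "AE x in lborel. multiplier \<sigma> (\<lambda>x. \<Sum>i\<in>I. f i x) x = (\<Sum>i\<in>I. multiplier \<sigma> (f i) x)"
    using insert by auto
  ultimately have "AE x in lborel. multiplier \<sigma> (\<lambda>x. f i x + (\<Sum>i\<in>I. f i x)) x = multiplier \<sigma> (f i) x + (\<Sum>i\<in>I. multiplier \<sigma> (f i) x)"
    by eventually_elim simp
  then show ?case using insert(1,2) by simp
qed (auto simp: multiplier_zero)

lemma componentwise_multiplier_L2:
  assumes "u \<in> L2"
  shows "componentwise (multiplier \<sigma>) u \<in> L2"
  unfolding L2_vec_iff[of "componentwise (multiplier \<sigma>) u"] componentwise_def
  using multiplier_L2[OF \<sigma> L2_component[OF assms]] by simp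

lemma componentwise_multiplier_cong_AE:
  assumes "u \<in> L2" "v \<in> L2" "AE x in lborel. u x = v x"
  shows "AE x in lborel. componentwise (multiplier \<sigma>) u x = componentwise (multiplier \<sigma>) v x"
  unfolding AE_vec_eq_iff componentwise_def vec_lambda_beta
proof
  fix a
  have "AE x in lborel. u x $ a = v x $ a" using assms(3) by eventually_elim simp
  then show "AE x in lborel. multiplier \<sigma> (\<lambda>y. u y $ a) x = multiplier \<sigma> (\<lambda>y. v y $ a) x"
    by (rule multiplier_cong_AE[OF L2_component[OF assms(1)] L2_component[OF assms(2)]])
qed

text \<open>A scalar multiplier commutes with constant matrices. Each use of linearity costs a null
  set, and the finitely many of them are collected before the pointwise identity is read
  off.\<close>

lemma componentwise_multiplier_dirac_of_laplace:
  assumes l: "\<And>a. l a \<in> L2" and dl: "\<And>k a. dl k a \<in> L2"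
  shows "AE x in lborel. componentwise (multiplier \<sigma>) (dirac_of_laplace \<alpha> m z l dl) x
    = dirac_of_laplace \<alpha> m z (\<lambda>a. multiplier \<sigma> (l a)) (\<lambda>k a. multiplier \<sigma> (dl k a)) x"
  unfolding AE_vec_eq_iff
proof
  fix a
  let ?c = "\<lambda>k b. - \<i> * \<alpha> (Some k) $ a $ b" and ?d = "\<lambda>b. of_real m * \<alpha> None $ a $ b"
  let ?A = "\<lambda>k x. \<Sum>b\<in>UNIV. ?c k b * dl k b x" and ?B = "\<lambda>x. \<Sum>b\<in>UNIV. ?d b * l b x"
  have A: "?A k \<in> L2" for k by (intro L2_sum L2_cmult dl)
  have S: "(\<lambda>x. \<Sum>k\<in>UNIV. ?A k x) \<in> L2" by (intro L2_sum A)
  have B: "?B \<in> L2" by (intro L2_sum L2_cmult l)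
  have Z: "(\<lambda>x. z * l a x) \<in> L2" by (intro L2_cmult l)
  have 1: "AE x in lborel. multiplier \<sigma> (\<lambda>x. (\<Sum>k\<in>UNIV. ?A k x) + (?B x + z * l a x)) x
    = multiplier \<sigma> (\<lambda>x. \<Sum>k\<in>UNIV. ?A k x) x + multiplier \<sigma> (\<lambda>x. ?B x + z * l a x) x"
    by (intro multiplier_add S L2_add B Z)
  have 2: "AE x in lborel. multiplier \<sigma> (\<lambda>x. \<Sum>k\<in>UNIV. ?A k x) x = (\<Sum>k\<in>UNIV. multiplier \<sigma> (?A k) x)"
    by (intro multiplier_sum A)
  have 3: "AE x in lborel. \<forall>k\<in>UNIV. multiplier \<sigma> (?A k) x = (\<Sum>b\<in>UNIV. multiplier \<sigma> (\<lambda>x. ?c k b * dl k b x) x)"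
    by (intro AE_finite_allI multiplier_sum L2_cmult dl) auto
  have 4: "AE x in lborel. \<forall>k\<in>UNIV. \<forall>b\<in>UNIV. multiplier \<sigma> (\<lambda>x. ?c k b * dl k b x) x = ?c k b * multiplier \<sigma> (dl k b) x"
    by (intro AE_finite_allI multiplier_cmult dl) auto
  have 5: "AE x in lborel. multiplier \<sigma> (\<lambda>x. ?B x + z * l a x) x = multiplier \<sigma> ?B x + multiplier \<sigma> (\<lambda>x. z * l a x) x"
    by (intro multiplier_add B Z)
  have 6: "AE x in lborel. multiplier \<sigma> ?B x = (\<Sum>b\<in>UNIV. multiplier \<sigma> (\<lambda>x. ?d b * l b x) x)"
    by (intro multiplier_sum L2_cmult l)
  have 7: "AE x in lborel. \<forall>b\<in>UNIV. multiplier \<sigma> (\<lambda>x. ?d b * l b x) x = ?d b * multiplier \<sigma> (l b) x"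
    by (intro AE_finite_allI multiplier_cmult l) auto
  have 8: "AE x in lborel. multiplier \<sigma> (\<lambda>x. z * l a x) x = z * multiplier \<sigma> (l a) x"
    by (intro multiplier_cmult l)
  show "AE x in lborel. componentwise (multiplier \<sigma>) (dirac_of_laplace \<alpha> m z l dl) x $ a
    = dirac_of_laplace \<alpha> m z (\<lambda>a. multiplier \<sigma> (l a)) (\<lambda>k a. multiplier \<sigma> (dl k a)) x $ a"
    unfolding dirac_of_laplace_component componentwise_def vec_lambda_beta
    using 1 2 3 4 5 6 7 8 by eventually_elim simp
qed

end

text \<open>Nonnegative functions with sum 1 are each at most 1; the weights 1/n of
  \<open>\<chi>inf\<close> add up to one full copy. The origin, where smoothness may fail, is a
  single point, which harms neither measurability nor statements almost everywhere.\<close>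

lemma frequency_partition_chi:
  fixes \<chi>p \<chi>m :: "'n::finite \<Rightarrow> (real ^ 'n) \<Rightarrow> real"
  assumes fp: "frequency_partition r R \<delta> \<chi>p \<chi>m \<chi>inf" and t: "t > 0"
  shows "dilated t (chi \<chi>p \<chi>m \<chi>inf j) \<in> borel_measurable borel"
    and "AE \<xi> in lborel. \<bar>dilated t (chi \<chi>p \<chi>m \<chi>inf j) \<xi>\<bar> \<le> 1"
    and "AE \<xi> in lborel. (\<Sum>j\<in>UNIV. dilated t (chi \<chi>p \<chi>m \<chi>inf j) \<xi>) = 1"
proof -
  have sm: "smooth_on (- {0}) (\<chi>p j)" "smooth_on (- {0}) (\<chi>m j)" "smooth_on (- {0}) \<chi>inf" for j
    using fp by (auto simp: frequency_partition_def)
  have nn: "\<xi> \<noteq> 0 \<Longrightarrow> \<chi>p j \<xi> \<ge> 0" "\<xi> \<noteq> 0 \<Longrightarrow> \<chi>m j \<xi> \<ge> 0" "\<xi> \<noteq> 0 \<Longrightarrow> \<chi>inf \<xi> \<ge> 0"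
    and one: "\<xi> \<noteq> 0 \<Longrightarrow> \<chi>inf \<xi> + (\<Sum>j\<in>UNIV. \<chi>p j \<xi> + \<chi>m j \<xi>) = 1" for j \<xi>
    using fp by (auto simp: frequency_partition_def)
  have meas: "f \<in> borel_measurable borel" if "smooth_on (- {0}) f" for f :: "real ^ 'n \<Rightarrow> real"
  proof -
    have "Ck_on 0 (- {0}) f" using that by (simp only: smooth_on_def)
    then have "continuous_on (- {0}) f" by simp
    then show ?thesis by (intro borel_measurable_continuous_countable_exceptions[of "{0}"]) auto
  qed
  note [measurable] = meas[OF sm(1)] meas[OF sm(2)] meas[OF sm(3)]
  show "dilated t (chi \<chi>p \<chi>m \<chi>inf j) \<in> borel_measurable borel"
    unfolding dilated_def[abs_def] chi_def[abs_def] by measurable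
  have sum1: "(\<Sum>j\<in>UNIV. chi \<chi>p \<chi>m \<chi>inf j \<xi>) = 1" if "\<xi> \<noteq> 0" for \<xi>
    using one[OF that] by (simp add: chi_def sum.distrib)
  have nonneg: "chi \<chi>p \<chi>m \<chi>inf j \<xi> \<ge> 0" if "\<xi> \<noteq> 0" for \<xi> j
    using nn that by (simp add: chi_def)
  have le1: "\<bar>chi \<chi>p \<chi>m \<chi>inf j \<xi>\<bar> \<le> 1" if "\<xi> \<noteq> 0" for \<xi> j
    using member_le_sum[of j UNIV "\<lambda>j. chi \<chi>p \<chi>m \<chi>inf j \<xi>"] nonneg[OF that] sum1[OF that] by simp
  have s: "t powr (-1/2) *\<^sub>R \<xi> \<noteq> 0" if "\<xi> \<noteq> 0" for \<xi> :: "real ^ 'n" using that t by simp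
  have ae: "AE \<xi> in lborel. \<xi> \<noteq> (0 :: real ^ 'n)" by (rule AE_lborel_singleton)
  show "AE \<xi> in lborel. \<bar>dilated t (chi \<chi>p \<chi>m \<chi>inf j) \<xi>\<bar> \<le> 1"
    using ae by eventually_elim (unfold dilated_def, rule le1, rule s)
  show "AE \<xi> in lborel. (\<Sum>j\<in>UNIV. dilated t (chi \<chi>p \<chi>m \<chi>inf j) \<xi>) = 1"
    using ae by eventually_elim (unfold dilated_def, rule sum1, rule s)
qed

text \<open>Supplies the decomposition that bounds the norm in the sum space: the j-th piece is the
  part of \<open>u\<close> cut out by the j-th symbol.\<close>

lemma componentwise_multiplier_partition:
  fixes \<sigma> :: "'i::finite \<Rightarrow> real ^ 'n::finite \<Rightarrow> real" and u :: "real ^ 'n \<Rightarrow> complex ^ 's::finite"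
  assumes \<sigma>: "\<And>j. \<sigma> j \<in> borel_measurable borel" "\<And>j. AE \<xi> in lborel. \<bar>\<sigma> j \<xi>\<bar> \<le> K"
    and one: "AE \<xi> in lborel. (\<Sum>j\<in>UNIV. \<sigma> j \<xi>) = 1" and u: "u \<in> L2"
  shows "AE x in lborel. u x = (\<Sum>j\<in>UNIV. componentwise (multiplier (\<sigma> j)) u x)"
  unfolding AE_vec_eq_iff
proof
  fix a
  note ua = L2_component[OF u, of a]
  have M: "multiplier (\<sigma> j) (\<lambda>x. u x $ a) \<in> L2" for j by (rule multiplier_L2[OF \<sigma> ua])
  have "AE \<xi> in lborel. fourier (\<lambda>x. \<Sum>j\<in>UNIV. multiplier (\<sigma> j) (\<lambda>x. u x $ a) x) \<xi> = (\<Sum>j\<in>UNIV. fourier (multiplier (\<sigma> j) (\<lambda>x. u x $ a)) \<xi>)"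
    by (intro fourier_sum M)
  moreover have "AE \<xi> in lborel. \<forall>j\<in>UNIV. fourier (multiplier (\<sigma> j) (\<lambda>x. u x $ a)) \<xi> = of_real (\<sigma> j \<xi>) * fourier (\<lambda>x. u x $ a) \<xi>"
    by (intro AE_finite_allI fourier_multiplier[OF \<sigma> ua]) auto
  ultimately have "AE \<xi> in lborel. fourier (\<lambda>x. u x $ a) \<xi> = fourier (\<lambda>x. \<Sum>j\<in>UNIV. multiplier (\<sigma> j) (\<lambda>x. u x $ a) x) \<xi>"
    using one by eventually_elim (simp flip: sum_distrib_right of_real_sum)
  then have "AE x in lborel. u x $ a = (\<Sum>j\<in>UNIV. multiplier (\<sigma> j) (\<lambda>x. u x $ a) x)"
    by (rule iffD1[OF fourier_eq_iff[OF ua L2_sum[OF M]]])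
  then show "AE x in lborel. u x $ a = (\<Sum>j\<in>UNIV. componentwise (multiplier (\<sigma> j)) u x) $ a"
    by (simp add: componentwise_def)
qed

section \<open>The sum space and the final estimates\<close>

definition xstar_decomp :: "(real ^ 'n::finite \<Rightarrow> 'b::real_normed_vector) \<Rightarrow> ('n \<Rightarrow> real ^ 'n \<Rightarrow> 'b) set" where
  "xstar_decomp f = {g. (\<forall>j. g j \<in> borel_measurable borel) \<and> (AE x in lborel. f x = (\<Sum>j\<in>UNIV. g j x))}"

lemma Xstar_norm_eq: "Xstar_norm f = (INF g \<in> xstar_decomp f. \<Sum>j\<in>UNIV. LinfL2_norm j (g j))"
  by (simp add: Xstar_norm_def xstar_decomp_def)

lemma Xstar_norm_le: "g \<in> xstar_decomp f \<Longrightarrow> Xstar_norm f \<le> (\<Sum>j\<in>UNIV. LinfL2_norm j (g j))"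
  unfolding Xstar_norm_eq by (rule INF_lower)

text \<open>The infimum over decompositions need not be attained, so inequalities between norms in
  the sum space are proved up to an arbitrary positive error.\<close>

lemma Xstar_norm_approx:
  assumes "Xstar_norm f < \<infinity>" "e > 0"
  obtains g where "g \<in> xstar_decomp f" "(\<Sum>j\<in>UNIV. LinfL2_norm j (g j)) \<le> Xstar_norm f + ennreal e"
proof -
  have "Xstar_norm f < Xstar_norm f + ennreal e"
    using assms by (cases "Xstar_norm f") (auto simp: ennreal_less_iff simp flip: ennreal_plus)
  then obtain g where "g \<in> xstar_decomp f" "(\<Sum>j\<in>UNIV. LinfL2_norm j (g j)) < Xstar_norm f + ennreal e"
    unfolding Xstar_norm_eq[of f] INF_less_iff by blast
  then show thesis using that by (simp add: less_imp_le)
qed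

lemma Xstar_norm_cong_AE:
  assumes "AE x in lborel. f x = g x"
  shows "Xstar_norm f = Xstar_norm g"
proof -
  have "xstar_decomp f = xstar_decomp g"
    unfolding xstar_decomp_def using assms by (auto elim: eventually_elim2)
  then show ?thesis by (simp add: Xstar_norm_eq)
qed

lemma Xstar_norm_add_le:
  fixes f g :: "real ^ 'n::finite \<Rightarrow> 'b::{real_normed_vector, second_countable_topology}"
  shows "Xstar_norm (\<lambda>x. f x + g x) \<le> Xstar_norm f + Xstar_norm g"
proof (rule ennreal_le_epsilon)
  fix e :: real assume fin: "Xstar_norm f + Xstar_norm g < top" and e: "e > 0"
  obtain a where a: "a \<in> xstar_decomp f" "(\<Sum>j\<in>UNIV. LinfL2_norm j (a j)) \<le> Xstar_norm f + ennreal (e/2)"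
    using Xstar_norm_approx[of f "e/2"] fin e by auto
  obtain b where b: "b \<in> xstar_decomp g" "(\<Sum>j\<in>UNIV. LinfL2_norm j (b j)) \<le> Xstar_norm g + ennreal (e/2)"
    using Xstar_norm_approx[of g "e/2"] fin e by auto
  have m: "a j \<in> borel_measurable borel" "b j \<in> borel_measurable borel" for j using a b by (auto simp: xstar_decomp_def)
  have "(\<lambda>j x. a j x + b j x) \<in> xstar_decomp (\<lambda>x. f x + g x)"
  proof -
    have "AE x in lborel. f x + g x = (\<Sum>j\<in>UNIV. a j x + b j x)"
      using a(1) b(1) unfolding xstar_decomp_def sum.distrib by (auto elim: eventually_elim2)
    then show ?thesis using m unfolding xstar_decomp_def by (simp add: borel_measurable_add)
  qed
  from Xstar_norm_le[OF this]
  have "Xstar_norm (\<lambda>x. f x + g x) \<le> (\<Sum>j\<in>UNIV. LinfL2_norm j (\<lambda>x. a j x + b j x))" .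
  also have "\<dots> \<le> (\<Sum>j\<in>UNIV. LinfL2_norm j (a j) + LinfL2_norm j (b j))"
    by (intro sum_mono LinfL2_norm_add_le m)
  also have "\<dots> \<le> (Xstar_norm f + ennreal (e/2)) + (Xstar_norm g + ennreal (e/2))"
    unfolding sum.distrib by (intro add_mono a b)
  also have "\<dots> = Xstar_norm f + Xstar_norm g + ennreal (e/2 + e/2)"
    using e by (subst ennreal_plus) (auto simp: add_ac)
  finally show "Xstar_norm (\<lambda>x. f x + g x) \<le> Xstar_norm f + Xstar_norm g + ennreal e" by simp
qed

lemma Xstar_norm_zero [simp]: "Xstar_norm (\<lambda>x. 0 :: 'b::real_normed_vector) = 0"
  using Xstar_norm_le[of "\<lambda>_ _. 0" "\<lambda>x. 0 :: 'b"] by (simp add: xstar_decomp_def)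

lemma Xstar_norm_sum_le:
  fixes f :: "'i \<Rightarrow> real ^ 'n::finite \<Rightarrow> 'b::{real_normed_vector, second_countable_topology}"
  shows "Xstar_norm (\<lambda>x. \<Sum>i\<in>I. f i x) \<le> (\<Sum>i\<in>I. Xstar_norm (f i))"
proof (induction I rule: infinite_finite_induct)
  case (insert i I)
  have "Xstar_norm (\<lambda>x. f i x + (\<Sum>i\<in>I. f i x)) \<le> Xstar_norm (f i) + Xstar_norm (\<lambda>x. \<Sum>i\<in>I. f i x)"
    by (rule Xstar_norm_add_le)
  with insert show ?case by (auto intro: order_trans add_left_mono)
qed auto

text \<open>A linear map sends decompositions to decompositions, and each piece grows by the factor
  \<open>c\<close> at most. Positivity of \<open>c\<close> transfers finiteness to the norm of
  \<open>f\<close> and allows the error \<open>e / c\<close>.\<close>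

lemma Xstar_norm_map_le:
  fixes f :: "real ^ 'n::finite \<Rightarrow> 'b::{real_normed_vector, second_countable_topology}"
    and T :: "'b \<Rightarrow> 'c::{real_normed_vector, second_countable_topology}"
  assumes T: "bounded_linear T" and le: "\<And>v. norm (T v) \<le> c * norm v" and c: "c > 0"
  shows "Xstar_norm (\<lambda>x. T (f x)) \<le> ennreal c * Xstar_norm f"
proof (rule ennreal_le_epsilon)
  interpret bounded_linear T by fact
  fix e :: real assume fin: "ennreal c * Xstar_norm f < top" and e: "e > 0"
  have "Xstar_norm f < \<infinity>" using fin c by (auto simp: ennreal_mult_less_top)
  then obtain a where a: "a \<in> xstar_decomp f" "(\<Sum>j\<in>UNIV. LinfL2_norm j (a j)) \<le> Xstar_norm f + ennreal (e/c)"
    using Xstar_norm_approx[of f "e/c"] e c by auto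
  have m: "a j \<in> borel_measurable borel" for j using a by (auto simp: xstar_decomp_def)
  have Tm: "(\<lambda>x. T (a j x)) \<in> borel_measurable borel" for j
    using borel_measurable_continuous_on[OF linear_continuous_on[OF T] m] by simp
  have "AE x in lborel. f x = (\<Sum>j\<in>UNIV. a j x)" using a by (simp add: xstar_decomp_def)
  then have "AE x in lborel. T (f x) = (\<Sum>j\<in>UNIV. T (a j x))" by eventually_elim (simp add: sum)
  then have "(\<lambda>j x. T (a j x)) \<in> xstar_decomp (\<lambda>x. T (f x))" using Tm by (simp add: xstar_decomp_def)
  from Xstar_norm_le[OF this] have "Xstar_norm (\<lambda>x. T (f x)) \<le> (\<Sum>j\<in>UNIV. LinfL2_norm j (\<lambda>x. T (a j x)))" .
  also have "\<dots> \<le> (\<Sum>j\<in>UNIV. ennreal c * LinfL2_norm j (a j))"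
    using c by (intro sum_mono LinfL2_norm_scale_le AE_I2 le Tm m) auto
  also have "\<dots> \<le> ennreal c * (Xstar_norm f + ennreal (e/c))"
    unfolding sum_distrib_left[symmetric] by (intro mult_left_mono a) auto
  also have "\<dots> = ennreal c * Xstar_norm f + ennreal e"
    using c e by (simp add: distrib_left flip: ennreal_mult)
  finally show "Xstar_norm (\<lambda>x. T (f x)) \<le> ennreal c * Xstar_norm f + ennreal e" .
qed

text \<open>The operator norm is an infimum of admissible constants, so the bound is first obtained
  with \<open>c + d\<close> in place of \<open>c\<close>, where \<open>d\<close> may be as small as
  desired for the given finite norm of \<open>f\<close>.\<close>

lemma op_norm_X_Xstar_D:
  assumes "op_norm_X_Xstar T \<le> ennreal c" "c \<ge> 0" and f: "f \<in> X_space"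
  shows "Xstar_norm (T f) \<le> ennreal c * X_norm f"
proof (rule ennreal_le_epsilon)
  fix e :: real assume e: "e > 0"
  obtain x where x: "X_norm f = ennreal x" "x \<ge> 0" using X_norm_less_top[OF f] by (cases "X_norm f") auto
  \<comment> \<open>The added 1 keeps the quotient meaningful when the norm of \<open>f\<close> is
    0.\<close>
  define d where "d = e / (x + 1)"
  have d: "d > 0" using e x by (simp add: d_def)
  have "op_norm_X_Xstar T < ennreal (c + d)" using assms(1,2) d by (auto intro: le_less_trans simp: ennreal_less_iff)
  then obtain b where b: "b < ennreal (c + d)" "\<And>f. f \<in> X_space \<Longrightarrow> Xstar_norm (T f) \<le> b * X_norm f"
    unfolding op_norm_X_Xstar_def Inf_less_iff by blast
  have "Xstar_norm (T f) \<le> ennreal (c + d) * X_norm f"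
    using b(1) by (intro order_trans[OF b(2)[OF f]] mult_right_mono) auto
  also have "\<dots> = ennreal (c * x + d * x)" using assms(2) d x by (simp add: distrib_right flip: ennreal_mult)
  also have "\<dots> \<le> ennreal (c * x + e)"
  proof (intro ennreal_leI add_left_mono)
    have "d * x \<le> d * (x + 1)" using d by (intro mult_left_mono) auto
    also have "\<dots> = e" using x by (simp add: d_def)
    finally show "d * x \<le> e" .
  qed
  also have "\<dots> = ennreal c * X_norm f + ennreal e" using assms(2) e x by (simp add: ennreal_mult)
  finally show "Xstar_norm (T f) \<le> ennreal c * X_norm f + ennreal e" .
qed

lemma op_norm_X_Xstar_I:
  assumes "\<And>f. f \<in> X_space \<Longrightarrow> Xstar_norm (T f) \<le> c * X_norm f"
  shows "op_norm_X_Xstar T \<le> c"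
  unfolding op_norm_X_Xstar_def using assms by (intro Inf_lower) auto

section \<open>The zeroth-order term and its constant\<close>

definition mass_shift :: "('n option \<Rightarrow> complex ^ 's ^ 's::finite) \<Rightarrow> real \<Rightarrow> complex \<Rightarrow> complex ^ 's \<Rightarrow> complex ^ 's" where
  "mass_shift \<alpha> m z v = of_real m *s (\<alpha> None *v v) + z *s v"

definition mass_shift_norm :: "real \<Rightarrow> complex \<Rightarrow> real" where
  "mass_shift_norm m z = max (cmod (z + of_real m)) (cmod (z - of_real m))"

lemma dirac_of_laplace_eq:
  "dirac_of_laplace \<alpha> m z l dl x = (\<Sum>k\<in>UNIV. (- \<i>) *s (\<alpha> (Some k) *v (\<chi> a. dl k a x))) + mass_shift \<alpha> m z (\<chi> a. l a x)"
  by (simp add: dirac_of_laplace_def mass_shift_def)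

lemma norm_mass_shift_le:
  fixes \<alpha> :: "'n::finite option \<Rightarrow> complex ^ ('h::finite + 'h) ^ ('h + 'h)"
  assumes \<alpha>: "dirac_matrices \<alpha>"
  shows "norm (mass_shift \<alpha> m z v) \<le> mass_shift_norm m z * norm v"
proof -
  have M: "mass_shift_norm m z \<ge> 0" by (simp add: mass_shift_norm_def le_max_iff_disj)
  have gen: "(\<Sum>b\<in>UNIV. (if a = b then s else 0) * v $ b) = s * v $ a" for a s
    by (simp add: if_distrib[where f="\<lambda>x. x * _"] cong: if_cong)
  have c: "mass_shift \<alpha> m z v $ a = (case a of Inl _ \<Rightarrow> (z + of_real m) * v $ a | Inr _ \<Rightarrow> (z - of_real m) * v $ a)" for a
    unfolding mass_shift_def dirac_matricesD(3)[OF \<alpha>] matrix_vector_mult_def vector_add_component vector_smult_component vec_lambda_beta gen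
    by (cases a) (simp_all add: algebra_simps)
  have "norm (mass_shift \<alpha> m z v $ a) \<le> mass_shift_norm m z * norm (v $ a)" for a
    unfolding c mass_shift_norm_def by (auto simp: norm_mult intro!: mult_right_mono split: sum.split)
  then have "norm (mass_shift \<alpha> m z v) \<le> L2_set (\<lambda>a. mass_shift_norm m z * norm (v $ a)) UNIV"
    unfolding norm_vec_def[of "mass_shift \<alpha> m z v"] by (intro L2_set_mono) auto
  also have "\<dots> = mass_shift_norm m z * norm v"
    unfolding norm_vec_def by (rule L2_set_right_distrib[OF M, symmetric])
  finally show ?thesis .
qed

lemma bounded_linear_smult_matrix:
  fixes A :: "complex ^ 's::finite ^ 's"
  shows "bounded_linear (\<lambda>v. c *s (A *v v))"
proof -
  have "linear (\<lambda>v. c *s (A *v v))"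
    by (rule linearI) (simp_all add: vec_eq_iff matrix_vector_mult_def algebra_simps sum.distrib scaleR_sum_right sum_distrib_left)
  then show ?thesis by (rule linear_conv_bounded_linear[THEN iffD1])
qed

lemma bounded_linear_mass_shift: "bounded_linear (mass_shift \<alpha> m z)"
proof -
  have "bounded_linear (\<lambda>v. of_real m *s (\<alpha> None *v v) + z *s (mat 1 *v v))"
    by (intro bounded_linear_add bounded_linear_smult_matrix)
  then show ?thesis by (simp add: mass_shift_def[abs_def])
qed

text \<open>With p = |z + m| and q = |z - m|, the product p q is |z^2 - m^2|, so the left side is
  the square root of the larger of p and q over the smaller. Which one is larger is decided by p^2 -
  q^2 = 4 m Re z; on the imaginary axis they coincide and both sides are 1.\<close>

lemma mass_shift_factor:
  assumes "m \<ge> 0" "z \<notin> of_real ` {\<zeta>. \<bar>\<zeta>\<bar> \<ge> m}"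
  shows "mass_shift_norm m z * cmod (z\<^sup>2 - (of_real m)\<^sup>2) powr (-1/2) = cmod ((z + of_real m) / (z - of_real m)) powr (sgn (Re z) / 2)"
    and "mass_shift_norm m z > 0"
proof -
  define p q where "p = cmod (z + of_real m)" and "q = cmod (z - of_real m)"
  have "z + of_real m \<noteq> 0"
  proof
    assume "z + of_real m = 0"
    then have "z = of_real (- m)" by (simp add: eq_neg_iff_add_eq_0)
    then show False using assms by auto
  qed
  moreover have "z - of_real m \<noteq> 0" using assms by auto
  ultimately have p: "p > 0" and q: "q > 0" by (auto simp: p_def q_def)
  have w: "cmod (z\<^sup>2 - (of_real m)\<^sup>2) = p * q"
    by (simp add: p_def q_def power2_eq_square square_diff_square_factored norm_mult)
  have sq: "p\<^sup>2 - q\<^sup>2 = 4 * m * Re z"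
    by (simp add: p_def q_def cmod_power2) (simp add: power2_eq_square algebra_simps)
  have half: "a * (a * b) powr (-1/2) = (a / b) powr (1/2)" if "a > 0" "b > 0" for a b :: real
  proof -
    have "a * (a * b) powr (-1/2) = a powr 1 * (a powr (-1/2) * b powr (-1/2))" using that by (simp add: powr_mult)
    also have "\<dots> = a powr (1/2) * b powr (-1/2)" using powr_add[of a 1 "-1/2"] by (simp only: mult.assoc[symmetric]) simp
    also have "\<dots> = (a / b) powr (1/2)" using that by (simp add: powr_divide powr_minus_divide)
    finally show ?thesis .
  qed
  show "mass_shift_norm m z > 0" using p by (simp add: mass_shift_norm_def p_def less_max_iff_disj)
  have "max p q * (p * q) powr (-1/2) = (p / q) powr (sgn (Re z) / 2)"
  proof (cases "Re z" "0 :: real" rule: linorder_cases)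
    case greater
    then have "q\<^sup>2 \<le> p\<^sup>2" using sq assms(1) by (metis diff_ge_0_iff_ge less_imp_le mult_nonneg_nonneg zero_le_numeral)
    then have "q \<le> p" using p by (intro power2_le_imp_le[of q p]) auto
    then show ?thesis using half[OF p q] greater by (simp add: max_def)
  next
    case less
    then have "m * Re z \<le> 0" using assms(1) by (intro mult_nonneg_nonpos) auto
    then have "p\<^sup>2 \<le> q\<^sup>2" using sq by linarith
    then have "p \<le> q" using q by (intro power2_le_imp_le[of p q]) auto
    then have "max p q * (p * q) powr (-1/2) = (q / p) powr (1/2)" using half[OF q p] by (simp add: max_def mult.commute)
    also have "\<dots> = (p / q) powr (- (1/2))" using p q by (simp add: powr_minus_divide powr_divide)
    finally show ?thesis using less by simp
  next
    case equal
    then have "p\<^sup>2 = q\<^sup>2" using sq by simp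
    then have "p = q" using p q by (simp add: power2_eq_iff_nonneg)
    then show ?thesis using half[OF q q] q equal by simp
  qed
  then show "mass_shift_norm m z * cmod (z\<^sup>2 - (of_real m)\<^sup>2) powr (-1/2) = cmod ((z + of_real m) / (z - of_real m)) powr (sgn (Re z) / 2)"
    by (simp add: mass_shift_norm_def w norm_divide p_def[symmetric] q_def[symmetric])
qed

lemma norm_dirac_term:
  fixes \<alpha> :: "'n::finite option \<Rightarrow> complex ^ ('h::finite + 'h) ^ ('h + 'h)"
  assumes "dirac_matrices \<alpha>"
  shows "norm ((- \<i>) *s (\<alpha> k *v v)) = norm v"
  by (simp add: norm_vector_smult dirac_matricesD(4)[OF assms])

lemma ennreal_dirac_factor:
  fixes a :: ennreal
  assumes "m \<ge> 0" "z \<notin> of_real ` {\<zeta>. \<bar>\<zeta>\<bar> \<ge> m}" "C > 0"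
  shows "of_nat n * (ennreal C * a) + ennreal (mass_shift_norm m z) * (ennreal (C * cmod (z\<^sup>2 - (of_real m)\<^sup>2) powr (-1/2)) * a)
    = ennreal (C * dirac_factor n m z) * a"
proof -
  have "of_nat n * (ennreal C * a) = ennreal (C * real n) * a"
    using assms(3) by (simp add: ennreal_mult mult_ac flip: ennreal_of_nat_eq_real_of_nat)
  moreover have "ennreal (mass_shift_norm m z) * (ennreal (C * cmod (z\<^sup>2 - (of_real m)\<^sup>2) powr (-1/2)) * a)
      = ennreal (C * (mass_shift_norm m z * cmod (z\<^sup>2 - (of_real m)\<^sup>2) powr (-1/2))) * a"
    using assms(3) mass_shift_factor(2)[OF assms(1,2)] by (simp add: mult_ac flip: ennreal_mult mult.assoc)
  ultimately show ?thesis
    unfolding mass_shift_factor(1)[OF assms(1,2)] dirac_factor_def using assms(3)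
    by (simp add: distrib_left distrib_right ennreal_plus)
qed

text \<open>Measurability and boundedness of the symbol only let the multiplier pass through the
  finite combination. The size of the result comes from \<open>b1\<close> and \<open>b2\<close>,
  applied to each component of \<open>f\<close> and reassembled with the same constant.\<close>

lemma dirac_estimate:
  fixes \<alpha> :: "'n::finite option \<Rightarrow> complex ^ ('h::finite + 'h) ^ ('h + 'h)"
    and f :: "real ^ 'n \<Rightarrow> complex ^ ('h + 'h)"
  assumes \<alpha>: "dirac_matrices \<alpha>" and m: "m \<ge> 0" and z: "z \<notin> of_real ` {\<zeta>. \<bar>\<zeta>\<bar> \<ge> m}" and C: "C > 0"
    and \<sigma>: "\<sigma> \<in> borel_measurable borel" "AE \<xi> in lborel. \<bar>\<sigma> \<xi>\<bar> \<le> 1"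
    and b1: "\<And>f. f \<in> L1L2 j \<Longrightarrow> LinfL2_norm j (multiplier \<sigma> (laplace_resolvent (L1L2_norm j) (z\<^sup>2 - (of_real m)\<^sup>2) f))
           \<le> ennreal (C * cmod (z\<^sup>2 - (of_real m)\<^sup>2) powr (-1/2)) * L1L2_norm j f"
    and b2: "\<And>k f. f \<in> L1L2 j \<Longrightarrow> LinfL2_norm j (multiplier \<sigma> (wpd k (laplace_resolvent (L1L2_norm j) (z\<^sup>2 - (of_real m)\<^sup>2) f)))
           \<le> ennreal C * L1L2_norm j f"
    and f: "f \<in> L1L2 j"
  shows "dirac_resolvent \<alpha> m (L1L2_norm j) z f \<in> L2"
    and "LinfL2_norm j (componentwise (multiplier \<sigma>) (dirac_resolvent \<alpha> m (L1L2_norm j) z f))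
      \<le> ennreal (C * dirac_factor CARD('n) m z) * L1L2_norm j f"
proof -
  let ?w = "z\<^sup>2 - (of_real m)\<^sup>2"
  have fb: "f \<in> borel_measurable borel" "L1L2_norm j f < \<infinity>" using f by (auto simp: L1L2_def)
  have fa: "(\<lambda>x. f x $ a) \<in> L1L2 j" for a
    using fb L1L2_norm_component_le[of j f a] by (auto simp: L1L2_def intro: le_less_trans)
  define l where "l a = laplace_resolvent (L1L2_norm j) ?w (\<lambda>x. f x $ a)" for a
  have mixed_or_X: "mixed_or_X (L1L2_norm j :: (real ^ 'n \<Rightarrow> complex ^ ('h + 'h)) \<Rightarrow> ennreal) j" "mixed_or_X (L1L2_norm j :: (real ^ 'n \<Rightarrow> complex) \<Rightarrow> ennreal) j"
    by (auto simp: mixed_or_X_def)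
  note R = dirac_resolvent_eq[of \<alpha> m z "L1L2_norm j" j "L1L2_norm j", OF \<alpha> m z mixed_or_X L1L2_norm_component_le fb, folded l_def]
  show RL: "dirac_resolvent \<alpha> m (L1L2_norm j) z f \<in> L2" by (rule R(1))
  have l: "l a \<in> L2" "wpd k (l a) \<in> L2" for k a using H1_L2[OF R(3)] wpd_spec(1)[OF R(3)] by auto
  define Ml where "Ml x = (\<chi> a. multiplier \<sigma> (l a) x)" for x
  define Md where "Md k x = (\<chi> a. multiplier \<sigma> (wpd k (l a)) x)" for k x
  have M: "Ml \<in> borel_measurable borel" "Md k \<in> borel_measurable borel" for k
    unfolding Ml_def[abs_def] Md_def[abs_def]
    using L2_D[OF multiplier_L2[OF \<sigma> l(1)]] L2_D[OF multiplier_L2[OF \<sigma> l(2)]] by (intro borel_measurable_vec_lambda; simp)+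
  let ?D = "dirac_of_laplace \<alpha> m z l (\<lambda>k a. wpd k (l a))"
  have DL: "?D \<in> L2"
    unfolding L2_vec_iff[of ?D] dirac_of_laplace_component by (intro allI L2_add L2_sum L2_cmult l)
  let ?E = "\<lambda>x. (\<Sum>k\<in>UNIV. (- \<i>) *s (\<alpha> (Some k) *v Md k x)) + mass_shift \<alpha> m z (Ml x)"
  have Em: "(\<lambda>x. (- \<i>) *s (\<alpha> (Some k) *v Md k x)) \<in> borel_measurable borel" "(\<lambda>x. mass_shift \<alpha> m z (Ml x)) \<in> borel_measurable borel" for k
    using borel_measurable_continuous_on[OF linear_continuous_on[OF bounded_linear_smult_matrix] M(2)]
      borel_measurable_continuous_on[OF linear_continuous_on[OF bounded_linear_mass_shift] M(1)] by auto
  have "AE x in lborel. componentwise (multiplier \<sigma>) (dirac_resolvent \<alpha> m (L1L2_norm j) z f) x = ?E x"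
    using componentwise_multiplier_cong_AE[OF \<sigma> RL DL R(2)] componentwise_multiplier_dirac_of_laplace[OF \<sigma>, of l "\<lambda>k a. wpd k (l a)" \<alpha> m z, OF l]
    by eventually_elim (simp only: dirac_of_laplace_eq[of \<alpha> m z "\<lambda>a. multiplier \<sigma> (l a)" "\<lambda>k a. multiplier \<sigma> (wpd k (l a))"] Ml_def Md_def)
  then have "LinfL2_norm j (componentwise (multiplier \<sigma>) (dirac_resolvent \<alpha> m (L1L2_norm j) z f)) = LinfL2_norm j ?E"
    using L2_D[OF componentwise_multiplier_L2[OF \<sigma> RL]] Em by (intro LinfL2_norm_cong_AE) auto
  also have "\<dots> \<le> LinfL2_norm j (\<lambda>x. \<Sum>k\<in>UNIV. (- \<i>) *s (\<alpha> (Some k) *v Md k x)) + LinfL2_norm j (\<lambda>x. mass_shift \<alpha> m z (Ml x))"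
    by (intro LinfL2_norm_add_le borel_measurable_sum Em)
  also have "\<dots> \<le> (\<Sum>k\<in>UNIV. LinfL2_norm j (\<lambda>x. (- \<i>) *s (\<alpha> (Some k) *v Md k x))) + LinfL2_norm j (\<lambda>x. mass_shift \<alpha> m z (Ml x))"
    by (intro add_right_mono LinfL2_norm_sum_le Em)
  also have "\<dots> \<le> of_nat CARD('n) * (ennreal C * L1L2_norm j f) + ennreal (mass_shift_norm m z) * (ennreal (C * cmod ?w powr (-1/2)) * L1L2_norm j f)"
  proof (intro add_mono sum_bounded_above)
    fix k
    have "LinfL2_norm j (\<lambda>x. (- \<i>) *s (\<alpha> (Some k) *v Md k x)) = LinfL2_norm j (Md k)"
      by (intro LinfL2_norm_cong_AE AE_I2 norm_dirac_term[OF \<alpha>] Em M)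
    also have "\<dots> \<le> ennreal C * L1L2_norm j f"
      by (rule LinfL2_norm_le_componentwise[OF M(2) fb(1)]) (unfold Md_def vec_lambda_beta l_def, rule b2[OF fa])
    finally show "LinfL2_norm j (\<lambda>x. (- \<i>) *s (\<alpha> (Some k) *v Md k x)) \<le> ennreal C * L1L2_norm j f" .
  next
    have "LinfL2_norm j (\<lambda>x. mass_shift \<alpha> m z (Ml x)) \<le> ennreal (mass_shift_norm m z) * LinfL2_norm j Ml"
      using mass_shift_factor(2)[OF m z] by (intro LinfL2_norm_scale_le AE_I2 norm_mass_shift_le \<alpha> Em M) auto
    also have "LinfL2_norm j Ml \<le> ennreal (C * cmod ?w powr (-1/2)) * L1L2_norm j f"
      by (rule LinfL2_norm_le_componentwise[OF M(1) fb(1)]) (unfold Ml_def vec_lambda_beta l_def, rule b1[OF fa])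
    finally show "LinfL2_norm j (\<lambda>x. mass_shift \<alpha> m z (Ml x)) \<le> ennreal (mass_shift_norm m z) * (ennreal (C * cmod ?w powr (-1/2)) * L1L2_norm j f)"
      by (simp add: mult_left_mono)
  qed
  also have "\<dots> = ennreal (C * dirac_factor CARD('n) m z) * L1L2_norm j f" by (rule ennreal_dirac_factor[OF m z C])
  finally show "LinfL2_norm j (componentwise (multiplier \<sigma>) (dirac_resolvent \<alpha> m (L1L2_norm j) z f))
      \<le> ennreal (C * dirac_factor CARD('n) m z) * L1L2_norm j f" .
qed

lemma dirac_resolvent_X_norm:
  fixes \<alpha> :: "'n::finite option \<Rightarrow> complex ^ ('h::finite + 'h) ^ ('h + 'h)"
    and f :: "real ^ 'n \<Rightarrow> complex ^ ('h + 'h)"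
  assumes "dirac_matrices \<alpha>" "m \<ge> 0" "z \<notin> of_real ` {\<zeta>. \<bar>\<zeta>\<bar> \<ge> m}" and f: "f \<in> X_space"
  defines "l \<equiv> \<lambda>a. laplace_resolvent X_norm (z\<^sup>2 - (of_real m)\<^sup>2) (\<lambda>x. f x $ a)"
  shows "dirac_resolvent \<alpha> m X_norm z f \<in> L2"
    and "AE x in lborel. dirac_resolvent \<alpha> m X_norm z f x = dirac_of_laplace \<alpha> m z l (\<lambda>k a. wpd k (l a)) x"
proof -
  have mixed_or_X: "mixed_or_X (X_norm :: (real ^ 'n \<Rightarrow> complex ^ ('h + 'h)) \<Rightarrow> ennreal) undefined"
      "mixed_or_X (X_norm :: (real ^ 'n \<Rightarrow> complex) \<Rightarrow> ennreal) undefined"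
    and fX: "f \<in> borel_measurable borel" "X_norm f < \<infinity>"
    using f by (auto simp: mixed_or_X_def X_space_iff)
  note R = dirac_resolvent_eq[of \<alpha> m z X_norm undefined X_norm, OF assms(1-3) mixed_or_X X_norm_component_le fX]
  show "dirac_resolvent \<alpha> m X_norm z f \<in> L2" by (rule R(1))
  show "AE x in lborel. dirac_resolvent \<alpha> m X_norm z f x = dirac_of_laplace \<alpha> m z l (\<lambda>k a. wpd k (l a)) x"
    unfolding l_def by (rule R(2))
qed

text \<open>The pieces cut out by the symbols form an admissible decomposition. Each has norm at
  most \<open>B\<close> times the norm of \<open>f\<close> in X, and adding them produces the factor
  n.\<close>

lemma dirac_resolvent_Xstar_of_partition:
  fixes \<alpha> :: "'n::finite option \<Rightarrow> complex ^ ('h::finite + 'h) ^ ('h + 'h)"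
  assumes \<alpha>: "dirac_matrices \<alpha>" and m: "m \<ge> 0" and z: "z \<notin> of_real ` {\<zeta>. \<bar>\<zeta>\<bar> \<ge> m}" and B: "B \<ge> 0"
    and \<sigma>: "\<And>j. \<sigma> j \<in> borel_measurable borel" "\<And>j. AE \<xi> in lborel. \<bar>\<sigma> j \<xi>\<bar> \<le> 1"
      "AE \<xi> in lborel. (\<Sum>j\<in>(UNIV::'n set). \<sigma> j \<xi>) = 1"
    and bound: "\<And>j f. f \<in> L1L2 j \<Longrightarrow> dirac_resolvent \<alpha> m (L1L2_norm j) z f \<in> L2"
      "\<And>j f. f \<in> L1L2 j \<Longrightarrow>
        LinfL2_norm j (componentwise (multiplier (\<sigma> j)) (dirac_resolvent \<alpha> m (L1L2_norm j) z f)) \<le> ennreal B * L1L2_norm j f"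
  shows "op_norm_X_Xstar (dirac_resolvent \<alpha> m X_norm z) \<le> ennreal (real CARD('n) * B)"
proof (rule op_norm_X_Xstar_I)
  fix f :: "real ^ 'n \<Rightarrow> complex ^ ('h + 'h)" assume f: "f \<in> X_space"
  let ?u = "dirac_resolvent \<alpha> m X_norm z f"
  have fj: "f \<in> L1L2 j" for j using f by (simp add: X_space_def)
  have u: "?u \<in> L2" by (rule dirac_resolvent_X_norm(1)[OF \<alpha> m z f])
  have g: "(\<lambda>j. componentwise (multiplier (\<sigma> j)) ?u) \<in> xstar_decomp ?u"
    using componentwise_multiplier_partition[OF \<sigma> u] L2_D[OF componentwise_multiplier_L2[OF \<sigma>(1,2) u]]
    by (simp add: xstar_decomp_def)
  have "LinfL2_norm j (componentwise (multiplier (\<sigma> j)) ?u) \<le> ennreal B * X_norm f" for j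
  proof -
    \<comment> \<open>The hypothesis concerns the extension through the j-th mixed norm, so the
      extension through the norm of X is exchanged for it, direction by direction.\<close>
    have "LinfL2_norm j (componentwise (multiplier (\<sigma> j)) ?u)
        = LinfL2_norm j (componentwise (multiplier (\<sigma> j)) (dirac_resolvent \<alpha> m (L1L2_norm j) z f))"
    proof (rule LinfL2_norm_cong_AE)
      show "AE x in lborel. norm (componentwise (multiplier (\<sigma> j)) ?u x)
          = norm (componentwise (multiplier (\<sigma> j)) (dirac_resolvent \<alpha> m (L1L2_norm j) z f) x)"
        using componentwise_multiplier_cong_AE[OF \<sigma>(1,2)[of j] u bound(1)[OF fj[of j]] dirac_resolvent_X_eq[OF \<alpha> m z f, of j]]
        by eventually_elim simp
    qed (use L2_D[OF componentwise_multiplier_L2[OF \<sigma>(1,2) u]] L2_D[OF componentwise_multiplier_L2[OF \<sigma>(1,2) bound(1)[OF fj]]] in auto)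
    also have "\<dots> \<le> ennreal B * L1L2_norm j f" by (rule bound(2)[OF fj])
    also have "\<dots> \<le> ennreal B * X_norm f" by (intro mult_left_mono X_norm_ge) auto
    finally show ?thesis .
  qed
  then have "(\<Sum>j\<in>UNIV. LinfL2_norm j (componentwise (multiplier (\<sigma> j)) ?u)) \<le> of_nat CARD('n) * (ennreal B * X_norm f)"
    by (intro sum_bounded_above) auto
  also have "\<dots> = ennreal (real CARD('n) * B) * X_norm f"
    using B by (simp add: ennreal_mult mult_ac flip: ennreal_of_nat_eq_real_of_nat)
  finally show "Xstar_norm ?u \<le> ennreal (real CARD('n) * B) * X_norm f"
    using Xstar_norm_le[OF g] by (rule order_trans[rotated])
qed

text \<open>No partition enters: every term of the factorization is estimated in the sum space as a
  whole, by the triangle inequality there and the operator bounds for the Laplacian. The only n that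
  arises is the number of derivative terms.\<close>

lemma dirac_resolvent_Xstar_of_laplace:
  fixes \<alpha> :: "'n::finite option \<Rightarrow> complex ^ ('h::finite + 'h) ^ ('h + 'h)"
  assumes \<alpha>: "dirac_matrices \<alpha>" and m: "m \<ge> 0" and z: "z \<notin> of_real ` {\<zeta>. \<bar>\<zeta>\<bar> \<ge> m}" and C: "C > 0"
    and b1: "op_norm_X_Xstar (componentwise (laplace_resolvent X_norm (z\<^sup>2 - (of_real m)\<^sup>2)) ::
              ((real ^ 'n) \<Rightarrow> complex ^ ('h + 'h)) \<Rightarrow> (real ^ 'n) \<Rightarrow> complex ^ ('h + 'h))
            \<le> ennreal (C * cmod (z\<^sup>2 - (of_real m)\<^sup>2) powr (-1/2))"
    and b2: "\<And>k. op_norm_X_Xstar (componentwise (\<lambda>f. wpd k (laplace_resolvent X_norm (z\<^sup>2 - (of_real m)\<^sup>2) f)) ::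
              ((real ^ 'n) \<Rightarrow> complex ^ ('h + 'h)) \<Rightarrow> (real ^ 'n) \<Rightarrow> complex ^ ('h + 'h))
            \<le> ennreal C"
  shows "op_norm_X_Xstar (dirac_resolvent \<alpha> m X_norm z) \<le> ennreal (C * dirac_factor CARD('n) m z)"
proof (rule op_norm_X_Xstar_I)
  fix f :: "real ^ 'n \<Rightarrow> complex ^ ('h + 'h)" assume f: "f \<in> X_space"
  let ?w = "z\<^sup>2 - (of_real m)\<^sup>2"
  let ?L = "componentwise (laplace_resolvent X_norm ?w) f"
  let ?d = "\<lambda>k. componentwise (\<lambda>f. wpd k (laplace_resolvent X_norm ?w f)) f"
  let ?l = "\<lambda>a. laplace_resolvent X_norm ?w (\<lambda>x. f x $ a)"
  have "AE x in lborel. dirac_resolvent \<alpha> m X_norm z f x = dirac_of_laplace \<alpha> m z ?l (\<lambda>k a. wpd k (?l a)) x"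
    by (rule dirac_resolvent_X_norm(2)[OF \<alpha> m z f])
  then have "AE x in lborel. dirac_resolvent \<alpha> m X_norm z f x
      = (\<Sum>k\<in>UNIV. (- \<i>) *s (\<alpha> (Some k) *v ?d k x)) + mass_shift \<alpha> m z (?L x)"
    by eventually_elim (simp only: dirac_of_laplace_eq componentwise_def)
  then have "Xstar_norm (dirac_resolvent \<alpha> m X_norm z f)
      = Xstar_norm (\<lambda>x. (\<Sum>k\<in>UNIV. (- \<i>) *s (\<alpha> (Some k) *v ?d k x)) + mass_shift \<alpha> m z (?L x))"
    by (rule Xstar_norm_cong_AE)
  also have "\<dots> \<le> (\<Sum>k\<in>UNIV. Xstar_norm (\<lambda>x. (- \<i>) *s (\<alpha> (Some k) *v ?d k x))) + Xstar_norm (\<lambda>x. mass_shift \<alpha> m z (?L x))"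
    by (rule order_trans[OF Xstar_norm_add_le add_right_mono[OF Xstar_norm_sum_le]])
  also have "\<dots> \<le> of_nat CARD('n) * (ennreal C * X_norm f)
      + ennreal (mass_shift_norm m z) * (ennreal (C * cmod ?w powr (-1/2)) * X_norm f)"
  proof (intro add_mono sum_bounded_above)
    fix k
    have "Xstar_norm (\<lambda>x. (- \<i>) *s (\<alpha> (Some k) *v ?d k x)) \<le> ennreal 1 * Xstar_norm (?d k)"
      by (intro Xstar_norm_map_le bounded_linear_smult_matrix) (simp_all only: norm_dirac_term[OF \<alpha>] mult_1 order_refl zero_less_one)
    also have "\<dots> \<le> ennreal C * X_norm f" using op_norm_X_Xstar_D[OF b2 _ f, of k] C by simp
    finally show "Xstar_norm (\<lambda>x. (- \<i>) *s (\<alpha> (Some k) *v ?d k x)) \<le> ennreal C * X_norm f" .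
  next
    have "Xstar_norm (\<lambda>x. mass_shift \<alpha> m z (?L x)) \<le> ennreal (mass_shift_norm m z) * Xstar_norm ?L"
      by (intro Xstar_norm_map_le bounded_linear_mass_shift norm_mass_shift_le \<alpha> mass_shift_factor(2) m z)
    also have "Xstar_norm ?L \<le> ennreal (C * cmod ?w powr (-1/2)) * X_norm f"
      using op_norm_X_Xstar_D[OF b1 _ f] C by simp
    finally show "Xstar_norm (\<lambda>x. mass_shift \<alpha> m z (?L x))
        \<le> ennreal (mass_shift_norm m z) * (ennreal (C * cmod ?w powr (-1/2)) * X_norm f)"
      by (simp add: mult_left_mono)
  qed
  also have "\<dots> = ennreal (C * dirac_factor CARD('n) m z) * X_norm f" by (rule ennreal_dirac_factor[OF m z C])
  finally show "Xstar_norm (dirac_resolvent \<alpha> m X_norm z f) \<le> ennreal (C * dirac_factor CARD('n) m z) * X_norm f" .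
qed

text \<open>The premise of the last assertion is about the Laplace resolvent acting on vectors,
  because the passage from components to vectors with unchanged constant is available for a single
  direction \<open>j\<close>, not for the sum space. The assertion before it rests on the
  directional estimates and therefore carries the factor n.\<close>

theorem lemma2:
  fixes \<alpha> :: "'n::finite option \<Rightarrow> complex ^ ('h::finite + 'h) ^ ('h + 'h)"
    and m r R \<delta> C :: real
    and \<chi>p \<chi>m :: "'n \<Rightarrow> (real ^ 'n) \<Rightarrow> real"
    and \<chi>inf :: "(real ^ 'n) \<Rightarrow> real"
  assumes "CARD('n) \<ge> 2" and "m \<ge> 0"
    and "dirac_matrices \<alpha>"
    and "1 < r" and "r < R" and "sqrt (R\<^sup>2 - 1) < \<delta>" and "\<delta> < 1"
    and "frequency_partition r R \<delta> \<chi>p \<chi>m \<chi>inf"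
    and "C > 0"
    and "\<And>w j f. w \<notin> of_real ` {0..} \<Longrightarrow> f \<in> L1L2 j \<Longrightarrow>
           LinfL2_norm j (multiplier (dilated (cmod w) (chi \<chi>p \<chi>m \<chi>inf j))
                            (laplace_resolvent (L1L2_norm j) w f))
           \<le> ennreal (C * cmod w powr (-1/2)) * L1L2_norm j f"
    and "\<And>w j k f. w \<notin> of_real ` {0..} \<Longrightarrow> f \<in> L1L2 j \<Longrightarrow>
           LinfL2_norm j (multiplier (dilated (cmod w) (chi \<chi>p \<chi>m \<chi>inf j))
                            (wpd k (laplace_resolvent (L1L2_norm j) w f)))
           \<le> ennreal C * L1L2_norm j f"
  shows "dirac_resolvent_set \<alpha> m = - (of_real ` {\<zeta>. \<bar>\<zeta>\<bar> \<ge> m})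
    \<and> (\<forall>z \<in> dirac_resolvent_set \<alpha> m. \<forall>j. \<forall>f \<in> L1L2 j.
         LinfL2_norm j
           (componentwise (multiplier (dilated (cmod (z\<^sup>2 - (of_real m)\<^sup>2)) (chi \<chi>p \<chi>m \<chi>inf j)))
              (dirac_resolvent \<alpha> m (L1L2_norm j) z f))
         \<le> ennreal (C * dirac_factor CARD('n) m z) * L1L2_norm j f)
    \<and> (\<forall>z \<in> dirac_resolvent_set \<alpha> m.
         op_norm_X_Xstar (dirac_resolvent \<alpha> m X_norm z)
         \<le> ennreal (real CARD('n) * (C * dirac_factor CARD('n) m z)))
    \<and> ((\<forall>w. w \<notin> of_real ` {0..} \<longrightarrow>
          op_norm_X_Xstar (componentwise (laplace_resolvent X_norm w) ::
              ((real ^ 'n) \<Rightarrow> complex ^ ('h + 'h)) \<Rightarrow> (real ^ 'n) \<Rightarrow> complex ^ ('h + 'h))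
            \<le> ennreal (C * cmod w powr (-1/2)) \<and>
          (\<forall>k. op_norm_X_Xstar (componentwise (\<lambda>f. wpd k (laplace_resolvent X_norm w f)) ::
              ((real ^ 'n) \<Rightarrow> complex ^ ('h + 'h)) \<Rightarrow> (real ^ 'n) \<Rightarrow> complex ^ ('h + 'h))
            \<le> ennreal C))
       \<longrightarrow> (\<forall>z \<in> dirac_resolvent_set \<alpha> m.
             op_norm_X_Xstar (dirac_resolvent \<alpha> m X_norm z)
             \<le> ennreal (C * dirac_factor CARD('n) m z)))"
proof (intro conjI ballI allI impI)
  note spectrum = dirac_resolvent_set_eq[OF assms(3,1,2)]
  show "dirac_resolvent_set \<alpha> m = - (of_real ` {\<zeta>. \<bar>\<zeta>\<bar> \<ge> m})" by (rule spectrum)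
  fix z assume "z \<in> dirac_resolvent_set \<alpha> m"
  then have z: "z \<notin> of_real ` {\<zeta>. \<bar>\<zeta>\<bar> \<ge> m}" by (simp add: spectrum)
  let ?w = "z\<^sup>2 - (of_real m)\<^sup>2"
  let ?\<sigma> = "\<lambda>j. dilated (cmod ?w) (chi \<chi>p \<chi>m \<chi>inf j)"
  have w: "?w \<notin> of_real ` {0..}" by (rule spectrum_square[OF z assms(2)])
  \<comment> \<open>The dilation by |w|^(-1/2) is meaningful only for nonzero w; here 0 is excluded
    as the end point of the half-line.\<close>
  have "cmod ?w > 0"
  proof (rule ccontr)
    assume "\<not> cmod ?w > 0"
    then have "?w = of_real 0" by simp
    with w show False by (metis atLeast_iff imageI order_refl)
  qed
  note \<sigma> = frequency_partition_chi[OF assms(8) this]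
  have est: "f \<in> L1L2 j \<Longrightarrow> dirac_resolvent \<alpha> m (L1L2_norm j) z f \<in> L2"
      "f \<in> L1L2 j \<Longrightarrow> LinfL2_norm j (componentwise (multiplier (?\<sigma> j)) (dirac_resolvent \<alpha> m (L1L2_norm j) z f))
        \<le> ennreal (C * dirac_factor CARD('n) m z) * L1L2_norm j f" for j f
    by (rule dirac_estimate[OF assms(3,2) z assms(9) \<sigma>(1,2) assms(10)[OF w] assms(11)[OF w]]; assumption)+
  have factor: "C * dirac_factor CARD('n) m z \<ge> 0" using assms(9) by (simp add: dirac_factor_def)
  show "LinfL2_norm j (componentwise (multiplier (?\<sigma> j)) (dirac_resolvent \<alpha> m (L1L2_norm j) z f))
        \<le> ennreal (C * dirac_factor CARD('n) m z) * L1L2_norm j f" if "f \<in> L1L2 j" for j f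
    by (rule est(2)[OF that])
  show "op_norm_X_Xstar (dirac_resolvent \<alpha> m X_norm z) \<le> ennreal (real CARD('n) * (C * dirac_factor CARD('n) m z))"
    by (rule dirac_resolvent_Xstar_of_partition[OF assms(3,2) z factor \<sigma> est])
  assume "\<forall>w. w \<notin> of_real ` {0..} \<longrightarrow>
          op_norm_X_Xstar (componentwise (laplace_resolvent X_norm w) ::
              ((real ^ 'n) \<Rightarrow> complex ^ ('h + 'h)) \<Rightarrow> (real ^ 'n) \<Rightarrow> complex ^ ('h + 'h))
            \<le> ennreal (C * cmod w powr (-1/2)) \<and>
          (\<forall>k. op_norm_X_Xstar (componentwise (\<lambda>f. wpd k (laplace_resolvent X_norm w f)) ::
              ((real ^ 'n) \<Rightarrow> complex ^ ('h + 'h)) \<Rightarrow> (real ^ 'n) \<Rightarrow> complex ^ ('h + 'h))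
            \<le> ennreal C)"
  from this[rule_format, OF w]
  show "op_norm_X_Xstar (dirac_resolvent \<alpha> m X_norm z) \<le> ennreal (C * dirac_factor CARD('n) m z)"
    by (intro dirac_resolvent_Xstar_of_laplace assms(2,3,9) z) auto
qed

end
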